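(* Let $(\epsilon_n)_{n\ge 1}$ be a positive sequence such that $$\lim_{n\to\infty}\epsilon_n^2(n-k)=\infty\qquad\text{and}\qquad \lim_{n\to\infty}\epsilon_n(\log n)^2=0 .$$ Then, with $a=a_n$, $k=k_n$, and the densities $p_{na}$ and $g_{na}$ on $(\mathbb{R}^d)^k$ defined in the context: 1. If $Y_1^k$ is a random vector with density $p_{na}$ (distribution $P_{na}$), then $$p(\mathbf{X}_1^k=Y_1^k\mid \mathbf{S}_{1,n}=na)=g_{na}(Y_1^k)\left(1+o_{P_{na}}\!\left(\epsilon_n(\log n)^2\right)\right).$$ 2. If $Y_1^k$ is a random vector with density $g_{na}$ (distribution $G_{na}$), then $$p(\mathbf{X}_1^k=Y_1^k\mid \mathbf{S}_{1,n}=na)=g_{na}(Y_1^k)\left(1+o_{G_{na}}\!\left(\epsilon_n(\log n)^2\right)\right).$$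
   Context: Setting. Let $d>1$ be an integer and let $\mathbf{X}_1,\dots,\mathbf{X}_n$ be i.i.d. copies of a random vector $\mathbf{X}$ in $\mathbb{R}^d$ with density $p=p_{\mathbf{X}}$. Write $\mathbf{X}_1^k=(\mathbf{X}_1,\dots,\mathbf{X}_k)$ and $\mathbf{S}_{1,n}=\mathbf{X}_1+\dots+\mathbf{X}_n$. Let $(a_n)_{n\ge1}$ be a convergent sequence in $\mathbb{R}^d$; write $a=a_n$. Let $k=k_n<n$ be integers with $k/n\to 1$ and $n-k\to\infty$ as $n\to\infty$. Standing assumptions. The characteristic function of $\mathbf{X}$ belongs to $L^r$ for some $r\ge1$. The moment generating function $\Phi(t)=E[\exp\langle t,\mathbf{X}\rangle]$ is finite for $t$ in a neighborhood of $0$ in $\mathbb{R}^d$. Put $m(t)=\nabla\log\Phi(t)$ and $\kappa(t)={}^t\nabla\nabla\log\Phi(t)$ (the Hessian matrix of $\log \Phi$). It is assumed that $\Phi$ satisfies conditions (steepness) ensuring that the equation $m(t)=\alpha$ has a unique solution $t$ for all values $\alpha$ considered here (in particular $\alpha=a_n$ and the $m_i$ below). For such $\alpha$, with $m(t)=\alpha$, the tilted density is $$\pi^{\alpha}(x)=\frac{\exp\langle t,x\rangle}{\Phi(t)}\,p(x),$$ which has mean $m(t)=\alpha$ and covariance matrix $\kappa(t)$. Conditional density. $p_{na}(y_1^k)=p(\mathbf{X}_1^k=y_1^k\mid\mathbf{S}_{1,n}=na)$ denotes the conditional density of $\mathbf{X}_1^k$ given $\mathbf{S}_{1,n}=na$,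 evaluated at $y_1^k=(y_1,\dots,y_k)\in(\mathbb{R}^d)^k$; $P_{na}$ is the corresponding probability measure. Approximating density. $\mathfrak{n}_d(x;\mu,\Sigma)$ is the $d$-dimensional normal density with mean $\mu$ and covariance matrix $\Sigma$, evaluated at $x$. Put $g_0(y_1\mid y_0)=\pi^{a}(y_1)$ ($y_0$ arbitrary). For $1\le i\le k-1$ let $s_{1,i}=y_1+\dots+y_i$ and let $t_i$ be the unique solution of $$m(t_i)=m_i:=\frac{n}{n-i}\left(a-\frac{s_{1,i}}{n}\right).$$ Let $\kappa_{(i,n)}$ be the $d\times d$ matrix with entries $$\kappa_{(i,n)}^{j,l}=\frac{\partial^2}{\partial t^{(j)}\partial t^{(l)}}\Big(\log E_{\pi^{m_i}}\exp\langle t,\mathbf{X}\rangle\Big)(0),$$ and let $$\kappa_{(i,n)}^{j,l,m}=\frac{\partial^3}{\partial t^{(j)}\partial t^{(l)}\partial t^{(m)}}\Big(\log E_{\pi^{m_i}}\exp\langle t,\mathbf{X}\rangle\Big)(0),$$ where $E_{\pi^{m_i}}$ is expectation when $\mathbf{X}$ has density $\pi^{m_i}$. Let $$\gamma=\Big(\sum_{j=1}^d\kappa_{(i,n)}^{j,j,p}\Big)_{1\le p\le d},\qquad \alpha=t_i+\frac{\kappa_{(i,n)}^{-2}\gamma}{2(n-i-1)},\qquad \beta=(n-i-1)\,\kappa_{(i,n)},$$ where $\kappa_{(i,n)}^{-2}$ is the square of the inverse matrix of $\kappa_{(i,n)}$. Define $$g(y_{i+1}\mid y_1^i)=C_i\,\mathfrak{n}_d(y_{i+1};\beta\alpha+a,\beta)\,p(y_{i+1}),$$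 where $C_i$ is the normalizing constant making $g(\cdot\mid y_1^i)$ a probability density on $\mathbb{R}^d$. Finally $$g_{na}(y_1^k)=g_0(y_1\mid y_0)\prod_{i=1}^{k-1}g(y_{i+1}\mid y_1^i),$$ and $G_{na}$ is the probability measure on $(\mathbb{R}^d)^k$ with density $g_{na}$. Notation. For probability measures $Q_n$ and a positive sequence $r_n$, $o_{Q_n}(r_n)$ denotes a random quantity $R_n$ such that $R_n/r_n\to0$ in probability under $Q_n$, i.e. $Q_n(|R_n|>\delta r_n)\to0$ for every $\delta>0$. All limits are as $n\to\infty$. *)

theory Defs
  imports "HOL-Probability.Probability"
begin

definition law :: "(real^'d \<Rightarrow> real) \<Rightarrow> (real^'d) measure" where
  "law q = density lborel (\<lambda>x. ennreal (q x))"

definition cf :: "(real^'d \<Rightarrow> real) \<Rightarrow> real^'d \<Rightarrow> complex" where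
  "cf q t = (\<integral>x. iexp (t \<bullet> x) \<partial>law q)"

definition mgf :: "(real^'d \<Rightarrow> real) \<Rightarrow> real^'d \<Rightarrow> real" where
  "mgf q t = (\<integral>x. exp (t \<bullet> x) \<partial>law q)"

definition mgf_dom :: "(real^'d \<Rightarrow> real) \<Rightarrow> (real^'d) set" where
  "mgf_dom q = {t. integrable (law q) (\<lambda>x. exp (t \<bullet> x))}"

definition cgf :: "(real^'d \<Rightarrow> real) \<Rightarrow> real^'d \<Rightarrow> real" where
  "cgf q t = ln (mgf q t)"

definition partial :: "'d \<Rightarrow> (real^'d \<Rightarrow> real) \<Rightarrow> real^'d \<Rightarrow> real" where
  "partial j f x = deriv (\<lambda>h. f (x + h *\<^sub>R axis j 1)) 0"

definition grad :: "(real^'d \<Rightarrow> real) \<Rightarrow> real^'d \<Rightarrow> real^'d" where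
  "grad f x = (\<chi> j. partial j f x)"

definition mean_fun :: "(real^'d \<Rightarrow> real) \<Rightarrow> real^'d \<Rightarrow> real^'d" where
  "mean_fun q = grad (cgf q)"

text \<open>The gradient of the cumulant generating function only makes sense at interior points of
  its domain, so solutions of the tilting equation are sought there.\<close>

definition is_tilt :: "(real^'d \<Rightarrow> real) \<Rightarrow> real^'d \<Rightarrow> real^'d \<Rightarrow> bool" where
  "is_tilt q \<alpha> t \<longleftrightarrow> t \<in> interior (mgf_dom q) \<and> mean_fun q t = \<alpha>"

definition tilt :: "(real^'d \<Rightarrow> real) \<Rightarrow> real^'d \<Rightarrow> real^'d" where
  "tilt q \<alpha> = (THE t. is_tilt q \<alpha> t)"

definition tilted :: "(real^'d \<Rightarrow> real) \<Rightarrow> real^'d \<Rightarrow> real^'d \<Rightarrow> real" where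
  "tilted q \<alpha> x = exp (tilt q \<alpha> \<bullet> x) / mgf q (tilt q \<alpha>) * q x"

definition cumulant2 :: "(real^'d \<Rightarrow> real) \<Rightarrow> real^'d^'d" where
  "cumulant2 q = (\<chi> j l. partial j (partial l (cgf q)) 0)"

definition cumulant3 :: "(real^'d \<Rightarrow> real) \<Rightarrow> 'd \<Rightarrow> 'd \<Rightarrow> 'd \<Rightarrow> real" where
  "cumulant3 q j l m = partial j (partial l (partial m (cgf q))) 0"

definition mvn_density :: "real^'d \<Rightarrow> real^'d^'d \<Rightarrow> real^'d \<Rightarrow> real" where
  "mvn_density \<mu> \<Sigma> x =
     exp (- ((x - \<mu>) \<bullet> (matrix_inv \<Sigma> *v (x - \<mu>))) / 2) / sqrt ((2 * pi) ^ CARD('d) * det \<Sigma>)"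

text \<open>The density of the sum of \<open>m \<ge> 1\<close> independent vectors with density \<open>q\<close>, as the \<open>m\<close>-fold
  convolution. A conditional density given that the sum equals one fixed point depends on the
  version of this density. If a power of the characteristic function is integrable, the
  convolution is, for all large \<open>m\<close> and at every point, the continuous version.\<close>

definition sum_pdf :: "(real^'d \<Rightarrow> real) \<Rightarrow> nat \<Rightarrow> real^'d \<Rightarrow> real" where
  "sum_pdf q m = ((\<lambda>f x. \<integral>y. q y * f (x - y) \<partial>lborel) ^^ (m - 1)) q"

text \<open>The joint density of the first \<open>k\<close> vectors and of the sum of all \<open>n\<close> of them
  (see \<open>distributed_joint_pdf\<close> below), for \<open>1 \<le> k < n\<close>. Points of the \<open>k\<close>-fold power of the
  space are functions on \<open>{1..k}\<close>.\<close>

definition joint_pdf ::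
  "(real^'d \<Rightarrow> real) \<Rightarrow> nat \<Rightarrow> nat \<Rightarrow> (nat \<Rightarrow> real^'d) \<Rightarrow> real^'d \<Rightarrow> real" where
  "joint_pdf q n k y s = (\<Prod>i=1..k. q (y i)) * sum_pdf q (n - k) (s - (\<Sum>i=1..k. y i))"

definition cond_pdf ::
  "(real^'d \<Rightarrow> real) \<Rightarrow> nat \<Rightarrow> nat \<Rightarrow> real^'d \<Rightarrow> (nat \<Rightarrow> real^'d) \<Rightarrow> real" where
  "cond_pdf q n k a y = joint_pdf q n k y (real n *\<^sub>R a) / sum_pdf q n (real n *\<^sub>R a)"

definition m_val :: "nat \<Rightarrow> real^'d \<Rightarrow> (nat \<Rightarrow> real^'d) \<Rightarrow> nat \<Rightarrow> real^'d" where
  "m_val n a y i = (real n / (real n - real i)) *\<^sub>R (a - (1 / real n) *\<^sub>R (\<Sum>j=1..i. y j))"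

definition g_kernel ::
  "(real^'d \<Rightarrow> real) \<Rightarrow> nat \<Rightarrow> real^'d \<Rightarrow> (nat \<Rightarrow> real^'d) \<Rightarrow> nat \<Rightarrow> real^'d \<Rightarrow> real" where
  "g_kernel q n a y i x =
    (let mi = m_val n a y i;
         N = real n - real i - 1;
         \<kappa> = cumulant2 (tilted q mi);
         \<gamma> = (\<chi> l. \<Sum>j\<in>UNIV. cumulant3 (tilted q mi) j j l);
         \<alpha> = tilt q mi + (1 / (2 * N)) *\<^sub>R ((matrix_inv \<kappa> ** matrix_inv \<kappa>) *v \<gamma>);
         \<beta> = N *\<^sub>R \<kappa>;
         h = (\<lambda>z. mvn_density (\<beta> *v \<alpha> + a) \<beta> z * q z);
         C = 1 / (\<integral>z. h z \<partial>lborel)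
     in C * h x)"

definition g_pdf ::
  "(real^'d \<Rightarrow> real) \<Rightarrow> nat \<Rightarrow> nat \<Rightarrow> real^'d \<Rightarrow> (nat \<Rightarrow> real^'d) \<Rightarrow> real" where
  "g_pdf q n k a y = tilted q a (y 1) * (\<Prod>i=1..<k. g_kernel q n a y i (y (i + 1)))"

definition path_law :: "nat \<Rightarrow> ((nat \<Rightarrow> real^'d) \<Rightarrow> real) \<Rightarrow> (nat \<Rightarrow> real^'d) measure" where
  "path_law k f = density (\<Pi>\<^sub>M i\<in>{1..k}. lborel) (\<lambda>y. ennreal (f y))"

definition small_o_prob :: "(nat \<Rightarrow> 'b measure) \<Rightarrow> (nat \<Rightarrow> real) \<Rightarrow> (nat \<Rightarrow> 'b \<Rightarrow> real) \<Rightarrow> bool" where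
  "small_o_prob Q r R \<longleftrightarrow>
     (\<forall>\<^sub>F n in sequentially. prob_space (Q n) \<and> R n \<in> borel_measurable (Q n)) \<and>
     (\<forall>\<delta>>0. (\<lambda>n. measure (Q n) {y \<in> space (Q n). \<bar>R n y\<bar> > \<delta> * r n}) \<longlonglongrightarrow> 0)"

lemma sum_pdf_1: "sum_pdf q (Suc 0) = q"
  by (simp add: sum_pdf_def)

lemma sum_pdf_Suc:
  "0 < m \<Longrightarrow> sum_pdf q (Suc m) x = (\<integral>y. q y * sum_pdf q m (x - y) \<partial>lborel)"
  by (cases m) (simp_all add: sum_pdf_def)

lemma sum_pdf_nonneg:
  assumes "\<And>x. 0 \<le> q x"
  shows "0 \<le> sum_pdf q m x"
proof (cases m)
  case 0
  then show ?thesis using assms by (simp add: sum_pdf_def)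
next
  case (Suc l)
  have "0 \<le> sum_pdf q (Suc l) x" for x
  proof (induction l arbitrary: x)
    case 0
    then show ?case using assms by (simp add: sum_pdf_1)
  next
    case (Suc l)
    then show ?case using assms by (simp add: sum_pdf_Suc)
  qed
  with Suc show ?thesis by simp
qed

lemma sum_pdf_measurable:
  assumes q[measurable]: "q \<in> borel_measurable borel"
  shows "sum_pdf q m \<in> borel_measurable borel"
proof (cases m)
  case 0
  then show ?thesis using assms by (simp add: sum_pdf_def)
next
  case (Suc l)
  have "sum_pdf q (Suc l) \<in> borel_measurable borel"
  proof (induction l)
    case 0
    then show ?case using assms by (simp add: sum_pdf_1)
  next
    case (Suc l)
    note [measurable] = Suc
    have "sum_pdf q (Suc (Suc l)) = (\<lambda>x. \<integral>y. q y * sum_pdf q (Suc l) (x - y) \<partial>lborel)"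
      by (simp add: sum_pdf_Suc fun_eq_iff)
    also have "\<dots> \<in> borel_measurable borel"
      by measurable
    finally show ?case .
  qed
  with Suc show ?thesis by simp
qed

lemma distributed_shear:
  fixes T :: "'a \<Rightarrow> 'b::euclidean_space"
  assumes N: "sigma_finite_measure N"
    and YT: "distributed M (N \<Otimes>\<^sub>M lborel) (\<lambda>\<omega>. (Y \<omega>, T \<omega>)) f"
    and c[measurable]: "c \<in> borel_measurable N"
  shows "distributed M (N \<Otimes>\<^sub>M lborel) (\<lambda>\<omega>. (Y \<omega>, c (Y \<omega>) + T \<omega>)) (\<lambda>(y, s). f (y, s - c y))"
proof -
  interpret N: sigma_finite_measure N by fact
  interpret pair_sigma_finite N "lborel :: 'b measure" ..
  have f[measurable]: "f \<in> borel_measurable (N \<Otimes>\<^sub>M lborel)"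
    and YTm[measurable]: "(\<lambda>\<omega>. (Y \<omega>, T \<omega>)) \<in> measurable M (N \<Otimes>\<^sub>M lborel)"
    using YT by (auto simp: distributed_def)
  let ?h = "\<lambda>(y, t). (y, c y + t)"
  have h[measurable]: "?h \<in> measurable (N \<Otimes>\<^sub>M lborel) (N \<Otimes>\<^sub>M lborel)"
    by measurable
  have comp: "(\<lambda>\<omega>. (Y \<omega>, c (Y \<omega>) + T \<omega>)) = ?h \<circ> (\<lambda>\<omega>. (Y \<omega>, T \<omega>))"
    by (simp add: fun_eq_iff)
  have "distr M (N \<Otimes>\<^sub>M lborel) (\<lambda>\<omega>. (Y \<omega>, c (Y \<omega>) + T \<omega>)) =
      distr (density (N \<Otimes>\<^sub>M lborel) f) (N \<Otimes>\<^sub>M lborel) ?h"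
    unfolding comp distributed_distr_eq_density[OF YT, symmetric]
    by (rule distr_distr[symmetric]) measurable
  also have "\<dots> = density (N \<Otimes>\<^sub>M lborel) (\<lambda>(y, s). f (y, s - c y))"
  proof (rule measure_eqI)
    fix A assume "A \<in> sets (distr (density (N \<Otimes>\<^sub>M lborel) f) (N \<Otimes>\<^sub>M lborel) ?h)"
    then have A[measurable]: "A \<in> sets (N \<Otimes>\<^sub>M lborel)" by simp
    have shift: "(\<integral>\<^sup>+t. f (y, t) * indicator A (y, c y + t) \<partial>lborel) =
        (\<integral>\<^sup>+s. f (y, s - c y) * indicator A (y, s) \<partial>lborel)" if [measurable]: "y \<in> space N" for y
    proof -
      have "(\<integral>\<^sup>+s. f (y, s - c y) * indicator A (y, s) \<partial>lborel) =
          (\<integral>\<^sup>+s. f (y, s - c y) * indicator A (y, s) \<partial>distr lborel borel ((+) (c y)))"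
        by (simp add: lborel_distr_plus)
      also have "\<dots> = (\<integral>\<^sup>+t. f (y, t) * indicator A (y, c y + t) \<partial>lborel)"
        by (subst nn_integral_distr) (auto simp: that)
      finally show ?thesis by simp
    qed
    have "emeasure (distr (density (N \<Otimes>\<^sub>M lborel) f) (N \<Otimes>\<^sub>M lborel) ?h) A =
        (\<integral>\<^sup>+x. f x * indicator (?h -` A \<inter> space (N \<Otimes>\<^sub>M lborel)) x \<partial>(N \<Otimes>\<^sub>M lborel))"
    proof -
      have h': "?h \<in> measurable (density (N \<Otimes>\<^sub>M lborel) f) (N \<Otimes>\<^sub>M lborel)"
        by (rule measurable_density_eq1[THEN iffD2, OF h])
      have B: "?h -` A \<inter> space (N \<Otimes>\<^sub>M lborel) \<in> sets (N \<Otimes>\<^sub>M lborel)"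
        by (rule measurable_sets[OF h A])
      show ?thesis
        unfolding emeasure_distr[OF h' A] space_density by (rule emeasure_density[OF f B])
    qed
    also have "\<dots> = (\<integral>\<^sup>+x. (case x of (y, t) \<Rightarrow> f (y, t) * indicator A (y, c y + t)) \<partial>(N \<Otimes>\<^sub>M lborel))"
      by (intro nn_integral_cong) (auto split: split_indicator)
    also have "\<dots> = (\<integral>\<^sup>+y. \<integral>\<^sup>+t. f (y, t) * indicator A (y, c y + t) \<partial>lborel \<partial>N)"
      by (subst lborel.nn_integral_fst[symmetric]) auto
    also have "\<dots> = (\<integral>\<^sup>+y. \<integral>\<^sup>+s. f (y, s - c y) * indicator A (y, s) \<partial>lborel \<partial>N)"
      by (intro nn_integral_cong shift)
    also have "\<dots> = (\<integral>\<^sup>+x. (case x of (y, s) \<Rightarrow> f (y, s - c y)) * indicator A x \<partial>(N \<Otimes>\<^sub>M lborel))"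
      by (subst lborel.nn_integral_fst[symmetric]) auto
    also have "\<dots> = emeasure (density (N \<Otimes>\<^sub>M lborel) (\<lambda>(y, s). f (y, s - c y))) A"
      by (rule emeasure_density[symmetric, OF _ A]) measurable
    finally show "emeasure (distr (density (N \<Otimes>\<^sub>M lborel) f) (N \<Otimes>\<^sub>M lborel) ?h) A =
        emeasure (density (N \<Otimes>\<^sub>M lborel) (\<lambda>(y, s). f (y, s - c y))) A" .
  qed simp
  finally show ?thesis
    unfolding distributed_def by (auto simp: comp intro: measurable_comp[OF YTm h])
qed

context prob_space
begin

lemma distr_pair_indep:
  fixes X :: "nat \<Rightarrow> 'a \<Rightarrow> 'b::topological_space"
  assumes ind: "indep_vars (\<lambda>_. borel) X (A \<union> B)" and AB: "A \<inter> B = {}"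
    and f[measurable]: "f \<in> measurable (PiM A (\<lambda>_. borel)) S"
    and g[measurable]: "g \<in> measurable (PiM B (\<lambda>_. borel)) T"
  shows "distr M S (\<lambda>\<omega>. f (\<lambda>i\<in>A. X i \<omega>)) \<Otimes>\<^sub>M distr M T (\<lambda>\<omega>. g (\<lambda>i\<in>B. X i \<omega>)) =
    distr M (S \<Otimes>\<^sub>M T) (\<lambda>\<omega>. (f (\<lambda>i\<in>A. X i \<omega>), g (\<lambda>i\<in>B. X i \<omega>)))"
proof -
  let ?A = "PiM A (\<lambda>_. borel :: 'b measure)" and ?B = "PiM B (\<lambda>_. borel :: 'b measure)"
  let ?Y = "\<lambda>\<omega>. \<lambda>i\<in>A. X i \<omega>" and ?Z = "\<lambda>\<omega>. \<lambda>i\<in>B. X i \<omega>"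
  have "indep_var ?A ?Y ?B ?Z"
    using AB by (intro indep_var_restrict[OF ind]) auto
  then have Y[measurable]: "?Y \<in> measurable M ?A" and Z[measurable]: "?Z \<in> measurable M ?B"
    and eq: "distr M ?A ?Y \<Otimes>\<^sub>M distr M ?B ?Z = distr M (?A \<Otimes>\<^sub>M ?B) (\<lambda>\<omega>. (?Y \<omega>, ?Z \<omega>))"
    unfolding indep_var_distribution_eq by auto
  interpret P: prob_space "distr M T (\<lambda>\<omega>. g (?Z \<omega>))"
    by (rule prob_space_distr) measurable
  have "distr M S (\<lambda>\<omega>. f (?Y \<omega>)) \<Otimes>\<^sub>M distr M T (\<lambda>\<omega>. g (?Z \<omega>)) =
      distr (distr M ?A ?Y) S f \<Otimes>\<^sub>M distr (distr M ?B ?Z) T g"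
    by (simp add: distr_distr comp_def)
  also have "\<dots> = distr (distr M ?A ?Y \<Otimes>\<^sub>M distr M ?B ?Z) (S \<Otimes>\<^sub>M T) (\<lambda>(x, y). (f x, g y))"
    using P.sigma_finite_measure_axioms
    by (intro pair_measure_distr) (simp_all add: distr_distr comp_def)
  also have "\<dots> = distr M (S \<Otimes>\<^sub>M T) (\<lambda>\<omega>. (f (?Y \<omega>), g (?Z \<omega>)))"
    unfolding eq by (subst distr_distr) (auto simp: comp_def)
  finally show ?thesis .
qed

lemma distributed_sum_pdf:
  fixes X :: "nat \<Rightarrow> 'a \<Rightarrow> real^'d"
  assumes q: "\<And>x. 0 \<le> q x"
    and ind: "indep_vars (\<lambda>_. borel) X J"
    and X: "\<And>i. i \<in> J \<Longrightarrow> distributed M lborel (X i) (\<lambda>x. ennreal (q x))"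
    and J: "finite J" "J \<noteq> {}"
  shows "distributed M lborel (\<lambda>\<omega>. \<Sum>i\<in>J. X i \<omega>) (\<lambda>x. ennreal (sum_pdf q (card J) x))"
  using J ind X
proof (induction J rule: finite_ne_induct)
  case (singleton i)
  then show ?case by (simp add: sum_pdf_1)
next
  case (insert i J)
  have Xi: "distributed M lborel (X i) (\<lambda>x. ennreal (q x))"
    using insert.prems by simp
  have qm[measurable]: "q \<in> borel_measurable borel"
    using distributed_real_measurable[OF _ Xi] q by simp
  have card: "card J > 0" using insert by (simp add: card_gt_0_iff)
  let ?f = "sum_pdf q (card J)"
  have fm[measurable]: "?f \<in> borel_measurable borel" by (rule sum_pdf_measurable[OF qm])
  have f0: "0 \<le> ?f x" for x by (rule sum_pdf_nonneg[OF q])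
  have S: "distributed M lborel (\<lambda>\<omega>. \<Sum>j\<in>J. X j \<omega>) (\<lambda>x. ennreal (?f x))"
    using insert by (intro insert.IH) (auto intro: indep_vars_subset)
  have lb: "sigma_finite_measure (lborel :: (real^'d) measure)" ..
  have J1: "distributed M (lborel \<Otimes>\<^sub>M lborel) (\<lambda>\<omega>. (X i \<omega>, \<Sum>j\<in>J. X j \<omega>))
      (\<lambda>(x, y). ennreal (q x) * ennreal (?f y))"
  proof (rule distributed_joint_indep'[OF lb lb Xi S])
    have f: "(\<lambda>y. y i) \<in> measurable (PiM {i} (\<lambda>_. borel)) (lborel :: (real^'d) measure)"
      by simp
    have g: "(\<lambda>y. \<Sum>j\<in>J. y j) \<in> measurable (PiM J (\<lambda>_. borel)) (lborel :: (real^'d) measure)"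
      by simp
    show "distr M lborel (X i) \<Otimes>\<^sub>M distr M lborel (\<lambda>\<omega>. \<Sum>j\<in>J. X j \<omega>) =
        distr M (lborel \<Otimes>\<^sub>M lborel) (\<lambda>\<omega>. (X i \<omega>, \<Sum>j\<in>J. X j \<omega>))"
      using distr_pair_indep[OF _ _ f g] insert by simp
  qed
  have J2: "distributed M (lborel \<Otimes>\<^sub>M lborel) (\<lambda>\<omega>. (X i \<omega>, X i \<omega> + (\<Sum>j\<in>J. X j \<omega>)))
      (\<lambda>(y, s). (\<lambda>(x, y). ennreal (q x) * ennreal (?f y)) (y, s - y))"
    using distributed_shear[OF lb J1, of "\<lambda>x. x"] by simp
  have D: "distributed M lborel (\<lambda>\<omega>. X i \<omega> + (\<Sum>j\<in>J. X j \<omega>))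
      (\<lambda>s. \<integral>\<^sup>+y. ennreal (q y) * ennreal (?f (s - y)) \<partial>lborel)"
    using distr_marginal2[OF lb lb J2] by simp
  interpret D: prob_space "density lborel (\<lambda>s. \<integral>\<^sup>+y. ennreal (q y) * ennreal (?f (s - y)) \<partial>lborel)"
    using prob_space_distr[OF distributed_measurable[OF D]] distributed_distr_eq_density[OF D]
    by simp
  have fin: "AE s in lborel. (\<integral>\<^sup>+y. ennreal (q y) * ennreal (?f (s - y)) \<partial>lborel) \<noteq> \<infinity>"
    using D.emeasure_space_1
    by (intro nn_integral_PInf_AE) (auto simp: emeasure_density)
  have eq: "AE s in lborel. (\<integral>\<^sup>+y. ennreal (q y) * ennreal (?f (s - y)) \<partial>lborel) =
      ennreal (sum_pdf q (card (insert i J)) s)"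
    using fin
  proof eventually_elim
    case (elim s)
    have "(\<integral>\<^sup>+y. ennreal (q y) * ennreal (?f (s - y)) \<partial>lborel) =
        (\<integral>\<^sup>+y. ennreal (q y * ?f (s - y)) \<partial>lborel)"
      by (simp add: ennreal_mult q f0)
    also have "\<dots> = ennreal (\<integral>y. q y * ?f (s - y) \<partial>lborel)"
    proof (rule nn_integral_eq_integral)
      show "integrable lborel (\<lambda>y. q y * ?f (s - y))"
        using elim q f0
        by (intro integrableI_nonneg) (auto simp: ennreal_mult top.not_eq_extremum)
    qed (use q f0 in auto)
    also have "(\<integral>y. q y * ?f (s - y) \<partial>lborel) = sum_pdf q (card (insert i J)) s"
      using insert card by (simp add: sum_pdf_Suc)
    finally show ?case .
  qed
  have "distributed M lborel (\<lambda>\<omega>. X i \<omega> + (\<Sum>j\<in>J. X j \<omega>))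
      (\<lambda>s. ennreal (sum_pdf q (card (insert i J)) s))"
    using D distributed_cong_density[THEN iffD1, OF eq _ _ D] sum_pdf_measurable[OF qm] by simp
  then show ?case using insert by simp
qed

lemma distributed_PiM_iid:
  fixes X :: "nat \<Rightarrow> 'a \<Rightarrow> real^'d"
  assumes q: "\<And>x. 0 \<le> q x"
    and ind: "indep_vars (\<lambda>_. borel) X J"
    and X: "\<And>i. i \<in> J \<Longrightarrow> distributed M lborel (X i) (\<lambda>x. ennreal (q x))"
    and J: "finite J" "J \<noteq> {}"
  shows "distributed M (\<Pi>\<^sub>M i\<in>J. lborel) (\<lambda>\<omega>. \<lambda>i\<in>J. X i \<omega>) (\<lambda>y. ennreal (\<Prod>i\<in>J. q (y i)))"
proof -
  obtain j where j: "j \<in> J" using J by auto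
  have qm[measurable]: "q \<in> borel_measurable borel"
    using distributed_real_measurable[OF _ X[OF j]] q by simp
  have Xm: "i \<in> J \<Longrightarrow> X i \<in> measurable M lborel" for i
    using X distributed_measurable by blast
  have ind': "indep_vars (\<lambda>_. lborel) X J"
    using ind unfolding indep_vars_def2 by simp
  have dm: "distr M lborel (X j) = density lborel (\<lambda>x. ennreal (q x))"
    using X[OF j] distributed_distr_eq_density by blast
  let ?D = "density lborel (\<lambda>x. ennreal (q x))"
  interpret D: prob_space ?D
    unfolding dm[symmetric] by (rule prob_space_distr[OF Xm[OF j]])
  interpret L: product_sigma_finite "\<lambda>_::nat. lborel :: (real^'d) measure" ..
  interpret P: product_sigma_finite "\<lambda>_::nat. ?D" ..
  have "distr M (\<Pi>\<^sub>M i\<in>J. lborel) (\<lambda>\<omega>. \<lambda>i\<in>J. X i \<omega>) = (\<Pi>\<^sub>M i\<in>J. distr M lborel (X i))"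
    using indep_vars_iff_distr_eq_PiM'[where M'="\<lambda>_. lborel", OF J(2) Xm] ind' by simp
  also have "\<dots> = (\<Pi>\<^sub>M i\<in>J. ?D)"
    using X distributed_distr_eq_density by (intro PiM_cong) blast+
  also have "\<dots> = density (\<Pi>\<^sub>M i\<in>J. lborel) (\<lambda>y. ennreal (\<Prod>i\<in>J. q (y i)))"
  proof (rule P.PiM_eqI[symmetric])
    show "sets (density (\<Pi>\<^sub>M i\<in>J. lborel) (\<lambda>y. ennreal (\<Prod>i\<in>J. q (y i)))) = sets (\<Pi>\<^sub>M i\<in>J. ?D)"
      by (simp cong: sets_PiM_cong)
  next
    fix A :: "nat \<Rightarrow> (real^'d) set" assume A: "\<And>i. i \<in> J \<Longrightarrow> A i \<in> sets ?D"
    then have A': "\<And>i. i \<in> J \<Longrightarrow> A i \<in> sets lborel" by simp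
    then have [measurable]: "Pi\<^sub>E J A \<in> sets (\<Pi>\<^sub>M i\<in>J. lborel)"
      using J by (intro sets_PiM_I_finite) auto
    have "emeasure (density (\<Pi>\<^sub>M i\<in>J. lborel) (\<lambda>y. ennreal (\<Prod>i\<in>J. q (y i)))) (Pi\<^sub>E J A) =
        (\<integral>\<^sup>+y. ennreal (\<Prod>i\<in>J. q (y i)) * indicator (Pi\<^sub>E J A) y \<partial>(\<Pi>\<^sub>M i\<in>J. lborel))"
      by (subst emeasure_density) auto
    also have "\<dots> = (\<integral>\<^sup>+y. (\<Prod>i\<in>J. ennreal (q (y i)) * indicator (A i) (y i)) \<partial>(\<Pi>\<^sub>M i\<in>J. lborel))"
    proof (intro nn_integral_cong)
      fix y :: "nat \<Rightarrow> real^'d" assume y: "y \<in> space (\<Pi>\<^sub>M i\<in>J. lborel)"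
      have "(indicator (Pi\<^sub>E J A) y :: ennreal) = (\<Prod>i\<in>J. indicator (A i) (y i))"
      proof (cases "\<forall>i\<in>J. y i \<in> A i")
        case True
        then show ?thesis using y by (simp add: space_PiM PiE_iff)
      next
        case False
        then have "y \<notin> Pi\<^sub>E J A" by auto
        moreover have "(\<Prod>i\<in>J. indicator (A i) (y i) :: ennreal) = 0"
          using False J by (intro prod_zero) (auto simp: indicator_def)
        ultimately show ?thesis by simp
      qed
      then show "ennreal (\<Prod>i\<in>J. q (y i)) * indicator (Pi\<^sub>E J A) y =
          (\<Prod>i\<in>J. ennreal (q (y i)) * indicator (A i) (y i))"
        by (simp add: prod.distrib prod_ennreal q)
    qed
    also have "\<dots> = (\<Prod>i\<in>J. \<integral>\<^sup>+x. ennreal (q x) * indicator (A i) x \<partial>lborel)"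
      using J A' by (intro L.product_nn_integral_prod) auto
    also have "\<dots> = (\<Prod>i\<in>J. emeasure ?D (A i))"
      using A' by (intro prod.cong refl) (simp add: emeasure_density)
    finally show "emeasure (density (\<Pi>\<^sub>M i\<in>J. lborel) (\<lambda>y. ennreal (\<Prod>i\<in>J. q (y i)))) (Pi\<^sub>E J A) =
        (\<Prod>i\<in>J. emeasure ?D (A i))" .
  qed (use J in auto)
  finally show ?thesis
    unfolding distributed_def using Xm by (auto intro!: measurable_restrict)
qed

lemma distributed_joint_pdf:
  fixes X :: "nat \<Rightarrow> 'a \<Rightarrow> real^'d"
  assumes q: "\<And>x. 0 \<le> q x"
    and ind: "indep_vars (\<lambda>_. borel) X {1..n}"
    and X: "\<And>i. i \<in> {1..n} \<Longrightarrow> distributed M lborel (X i) (\<lambda>x. ennreal (q x))"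
    and k: "1 \<le> k" "k < n"
  shows "distributed M ((\<Pi>\<^sub>M i\<in>{1..k}. lborel) \<Otimes>\<^sub>M lborel)
      (\<lambda>\<omega>. (\<lambda>i\<in>{1..k}. X i \<omega>, \<Sum>i=1..n. X i \<omega>)) (\<lambda>(y, s). ennreal (joint_pdf q n k y s))"
proof -
  interpret L: product_sigma_finite "\<lambda>_::nat. lborel :: (real^'d) measure" ..
  let ?P = "\<Pi>\<^sub>M i\<in>{1..k}. lborel :: (real^'d) measure"
  have P: "sigma_finite_measure ?P" by (rule L.sigma_finite) simp
  have lb: "sigma_finite_measure (lborel :: (real^'d) measure)" ..
  have Y: "distributed M ?P (\<lambda>\<omega>. \<lambda>i\<in>{1..k}. X i \<omega>) (\<lambda>y. ennreal (\<Prod>i=1..k. q (y i)))"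
    using k by (intro distributed_PiM_iid q X indep_vars_subset[OF ind]) auto
  have "distributed M lborel (\<lambda>\<omega>. \<Sum>i\<in>{k+1..n}. X i \<omega>) (\<lambda>x. ennreal (sum_pdf q (card {k+1..n}) x))"
    using k by (intro distributed_sum_pdf q X indep_vars_subset[OF ind]) auto
  then have T: "distributed M lborel (\<lambda>\<omega>. \<Sum>i\<in>{k+1..n}. X i \<omega>) (\<lambda>x. ennreal (sum_pdf q (n - k) x))"
    by simp
  have f: "(\<lambda>y. y) \<in> measurable (PiM {1..k} (\<lambda>_. borel)) ?P"
    by (simp cong: measurable_cong_sets sets_PiM_cong)
  have g: "(\<lambda>y. \<Sum>i\<in>{k+1..n}. y i) \<in> measurable (PiM {k+1..n} (\<lambda>_. borel)) (lborel :: (real^'d) measure)"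
    by simp
  have "{1..k} \<union> {k+1..n} = {1..n}" using k by auto
  then have indYT: "distr M ?P (\<lambda>\<omega>. \<lambda>i\<in>{1..k}. X i \<omega>) \<Otimes>\<^sub>M distr M lborel (\<lambda>\<omega>. \<Sum>i\<in>{k+1..n}. X i \<omega>) =
      distr M (?P \<Otimes>\<^sub>M lborel) (\<lambda>\<omega>. (\<lambda>i\<in>{1..k}. X i \<omega>, \<Sum>i\<in>{k+1..n}. X i \<omega>))"
    using distr_pair_indep[OF _ _ f g] ind by simp
  have split: "(\<Sum>i=1..k. X i \<omega>) + (\<Sum>i\<in>{k+1..n}. X i \<omega>) = (\<Sum>i=1..n. X i \<omega>)" for \<omega>
    using k sum.ub_add_nat[of 1 k "\<lambda>i. X i \<omega>" "n - k"] by simp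
  have restr: "(\<Sum>i=1..k. (\<lambda>i\<in>{1..k}. X i \<omega>) i) = (\<Sum>i=1..k. X i \<omega>)" for \<omega>
    by simp
  have dens: "ennreal (\<Prod>i=1..k. q (y i)) * ennreal (sum_pdf q (n - k) t) =
      ennreal ((\<Prod>i=1..k. q (y i)) * sum_pdf q (n - k) t)" for y t
    by (simp add: ennreal_mult sum_pdf_nonneg q prod_nonneg)
  have "distributed M (?P \<Otimes>\<^sub>M lborel)
      (\<lambda>\<omega>. (\<lambda>i\<in>{1..k}. X i \<omega>,
        (\<lambda>y. \<Sum>i=1..k. y i) (\<lambda>i\<in>{1..k}. X i \<omega>) + (\<Sum>i\<in>{k+1..n}. X i \<omega>)))
      (\<lambda>(y, s). (\<lambda>(y, t). ennreal (\<Prod>i=1..k. q (y i)) * ennreal (sum_pdf q (n - k) t))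
        (y, s - (\<lambda>y. \<Sum>i=1..k. y i) y))"
    by (rule distributed_shear[OF P distributed_joint_indep'[OF P lb Y T indYT]]) measurable
  then show ?thesis
    by (simp only: restr split dens joint_pdf_def prod.case)
qed

end

end

theory Submission
 imports Defs "HOL-Real_Asymp.Real_Asymp"
begin

text \<open>Both laws are compared with a reference chain that, given the first \<open>i\<close> points, draws the next
  one from the tilted density whose mean is \<open>m_val n a y i\<close>, the mean that the remaining points need
  in order to reach the prescribed sum.

  The conditional density is the product of these tilted densities and of ratios
  \<open>urat\<close>: densities of sums of \<open>N\<close> and \<open>N + 1\<close> summands of the tilted law, with \<open>N = n - i\<close> in the
  \<open>i\<close>-th factor. The approximating density is the product of the same tilted densities and of ratios
  \<open>wrat\<close>, since completing the square in its normal factor leaves the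
  tilting factor and an exponent of order \<open>1 / N\<close>. Under the tilted density each ratio has mean one
  and a variance of order \<open>1 / N\<^sup>2\<close>; this is \<open>local_limit\<close> and \<open>kernel_ratio\<close>. For the first one
  a uniform local limit theorem suffices, because conditioning takes place at the mean, where the
  term of order \<open>1 / sqrt N\<close> is odd and drops out of the inversion integral.

  Both products of ratios are therefore martingales under the reference chain, and their variance
  is of order \<open>\<Sum>i\<le>k. 1 / (n - i)\<^sup>2\<close>, that is \<open>1 / (n - k)\<close> (\<open>path_variance\<close>). By Chebyshev's inequality
  they are \<open>1\<close> up to errors that are small compared with \<open>\<epsilon> n * (ln n)\<^sup>2\<close>, because
  \<open>(\<epsilon> n)\<^sup>2 * (n - k)\<close> tends to infinity. The same second moments show that
  both laws are close to the reference chain in total variation, so that the estimate holds under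
  each of them (\<open>ratio_deviation\<close>).

  All bounds have to be uniform in the tilting parameter. This holds for means in a small ball around
  the limit of the sequence \<open>a\<close> (\<open>near_point_exists\<close>), and the reference chain stays in this ball with
  high probability because its means form a martingale with small increments (\<open>tau_exited_le\<close>).
  That the limit of \<open>a\<close> is itself the mean of a tilted density follows from the
  solvability of the tilting equation along all admissible paths (\<open>limit_in_mrange\<close>).\<close>

section \<open>Fourier transforms of densities\<close>

definition ft :: "('a::euclidean_space => real) => 'a => complex" where
 "ft f s = (LBINT x. f x *\<^sub>R cis (s \<bullet> x))"

lemma cis_measurable [measurable (raw)]:
 "f \<in> borel_measurable M ==> (%x. cis (f x)) \<in> borel_measurable M"
 by (rule borel_measurable_continuous_on[OF _ , of cis]) (auto intro!: continuous_intros)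

lemma integrable_scaleR_cis:
 fixes f :: "'b => real"
 assumes "integrable M f" "g \<in> borel_measurable M"
 shows "integrable M (%x. f x *\<^sub>R cis (g x))"
 by (rule Bochner_Integration.integrable_bound[OF assms(1)]) (use assms in auto)

lemma ft_minus: "ft f (- s) = cnj (ft f s)"
proof -
 have "cnj (ft f s) = (LBINT x. cnj (f x *\<^sub>R cis (s \<bullet> x)))"
  unfolding ft_def by (rule Bochner_Integration.integral_cnj[symmetric])
 then show ?thesis by (simp add: ft_def cis_cnj)
qed

lemma norm_ft_le: "norm (ft f s) \<le> (LBINT x. \<bar>f x\<bar>)"
 unfolding ft_def by (rule order_trans[OF integral_norm_bound]) simp

lemma gauss_real:
 fixes e u :: real
 assumes e: "e > 0"
 shows "integrable lborel (%y::real. exp (- (e * y\<^sup>2) / 2) *\<^sub>R cis (y * u))"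
  and "(LBINT y. exp (- (e * y\<^sup>2) / 2) *\<^sub>R cis (y * u)) =
    complex_of_real (sqrt (2 * pi / e) * exp (- (u\<^sup>2 / (2 * e))))"
proof -
 have nd: "normal_density 0 (1 / sqrt e) y = sqrt (e / (2 * pi)) * exp (- (e * y\<^sup>2) / 2)" for y
  using e by (simp add: normal_density_def power_divide real_sqrt_divide field_simps)
 have i0: "integrable lborel (%y::real. exp (- (e * y\<^sup>2) / 2))"
 proof -
  have "integrable lborel (%y. sqrt (2 * pi / e) * normal_density 0 (1 / sqrt e) y)"
   using e by (intro integrable_mult_right integrable_normal_density) auto
  moreover have "sqrt (2 * pi / e) * normal_density 0 (1 / sqrt e) y = exp (- (e * y\<^sup>2) / 2)" for y
   using e by (simp add: nd real_sqrt_divide)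
  ultimately show ?thesis by simp
 qed
 show "integrable lborel (%y::real. exp (- (e * y\<^sup>2) / 2) *\<^sub>R cis (y * u))"
  using i0 by (rule integrable_scaleR_cis) simp
 have "char std_normal_distribution (u / sqrt e) =
   (LBINT x. std_normal_density x *\<^sub>R iexp (u / sqrt e * x))"
  unfolding char_def by (subst integral_density) (auto simp: normal_density_nonneg)
 also have "... = \<bar>sqrt e\<bar> *\<^sub>R (LBINT y. std_normal_density (0 + sqrt e * y) *\<^sub>R iexp (u / sqrt e * (0 + sqrt e * y)))"
  using e by (intro lborel_integral_real_affine) auto
 also have "... = sqrt e *\<^sub>R (LBINT y. (1 / sqrt (2 * pi)) *\<^sub>R (exp (- (e * y\<^sup>2) / 2) *\<^sub>R cis (y * u)))"
  using e by (simp add: normal_density_def power_mult_distrib cis_conv_exp mult_ac)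
 also have "... = (sqrt e / sqrt (2 * pi)) *\<^sub>R (LBINT y. exp (- (e * y\<^sup>2) / 2) *\<^sub>R cis (y * u))"
  by (subst integral_scaleR_right) simp
 finally have *: "(sqrt e / sqrt (2 * pi)) *\<^sub>R (LBINT y. exp (- (e * y\<^sup>2) / 2) *\<^sub>R cis (y * u))
   = complex_of_real (exp (- (u / sqrt e)\<^sup>2 / 2))"
  by (simp add: char_std_normal_distribution)
 have "(LBINT y. exp (- (e * y\<^sup>2) / 2) *\<^sub>R cis (y * u)) =
   sqrt (2 * pi / e) *\<^sub>R ((sqrt e / sqrt (2 * pi)) *\<^sub>R (LBINT y. exp (- (e * y\<^sup>2) / 2) *\<^sub>R cis (y * u)))"
  using e by (simp add: real_sqrt_divide)
 also have "... = sqrt (2 * pi / e) *\<^sub>R complex_of_real (exp (- (u / sqrt e)\<^sup>2 / 2))"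
  unfolding * ..
 also have "... = complex_of_real (sqrt (2 * pi / e) * exp (- (u\<^sup>2 / (2 * e))))"
  using e by (simp add: scaleR_conv_of_real power_divide field_simps)
 finally show "(LBINT y. exp (- (e * y\<^sup>2) / 2) *\<^sub>R cis (y * u)) =
    complex_of_real (sqrt (2 * pi / e) * exp (- (u\<^sup>2 / (2 * e))))" .
qed

lemma cis_sum: "finite I ==> cis (\<Sum>i\<in>I. f i) = (\<Prod>i\<in>I. cis (f i))"
 by (induction I rule: finite_induct) (auto simp: cis_mult[symmetric])

lemma norm_sq_basis: "(norm (x::'a::euclidean_space))\<^sup>2 = (\<Sum>b\<in>Basis. (x \<bullet> b)\<^sup>2)"
 unfolding power2_norm_eq_inner by (subst euclidean_inner) (simp add: power2_eq_square)

lemma gauss_euclidean: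
 fixes x :: "'a::euclidean_space" and e :: real
 assumes e: "e > 0"
 shows "integrable lborel (%s::'a. exp (- (e * (norm s)\<^sup>2) / 2) *\<^sub>R cis (s \<bullet> x))"
  and "(LBINT s. exp (- (e * (norm s)\<^sup>2) / 2) *\<^sub>R cis (s \<bullet> x)) =
    complex_of_real (sqrt (2 * pi / e) ^ DIM('a) * exp (- ((norm x)\<^sup>2 / (2 * e))))"
proof -
 interpret product_sigma_finite "%_::'a. lborel :: real measure" ..
 let ?T = "%f. \<Sum>b\<in>Basis. f b *\<^sub>R b :: 'a"
 let ?h = "%s::'a. exp (- (e * (norm s)\<^sup>2) / 2) *\<^sub>R cis (s \<bullet> x)"
 let ?g = "%b y. exp (- (e * y\<^sup>2) / 2) *\<^sub>R cis (y * (x \<bullet> b))"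
 have comp: "?T f \<bullet> b = f b" if "b \<in> Basis" for f :: "'a => real" and b
  using that by (simp add: inner_sum_left inner_Basis if_distrib cong: if_cong)
 have T[measurable]: "?T \<in> measurable (\<Pi>\<^sub>M b\<in>Basis. lborel) borel"
  by measurable
 have h[measurable]: "?h \<in> borel_measurable borel" by measurable
 have eq: "?h (?T f) = (\<Prod>b\<in>Basis. ?g b (f b))" for f
 proof -
  have 1: "(norm (?T f))\<^sup>2 = (\<Sum>b\<in>Basis. (f b)\<^sup>2)"
   unfolding norm_sq_basis by (intro sum.cong) (simp_all add: comp)
  have 2: "?T f \<bullet> x = (\<Sum>b\<in>Basis. f b * (x \<bullet> b))"
   by (simp add: inner_sum_left inner_commute[of x])
  have 3: "exp (- (e * (\<Sum>b\<in>Basis. (f b)\<^sup>2)) / 2) = (\<Prod>b\<in>Basis. exp (- (e * (f b)\<^sup>2) / 2))"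
   by (subst exp_sum[symmetric]) (auto simp: sum_distrib_left sum_negf sum_divide_distrib)
  show ?thesis
   unfolding 1 2 3 by (simp add: cis_sum scaleR_conv_of_real prod.distrib of_real_prod)
 qed
 have int: "integrable (\<Pi>\<^sub>M b\<in>Basis. lborel) (%f. \<Prod>b\<in>Basis. ?g b (f b))"
  by (intro product_integrable_prod gauss_real e) simp
 show "integrable lborel ?h"
  by (subst lborel_eq, subst integrable_distr_eq[OF T h]) (use int eq in simp)
 have "(LBINT s. ?h s) = (\<integral>f. ?h (?T f) \<partial>(\<Pi>\<^sub>M b\<in>Basis. lborel))"
  by (subst lborel_eq, subst integral_distr[OF T h]) simp
 also have "... = (\<Prod>b\<in>Basis. integral\<^sup>L lborel (?g b))"
  unfolding eq by (intro product_integral_prod gauss_real e) simp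
 also have "... = (\<Prod>b\<in>Basis. complex_of_real (sqrt (2 * pi / e) * exp (- ((x \<bullet> b)\<^sup>2 / (2 * e)))))"
  by (intro prod.cong refl gauss_real e)
 also have "... = complex_of_real (sqrt (2 * pi / e) ^ DIM('a) * exp (- ((norm x)\<^sup>2 / (2 * e))))"
  unfolding norm_sq_basis of_real_prod[symmetric] prod.distrib
  by (simp add: exp_sum[symmetric] sum_negf sum_divide_distrib)
 finally show "(LBINT s. ?h s) =
   complex_of_real (sqrt (2 * pi / e) ^ DIM('a) * exp (- ((norm x)\<^sup>2 / (2 * e))))" .
qed

lemma gauss_integral:
 fixes e :: real
 assumes e: "e > 0"
 shows "integrable lborel (%s::'a::euclidean_space. exp (- (e * (norm s)\<^sup>2) / 2))"
  and "(LBINT s. exp (- (e * (norm (s::'a))\<^sup>2) / 2)) = sqrt (2 * pi / e) ^ DIM('a)"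
proof -
 have i: "integrable lborel (%s::'a. complex_of_real (exp (- (e * (norm s)\<^sup>2) / 2)))"
  using gauss_euclidean(1)[OF e, of "0::'a"] by (simp add: scaleR_conv_of_real)
 then show "integrable lborel (%s::'a. exp (- (e * (norm s)\<^sup>2) / 2))"
  by (simp only: complex_of_real_integrable_eq)
 have "complex_of_real (LBINT s. exp (- (e * (norm (s::'a))\<^sup>2) / 2)) =
  complex_of_real (sqrt (2 * pi / e) ^ DIM('a))"
  using gauss_euclidean(2)[OF e, of "0::'a"]
  by (simp add: scaleR_conv_of_real del: of_real_power of_real_mult of_real_divide of_real_exp)
 then show "(LBINT s. exp (- (e * (norm (s::'a))\<^sup>2) / 2)) = sqrt (2 * pi / e) ^ DIM('a)"
  by (simp only: of_real_eq_iff)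
qed

definition heat_kernel :: "real => 'a::euclidean_space => real" where
 "heat_kernel e z = exp (- ((norm z)\<^sup>2 / (2 * e))) / sqrt (2 * pi * e) ^ DIM('a)"

lemma heat_kernel_measurable [measurable]: "heat_kernel e \<in> borel_measurable borel"
 unfolding heat_kernel_def by measurable

lemma heat_kernel_nonneg: "e > 0 ==> 0 \<le> heat_kernel e z"
 unfolding heat_kernel_def by simp

lemma heat_kernel_minus: "heat_kernel e (x - y) = heat_kernel e (y - x)"
 unfolding heat_kernel_def by (simp add: norm_minus_commute)

lemma heat_kernel_integral:
 assumes e: "e > 0"
 shows "integrable lborel (heat_kernel e :: 'a::euclidean_space => real)"
  and "(LBINT z. heat_kernel e (z::'a)) = 1"
proof -
 have e': "1 / e > 0" using e by simp
 have eq: "heat_kernel e = (%z::'a. exp (- (1 / e * (norm z)\<^sup>2) / 2) / sqrt (2 * pi * e) ^ DIM('a))"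
  using e by (simp add: heat_kernel_def fun_eq_iff mult_ac)
 show "integrable lborel (heat_kernel e :: 'a => real)"
  unfolding eq using gauss_integral(1)[OF e'] by (rule integrable_divide)
 show "(LBINT z. heat_kernel e (z::'a)) = 1"
  unfolding eq using gauss_integral(2)[OF e', where 'a='a] e by simp
qed

lemma lborel_integrable_translate:
 fixes f :: "'a::euclidean_space => 'b::{banach, second_countable_topology}"
 assumes "integrable lborel f"
 shows "integrable lborel (%x. f (c + x))" and "(LBINT x. f (c + x)) = (LBINT x. f x)"
proof -
 have fm[measurable]: "f \<in> borel_measurable borel" using assms by auto
 have *: "integrable (distr lborel borel ((+) c)) f" using assms by (simp add: lborel_distr_plus)
 then show "integrable lborel (%x. f (c + x))" by (subst (asm) integrable_distr_eq) auto
 have "(LBINT x. f x) = (\<integral>x. f x \<partial>distr lborel borel ((+) c))" by (simp add: lborel_distr_plus)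
 also have "... = (LBINT x. f (c + x))" by (subst integral_distr) auto
 finally show "(LBINT x. f (c + x)) = (LBINT x. f x)" by simp
qed

lemma lborel_integrable_reflect:
 fixes f :: "'a::euclidean_space => 'b::{banach, second_countable_topology}"
 assumes "integrable lborel f"
 shows "integrable lborel (%x. f (- x))" and "(LBINT x. f (- x)) = (LBINT x. f x)"
proof -
 have fm[measurable]: "f \<in> borel_measurable borel" using assms by auto
 have d: "distr lborel borel uminus = (lborel :: 'a measure)"
  using lborel_affine[of "-1" "0::'a"] by (simp add: density_1 one_ennreal_def[symmetric])
 have *: "integrable (distr lborel borel uminus) f" using assms by (simp add: d)
 then show "integrable lborel (%x. f (- x))" by (subst (asm) integrable_distr_eq) auto
 have "(LBINT x. f x) = (\<integral>x. f x \<partial>distr lborel borel uminus)" by (simp add: d)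
 also have "... = (LBINT x. f (- x))" by (subst integral_distr) auto
 finally show "(LBINT x. f (- x)) = (LBINT x. f x)" by simp
qed

lemma heat_kernel_shift_integral:
 assumes e: "e > 0"
 shows "integrable lborel (%z. heat_kernel e (x - z :: 'a::euclidean_space))"
  and "(LBINT z. heat_kernel e (x - z :: 'a)) = 1"
proof -
 have *: "heat_kernel e (x - z) = heat_kernel e (- x + z)" for z :: 'a
  by (subst heat_kernel_minus) simp
 show "integrable lborel (%z. heat_kernel e (x - z :: 'a))" "(LBINT z. heat_kernel e (x - z :: 'a)) = 1"
  unfolding * using lborel_integrable_translate[OF heat_kernel_integral(1)[OF e], of "- x"] heat_kernel_integral(2)[OF e, where 'a='a]
  by auto
qed

lemma heat_kernel_le: "e > 0 ==> heat_kernel e (z::'a::euclidean_space) \<le> 1 / sqrt (2 * pi * e) ^ DIM('a)"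
 unfolding heat_kernel_def by (intro divide_right_mono) auto

lemma ft_measurable [measurable]:
 assumes [measurable]: "f \<in> borel_measurable borel"
 shows "ft f \<in> borel_measurable borel"
 unfolding ft_def by measurable

lemma fubini_scaleR_cis:
 fixes f :: "'a::euclidean_space => real" and g :: "'b::euclidean_space => complex"
 assumes f: "integrable lborel f" and g: "integrable lborel g"
  and k[measurable]: "(%(x, y). k x y) \<in> borel_measurable (borel \<Otimes>\<^sub>M borel)"
  and k1: "!!x y. norm (k x y :: complex) \<le> K"
 shows "(LBINT y. (LBINT x. f x *\<^sub>R (g y * k x y))) =
   (LBINT x. (LBINT y. f x *\<^sub>R (g y * k x y)))"
proof (rule lborel_pair.Fubini_integral)
 have [measurable]: "f \<in> borel_measurable borel" "g \<in> borel_measurable borel"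
  using f g by auto
 have K: "0 \<le> K" using k1[of undefined undefined] norm_ge_zero order_trans by blast
 have b: "norm (f x *\<^sub>R (g y * k x y)) \<le> \<bar>f x\<bar> * (norm (g y) * K)" for x y
  by (simp add: norm_mult mult_left_mono k1)
 have i: "integrable lborel (%y. f x *\<^sub>R (g y * k x y))" for x
  by (rule Bochner_Integration.integrable_bound[where f="%y. \<bar>f x\<bar> * (norm (g y) * K)"])
   (use g b K in \<open>auto intro!: AE_I2 simp: norm_mult abs_mult mult_left_mono k1\<close>)
 show "integrable (lborel \<Otimes>\<^sub>M lborel) (%(x, y). f x *\<^sub>R (g y * k x y))"
 proof (rule lborel_pair.Fubini_integrable)
  show "integrable lborel (%x. \<integral>y. norm (case (x, y) of (x, y) => f x *\<^sub>R (g y * k x y)) \<partial>lborel)"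
  proof (rule Bochner_Integration.integrable_bound[where f="%x. \<bar>f x\<bar> * (LBINT y. norm (g y) * K)"])
   show "AE x in lborel. norm (LBINT y. norm (case (x, y) of (x, y) => f x *\<^sub>R (g y * k x y)))
     \<le> norm (\<bar>f x\<bar> * (LBINT y. norm (g y) * K))"
   proof (intro AE_I2)
    fix x
    have "norm (LBINT y. norm (f x *\<^sub>R (g y * k x y))) = (LBINT y. norm (f x *\<^sub>R (g y * k x y)))"
     by (simp del: norm_scaleR norm_mult)
    also have "... \<le> (LBINT y. \<bar>f x\<bar> * (norm (g y) * K))"
     by (intro integral_mono integrable_norm i b) (use g in auto)
    also have "... \<le> norm (\<bar>f x\<bar> * (LBINT y. norm (g y) * K))" by simp
    finally show "norm (LBINT y. norm (case (x, y) of (x, y) => f x *\<^sub>R (g y * k x y)))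
     \<le> norm (\<bar>f x\<bar> * (LBINT y. norm (g y) * K))" by simp
   qed
  qed (use f in auto)
 qed (use i in auto)
qed

text \<open>Fubini's theorem together with the Fourier transform of a Gaussian: damping the transform by a
  Gaussian factor is smoothing the function by the heat kernel.\<close>

lemma ft_heat_smoothing:
 fixes f :: "'a::euclidean_space => real"
 assumes f: "integrable lborel f" and e: "e > 0"
 shows "(LBINT s. exp (- (e * (norm s)\<^sup>2) / 2) *\<^sub>R (ft f s * cis (- (s \<bullet> x)))) =
  complex_of_real ((2 * pi) ^ DIM('a) * (LBINT y. f y * heat_kernel e (x - y)))"
proof -
 have [measurable]: "f \<in> borel_measurable borel" using f by auto
 let ?G = "%s::'a. complex_of_real (exp (- (e * (norm s)\<^sup>2) / 2))"
 have G: "integrable lborel ?G"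
  using gauss_integral(1)[OF e] by (simp only: complex_of_real_integrable_eq)
 have "sqrt (2 * pi / e) * sqrt (2 * pi * e) = sqrt ((2 * pi)\<^sup>2)"
  using e unfolding real_sqrt_mult[symmetric] by (simp add: power2_eq_square)
 then have "sqrt (2 * pi / e) * sqrt (2 * pi * e) = 2 * pi"
  unfolding real_sqrt_abs by simp
 then have "sqrt (2 * pi / e) = 2 * pi / sqrt (2 * pi * e)"
  using e by (simp only: eq_divide_eq) auto
 then have const: "sqrt (2 * pi / e) ^ DIM('a) = (2 * pi) ^ DIM('a) / sqrt (2 * pi * e) ^ DIM('a)"
  by (simp only: power_divide)
 have "(LBINT s. exp (- (e * (norm s)\<^sup>2) / 2) *\<^sub>R (ft f s * cis (- (s \<bullet> x)))) =
   (LBINT s. (LBINT y. f y *\<^sub>R (?G s * cis (s \<bullet> (y - x)))))"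
 proof (rule Bochner_Integration.integral_cong[OF refl])
  fix s :: 'a
  have "exp (- (e * (norm s)\<^sup>2) / 2) *\<^sub>R (ft f s * cis (- (s \<bullet> x))) =
    (?G s * cis (- (s \<bullet> x))) * (LBINT y. f y *\<^sub>R cis (s \<bullet> y))"
   by (simp add: ft_def scaleR_conv_of_real)
  also have "... = (LBINT y. (?G s * cis (- (s \<bullet> x))) * (f y *\<^sub>R cis (s \<bullet> y)))"
   by (rule integral_mult_right_zero[symmetric])
  also have "... = (LBINT y. f y *\<^sub>R (?G s * cis (s \<bullet> (y - x))))"
  proof (rule Bochner_Integration.integral_cong[OF refl])
   fix y :: 'a
   have "cis (s \<bullet> (y - x)) = cis (- (s \<bullet> x)) * cis (s \<bullet> y)"
    by (simp add: inner_diff_right cis_mult)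
   then show "(?G s * cis (- (s \<bullet> x))) * (f y *\<^sub>R cis (s \<bullet> y)) = f y *\<^sub>R (?G s * cis (s \<bullet> (y - x)))"
    by (simp add: scaleR_conv_of_real)
  qed
  finally show "exp (- (e * (norm s)\<^sup>2) / 2) *\<^sub>R (ft f s * cis (- (s \<bullet> x))) =
   (LBINT y. f y *\<^sub>R (?G s * cis (s \<bullet> (y - x))))" .
 qed
 also have "... = (LBINT y. (LBINT s. f y *\<^sub>R (?G s * cis (s \<bullet> (y - x)))))"
  by (rule fubini_scaleR_cis[OF f G, where K=1]) auto
 also have "... = (LBINT y. complex_of_real ((2 * pi) ^ DIM('a) * (f y * heat_kernel e (x - y))))"
 proof (rule Bochner_Integration.integral_cong[OF refl])
  fix y :: 'a
  have "(LBINT s. f y *\<^sub>R (?G s * cis (s \<bullet> (y - x)))) =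
    f y *\<^sub>R (LBINT s. exp (- (e * (norm s)\<^sup>2) / 2) *\<^sub>R cis (s \<bullet> (y - x)))"
   by (simp add: scaleR_conv_of_real)
  also have "... = complex_of_real ((2 * pi) ^ DIM('a) * (f y * heat_kernel e (x - y)))"
   unfolding gauss_euclidean(2)[OF e] const
   by (simp add: heat_kernel_def scaleR_conv_of_real norm_minus_commute)
  finally show "(LBINT s. f y *\<^sub>R (?G s * cis (s \<bullet> (y - x)))) =
   complex_of_real ((2 * pi) ^ DIM('a) * (f y * heat_kernel e (x - y)))" .
 qed
 also have "... = complex_of_real ((2 * pi) ^ DIM('a) * (LBINT y. f y * heat_kernel e (x - y)))"
  by (simp only: integral_complex_of_real integral_mult_right_zero)
 finally show ?thesis .
qed

lemma heat_smoothing_le: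
 fixes f :: "'a::euclidean_space => real"
 assumes [measurable]: "f \<in> borel_measurable borel" and f: "AE x in lborel. f x \<le> B" "!!x. 0 \<le> f x" and e: "e > 0"
 shows "(LBINT y. f y * heat_kernel e (x - y)) \<le> B"
proof -
 have i: "integrable lborel (%y. B * heat_kernel e (x - y))"
  using heat_kernel_shift_integral[OF e] by auto
 have le: "AE y in lborel. f y * heat_kernel e (x - y) \<le> B * heat_kernel e (x - y)"
  using f(1) by eventually_elim (intro mult_right_mono heat_kernel_nonneg e)
 then have two_le_mult: "AE y in lborel. norm (f y * heat_kernel e (x - y)) \<le> norm (B * heat_kernel e (x - y))"
 proof eventually_elim
  case (elim y)
  have "0 \<le> f y * heat_kernel e (x - y)" by (intro mult_nonneg_nonneg f(2) heat_kernel_nonneg e)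
  with elim show ?case by (simp only: real_norm_def abs_of_nonneg)
 qed
 have "(LBINT y. f y * heat_kernel e (x - y)) \<le> (LBINT y. B * heat_kernel e (x - y))"
 proof (rule integral_mono_AE)
  show "integrable lborel (%y. f y * heat_kernel e (x - y))"
   by (rule Bochner_Integration.integrable_bound[OF i])
    (use two_le_mult in auto)
 qed (use i le in auto)
 also have "... = B" using heat_kernel_shift_integral[OF e, of x] by simp
 finally show ?thesis .
qed

text \<open>A one-sided form of Plancherel's theorem: the Gaussian damping makes all integrals finite, and
  Fatou's lemma removes it.\<close>

lemma plancherel_bound:
 fixes f :: "'a::euclidean_space => real"
 assumes f: "integrable lborel f" and B: "AE x in lborel. f x \<le> B" and f0: "!!x. 0 \<le> f x"
 shows "integrable lborel (%s. (norm (ft f s))\<^sup>2)"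
  and "(LBINT s. (norm (ft f s))\<^sup>2) \<le> (2 * pi) ^ DIM('a) * B * (LBINT x. f x)"
proof -
 have [measurable]: "f \<in> borel_measurable borel" using f by auto
 let ?I = "\<integral>x. f x \<partial>lborel" and ?C = "(2 * pi) ^ DIM('a) * B * (LBINT x. f x)"
 have I0: "0 \<le> ?I" by (simp add: f0)
 have bd: "norm (ft f s) \<le> ?I" for s
  using norm_ft_le[of f s] f0 by simp
 have B0: "0 \<le> B"
  by (rule order_trans[OF Bochner_Integration.integral_nonneg heat_smoothing_le[OF _ B f0, of 1 0]])
   (auto intro!: mult_nonneg_nonneg f0 heat_kernel_nonneg)
 have step: "integrable lborel (%s::'a. exp (- (e * (norm s)\<^sup>2) / 2) * (norm (ft f s))\<^sup>2)"
  "(LBINT s. exp (- (e * (norm s)\<^sup>2) / 2) * (norm (ft f s))\<^sup>2) \<le> ?C" if e: "e > 0" for e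
 proof -
  let ?E = "%s::'a. exp (- (e * (norm s)\<^sup>2) / 2)"
  have bd2: "(norm (ft f s))\<^sup>2 \<le> ?I\<^sup>2" for s using bd by (intro power_mono) auto
  show int: "integrable lborel (%s. ?E s * (norm (ft f s))\<^sup>2)"
   by (rule Bochner_Integration.integrable_bound[where f="%s. ?E s * ?I\<^sup>2"])
    (use gauss_integral(1)[OF e] bd2 in \<open>auto intro!: AE_I2 mult_left_mono simp: abs_mult\<close>)
  have G: "integrable lborel (%s. ?E s *\<^sub>R ft f s)"
   by (rule Bochner_Integration.integrable_bound[where f="%s. ?E s * ?I"])
    (use gauss_integral(1)[OF e] bd I0 in \<open>auto intro!: AE_I2 mult_left_mono simp: abs_mult\<close>)
  have "complex_of_real (LBINT s. ?E s * (norm (ft f s))\<^sup>2) =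
    (LBINT s. complex_of_real (?E s * (norm (ft f s))\<^sup>2))"
   by (rule integral_complex_of_real[symmetric])
  also have "... = (LBINT s. (LBINT x. f x *\<^sub>R ((?E s *\<^sub>R ft f s) * cis (- (s \<bullet> x)))))"
  proof (rule Bochner_Integration.integral_cong[OF refl])
   fix s :: 'a
   have "complex_of_real (?E s * (norm (ft f s))\<^sup>2) = (?E s *\<^sub>R ft f s) * cnj (ft f s)"
    by (simp only: of_real_mult complex_norm_square scaleR_conv_of_real mult.assoc)
   also have "... = (?E s *\<^sub>R ft f s) * (LBINT x. f x *\<^sub>R cis ((- s) \<bullet> x))"
    unfolding ft_minus[symmetric] by (simp add: ft_def)
   also have "... = (LBINT x. (?E s *\<^sub>R ft f s) * (f x *\<^sub>R cis ((- s) \<bullet> x)))"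
    by (rule integral_mult_right_zero[symmetric])
   finally show "complex_of_real (?E s * (norm (ft f s))\<^sup>2) = (LBINT x. f x *\<^sub>R ((?E s *\<^sub>R ft f s) * cis (- (s \<bullet> x))))"
    by simp
  qed
  also have "... = (LBINT x. (LBINT s. f x *\<^sub>R ((?E s *\<^sub>R ft f s) * cis (- (s \<bullet> x)))))"
   by (rule fubini_scaleR_cis[OF f G, where K=1]) auto
  also have "... = (LBINT x. complex_of_real (f x * ((2 * pi) ^ DIM('a) * (LBINT y. f y * heat_kernel e (x - y)))))"
   unfolding of_real_mult[of "f _"] scaleR_conv_of_real[symmetric] ft_heat_smoothing[OF f e, symmetric]
   by (simp only: mult_scaleR_left integral_scaleR_right)
  also have "... = complex_of_real (LBINT x. (f x * ((2 * pi) ^ DIM('a) * (LBINT y. f y * heat_kernel e (x - y)))))"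
   by (rule integral_complex_of_real)
  finally have eq: "(LBINT s. ?E s * (norm (ft f s))\<^sup>2) =
    (LBINT x. (f x * ((2 * pi) ^ DIM('a) * (LBINT y. f y * heat_kernel e (x - y)))))"
   by (simp only: of_real_eq_iff)
  also have "... \<le> (LBINT x. f x * ((2 * pi) ^ DIM('a) * B))"
  proof (rule integral_mono')
   show "f x * ((2 * pi) ^ DIM('a) * (LBINT y. f y * heat_kernel e (x - y))) \<le> f x * ((2 * pi) ^ DIM('a) * B)" for x
    by (intro mult_left_mono heat_smoothing_le B f0 e) auto
   show "0 \<le> f x * ((2 * pi) ^ DIM('a) * B)" for x using f0 B0 by simp
  qed (use f in auto)
  also have "... = ?C" by (simp add: mult_ac)
  finally show "(LBINT s. ?E s * (norm (ft f s))\<^sup>2) \<le> ?C" .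
 qed
 let ?u = "%n s::'a. exp (- (1 / real (Suc n) * (norm s)\<^sup>2) / 2) * (norm (ft f s))\<^sup>2"
 have lim: "(%n. ?u n s) \<longlonglongrightarrow> (norm (ft f s))\<^sup>2" for s
 proof -
  have "(%n. ?u n s) \<longlonglongrightarrow> exp (- (0 * (norm s)\<^sup>2) / 2) * (norm (ft f s))\<^sup>2"
   by (intro tendsto_intros LIMSEQ_inverse_real_of_nat[unfolded inverse_eq_divide]) auto
  then show ?thesis by simp
 qed
 have C0: "0 \<le> ?C" using B0 I0 by simp
 have "(\<integral>\<^sup>+s. ennreal ((norm (ft f s))\<^sup>2) \<partial>lborel) = (\<integral>\<^sup>+s. liminf (%n. ennreal (?u n s)) \<partial>lborel)"
  by (intro nn_integral_cong lim_imp_Liminf[symmetric] tendsto_ennrealI lim) auto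
 also have "... \<le> liminf (%n. \<integral>\<^sup>+s. ennreal (?u n s) \<partial>lborel)"
  by (intro nn_integral_liminf) measurable
 also have "... \<le> liminf (%n. ennreal ?C)"
 proof (intro Liminf_mono always_eventually allI)
  fix n
  have "(\<integral>\<^sup>+s. ennreal (?u n s) \<partial>lborel) = ennreal (LBINT s. ?u n s)"
   by (rule nn_integral_eq_integral) (use step(1)[of "1 / real (Suc n)"] in auto)
  also have "... \<le> ennreal ?C"
   using step(2)[of "1 / real (Suc n)"] by (intro ennreal_leI) simp
  finally show "(\<integral>\<^sup>+s. ennreal (?u n s) \<partial>lborel) \<le> ennreal ?C" .
 qed
 also have "... = ennreal ?C" by (simp add: Liminf_const)
 finally have fin: "(\<integral>\<^sup>+s. ennreal ((norm (ft f s))\<^sup>2) \<partial>lborel) \<le> ennreal ?C" .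
 show int: "integrable lborel (%s. (norm (ft f s))\<^sup>2)"
  by (rule integrableI_bounded) (use fin in \<open>auto simp: le_less_trans\<close>)
 have "ennreal (LBINT s. (norm (ft f s))\<^sup>2) \<le> ennreal ?C"
  using fin nn_integral_eq_integral[OF int] by simp
 then show "(LBINT s. (norm (ft f s))\<^sup>2) \<le> ?C"
  using C0 by (simp add: ennreal_le_iff)
qed

lemma ft_continuous:
 fixes f :: "'a::euclidean_space => real"
 assumes f: "integrable lborel f"
 shows "continuous_on UNIV (ft f)"
proof -
 have [measurable]: "f \<in> borel_measurable borel" using f by auto
 have "isCont (ft f) s" for s
  unfolding continuous_at_sequentially comp_def ft_def
 proof (intro allI impI)
  fix X assume X: "X \<longlonglongrightarrow> s"
  show "(%n. \<integral>x. f x *\<^sub>R cis (X n \<bullet> x) \<partial>lborel) \<longlonglongrightarrow> (LBINT x. f x *\<^sub>R cis (s \<bullet> x))"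
   by (rule integral_dominated_convergence[where w="%x. \<bar>f x\<bar>"])
    (use f X in \<open>auto intro!: AE_I2 tendsto_scaleR tendsto_cis tendsto_inner\<close>)
 qed
 then show ?thesis by (simp add: continuous_on_eq_continuous_at)
qed

definition ift :: "('a::euclidean_space => complex) => 'a => complex" where
 "ift g x = (1 / (2 * pi) ^ DIM('a)) *\<^sub>R (LBINT s. g s * cis (- (s \<bullet> x)))"

lemma heat_tail:
 assumes e: "e > 0" and rho: "0 \<le> \<rho>"
 shows "(LBINT z. indicator {z. \<rho> \<le> norm z} z * heat_kernel e (z::'a::euclidean_space))
  \<le> sqrt 2 ^ DIM('a) * exp (- (\<rho>\<^sup>2 / (4 * e)))"
proof -
 have e2: "2 * e > 0" using e by simp
 have c: "sqrt (2 * pi * (2 * e)) ^ DIM('a) = sqrt 2 ^ DIM('a) * sqrt (2 * pi * e) ^ DIM('a)"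
  by (simp add: power_mult_distrib[symmetric] real_sqrt_mult[symmetric] mult_ac)
 have le: "indicator {z. \<rho> \<le> norm z} z * heat_kernel e z \<le> sqrt 2 ^ DIM('a) * exp (- (\<rho>\<^sup>2 / (4 * e))) * heat_kernel (2 * e) z"
  for z :: 'a
 proof (cases "\<rho> \<le> norm z")
  case True
  then have "\<rho>\<^sup>2 \<le> (norm z)\<^sup>2" using rho by (intro power_mono)
  then have "exp (- ((norm z)\<^sup>2 / (2 * e))) \<le> exp (- (\<rho>\<^sup>2 / (4 * e))) * exp (- ((norm z)\<^sup>2 / (2 * (2 * e))))"
   using e by (simp add: exp_add[symmetric] field_simps)
  then have "heat_kernel e z \<le> exp (- (\<rho>\<^sup>2 / (4 * e))) * exp (- ((norm z)\<^sup>2 / (2 * (2 * e)))) / sqrt (2 * pi * e) ^ DIM('a)"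
   unfolding heat_kernel_def using e by (intro divide_right_mono) auto
  also have "... = sqrt 2 ^ DIM('a) * exp (- (\<rho>\<^sup>2 / (4 * e))) * heat_kernel (2 * e) z"
   unfolding heat_kernel_def c by simp
  finally show ?thesis using True by simp
 next
  case False
  then show ?thesis using heat_kernel_nonneg[OF e2, of z] by simp
 qed
 have "(LBINT z. indicator {z. \<rho> \<le> norm z} z * heat_kernel e (z::'a)) \<le>
   (LBINT z. sqrt 2 ^ DIM('a) * exp (- (\<rho>\<^sup>2 / (4 * e))) * heat_kernel (2 * e) (z::'a))"
  by (rule integral_mono') (auto intro!: mult_nonneg_nonneg heat_kernel_nonneg e2 heat_kernel_integral integrable_mult_right le)
 also have "... = sqrt 2 ^ DIM('a) * exp (- (\<rho>\<^sup>2 / (4 * e)))"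
  using heat_kernel_integral[OF e2, where 'a='a] by simp
 finally show ?thesis .
qed

text \<open>The heat kernel concentrates at its centre. Boxes suffice as test sets because they determine
  a finite Borel measure.\<close>

lemma heat_box_tendsto:
 fixes l u y :: "'a::euclidean_space"
 assumes y: "y \<notin> frontier (box l u)"
 shows "(%n. \<integral>x. indicator (box l u) x * heat_kernel (1 / real (Suc n)) (x - y) \<partial>lborel) \<longlonglongrightarrow> indicator (box l u) y"
proof -
 let ?q = "%n. \<integral>x. indicator (box l u) x * heat_kernel (1 / real (Suc n)) (x - y) \<partial>lborel"
 have ep: "1 / real (Suc n) > 0" for n by simp
 have i: "integrable lborel (%x. heat_kernel (1 / real (Suc n)) (x - y))"
  and i1: "(LBINT x. heat_kernel (1 / real (Suc n)) (x - y)) = 1" for n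
  using heat_kernel_shift_integral[OF ep, of n y] by (simp_all add: heat_kernel_minus[of _ y])
 have iA: "integrable lborel (%x. indicator A x * heat_kernel (1 / real (Suc n)) (x - y))"
  if "A \<in> sets borel" for A n
  using integrable_mult_indicator[OF _ i, of A] that by simp
 obtain \<rho> where rho: "\<rho> > 0" and sub: "!!x. norm (x - y) < \<rho> ==> x \<in> box l u \<longleftrightarrow> y \<in> box l u"
 proof (cases "y \<in> box l u")
  case True
  then obtain \<rho> where "\<rho> > 0" "ball y \<rho> \<subseteq> box l u" using open_box openE by blast
  then show ?thesis using that[of \<rho>] True by (auto simp: subset_iff dist_norm norm_minus_commute)
 next
  case False
  then have "y \<notin> closure (box l u)" using y by (simp add: frontier_def interior_open[OF open_box])
  then obtain \<rho> where "\<rho> > 0" "ball y \<rho> \<subseteq> - closure (box l u)"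
   using openE[of "- closure (box l u)" y] by auto
  moreover have "box l u \<subseteq> closure (box l u)" by (rule closure_subset)
  ultimately show ?thesis using that[of \<rho>] False
   by (auto simp: subset_iff dist_norm norm_minus_commute)
 qed
 let ?t = "%n. sqrt 2 ^ DIM('a) * exp (- (\<rho>\<^sup>2 / (4 * (1 / real (Suc n)))))"
 have tl: "(LBINT x. indicator {x. \<rho> \<le> norm (x - y)} x * heat_kernel (1 / real (Suc n)) (x - y)) \<le> ?t n" for n
 proof -
  have "(LBINT x. indicator {x. \<rho> \<le> norm (x - y)} x * heat_kernel (1 / real (Suc n)) (x - y)) =
   (LBINT x. (%z. indicator {z. \<rho> \<le> norm z} z * heat_kernel (1 / real (Suc n)) z) (- y + x))"
   by (intro Bochner_Integration.integral_cong) (auto simp: indicator_def)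
  also have "... = (LBINT z. indicator {z. \<rho> \<le> norm z} z * heat_kernel (1 / real (Suc n)) (z::'a))"
  proof (rule lborel_integrable_translate)
   show "integrable lborel (%z::'a. indicator {z. \<rho> \<le> norm z} z * heat_kernel (1 / real (Suc n)) z)"
    using integrable_mult_indicator[OF _ heat_kernel_integral(1)[OF ep, where 'a='a], of "{z. \<rho> \<le> norm z}" n]
    by simp
  qed
  also have "... \<le> ?t n" using heat_tail[OF ep, where 'a='a] rho by simp
  finally show ?thesis .
 qed
 have bound: "norm (?q n - indicator (box l u) y) \<le> ?t n" for n
 proof -
  have "?q n - indicator (box l u) y = (LBINT x. indicator (box l u) x * heat_kernel (1 / real (Suc n)) (x - y)
    - indicator (box l u) y * heat_kernel (1 / real (Suc n)) (x - y))"
   using iA[of "box l u" n] i[of n] i1[of n] by (subst Bochner_Integration.integral_diff) auto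
  also have "norm ... \<le> (LBINT x. norm (indicator (box l u) x * heat_kernel (1 / real (Suc n)) (x - y)
    - indicator (box l u) y * heat_kernel (1 / real (Suc n)) (x - y)))"
   by (rule integral_norm_bound)
  also have "... \<le> (LBINT x. indicator {x. \<rho> \<le> norm (x - y)} x * heat_kernel (1 / real (Suc n)) (x - y))"
   using iA[of "box l u" n] i[of n] iA[of "{x. \<rho> \<le> norm (x - y)}" n] heat_kernel_nonneg[OF ep, where 'a='a] sub
   by (intro integral_mono) (auto simp: indicator_def not_le)
  also have "... \<le> ?t n" by (rule tl)
  finally show ?thesis .
 qed
 have "?t \<longlonglongrightarrow> 0" using rho by real_asymp
 then have "(%n. ?q n - indicator (box l u) y) \<longlonglongrightarrow> 0"
  by (rule Lim_null_comparison[rotated]) (use bound in auto)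
 then show ?thesis by (simp add: LIM_zero_cancel)
qed

lemma ift_real_part_lim:
 fixes f :: "'a::euclidean_space => real"
 assumes f: "integrable lborel f" and g: "integrable lborel (ft f)"
 shows "(%n. \<integral>y. f y * heat_kernel (1 / real (Suc n)) (x - y) \<partial>lborel) \<longlonglongrightarrow> Re (ift (ft f) x)"
proof -
 have [measurable]: "f \<in> borel_measurable borel" using f by auto
 let ?h = "%n. \<integral>y. f y * heat_kernel (1 / real (Suc n)) (x - y) \<partial>lborel"
 let ?J = "%n. \<integral>s. exp (- (1 / real (Suc n) * (norm s)\<^sup>2) / 2) *\<^sub>R (ft f s * cis (- (s \<bullet> x))) \<partial>lborel"
 have "?J \<longlonglongrightarrow> (LBINT s. ft f s * cis (- (s \<bullet> x)))"
 proof (rule integral_dominated_convergence[where w="%s. norm (ft f s)"])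
  show "AE s in lborel. (%n. exp (- (1 / real (Suc n) * (norm s)\<^sup>2) / 2) *\<^sub>R (ft f s * cis (- (s \<bullet> x)))) \<longlonglongrightarrow> ft f s * cis (- (s \<bullet> x))"
  proof (intro AE_I2)
   fix s :: 'a
   have "(%n. exp (- (1 / real (Suc n) * (norm s)\<^sup>2) / 2) *\<^sub>R (ft f s * cis (- (s \<bullet> x)))) \<longlonglongrightarrow>
    exp (- (0 * (norm s)\<^sup>2) / 2) *\<^sub>R (ft f s * cis (- (s \<bullet> x)))"
    by (intro tendsto_intros LIMSEQ_inverse_real_of_nat[unfolded inverse_eq_divide]) auto
   then show "(%n. exp (- (1 / real (Suc n) * (norm s)\<^sup>2) / 2) *\<^sub>R (ft f s * cis (- (s \<bullet> x)))) \<longlonglongrightarrow> ft f s * cis (- (s \<bullet> x))"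
    by simp
  qed
  show "AE s in lborel. norm (exp (- (1 / real (Suc n) * (norm s)\<^sup>2) / 2) *\<^sub>R (ft f s * cis (- (s \<bullet> x)))) \<le> norm (ft f s)" for n
   by (auto simp: norm_mult intro!: AE_I2 mult_left_le_one_le)
 qed (use g in auto)
 moreover have "?J n = complex_of_real ((2 * pi) ^ DIM('a) * ?h n)" for n
  by (rule ft_heat_smoothing[OF f]) simp
 ultimately have "(%n. complex_of_real ((2 * pi) ^ DIM('a) * ?h n)) \<longlonglongrightarrow> (LBINT s. ft f s * cis (- (s \<bullet> x)))"
  by simp
 then have "(%n. (1 / (2 * pi) ^ DIM('a)) *\<^sub>R complex_of_real ((2 * pi) ^ DIM('a) * ?h n)) \<longlonglongrightarrow> ift (ft f) x"
  unfolding ift_def by (intro tendsto_intros)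
 then have "(%n. Re ((1 / (2 * pi) ^ DIM('a)) *\<^sub>R complex_of_real ((2 * pi) ^ DIM('a) * ?h n))) \<longlonglongrightarrow> Re (ift (ft f) x)"
  by (rule tendsto_Re)
 then show ?thesis by (simp only: scaleR_complex.sel Re_complex_of_real) simp
qed

lemma norm_ift_le:
 "norm (ift g (x::'a::euclidean_space)) \<le> (LBINT s. norm (g s)) / (2 * pi) ^ DIM('a)"
proof -
 have "norm (LBINT s. g s * cis (- (s \<bullet> x))) \<le> (LBINT s. norm (g s))"
  by (rule order_trans[OF integral_norm_bound]) (simp add: norm_mult)
 then show ?thesis by (simp add: ift_def divide_right_mono)
qed

lemma heat_smoothing_box:
 fixes f :: "'a::euclidean_space => real"
 assumes f: "integrable lborel f" and e: "e > 0"
 shows "(LBINT x. indicator (box l u) x * (LBINT y. f y * heat_kernel e (x - y))) =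
  (LBINT y. f y * (LBINT x. indicator (box l u) x * heat_kernel e (x - y)))"
proof -
 have [measurable]: "f \<in> borel_measurable borel" using f by auto
 let ?K = "1 / sqrt (2 * pi * e) ^ DIM('a)"
 have g: "integrable lborel (%x. complex_of_real (indicator (box l u) x))"
  unfolding complex_of_real_integrable_eq
  using emeasure_lborel_box_finite[of l u] by (intro integrable_real_indicator) auto
 have F: "(LBINT x. (LBINT y. f y *\<^sub>R (complex_of_real (indicator (box l u) x) * complex_of_real (heat_kernel e (x - y))))) =
  (LBINT y. (LBINT x. f y *\<^sub>R (complex_of_real (indicator (box l u) x) * complex_of_real (heat_kernel e (x - y)))))"
  by (rule fubini_scaleR_cis[OF f g, where K="?K"])
   (use heat_kernel_le[OF e, where 'a='a] heat_kernel_nonneg[OF e, where 'a='a] in \<open>auto simp: abs_of_nonneg\<close>)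
 have "complex_of_real (indicator (box l u) x * (LBINT y. f y * heat_kernel e (x - y))) =
   (LBINT y. f y *\<^sub>R (complex_of_real (indicator (box l u) x) * complex_of_real (heat_kernel e (x - y))))" for x
  unfolding integral_mult_right_zero[symmetric] integral_complex_of_real[symmetric]
  by (intro Bochner_Integration.integral_cong) (auto simp: scaleR_conv_of_real indicator_def)
 moreover have "complex_of_real (f y * (LBINT x. indicator (box l u) x * heat_kernel e (x - y))) =
   (LBINT x. f y *\<^sub>R (complex_of_real (indicator (box l u) x) * complex_of_real (heat_kernel e (x - y))))" for y
  unfolding integral_mult_right_zero[symmetric] integral_complex_of_real[symmetric]
  by (intro Bochner_Integration.integral_cong) (auto simp: scaleR_conv_of_real indicator_def)
 ultimately have "complex_of_real (LBINT x. indicator (box l u) x * (LBINT y. f y * heat_kernel e (x - y))) =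
  complex_of_real (LBINT y. f y * (LBINT x. indicator (box l u) x * heat_kernel e (x - y)))"
  using F by (simp only: integral_complex_of_real[symmetric])
 then show ?thesis by (simp only: of_real_eq_iff)
qed

lemma ft_inversion_box:
 fixes f :: "'a::euclidean_space => real"
 assumes f: "integrable lborel f" and f0: "!!x. 0 \<le> f x" and g: "integrable lborel (ft f)"
 shows "(LBINT x. indicator (box l u) x * Re (ift (ft f) x)) = (LBINT x. indicator (box l u) x * f x)"
proof -
 have [measurable]: "f \<in> borel_measurable borel" using f by auto
 have [measurable]: "ift (ft f) \<in> borel_measurable borel"
  unfolding ift_def[abs_def] by measurable
 have ep: "1 / real (Suc n) > 0" for n by simp
 let ?h = "%n x. \<integral>y. f y * heat_kernel (1 / real (Suc n)) (x - y) \<partial>lborel"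
 let ?K = "(LBINT s. norm (ft f s)) / (2 * pi) ^ DIM('a)"
 have hb: "\<bar>?h n x\<bar> \<le> ?K" for n x
 proof -
  have "(2 * pi) ^ DIM('a) * \<bar>?h n x\<bar> = norm (complex_of_real ((2 * pi) ^ DIM('a) * ?h n x))"
   by (simp only: norm_of_real abs_mult) simp
  also have "... = norm (LBINT s. exp (- (1 / real (Suc n) * (norm s)\<^sup>2) / 2) *\<^sub>R (ft f s * cis (- (s \<bullet> x))))"
   by (subst ft_heat_smoothing[OF f ep]) (rule refl)
  also have "... \<le> (LBINT s. norm (exp (- (1 / real (Suc n) * (norm s)\<^sup>2) / 2) *\<^sub>R (ft f s * cis (- (s \<bullet> x)))))"
   by (rule integral_norm_bound)
  also have "... \<le> (LBINT s. norm (ft f s))"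
   by (rule integral_mono') (use g in \<open>auto simp: norm_mult intro!: mult_left_le_one_le\<close>)
  finally show ?thesis by (simp add: field_simps)
 qed
 have boxi: "integrable lborel (%x. indicator (box l u) x * c :: real)" for c
  using emeasure_lborel_box_finite[of l u] by (intro integrable_mult_left integrable_real_indicator) auto
 have 1: "(%n. \<integral>x. indicator (box l u) x * ?h n x \<partial>lborel) \<longlonglongrightarrow> (LBINT x. indicator (box l u) x * Re (ift (ft f) x))"
 proof (rule integral_dominated_convergence[where w="%x. indicator (box l u) x * ?K"])
  show "AE x in lborel. (%n. indicator (box l u) x * ?h n x) \<longlonglongrightarrow> indicator (box l u) x * Re (ift (ft f) x)"
   by (intro AE_I2 tendsto_mult tendsto_const ift_real_part_lim f g)
  show "AE x in lborel. norm (indicator (box l u) x * ?h n x) \<le> indicator (box l u) x * ?K" for n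
  proof (intro AE_I2)
   show "norm (indicator (box l u) x * ?h n x) \<le> indicator (box l u) x * ?K" for x
    using hb[of n x] by (cases "x \<in> box l u") simp_all
  qed
 qed (use boxi in auto)
 have 2: "(%n. \<integral>y. f y * (LBINT x. indicator (box l u) x * heat_kernel (1 / real (Suc n)) (x - y)) \<partial>lborel) \<longlonglongrightarrow> (LBINT y. f y * indicator (box l u) y)"
 proof (rule integral_dominated_convergence[where w=f])
  have "AE y in lborel. y \<notin> frontier (box l u)"
  proof (rule AE_not_in)
   have "negligible (frontier (box l u))" by (rule negligible_convex_frontier) simp
   then show "frontier (box l u) \<in> null_sets lborel"
    by (simp add: negligible_iff_null_sets null_sets_completion_iff)
  qed
  then show "AE y in lborel. (%n. f y * (LBINT x. indicator (box l u) x * heat_kernel (1 / real (Suc n)) (x - y))) \<longlonglongrightarrow> f y * indicator (box l u) y"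
   by eventually_elim (intro tendsto_mult tendsto_const heat_box_tendsto)
  show "AE y in lborel. norm (f y * (LBINT x. indicator (box l u) x * heat_kernel (1 / real (Suc n)) (x - y))) \<le> f y" for n
  proof (intro AE_I2)
   fix y :: 'a
   let ?q = "\<integral>x. indicator (box l u) x * heat_kernel (1 / real (Suc n)) (x - y) \<partial>lborel"
   have "0 \<le> ?q" using heat_kernel_nonneg[OF ep, where 'a='a] by (intro Bochner_Integration.integral_nonneg) auto
   moreover have "?q \<le> (LBINT x. heat_kernel (1 / real (Suc n)) (x - y))"
    using heat_kernel_shift_integral(1)[OF ep, of n y] heat_kernel_nonneg[OF ep, where 'a='a]
    by (intro integral_mono') (auto simp: heat_kernel_minus[of _ y] indicator_def)
   ultimately show "norm (f y * ?q) \<le> f y"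
    using heat_kernel_shift_integral(2)[OF ep, of n y] f0[of y]
    by (auto simp: heat_kernel_minus[of _ y] abs_mult intro!: mult_left_le)
  qed
 qed (use f in auto)
 show ?thesis
  using LIMSEQ_unique[OF 1] 2 heat_smoothing_box[OF f ep] by (simp add: mult.commute)
qed

text \<open>Smoothing by the heat kernel commutes with integration over a box; as the smoothing parameter
  vanishes, both sides of the inversion formula have the same integral over every box.\<close>

lemma ft_inversion:
 fixes f :: "'a::euclidean_space => real"
 assumes f: "integrable lborel f" and f0: "!!x. 0 \<le> f x" and g: "integrable lborel (ft f)"
 shows "AE x in lborel. f x = Re (ift (ft f) x)" and "!!x. 0 \<le> Re (ift (ft f) x)"
proof -
 have [measurable]: "f \<in> borel_measurable borel" using f by auto
 have [measurable]: "ift (ft f) \<in> borel_measurable borel"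
  unfolding ift_def[abs_def] by measurable
 let ?r = "%x. Re (ift (ft f) x)"
 have ep: "1 / real (Suc n) > 0" for n by simp
 show r0: "0 \<le> ?r x" for x
  by (rule LIMSEQ_le_const[OF ift_real_part_lim[OF f g]])
   (auto intro!: exI[of _ 0] Bochner_Integration.integral_nonneg mult_nonneg_nonneg f0 heat_kernel_nonneg)
 have box: "emeasure (density lborel (%x. ennreal (f x))) (box l u) = emeasure (density lborel (%x. ennreal (?r x))) (box l u)"
  and fin: "emeasure (density lborel (%x. ennreal (f x))) (box l u) \<noteq> \<infinity>" for l u
 proof -
  let ?K = "(LBINT s. norm (ft f s)) / (2 * pi) ^ DIM('a)"
  have rK: "?r x \<le> ?K" for x
   using norm_ift_le[of "ft f" x] complex_Re_le_cmod order_trans by blast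
  have i1: "integrable lborel (%x. indicator (box l u) x * f x)"
   using integrable_mult_indicator[OF _ f, of "box l u"] by simp
  have i2: "integrable lborel (%x. indicator (box l u) x * ?r x)"
  proof (rule Bochner_Integration.integrable_bound[where f="%x. indicator (box l u) x * ?K"])
   show "integrable lborel (%x. indicator (box l u) x * ?K)"
    using emeasure_lborel_box_finite[of l u] by (intro integrable_mult_left integrable_real_indicator) auto
  qed (use rK r0 in \<open>auto intro!: AE_I2 simp: indicator_def intro: order_trans[OF rK abs_ge_self]\<close>)
  have e1: "emeasure (density lborel (%x. ennreal (f x))) (box l u) = ennreal (LBINT x. indicator (box l u) x * f x)"
   by (subst emeasure_density)
    (auto simp: nn_integral_eq_integral[OF i1, symmetric] f0 intro!: nn_integral_cong split: split_indicator)
  have e2: "emeasure (density lborel (%x. ennreal (?r x))) (box l u) = ennreal (LBINT x. indicator (box l u) x * ?r x)"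
   by (subst emeasure_density)
    (auto simp: nn_integral_eq_integral[OF i2, symmetric] r0 intro!: nn_integral_cong split: split_indicator)
  show "emeasure (density lborel (%x. ennreal (f x))) (box l u) = emeasure (density lborel (%x. ennreal (?r x))) (box l u)"
   unfolding e1 e2 using ft_inversion_box[OF f f0 g, of l u] by simp
  show "emeasure (density lborel (%x. ennreal (f x))) (box l u) \<noteq> \<infinity>"
   unfolding e1 by simp
 qed
 have "density lborel (%x. ennreal (f x)) = density lborel (%x. ennreal (?r x))"
 proof (rule measure_eqI_generator_eq[where \<Omega>=UNIV and E="range (%(a, b). box a b :: 'a set)"
   and A="%n::nat. box (- (real n *\<^sub>R One)) (real n *\<^sub>R One) :: 'a set"])
  show "Int_stable (range (%(a, b). box a b :: 'a set))"
   by (auto simp: Int_stable_def box_Int_box)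
  show "sets (density lborel (%x. ennreal (f x))) = sigma_sets UNIV (range (%(a, b). box a b :: 'a set))"
   by (simp add: borel_eq_box)
  show "sets (density lborel (%x. ennreal (?r x))) = sigma_sets UNIV (range (%(a, b). box a b :: 'a set))"
   by (simp add: borel_eq_box)
  show "(\<Union>n::nat. box (- (real n *\<^sub>R One)) (real n *\<^sub>R One)) = (UNIV :: 'a set)"
   unfolding UN_box_eq_UNIV ..
 qed (use box fin in auto)
 then show "AE x in lborel. f x = ?r x"
  using sigma_finite_measure.density_unique[OF sigma_finite_lborel, of "%x. ennreal (f x)" "%x. ennreal (?r x)"] f0 r0
  by (auto elim!: eventually_mono)
qed

section \<open>Exponential families\<close>

definition mom :: "(real^'d => real) => (real^'d => real) => real^'d => real" where
 "mom q F t = (LBINT x. F x * (exp (t \<bullet> x) * q x))"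

definition subexp :: "(real^'d => real) => bool" where
 "subexp F \<longleftrightarrow> F \<in> borel_measurable borel \<and> (\<forall>\<eta>>0. \<exists>A. \<forall>x. \<bar>F x\<bar> \<le> A * exp (\<eta> * norm x))"

definition tl :: "(real^'d => real) => real^'d => real^'d => real" where
 "tl q t x = exp (t \<bullet> x) / mgf q t * q x"

lemma tilted_eq_tl: "tilted q \<alpha> = tl q (tilt q \<alpha>)"
 by (simp add: tilted_def tl_def fun_eq_iff)

lemma subexp_measurable: "subexp F ==> F \<in> borel_measurable borel"
 by (simp add: subexp_def)

lemma subexpD:
 assumes "subexp F" "\<eta> > 0"
 obtains A where "A \<ge> 0" "!!x. \<bar>F x\<bar> \<le> A * exp (\<eta> * norm x)"
proof -
 obtain A where A: "!!x. \<bar>F x\<bar> \<le> A * exp (\<eta> * norm x)"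
  using assms by (auto simp: subexp_def)
 have "0 \<le> A * exp (\<eta> * norm (0::real^'a))" using A[of 0] by linarith
 then have "A \<ge> 0" by simp
 then show ?thesis using that A by blast
qed

lemma subexp_const: "subexp (%_. c)"
 unfolding subexp_def
proof (intro conjI allI impI)
 fix \<eta> :: real assume "\<eta> > 0"
 then have "\<bar>c\<bar> \<le> \<bar>c\<bar> * exp (\<eta> * norm x)" for x :: "real^'a"
  by (simp add: mult_le_cancel_left1)
 then show "\<exists>A. \<forall>x::real^'a. \<bar>c\<bar> \<le> A * exp (\<eta> * norm x)" by blast
qed simp

lemma subexp_mult:
 assumes "subexp F" "subexp G"
 shows "subexp (%x. F x * G x)"
 unfolding subexp_def
proof (intro conjI allI impI)
 show "(%x. F x * G x) \<in> borel_measurable borel"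
  using assms[THEN subexp_measurable] by measurable
 fix \<eta> :: real assume "\<eta> > 0"
 then have h: "\<eta> / 2 > 0" by simp
 obtain A where A: "A \<ge> 0" "!!x. \<bar>F x\<bar> \<le> A * exp (\<eta> / 2 * norm x)" using subexpD[OF assms(1) h] by blast
 obtain B where B: "B \<ge> 0" "!!x. \<bar>G x\<bar> \<le> B * exp (\<eta> / 2 * norm x)" using subexpD[OF assms(2) h] by blast
 have "\<bar>F x * G x\<bar> \<le> A * B * exp (\<eta> * norm x)" for x
 proof -
  have "\<bar>F x\<bar> * \<bar>G x\<bar> \<le> (A * exp (\<eta> / 2 * norm x)) * (B * exp (\<eta> / 2 * norm x))"
   using A B by (intro mult_mono) auto
  also have "... = A * B * (exp (\<eta> / 2 * norm x) * exp (\<eta> / 2 * norm x))" by simp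
  also have "... = A * B * exp (\<eta> * norm x)" by (simp add: exp_add[symmetric])
  finally show ?thesis by (simp add: abs_mult)
 qed
 then show "\<exists>A. \<forall>x. \<bar>F x * G x\<bar> \<le> A * exp (\<eta> * norm x)" by blast
qed

lemma subexp_norm: "subexp (%x. norm x)"
 unfolding subexp_def
proof (intro conjI allI impI)
 fix \<eta> :: real assume e: "\<eta> > 0"
 have "\<bar>norm x\<bar> \<le> 1 / \<eta> * exp (\<eta> * norm x)" for x :: "real^'a"
 proof -
  have "\<eta> * norm x \<le> exp (\<eta> * norm x)" using exp_ge_add_one_self[of "\<eta> * norm x"] by linarith
  then show ?thesis using e by (simp add: field_simps)
 qed
 then show "\<exists>A. \<forall>x::real^'a. \<bar>norm x\<bar> \<le> A * exp (\<eta> * norm x)" by blast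
qed simp

lemma subexp_le:
 assumes "subexp F" "G \<in> borel_measurable borel" "!!x. \<bar>G x\<bar> \<le> \<bar>F x\<bar>"
 shows "subexp G"
 using assms unfolding subexp_def by (meson order_trans)

lemma subexp_power: "subexp F ==> subexp (%x. F x ^ k)"
 by (induction k) (auto intro: subexp_const subexp_mult)

lemma subexp_component: "subexp (%x. x $ j)"
 by (rule subexp_le[OF subexp_norm]) (auto simp: component_le_norm_cart)

lemma subexp_inner: "subexp (%x. v \<bullet> x)"
 by (rule subexp_le[OF subexp_mult[OF subexp_const[of "norm v"] subexp_norm]])
  (auto simp: Cauchy_Schwarz_ineq2 abs_mult)

lemma subexp_add:
 assumes F: "subexp F" and G: "subexp G"
 shows "subexp (%x. F x + G x)"
 unfolding subexp_def
proof (intro conjI allI impI)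
 show "(%x. F x + G x) \<in> borel_measurable borel"
  using assms[THEN subexp_measurable] by measurable
 fix \<eta> :: real assume h: "\<eta> > 0"
 obtain A where A: "A \<ge> 0" "!!x. \<bar>F x\<bar> \<le> A * exp (\<eta> * norm x)" using subexpD[OF assms(1) h] by blast
 obtain B where B: "B \<ge> 0" "!!x. \<bar>G x\<bar> \<le> B * exp (\<eta> * norm x)" using subexpD[OF assms(2) h] by blast
 have "\<bar>F x + G x\<bar> \<le> (A + B) * exp (\<eta> * norm x)" for x
  using A(2)[of x] B(2)[of x] by (simp add: distrib_right)
 then show "\<exists>A. \<forall>x. \<bar>F x + G x\<bar> \<le> A * exp (\<eta> * norm x)" by blast
qed

lemma abs_exp_minus_one_le: "\<bar>exp u - 1\<bar> \<le> \<bar>u\<bar> * exp \<bar>u\<bar>" for u :: real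
proof (cases "u \<ge> 0")
 case True
 have "1 - u \<le> exp (- u)" using exp_ge_add_one_self[of "- u"] by simp
 then have "(1 - u) * exp u \<le> exp (- u) * exp u" by (intro mult_right_mono) auto
 also have "exp (- u) * exp u = 1" by (simp add: exp_add[symmetric])
 finally have "exp u - 1 \<le> u * exp u" by (simp add: algebra_simps)
 moreover have "0 \<le> exp u - 1" using True by simp
 ultimately show ?thesis using True by simp
next
 case False
 have "\<bar>exp u - 1\<bar> = 1 - exp u" "\<bar>u\<bar> = - u" using False by simp_all
 then have "\<bar>exp u - 1\<bar> \<le> \<bar>u\<bar> * 1" using exp_ge_add_one_self[of u] by linarith
 also have "... \<le> \<bar>u\<bar> * exp \<bar>u\<bar>" by (intro mult_left_mono) auto
 finally show ?thesis .
qed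

lemma abs_exp_remainder_le: "\<bar>exp u - 1 - u\<bar> \<le> u\<^sup>2 * exp \<bar>u\<bar>" for u :: real
proof -
 have 1: "(1 - u) * exp u \<le> exp (- u) * exp u" 
  using exp_ge_add_one_self[of "- u"] by (intro mult_right_mono) auto
 have 2: "exp (- u) * exp u = 1" by (simp add: exp_add[symmetric])
 have "exp u - 1 \<le> u * exp u" using 1 unfolding 2 by (simp add: algebra_simps)
 then have "exp u - 1 - u \<le> u * (exp u - 1)" by (simp add: algebra_simps)
 also have "... \<le> \<bar>u\<bar> * \<bar>exp u - 1\<bar>" by (metis abs_ge_self abs_mult)
 also have "... \<le> \<bar>u\<bar> * (\<bar>u\<bar> * exp \<bar>u\<bar>)" by (intro mult_left_mono abs_exp_minus_one_le) auto
 also have "... = u\<^sup>2 * exp \<bar>u\<bar>" by (simp add: power2_eq_square)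
 finally have "exp u - 1 - u \<le> u\<^sup>2 * exp \<bar>u\<bar>" .
 moreover have "0 \<le> exp u - 1 - u" using exp_ge_add_one_self[of u] by linarith
 ultimately show ?thesis by simp
qed

lemma integral_pos_AE:
 fixes q g :: "'a::euclidean_space => real"
 assumes q: "!!x. 0 \<le> q x" and qpos: "0 < (LBINT x. q x)"
  and g: "!!x. 0 \<le> g x" and gpos: "AE x in lborel. 0 < g x"
  and int: "integrable lborel (%x. g x * q x)"
 shows "0 < (LBINT x. g x * q x)"
proof (rule ccontr)
 assume "\<not> 0 < (LBINT x. g x * q x)"
 moreover have "0 \<le> (LBINT x. g x * q x)" using q g by simp
 ultimately have "(LBINT x. g x * q x) = 0" by simp
 then have "AE x in lborel. g x * q x = 0"
  using integral_nonneg_eq_0_iff_AE[OF int] q g by auto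
 with gpos have "AE x in lborel. q x = 0"
  by eventually_elim auto
 then have "(LBINT x. q x) = 0"
  by (rule integral_eq_zero_AE)
 with qpos show False by simp
qed

lemma AE_not_hyperplane:
 fixes v :: "'a::euclidean_space"
 assumes "v \<noteq> 0"
 shows "AE x in lborel. v \<bullet> x \<noteq> b"
proof -
 have "negligible {x. v \<bullet> x = b}" using assms by (intro negligible_hyperplane) auto
 then have "{x. v \<bullet> x = b} \<in> null_sets lborel"
  by (simp add: negligible_iff_null_sets null_sets_completion_iff)
 then show ?thesis using AE_not_in by fastforce
qed

lemma partial_cong:
 assumes "open S" "x \<in> S" "!!y. y \<in> S ==> f y = g y"
 shows "partial j f x = partial j g x"
 unfolding partial_def
proof (rule deriv_cong_ev)
 have "((%h. x + h *\<^sub>R axis j 1) \<longlongrightarrow> x + 0 *\<^sub>R axis j 1) (nhds (0::real))"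
  by (intro tendsto_intros filterlim_ident)
 then have "\<forall>\<^sub>F h in nhds (0::real). x + h *\<^sub>R axis j 1 \<in> S"
  using assms(1,2) by (simp add: tendsto_def)
 then show "\<forall>\<^sub>F h in nhds 0. f (x + h *\<^sub>R axis j 1) = g (x + h *\<^sub>R axis j 1)"
  by eventually_elim (rule assms(3))
qed simp

locale pdf =
 fixes q :: "real^'d => real"
 assumes q_meas [measurable]: "q \<in> borel_measurable borel"
  and q_nonneg: "!!x. 0 \<le> q x"
  and q_int: "integrable lborel q"
  and q_mass: "(LBINT x. q x) = 1"
begin

lemma integrable_law: 
 fixes f :: "real^'d => 'b::{banach, second_countable_topology}"
 assumes "f \<in> borel_measurable borel"
 shows "integrable (law q) f \<longleftrightarrow> integrable lborel (%x. q x *\<^sub>R f x)"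
 unfolding law_def using assms q_nonneg by (subst integrable_density) auto

lemma integral_law:
 fixes f :: "real^'d => 'b::{banach, second_countable_topology}"
 assumes "f \<in> borel_measurable borel"
 shows "(\<integral>x. f x \<partial>law q) = (LBINT x. q x *\<^sub>R f x)"
 unfolding law_def using assms q_nonneg by (subst integral_density) auto

lemma mgf_dom_iff: "t \<in> mgf_dom q \<longleftrightarrow> integrable lborel (%x. exp (t \<bullet> x) * q x)"
 unfolding mgf_dom_def by (simp add: integrable_law mult.commute)

lemma mgf_eq_mom: "mgf q t = mom q (%_. 1) t"
 unfolding mgf_def mom_def by (subst integral_law) (auto simp: mult.commute)

lemma cf_eq_ft: "cf q = ft q"
 unfolding cf_def[abs_def] ft_def[abs_def] by (subst integral_law) (auto simp: cis_conv_exp)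

lemma mgf_pos:
 assumes "t \<in> mgf_dom q"
 shows "0 < mgf q t"
 unfolding mgf_eq_mom mom_def using assms
 by (simp, intro integral_pos_AE) (auto simp: q_nonneg q_mass mgf_dom_iff)

text \<open>There is room for a small extra exponential weight around an interior point, since
  \<open>exp (c * norm x)\<close> is dominated by a finite sum of exponentials in the coordinate directions.
 All differentiations below the integral sign rest on this.\<close>

lemma dominated:
 assumes t: "t \<in> interior (mgf_dom q)"
 obtains c where "c > 0" "integrable lborel (%x. exp (t \<bullet> x + c * norm x) * q x)"
proof -
 obtain e where e: "e > 0" "cball t e \<subseteq> mgf_dom q"
  using t by (meson interior_subset mem_interior_cball subset_trans)
 let ?n = "real CARD('d)"
 define c where "c = e / ?n"
 have c: "c > 0" using e by (simp add: c_def)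
 have i: "integrable lborel (%x. exp ((t + s *\<^sub>R axis j 1) \<bullet> x) * q x)" if "\<bar>s\<bar> \<le> e" for s j
 proof -
  have "norm (s *\<^sub>R axis j (1::real)) = \<bar>s\<bar>" by simp
  then have "t + s *\<^sub>R axis j 1 \<in> cball t e" using that by (simp add: dist_norm)
  then show ?thesis using e mgf_dom_iff by blast
 qed
 have int: "integrable lborel (%x. \<Sum>j\<in>UNIV. exp ((t + e *\<^sub>R axis j 1) \<bullet> x) * q x + exp ((t + (- e) *\<^sub>R axis j 1) \<bullet> x) * q x)"
  using e by (intro Bochner_Integration.integrable_sum Bochner_Integration.integrable_add i) auto
 have le: "exp (t \<bullet> x + c * norm x) * q x \<le> (\<Sum>j\<in>UNIV. exp ((t + e *\<^sub>R axis j 1) \<bullet> x) * q x + exp ((t + (- e) *\<^sub>R axis j 1) \<bullet> x) * q x)" for x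
 proof -
  have "norm x \<le> (\<Sum>j\<in>UNIV. \<bar>x $ j\<bar>)" by (rule norm_le_l1_cart)
  also have "... \<le> (\<Sum>j\<in>(UNIV::'d set). Max (range (%j. \<bar>x $ j\<bar>)))" by (intro sum_mono) auto
  finally have n: "norm x \<le> ?n * Max (range (%j. \<bar>x $ j\<bar>))" by simp
  have "Max (range (%j. \<bar>x $ j\<bar>)) \<in> range (%j. \<bar>x $ j\<bar>)" by (intro Max_in) auto
  then obtain j where j: "Max (range (%j. \<bar>x $ j\<bar>)) = \<bar>x $ j\<bar>" unfolding image_iff by blast
  have "c * norm x \<le> c * (?n * \<bar>x $ j\<bar>)" using n c unfolding j by (intro mult_left_mono) auto
  then have "c * norm x \<le> e * \<bar>x $ j\<bar>" by (simp add: c_def)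
  then have "exp (t \<bullet> x + c * norm x) \<le> exp (t \<bullet> x + e * \<bar>x $ j\<bar>)" by simp
  also have "... \<le> exp ((t + e *\<^sub>R axis j 1) \<bullet> x) + exp ((t + (- e) *\<^sub>R axis j 1) \<bullet> x)"
   by (cases "x $ j \<ge> 0") (auto simp: inner_add_left inner_diff_left inner_axis' add_increasing add_increasing2)
  finally have "exp (t \<bullet> x + c * norm x) * q x \<le> (exp ((t + e *\<^sub>R axis j 1) \<bullet> x) + exp ((t + (- e) *\<^sub>R axis j 1) \<bullet> x)) * q x"
   by (intro mult_right_mono q_nonneg)
  also have "... = exp ((t + e *\<^sub>R axis j 1) \<bullet> x) * q x + exp ((t + (- e) *\<^sub>R axis j 1) \<bullet> x) * q x"
   by (simp add: distrib_right)
  also have "... \<le> (\<Sum>j\<in>UNIV. exp ((t + e *\<^sub>R axis j 1) \<bullet> x) * q x + exp ((t + (- e) *\<^sub>R axis j 1) \<bullet> x) * q x)"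
   by (intro member_le_sum) (auto simp: q_nonneg)
  finally show ?thesis .
 qed
 have "integrable lborel (%x. exp (t \<bullet> x + c * norm x) * q x)"
  by (rule Bochner_Integration.integrable_bound[OF int])
   (use order_trans[OF le abs_ge_self] in \<open>auto intro!: AE_I2 simp: q_nonneg abs_mult\<close>)
 with c that show ?thesis by blast
qed

lemma mom_dominated:
 assumes c: "0 < c" and i: "integrable lborel (%x. exp (t \<bullet> x + c * norm x) * q x)" and F: "subexp F"
  and s: "norm (s - t) < c"
 shows "integrable lborel (%x. F x * (exp (s \<bullet> x) * q x))"
proof -
 obtain A where A: "A \<ge> 0" "!!x. \<bar>F x\<bar> \<le> A * exp ((c - norm (s - t)) * norm x)" using subexpD[OF F, of "c - norm (s - t)"] s by auto
 have [measurable]: "F \<in> borel_measurable borel" by (rule subexp_measurable[OF F])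
 show ?thesis
 proof (rule Bochner_Integration.integrable_bound[where f="%x. A * (exp (t \<bullet> x + c * norm x) * q x)"])
  show "integrable lborel (%x. A * (exp (t \<bullet> x + c * norm x) * q x))" by (intro integrable_mult_right i)
  show "AE x in lborel. norm (F x * (exp (s \<bullet> x) * q x)) \<le> norm (A * (exp (t \<bullet> x + c * norm x) * q x))"
  proof (intro AE_I2)
   fix x
   have "(s - t) \<bullet> x \<le> norm (s - t) * norm x" by (rule norm_cauchy_schwarz)
   then have "s \<bullet> x \<le> t \<bullet> x + norm (s - t) * norm x" by (simp add: inner_diff_left)
   then have e: "exp (s \<bullet> x) \<le> exp (t \<bullet> x + norm (s - t) * norm x)" by simp
   have "norm (F x * (exp (s \<bullet> x) * q x)) = \<bar>F x\<bar> * (exp (s \<bullet> x) * q x)"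
    by (simp add: abs_mult q_nonneg)
   also have "... \<le> (A * exp ((c - norm (s - t)) * norm x)) * (exp (t \<bullet> x + norm (s - t) * norm x) * q x)"
    using A by (intro mult_mono mult_right_mono e A q_nonneg) (auto simp: q_nonneg)
   also have "... = A * ((exp ((c - norm (s - t)) * norm x) * exp (t \<bullet> x + norm (s - t) * norm x)) * q x)"
    by (simp add: mult_ac)
   also have "exp ((c - norm (s - t)) * norm x) * exp (t \<bullet> x + norm (s - t) * norm x) = exp (t \<bullet> x + c * norm x)"
    by (simp add: exp_add[symmetric] algebra_simps)
   finally show "norm (F x * (exp (s \<bullet> x) * q x)) \<le> norm (A * (exp (t \<bullet> x + c * norm x) * q x))"
    using A by (simp add: q_nonneg)
  qed
 qed simp
qed

lemma mom_integrable:
 assumes t: "t \<in> interior (mgf_dom q)" and F: "subexp F"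
 shows "integrable lborel (%x. F x * (exp (t \<bullet> x) * q x))"
proof -
 obtain c where c: "c > 0" "integrable lborel (%x. exp (t \<bullet> x + c * norm x) * q x)"
  using dominated[OF t] by blast
 show ?thesis using mom_dominated[OF c F, of t] c by simp
qed

lemma mom_has_derivative:
 assumes t: "t \<in> interior (mgf_dom q)" and F: "subexp F"
 shows "((%h. mom q F (t + h *\<^sub>R axis j 1)) has_real_derivative mom q (%x. F x * x $ j) t) (at 0)"
proof -
 obtain c where c: "c > 0" and i: "integrable lborel (%x. exp (t \<bullet> x + c * norm x) * q x)"
  using dominated[OF t] by blast
 have F2: "subexp (%x. F x * (norm x)\<^sup>2)" by (intro subexp_mult F subexp_power subexp_norm)
 then obtain A where A: "A \<ge> 0" "!!x. \<bar>F x * (norm x)\<^sup>2\<bar> \<le> A * exp (c / 2 * norm x)"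
  using subexpD[OF F2, of "c / 2"] c by auto
 have [measurable]: "F \<in> borel_measurable borel" by (rule subexp_measurable[OF F])
 define K where "K = (LBINT x. A * (exp (t \<bullet> x + c * norm x) * q x))"
 have bnd: "\<bar>(mom q F (t + h *\<^sub>R axis j 1) - mom q F t) / h - mom q (%x. F x * x $ j) t\<bar> \<le> K * \<bar>h\<bar>"
  if h: "h \<noteq> 0" "\<bar>h\<bar> < c / 2" for h
 proof -
  have nh: "norm (h *\<^sub>R axis j (1::real)) = \<bar>h\<bar>" by simp
  have i1: "integrable lborel (%x. F x * (exp ((t + h *\<^sub>R axis j 1) \<bullet> x) * q x))"
   using c h by (intro mom_dominated[OF c i F]) auto
  have i2: "integrable lborel (%x. F x * (exp (t \<bullet> x) * q x))"
   using c by (intro mom_dominated[OF c i F]) auto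
  have i3: "integrable lborel (%x. (F x * x $ j) * (exp (t \<bullet> x) * q x))"
   using c by (intro mom_dominated[OF c i] subexp_mult F subexp_component) auto
  have "\<bar>(mom q F (t + h *\<^sub>R axis j 1) - mom q F t) - h * mom q (%x. F x * x $ j) t\<bar> =
   \<bar>\<integral>x. F x * (exp ((t + h *\<^sub>R axis j 1) \<bullet> x) * q x) - F x * (exp (t \<bullet> x) * q x) - h * ((F x * x $ j) * (exp (t \<bullet> x) * q x)) \<partial>lborel\<bar>"
   unfolding mom_def using i1 i2 i3 by simp
  also have "... \<le> (LBINT x. h\<^sup>2 * (A * (exp (t \<bullet> x + c * norm x) * q x)))"
  proof (rule order_trans[OF integral_abs_bound integral_mono'])
   show "integrable lborel (%x. h\<^sup>2 * (A * (exp (t \<bullet> x + c * norm x) * q x)))"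
    by (intro integrable_mult_right i)
   fix x
   let ?u = "h * x $ j"
   have u: "\<bar>?u\<bar> \<le> \<bar>h\<bar> * norm x" by (simp add: abs_mult mult_left_mono component_le_norm_cart)
   also have "... \<le> c / 2 * norm x" using h by (intro mult_right_mono) auto
   finally have u2: "exp \<bar>?u\<bar> \<le> exp (c / 2 * norm x)" by simp
   have "?u\<^sup>2 \<le> (\<bar>h\<bar> * norm x)\<^sup>2" using u by (metis abs_ge_zero power2_abs power_mono)
   then have u3: "?u\<^sup>2 \<le> h\<^sup>2 * (norm x)\<^sup>2" by (simp add: power_mult_distrib)
   have ex: "exp ((t + h *\<^sub>R axis j 1) \<bullet> x) = exp (t \<bullet> x) * exp ?u"
    by (simp add: inner_add_left inner_axis' exp_add)
   have "F x * (exp ((t + h *\<^sub>R axis j 1) \<bullet> x) * q x) - F x * (exp (t \<bullet> x) * q x) - h * ((F x * x $ j) * (exp (t \<bullet> x) * q x))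
     = F x * (exp ?u - 1 - ?u) * (exp (t \<bullet> x) * q x)"
    unfolding ex by (simp add: algebra_simps)
   then have "\<bar>F x * (exp ((t + h *\<^sub>R axis j 1) \<bullet> x) * q x) - F x * (exp (t \<bullet> x) * q x) - h * ((F x * x $ j) * (exp (t \<bullet> x) * q x))\<bar>
     = \<bar>F x\<bar> * \<bar>exp ?u - 1 - ?u\<bar> * (exp (t \<bullet> x) * q x)"
    by (simp add: abs_mult q_nonneg)
   also have "... \<le> \<bar>F x\<bar> * ((h\<^sup>2 * (norm x)\<^sup>2) * exp (c / 2 * norm x)) * (exp (t \<bullet> x) * q x)"
    using order_trans[OF abs_exp_remainder_le mult_mono[OF u3 u2]]
    by (intro mult_right_mono mult_left_mono) (auto simp: q_nonneg)
   also have "... = h\<^sup>2 * (\<bar>F x * (norm x)\<^sup>2\<bar> * (exp (c / 2 * norm x) * (exp (t \<bullet> x) * q x)))"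
    by (simp add: abs_mult mult_ac)
   also have "... \<le> h\<^sup>2 * ((A * exp (c / 2 * norm x)) * (exp (c / 2 * norm x) * (exp (t \<bullet> x) * q x)))"
    by (intro mult_left_mono mult_right_mono A) (auto simp: q_nonneg)
   also have "... = h\<^sup>2 * (A * ((exp (c / 2 * norm x) * exp (c / 2 * norm x) * exp (t \<bullet> x)) * q x))"
    by (simp add: mult_ac)
   also have "exp (c / 2 * norm x) * exp (c / 2 * norm x) * exp (t \<bullet> x) = exp (t \<bullet> x + c * norm x)"
    by (simp add: exp_add[symmetric] algebra_simps)
   finally show "\<bar>F x * (exp ((t + h *\<^sub>R axis j 1) \<bullet> x) * q x) - F x * (exp (t \<bullet> x) * q x) - h * ((F x * x $ j) * (exp (t \<bullet> x) * q x))\<bar>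
     \<le> h\<^sup>2 * (A * (exp (t \<bullet> x + c * norm x) * q x))" .
   show "0 \<le> h\<^sup>2 * (A * (exp (t \<bullet> x + c * norm x) * q x))" using A q_nonneg by simp
  qed
  also have "... = h\<^sup>2 * K" unfolding K_def by (rule integral_mult_right_zero)
  finally have 1: "\<bar>(mom q F (t + h *\<^sub>R axis j 1) - mom q F t) - h * mom q (%x. F x * x $ j) t\<bar> \<le> h\<^sup>2 * K" .
  have "\<bar>(mom q F (t + h *\<^sub>R axis j 1) - mom q F t) / h - mom q (%x. F x * x $ j) t\<bar> =
   \<bar>((mom q F (t + h *\<^sub>R axis j 1) - mom q F t) - h * mom q (%x. F x * x $ j) t) / h\<bar>"
   using h by (simp add: diff_divide_distrib)
  also have "... \<le> h\<^sup>2 * K / \<bar>h\<bar>" unfolding abs_divide by (intro divide_right_mono 1) simp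
  also have "... = K * \<bar>h\<bar>" using h by (simp add: power2_eq_square abs_mult[symmetric] field_simps)
  finally show ?thesis .
 qed
 have "((%h. (mom q F (t + h *\<^sub>R axis j 1) - mom q F t) / h - mom q (%x. F x * x $ j) t) \<longlongrightarrow> 0) (at 0)"
 proof (rule Lim_null_comparison)
  show "\<forall>\<^sub>F h in at 0. norm ((mom q F (t + h *\<^sub>R axis j 1) - mom q F t) / h - mom q (%x. F x * x $ j) t) \<le> K * \<bar>h\<bar>"
   unfolding eventually_at using bnd c by (intro exI[of _ "c / 2"]) (auto simp: dist_real_def)
  show "((%h. K * \<bar>h\<bar>) \<longlongrightarrow> 0) (at (0::real))" by (auto intro!: tendsto_eq_intros)
 qed
 then show ?thesis
  by (simp add: DERIV_def LIM_zero_cancel)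
qed

lemma mom_continuous:
 assumes F: "subexp F"
 shows "continuous_on (interior (mgf_dom q)) (mom q F)"
proof (rule continuous_at_imp_continuous_on, rule ballI)
 fix t assume t: "t \<in> interior (mgf_dom q)"
 obtain c where c: "c > 0" and i: "integrable lborel (%x. exp (t \<bullet> x + c * norm x) * q x)"
  using dominated[OF t] by blast
 have F2: "subexp (%x. F x * norm x)" by (intro subexp_mult F subexp_norm)
 then obtain A where A: "A \<ge> 0" "!!x. \<bar>F x * norm x\<bar> \<le> A * exp (c / 2 * norm x)"
  using subexpD[OF F2, of "c / 2"] c by auto
 have [measurable]: "F \<in> borel_measurable borel" by (rule subexp_measurable[OF F])
 define K where "K = (LBINT x. A * (exp (t \<bullet> x + c * norm x) * q x))"
 have bnd: "\<bar>mom q F s - mom q F t\<bar> \<le> norm (s - t) * K" if h: "norm (s - t) < c / 2" for s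
 proof -
  have i1: "integrable lborel (%x. F x * (exp (s \<bullet> x) * q x))"
   using c h by (intro mom_dominated[OF c i F]) auto
  have i2: "integrable lborel (%x. F x * (exp (t \<bullet> x) * q x))"
   using c by (intro mom_dominated[OF c i F]) auto
  have "\<bar>mom q F s - mom q F t\<bar> = \<bar>\<integral>x. F x * (exp (s \<bullet> x) * q x) - F x * (exp (t \<bullet> x) * q x) \<partial>lborel\<bar>"
   unfolding mom_def using i1 i2 by simp
  also have "... \<le> (LBINT x. norm (s - t) * (A * (exp (t \<bullet> x + c * norm x) * q x)))"
  proof (rule order_trans[OF integral_abs_bound integral_mono'])
   show "integrable lborel (%x. norm (s - t) * (A * (exp (t \<bullet> x + c * norm x) * q x)))"
    by (intro integrable_mult_right i)
   fix x
   let ?u = "(s - t) \<bullet> x"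
   have u: "\<bar>?u\<bar> \<le> norm (s - t) * norm x" by (rule Cauchy_Schwarz_ineq2)
   also have "... \<le> c / 2 * norm x" using h by (intro mult_right_mono) auto
   finally have u2: "exp \<bar>?u\<bar> \<le> exp (c / 2 * norm x)" by simp
   have ex: "exp (s \<bullet> x) = exp (t \<bullet> x) * exp ?u"
    by (simp add: inner_diff_left exp_add[symmetric])
   have "F x * (exp (s \<bullet> x) * q x) - F x * (exp (t \<bullet> x) * q x) = F x * (exp ?u - 1) * (exp (t \<bullet> x) * q x)"
    unfolding ex by (simp add: algebra_simps)
   then have "\<bar>F x * (exp (s \<bullet> x) * q x) - F x * (exp (t \<bullet> x) * q x)\<bar>
     = \<bar>F x\<bar> * \<bar>exp ?u - 1\<bar> * (exp (t \<bullet> x) * q x)"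
    by (simp add: abs_mult q_nonneg)
   also have "... \<le> \<bar>F x\<bar> * ((norm (s - t) * norm x) * exp (c / 2 * norm x)) * (exp (t \<bullet> x) * q x)"
    using order_trans[OF abs_exp_minus_one_le mult_mono[OF u u2]]
    by (intro mult_right_mono mult_left_mono) (auto simp: q_nonneg)
   also have "... = norm (s - t) * (\<bar>F x * norm x\<bar> * (exp (c / 2 * norm x) * (exp (t \<bullet> x) * q x)))"
    by (simp add: abs_mult mult_ac)
   also have "... \<le> norm (s - t) * ((A * exp (c / 2 * norm x)) * (exp (c / 2 * norm x) * (exp (t \<bullet> x) * q x)))"
    by (intro mult_left_mono mult_right_mono A) (auto simp: q_nonneg)
   also have "... = norm (s - t) * (A * ((exp (c / 2 * norm x) * exp (c / 2 * norm x) * exp (t \<bullet> x)) * q x))"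
    by (simp add: mult_ac)
   also have "exp (c / 2 * norm x) * exp (c / 2 * norm x) * exp (t \<bullet> x) = exp (t \<bullet> x + c * norm x)"
    by (simp add: exp_add[symmetric] algebra_simps)
   finally show "\<bar>F x * (exp (s \<bullet> x) * q x) - F x * (exp (t \<bullet> x) * q x)\<bar> \<le> norm (s - t) * (A * (exp (t \<bullet> x + c * norm x) * q x))" .
   show "0 \<le> norm (s - t) * (A * (exp (t \<bullet> x + c * norm x) * q x))" using A q_nonneg by simp
  qed
  also have "... = norm (s - t) * K" unfolding K_def by (rule integral_mult_right_zero)
  finally show ?thesis .
 qed
 have "((%s. mom q F s - mom q F t) \<longlongrightarrow> 0) (at t)"
 proof (rule Lim_null_comparison)
  show "\<forall>\<^sub>F s in at t. norm (mom q F s - mom q F t) \<le> norm (s - t) * K"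
   unfolding eventually_at using bnd c by (intro exI[of _ "c / 2"]) (auto simp: dist_norm)
  show "((%s. norm (s - t) * K) \<longlongrightarrow> 0) (at t)" by (auto intro!: tendsto_eq_intros)
 qed
 then show "isCont (mom q F) t" by (simp add: isCont_def LIM_zero_cancel)
qed

end

lemma ln_deriv_line:
 assumes "((%h. f (t + h *\<^sub>R axis j 1)) has_real_derivative D) (at 0)" "f t > (0::real)"
 shows "((%h. ln (f (t + h *\<^sub>R axis j 1))) has_real_derivative D / f t) (at 0)"
 using DERIV_chain2[OF DERIV_ln_divide[of "f (t + 0 *\<^sub>R axis j 1)"] assms(1)] assms(2) by simp

lemma one_plus_less_exp:
 assumes "u \<noteq> (0::real)"
 shows "1 + u < exp u"
proof (cases "1 + u / 2 \<ge> 0")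
 case True
 have "1 + u < 1 + u + u\<^sup>2 / 4" using assms by simp
 also have "... = (1 + u / 2)\<^sup>2" by (simp add: power2_eq_square field_simps)
 also have "... \<le> (exp (u / 2))\<^sup>2"
  using True exp_ge_add_one_self[of "u / 2"] by (intro power_mono)
 also have "... = exp u" by (simp add: exp_double[symmetric])
 finally show ?thesis .
next
 case False
 then have "1 + u < 0" by simp
 also have "0 < exp u" by simp
 finally show ?thesis .
qed

context pdf
begin

lemma interior_dom_dom: "t \<in> interior (mgf_dom q) ==> t \<in> mgf_dom q"
 using interior_subset by blast

lemma mom_one_pos: "t \<in> interior (mgf_dom q) ==> 0 < mom q (%_. 1) t"
 using mgf_pos interior_dom_dom mgf_eq_mom by metis

lemma partial_cgf:
 assumes t: "t \<in> interior (mgf_dom q)"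
 shows "partial j (cgf q) t = mom q (%x. x $ j) t / mom q (%_. 1) t"
 unfolding partial_def cgf_def mgf_eq_mom
 using ln_deriv_line[OF mom_has_derivative[OF t subexp_const] mom_one_pos[OF t], of j]
 by (auto intro: DERIV_imp_deriv)

lemma mean_fun_eq:
 "t \<in> interior (mgf_dom q) ==> mean_fun q t = (\<chi> j. mom q (%x. x $ j) t / mom q (%_. 1) t)"
 unfolding mean_fun_def grad_def by (simp add: partial_cgf)

lemma partial_partial_cgf:
 assumes t: "t \<in> interior (mgf_dom q)"
 shows "partial l (partial m (cgf q)) t =
   (mom q (%x. x $ m * x $ l) t * mom q (%_. 1) t - mom q (%x. x $ m) t * mom q (%x. x $ l) t)
    / (mom q (%_. 1) t * mom q (%_. 1) t)"
proof -
 have 1: "mom q (%_. 1) (t + 0 *\<^sub>R axis l 1) \<noteq> 0" using mom_one_pos[OF t] by simp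
 have "partial l (partial m (cgf q)) t = partial l (%t. mom q (%x. x $ m) t / mom q (%_. 1) t) t"
  by (rule partial_cong[OF open_interior t partial_cgf])
 also have "... = (mom q (%x. x $ m * x $ l) t * mom q (%_. 1) t - mom q (%x. x $ m) t * mom q (%x. x $ l) t)
    / (mom q (%_. 1) t * mom q (%_. 1) t)"
  unfolding partial_def
  using DERIV_divide[OF mom_has_derivative[OF t subexp_component] mom_has_derivative[OF t subexp_const[of 1]] 1]
  by (auto intro: DERIV_imp_deriv)
 finally show ?thesis .
qed

lemma partial3_cgf:
 assumes t: "t \<in> interior (mgf_dom q)" and m1: "mom q (%_. 1) t = 1"
 defines "E \<equiv> %F. mom q F t"
 shows "partial j (partial l (partial m (cgf q))) t =
   E (%x. x $ m * x $ l * x $ j) + E (%x. x $ m * x $ l) * E (%x. x $ j)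
   - E (%x. x $ m * x $ j) * E (%x. x $ l) - E (%x. x $ m) * E (%x. x $ l * x $ j)
   - 2 * E (%x. x $ j) * (E (%x. x $ m * x $ l) - E (%x. x $ m) * E (%x. x $ l))"
proof -
 let ?N = "%t. mom q (%x. x $ m * x $ l) t * mom q (%_. 1) t - mom q (%x. x $ m) t * mom q (%x. x $ l) t"
 let ?D = "%t. mom q (%_. 1) t * mom q (%_. 1) t"
 note c = subexp_component subexp_mult[OF subexp_component subexp_component]
 note d = mom_has_derivative[OF t subexp_component] mom_has_derivative[OF t subexp_mult[OF subexp_component subexp_component]]
   mom_has_derivative[OF t subexp_const[of 1]]
 have D0: "?D (t + 0 *\<^sub>R axis j 1) \<noteq> 0" using m1 by simp
 have "partial j (partial l (partial m (cgf q))) t = partial j (%t. ?N t / ?D t) t"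
  by (rule partial_cong[OF open_interior t partial_partial_cgf])
 also have "... = deriv (%h. ?N (t + h *\<^sub>R axis j 1) / ?D (t + h *\<^sub>R axis j 1)) 0"
  unfolding partial_def ..
 also have "... = (((E (%x. x $ m * x $ l * x $ j) * 1 + E (%x. x $ j) * E (%x. x $ m * x $ l))
    - (E (%x. x $ m * x $ j) * E (%x. x $ l) + E (%x. x $ l * x $ j) * E (%x. x $ m))) * 1
    - (E (%x. x $ m * x $ l) * 1 - E (%x. x $ m) * E (%x. x $ l)) * (E (%x. x $ j) * 1 + E (%x. x $ j) * 1)) / 1"
  using DERIV_divide[OF DERIV_diff[OF DERIV_mult[OF d(2)[where j=j] d(3)[where j=j]] DERIV_mult[OF d(1)[where j=j] d(1)[where j=j]]]
    DERIV_mult[OF d(3) d(3)] D0]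
  unfolding E_def
  by (intro DERIV_imp_deriv) (simp add: m1)
 finally show ?thesis by (simp add: algebra_simps)
qed

lemma inner_mean_fun:
 assumes t: "t \<in> interior (mgf_dom q)"
 shows "v \<bullet> mean_fun q t = mom q (%x. v \<bullet> x) t / mgf q t"
proof -
 have "mom q (%x. v \<bullet> x) t = (LBINT x. (\<Sum>j\<in>UNIV. v $ j * (x $ j * (exp (t \<bullet> x) * q x))))"
  unfolding mom_def
 proof (rule Bochner_Integration.integral_cong[OF refl])
  fix x
  have "v \<bullet> x = (\<Sum>j\<in>UNIV. v $ j * x $ j)" by (simp add: inner_vec_def)
  then show "v \<bullet> x * (exp (t \<bullet> x) * q x) = (\<Sum>j\<in>UNIV. v $ j * (x $ j * (exp (t \<bullet> x) * q x)))"
   by (simp add: sum_distrib_right mult.assoc)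
 qed
 also have "... = (\<Sum>j\<in>UNIV. v $ j * mom q (%x. x $ j) t)"
  unfolding mom_def
  by (subst Bochner_Integration.integral_sum) (auto intro!: integrable_mult_right mom_integrable[OF t] subexp_component)
 finally show ?thesis
  unfolding mean_fun_eq[OF t] mgf_eq_mom by (simp add: inner_vec_def sum_divide_distrib)
qed

lemma mean_fun_continuous: "continuous_on (interior (mgf_dom q)) (mean_fun q)"
proof -
 have "continuous_on (interior (mgf_dom q)) (%t. \<chi> j. mom q (%x. x $ j) t / mom q (%_. 1) t)"
  using mom_one_pos by (intro continuous_intros mom_continuous subexp_component subexp_const) force
 then show ?thesis
  by (rule continuous_on_eq) (simp add: mean_fun_eq)
qed

lemma tl_nonneg: "t \<in> mgf_dom q ==> 0 \<le> tl q t x"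
 using mgf_pos[of t] q_nonneg by (simp add: tl_def)

lemma tl_measurable [measurable]: "tl q t \<in> borel_measurable borel"
 unfolding tl_def[abs_def] by measurable

lemma pdf_tl: "t \<in> mgf_dom q ==> pdf (tl q t)"
proof
 assume t: "t \<in> mgf_dom q"
 have i: "integrable lborel (%x. exp (t \<bullet> x) * q x / mgf q t)"
  using t mgf_dom_iff by simp
 have eq: "tl q t = (%x. exp (t \<bullet> x) * q x / mgf q t)" by (simp add: tl_def fun_eq_iff)
 show "integrable lborel (tl q t)" unfolding eq by (rule i)
 show "(LBINT x. tl q t x) = 1"
  unfolding eq using mgf_pos[OF t] by (simp add: mgf_eq_mom mom_def)
 show "0 \<le> tl q t x" for x by (rule tl_nonneg[OF t])
qed simp

lemma mom_tl: "mom (tl q t) F s = mom q F (t + s) / mgf q t"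
proof -
 have eq: "F x * (exp (s \<bullet> x) * tl q t x) = F x * (exp ((t + s) \<bullet> x) * q x) / mgf q t" for x
  by (simp add: tl_def inner_add_left exp_add mult_ac)
 show ?thesis unfolding mom_def eq by simp
qed

lemma mgf_dom_tl:
 assumes t: "t \<in> interior (mgf_dom q)"
 shows "0 \<in> interior (mgf_dom (tl q t))"
proof (rule interiorI)
 interpret T: pdf "tl q t" by (rule pdf_tl[OF interior_dom_dom[OF t]])
 show "open ((%s. - t + s) ` interior (mgf_dom q))"
  by (rule open_translation) simp
 show "0 \<in> (%s. - t + s) ` interior (mgf_dom q)" using t by force
 show "(%s. - t + s) ` interior (mgf_dom q) \<subseteq> mgf_dom (tl q t)"
 proof safe
  fix s assume s: "s \<in> interior (mgf_dom q)"
  have i: "integrable lborel (%x. exp (s \<bullet> x) * q x / mgf q t)"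
   using interior_dom_dom[OF s] mgf_dom_iff by simp
  have "exp ((- t + s) \<bullet> x) * tl q t x = exp (s \<bullet> x) * q x / mgf q t" for x
   by (simp add: tl_def inner_diff_left exp_diff)
  then show "- t + s \<in> mgf_dom (tl q t)"
   unfolding T.mgf_dom_iff using i by simp
 qed
qed

lemma tl_integrable:
 assumes t: "t \<in> interior (mgf_dom q)" and F: "subexp F"
 shows "integrable lborel (%x. F x * tl q t x)"
proof -
 have "F x * tl q t x = F x * (exp (t \<bullet> x) * q x) / mgf q t" for x by (simp add: tl_def)
 then show ?thesis using mom_integrable[OF t F] by simp
qed

lemma tl_integral: "(LBINT x. F x * tl q t x) = mom q F t / mgf q t"
proof -
 have "F x * tl q t x = F x * (exp (t \<bullet> x) * q x) / mgf q t" for x by (simp add: tl_def)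
 then show ?thesis by (simp add: mom_def)
qed

lemma tl_mean:
 assumes t: "t \<in> interior (mgf_dom q)"
 shows "(LBINT x. (v \<bullet> (x - mean_fun q t)) * tl q t x) = 0"
proof -
 interpret T: pdf "tl q t" by (rule pdf_tl[OF interior_dom_dom[OF t]])
 have "(LBINT x. (v \<bullet> (x - mean_fun q t)) * tl q t x) =
   (LBINT x. (v \<bullet> x) * tl q t x - (v \<bullet> mean_fun q t) * tl q t x)"
  by (simp add: inner_diff_right left_diff_distrib)
 also have "... = (LBINT x. (v \<bullet> x) * tl q t x) - (v \<bullet> mean_fun q t) * (LBINT x. tl q t x)"
  using tl_integrable[OF t subexp_inner, of v] T.q_int by simp
 also have "... = 0" by (simp add: T.q_mass tl_integral inner_mean_fun[OF t])
 finally show ?thesis .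
qed

lemma cumulant2_tl:
 assumes t: "t \<in> interior (mgf_dom q)"
 shows "cumulant2 (tl q t) = (\<chi> j l. (mom q (%x. x $ l * x $ j) t * mom q (%_. 1) t - mom q (%x. x $ l) t * mom q (%x. x $ j) t)
    / (mom q (%_. 1) t * mom q (%_. 1) t))"
proof -
 interpret T: pdf "tl q t" by (rule pdf_tl[OF interior_dom_dom[OF t]])
 have "mgf q t > 0" by (rule mgf_pos[OF interior_dom_dom[OF t]])
 then show ?thesis
  unfolding cumulant2_def T.partial_partial_cgf[OF mgf_dom_tl[OF t]] mom_tl
  by (simp add: mgf_eq_mom[symmetric] vec_eq_iff field_simps)
qed

definition ev :: "real^'d => (real^'d => real) => real" where
 "ev t F = mom q F t / mgf q t"

lemma ev_eq: "ev t F = (LBINT x. F x * tl q t x)"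
 by (simp add: tl_integral ev_def)

lemma cumulant3_tl:
 assumes t: "t \<in> interior (mgf_dom q)"
 shows "cumulant3 (tl q t) j l m = ev t (%x. x $ m * x $ l * x $ j) + ev t (%x. x $ m * x $ l) * ev t (%x. x $ j)
   - ev t (%x. x $ m * x $ j) * ev t (%x. x $ l) - ev t (%x. x $ m) * ev t (%x. x $ l * x $ j)
   - 2 * ev t (%x. x $ j) * (ev t (%x. x $ m * x $ l) - ev t (%x. x $ m) * ev t (%x. x $ l))"
proof -
 interpret T: pdf "tl q t" by (rule pdf_tl[OF interior_dom_dom[OF t]])
 have p: "mgf q t > 0" by (rule mgf_pos[OF interior_dom_dom[OF t]])
 have 1: "mom (tl q t) (%_. 1) 0 = 1" using p by (simp add: mom_tl mgf_eq_mom)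
 show ?thesis
  unfolding cumulant3_def T.partial3_cgf[OF mgf_dom_tl[OF t] 1] mom_tl ev_def by simp
qed

lemma cumulant2_quadratic:
 assumes t: "t \<in> interior (mgf_dom q)"
 shows "v \<bullet> (cumulant2 (tl q t) *v v) = (LBINT x. (v \<bullet> (x - mean_fun q t))\<^sup>2 * tl q t x)"
proof -
 interpret T: pdf "tl q t" by (rule pdf_tl[OF interior_dom_dom[OF t]])
 have p: "mgf q t > 0" by (rule mgf_pos[OF interior_dom_dom[OF t]])
 let ?b = "v \<bullet> mean_fun q t"
 have c2: "cumulant2 (tl q t) $ j $ l = ev t (%x. x $ l * x $ j) - ev t (%x. x $ l) * ev t (%x. x $ j)" for j l
  using p by (simp add: cumulant2_tl[OF t] ev_def mgf_eq_mom[symmetric] field_simps)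
 have i2: "integrable lborel (%x. x $ l * x $ j * tl q t x)" for l j
  by (intro tl_integrable[OF t] subexp_mult subexp_component)
 have sq: "ev t (%x. (v \<bullet> x)\<^sup>2) = (\<Sum>j\<in>UNIV. \<Sum>l\<in>UNIV. v $ j * v $ l * ev t (%x. x $ l * x $ j))"
 proof -
  have "(v \<bullet> x)\<^sup>2 * tl q t x = (\<Sum>j\<in>UNIV. \<Sum>l\<in>UNIV. v $ j * v $ l * (x $ l * x $ j * tl q t x))" for x
  proof -
   have "(v \<bullet> x)\<^sup>2 = (\<Sum>j\<in>UNIV. \<Sum>l\<in>UNIV. v $ j * v $ l * (x $ l * x $ j))"
    by (simp add: inner_vec_def power2_eq_square sum_product mult_ac)
   then show ?thesis by (simp add: sum_distrib_right mult.assoc)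
  qed
  then show ?thesis unfolding ev_eq using i2
   by (simp add: Bochner_Integration.integral_sum Bochner_Integration.integrable_sum)
 qed
 have lin: "ev t (%x. v \<bullet> x) = (\<Sum>j\<in>UNIV. v $ j * ev t (%x. x $ j))"
 proof -
  have "ev t (%x. v \<bullet> x) = v \<bullet> mean_fun q t" by (simp add: inner_mean_fun[OF t] ev_def)
  also have "... = (\<Sum>j\<in>UNIV. v $ j * mean_fun q t $ j)" by (simp add: inner_vec_def)
  also have "... = (\<Sum>j\<in>UNIV. v $ j * ev t (%x. x $ j))"
   by (simp add: mean_fun_eq[OF t] ev_def mgf_eq_mom)
  finally show ?thesis .
 qed
 have b: "?b = ev t (%x. v \<bullet> x)" by (simp add: inner_mean_fun[OF t] ev_def)
 have "v \<bullet> (cumulant2 (tl q t) *v v) = (\<Sum>j\<in>UNIV. \<Sum>l\<in>UNIV. v $ j * v $ l * (ev t (%x. x $ l * x $ j) - ev t (%x. x $ l) * ev t (%x. x $ j)))"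
  by (simp add: inner_vec_def matrix_vector_mult_def c2 sum_distrib_left mult_ac)
 also have "... = ev t (%x. (v \<bullet> x)\<^sup>2) - ?b * ?b"
  unfolding sq b lin by (simp add: sum_product right_diff_distrib sum_subtractf mult_ac)
 also have "... = (LBINT x. (v \<bullet> x)\<^sup>2 * tl q t x - 2 * ?b * ((v \<bullet> x) * tl q t x) + ?b\<^sup>2 * tl q t x)"
  using tl_integrable[OF t subexp_inner, of v] tl_integrable[OF t subexp_power[OF subexp_inner], of v 2] T.q_int
  by (simp add: T.q_mass ev_eq[symmetric] b[symmetric] power2_eq_square)
 also have "... = (LBINT x. (v \<bullet> (x - mean_fun q t))\<^sup>2 * tl q t x)"
  by (intro Bochner_Integration.integral_cong refl) (simp add: inner_diff_right power2_eq_square algebra_simps)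
 finally show ?thesis .
qed

lemma cumulant2_symmetric:
 assumes t: "t \<in> interior (mgf_dom q)"
 shows "transpose (cumulant2 (tl q t)) = cumulant2 (tl q t)"
 unfolding cumulant2_tl[OF t] transpose_def vec_eq_iff by (simp add: mult.commute)

text \<open>Strict convexity of the cumulant generating function, in the form of Gibbs' inequality; it makes
  the mean injective, so that the tilt is determined by the mean.\<close>

lemma cgf_strict_tangent:
 assumes t: "t \<in> interior (mgf_dom q)" and s: "s \<in> interior (mgf_dom q)" and ne: "s \<noteq> t"
 shows "cgf q s - cgf q t > (s - t) \<bullet> mean_fun q t"
proof -
 interpret T: pdf "tl q t" by (rule pdf_tl[OF interior_dom_dom[OF t]])
 have p: "mgf q t > 0" "mgf q s > 0" using mgf_pos interior_dom_dom t s by blast+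
 let ?b = "(s - t) \<bullet> mean_fun q t"
 let ?u = "%x. (s - t) \<bullet> (x - mean_fun q t)"
 have ex: "exp (?u x) * tl q t x = exp (- ?b) * (exp (s \<bullet> x) * q x) / mgf q t" for x
 proof -
  have "?u x + t \<bullet> x = - ?b + s \<bullet> x" by (simp add: inner_diff_left inner_diff_right)
  then have "exp (?u x) * exp (t \<bullet> x) = exp (- ?b) * exp (s \<bullet> x)" by (simp only: exp_add[symmetric])
  then show ?thesis by (simp add: tl_def)
 qed
 have i1: "integrable lborel (%x. exp (?u x) * tl q t x)"
  unfolding ex using interior_dom_dom[OF s] mgf_dom_iff by simp
 have e1: "(LBINT x. exp (?u x) * tl q t x) = exp (- ?b) * mgf q s / mgf q t"
  unfolding ex by (simp add: mgf_eq_mom mom_def)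
 have i2: "integrable lborel (%x. ?u x * tl q t x)"
 proof -
  have "subexp (%x. (s - t) \<bullet> x + - ?b)" by (intro subexp_add subexp_inner subexp_const)
  from tl_integrable[OF t this] show ?thesis by (simp add: inner_diff_right)
 qed
 have eq: "(exp (?u x) - 1 - ?u x) * tl q t x = exp (?u x) * tl q t x - tl q t x - ?u x * tl q t x" for x
  by (simp add: left_diff_distrib)
 have i3: "integrable lborel (%x. (exp (?u x) - 1 - ?u x) * tl q t x)"
  unfolding eq using i1 i2 T.q_int by simp
 have "0 < (LBINT x. (exp (?u x) - 1 - ?u x) * tl q t x)"
 proof (rule integral_pos_AE[OF T.q_nonneg _ _ _ i3])
  show "0 \<le> exp (?u x) - 1 - ?u x" for x using exp_ge_add_one_self[of "?u x"] by linarith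
  have "AE x in lborel. (s - t) \<bullet> x \<noteq> ?b" using ne by (intro AE_not_hyperplane) simp
  then show "AE x in lborel. 0 < exp (?u x) - 1 - ?u x"
  proof eventually_elim
   case (elim x)
   then have "?u x \<noteq> 0" by (simp add: inner_diff_right)
   then have "1 + ?u x < exp (?u x)" by (rule one_plus_less_exp)
   then show ?case by simp
  qed
 qed (simp add: T.q_mass)
 also have "(LBINT x. (exp (?u x) - 1 - ?u x) * tl q t x) = exp (- ?b) * mgf q s / mgf q t - 1"
  unfolding eq using i1 i2 T.q_int e1 tl_mean[OF t, of "s - t"] by (simp add: T.q_mass)
 finally have "mgf q t * exp ?b < mgf q s"
  using p by (simp add: exp_minus field_simps)
 then have "ln (mgf q t * exp ?b) < ln (mgf q s)" using p by simp
 then show ?thesis using p by (simp add: cgf_def ln_mult)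
qed

lemma mean_fun_inj: "inj_on (mean_fun q) (interior (mgf_dom q))"
proof (rule inj_onI, rule ccontr)
 fix s t assume *: "s \<in> interior (mgf_dom q)" "t \<in> interior (mgf_dom q)" "mean_fun q s = mean_fun q t" "s \<noteq> t"
 show False
  using cgf_strict_tangent[OF *(1,2) *(4)[symmetric]] cgf_strict_tangent[OF *(2,1) *(4)] *(3)
  by (simp add: inner_diff_left)
qed

lemma mean_fun_open: "open S ==> S \<subseteq> interior (mgf_dom q) ==> open (mean_fun q ` S)"
 using invariance_of_domain[of S "mean_fun q"] mean_fun_continuous mean_fun_inj
 by (meson continuous_on_subset inj_on_subset)

lemma tilt_mean_fun: "t \<in> interior (mgf_dom q) ==> tilt q (mean_fun q t) = t"
 unfolding tilt_def is_tilt_def using mean_fun_inj by (auto simp: inj_on_def)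

definition mrange :: "(real^'d) set" where
 "mrange = mean_fun q ` interior (mgf_dom q)"

lemma tilt_props:
 assumes "\<alpha> \<in> mrange"
 shows "tilt q \<alpha> \<in> interior (mgf_dom q)" "mean_fun q (tilt q \<alpha>) = \<alpha>"
 using assms tilt_mean_fun unfolding mrange_def by auto

lemma is_tilt_mrange: "is_tilt q \<alpha> t ==> \<alpha> \<in> mrange"
 by (auto simp: is_tilt_def mrange_def)

lemma open_mrange: "open mrange"
 unfolding mrange_def by (rule mean_fun_open) auto

lemma tilt_continuous: "continuous_on mrange (tilt q)"
 unfolding mrange_def
proof (rule continuous_on_inverse_open_map[OF mean_fun_continuous])
 show "tilt q (mean_fun q x) = x" if "x \<in> interior (mgf_dom q)" for x
  using tilt_mean_fun that .
 show "openin (top_of_set (mean_fun q ` interior (mgf_dom q))) (mean_fun q ` U)"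
  if "openin (top_of_set (interior (mgf_dom q))) U" for U
 proof -
  have "open U" "U \<subseteq> interior (mgf_dom q)" using that openin_open_eq[OF open_interior] by auto
  then have "open (mean_fun q ` U)" by (rule mean_fun_open)
  then show ?thesis using \<open>U \<subseteq> interior (mgf_dom q)\<close> by (auto intro!: open_subset)
 qed
qed auto

lemma tilt_off_mrange: "\<alpha> \<notin> mrange ==> tilt q \<alpha> = (THE t. False)"
proof -
 assume "\<alpha> \<notin> mrange"
 then have "is_tilt q \<alpha> t \<longleftrightarrow> False" for t using is_tilt_mrange by blast
 then show ?thesis by (simp add: tilt_def)
qed

text \<open>On the open set of attained means the tilt is continuous, and elsewhere it is a constant, the
  value of \<open>THE\<close> without a solution; so only continuity on the domain has to be checked.\<close>

lemma measurable_tilt_comp: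
 fixes \<Psi> :: "real^'d => 'b::{second_countable_topology,t2_space}"
 assumes "continuous_on (interior (mgf_dom q)) \<Psi>"
 shows "(%\<alpha>. \<Psi> (tilt q \<alpha>)) \<in> borel_measurable borel"
proof -
 have c: "continuous_on mrange (%\<alpha>. \<Psi> (tilt q \<alpha>))"
  by (rule continuous_on_compose2[OF assms tilt_continuous]) (auto simp: tilt_props)
 have "(%\<alpha>. if \<alpha> \<in> mrange then \<Psi> (tilt q \<alpha>) else \<Psi> (THE t. False)) \<in> borel_measurable borel"
  by (rule borel_measurable_continuous_on_if) (use c open_mrange in auto)
 moreover have "(%\<alpha>. if \<alpha> \<in> mrange then \<Psi> (tilt q \<alpha>) else \<Psi> (THE t. False)) = (%\<alpha>. \<Psi> (tilt q \<alpha>))"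
  using tilt_off_mrange by (auto simp: fun_eq_iff)
 ultimately show ?thesis by simp
qed

end

section \<open>Densities of sums\<close>

lemma integral_lborel_reflect:
 fixes f :: "'a::euclidean_space => 'b::{banach, second_countable_topology}"
 assumes [measurable]: "f \<in> borel_measurable borel"
 shows "(LBINT y. f (x - y)) = (LBINT z. f z)"
proof -
 have d: "distr lborel borel (%y. x - y) = (lborel :: 'a measure)"
  using lborel_affine[of "-1" x] by (simp add: density_1 one_ennreal_def[symmetric])
 have "(LBINT z. f z) = (\<integral>z. f z \<partial>distr lborel borel (%y. x - y))" by (simp add: d)
 also have "... = (LBINT y. f (x - y))" by (subst integral_distr) auto
 finally show ?thesis by simp
qed

lemma integrable_lborel_reflect:
 fixes f :: "'a::euclidean_space => 'b::{banach, second_countable_topology}"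
 assumes f: "integrable lborel f"
 shows "integrable lborel (%y. f (x - y))"
proof -
 have [measurable]: "f \<in> borel_measurable borel" using f by auto
 have d: "distr lborel borel (%y. x - y) = (lborel :: 'a measure)"
  using lborel_affine[of "-1" x] by (simp add: density_1 one_ennreal_def[symmetric])
 have "integrable (distr lborel borel (%y. x - y)) f" using f by (simp add: d)
 then show ?thesis by (subst (asm) integrable_distr_eq) auto
qed

lemma pdf_ft_le_1: "pdf q ==> norm (ft q s) \<le> 1"
 using norm_ft_le[of q s] by (simp add: pdf.q_nonneg pdf.q_mass)

lemma conv_pdf:
 fixes q f :: "real^'d => real"
 assumes "pdf q" "pdf f"
 defines "h \<equiv> %x. \<integral>y. q y * f (x - y) \<partial>lborel"
 shows "pdf h" and "ft h s = ft q s * ft f s"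
proof -
 interpret Q: pdf q by fact
 interpret F: pdf f by fact
 have tr: "integrable lborel (%x. f (x - y))" "(LBINT x. f (x - y)) = 1" for y
  using lborel_integrable_translate[OF F.q_int, of "- y"] F.q_mass by simp_all
 have int: "integrable (lborel \<Otimes>\<^sub>M lborel) (%(y, x). q y * f (x - y))"
 proof (rule lborel_pair.Fubini_integrable)
  have "(%y. \<integral>x. norm (case (y, x) of (y, x) => q y * f (x - y)) \<partial>lborel) = q"
   by (simp add: abs_mult Q.q_nonneg F.q_nonneg tr fun_eq_iff)
  then show "integrable lborel (%y. \<integral>x. norm (case (y, x) of (y, x) => q y * f (x - y)) \<partial>lborel)"
   using Q.q_int by simp
 qed (use tr in auto)
 show "pdf h"
 proof
  show "h \<in> borel_measurable borel" unfolding h_def by measurable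
  show "0 \<le> h x" for x unfolding h_def by (simp add: Q.q_nonneg F.q_nonneg)
  show "integrable lborel h" unfolding h_def using lborel_pair.integrable_snd[OF int] by simp
  have "(LBINT x. h x) = (LBINT y. (LBINT x. q y * f (x - y)))"
   unfolding h_def by (rule lborel_pair.Fubini_integral[OF int])
  also have "... = 1" by (simp add: tr Q.q_mass)
  finally show "(LBINT x. h x) = 1" .
 qed
 have intc: "integrable (lborel \<Otimes>\<^sub>M lborel) (%(y, x). (q y * f (x - y)) *\<^sub>R cis (s \<bullet> x))"
  by (rule Bochner_Integration.integrable_bound[OF int]) (auto simp: split_beta)
 have "ft h s = (LBINT x. (LBINT y. (q y * f (x - y)) *\<^sub>R cis (s \<bullet> x)))"
  unfolding ft_def h_def
 proof (rule integral_cong_AE)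
  have "AE x in lborel. integrable lborel (%y. q y * f (x - y))"
   using lborel_pair.AE_integrable_snd[OF int] by simp
  then show "AE x in lborel. (LBINT y. q y * f (x - y)) *\<^sub>R cis (s \<bullet> x) = (LBINT y. (q y * f (x - y)) *\<^sub>R cis (s \<bullet> x))"
   by eventually_elim (rule integral_scaleR_left[symmetric], simp)
 qed measurable
 also have "... = (LBINT y. (LBINT x. (q y * f (x - y)) *\<^sub>R cis (s \<bullet> x)))"
  by (rule lborel_pair.Fubini_integral[OF intc])
 also have "... = (LBINT y. (q y *\<^sub>R cis (s \<bullet> y)) * ft f s)"
 proof (rule Bochner_Integration.integral_cong[OF refl])
  fix y
  have "(LBINT x. (q y * f (x - y)) *\<^sub>R cis (s \<bullet> x)) = (LBINT x. (q y *\<^sub>R cis (s \<bullet> y)) * (f (- y + x) *\<^sub>R cis (s \<bullet> (- y + x))))"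
  proof (rule Bochner_Integration.integral_cong[OF refl])
   fix x
   have "cis (s \<bullet> x) = cis (s \<bullet> y) * cis (s \<bullet> (- y + x))"
    by (simp add: cis_mult inner_diff_right)
   then show "(q y * f (x - y)) *\<^sub>R cis (s \<bullet> x) = (q y *\<^sub>R cis (s \<bullet> y)) * (f (- y + x) *\<^sub>R cis (s \<bullet> (- y + x)))"
    by (simp add: scaleR_conv_of_real)
  qed
  also have "... = (q y *\<^sub>R cis (s \<bullet> y)) * (LBINT x. f (- y + x) *\<^sub>R cis (s \<bullet> (- y + x)))"
   by (rule integral_mult_right_zero)
  also have "(LBINT x. f (- y + x) *\<^sub>R cis (s \<bullet> (- y + x))) = ft f s"
   unfolding ft_def
   by (rule lborel_integrable_translate(2)[of "%x. f x *\<^sub>R cis (s \<bullet> x)"]) (simp add: integrable_scaleR_cis F.q_int)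
  finally show "(LBINT x. (q y * f (x - y)) *\<^sub>R cis (s \<bullet> x)) = (q y *\<^sub>R cis (s \<bullet> y)) * ft f s" .
 qed
 also have "... = ft q s * ft f s"
  unfolding ft_def[of q] by (rule integral_mult_left_zero)
 finally show "ft h s = ft q s * ft f s" .
qed

lemma ift_continuous:
 fixes g :: "'a::euclidean_space => complex"
 assumes g: "integrable lborel g"
 shows "continuous_on UNIV (ift g)"
proof -
 have [measurable]: "g \<in> borel_measurable borel" using g by auto
 have "isCont (ift g) x" for x
  unfolding continuous_at_sequentially comp_def ift_def
 proof (intro allI impI tendsto_scaleR tendsto_const)
  fix X assume X: "X \<longlonglongrightarrow> x"
  show "(%n. \<integral>s. g s * cis (- (s \<bullet> X n)) \<partial>lborel) \<longlonglongrightarrow> (LBINT s. g s * cis (- (s \<bullet> x)))"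
   by (rule integral_dominated_convergence[where w="%s. norm (g s)"])
    (use g X in \<open>auto intro!: AE_I2 tendsto_mult tendsto_cis tendsto_minus tendsto_inner simp: norm_mult\<close>)
 qed
 then show ?thesis by (simp add: continuous_on_eq_continuous_at)
qed

context pdf
begin

lemma pdf_sum_pdf: "pdf (sum_pdf q (Suc n))"
proof (induction n)
 case 0
 then show ?case by (simp add: sum_pdf_1 pdf_axioms)
next
 case (Suc n)
 have "sum_pdf q (Suc (Suc n)) = (%x. \<integral>y. q y * sum_pdf q (Suc n) (x - y) \<partial>lborel)"
  by (simp add: sum_pdf_Suc fun_eq_iff)
 then show ?case using conv_pdf(1)[OF pdf_axioms Suc] by simp
qed

lemma ft_sum_pdf: "ft (sum_pdf q (Suc n)) s = ft q s ^ Suc n"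
proof (induction n)
 case 0
 then show ?case by (simp add: sum_pdf_1)
next
 case (Suc n)
 have "sum_pdf q (Suc (Suc n)) = (%x. \<integral>y. q y * sum_pdf q (Suc n) (x - y) \<partial>lborel)"
  by (simp add: sum_pdf_Suc fun_eq_iff)
 then show ?case using conv_pdf(2)[OF pdf_axioms pdf_sum_pdf[of n], of s] Suc by simp
qed

lemma sum_pdf_tl:
 "sum_pdf (tl q t) (Suc n) x = exp (t \<bullet> x) / mgf q t ^ Suc n * sum_pdf q (Suc n) x"
proof (induction n arbitrary: x)
 case 0
 then show ?case by (simp add: sum_pdf_1 tl_def)
next
 case (Suc n)
 have "tl q t y * sum_pdf (tl q t) (Suc n) (x - y) =
   exp (t \<bullet> x) / mgf q t ^ Suc (Suc n) * (q y * sum_pdf q (Suc n) (x - y))" for y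
 proof -
  have "exp (t \<bullet> y) * exp (t \<bullet> (x - y)) = exp (t \<bullet> x)"
   by (simp add: exp_add[symmetric] inner_diff_right)
  then show ?thesis unfolding Suc.IH tl_def by simp
 qed
 then show ?case by (simp add: sum_pdf_Suc)
qed

text \<open>If some power of the Fourier transform is integrable, then the density of the sum is given
  by the inversion formula: almost everywhere at that power, and everywhere one step later.\<close>

lemma sum_pdf_inversion_AE:
 assumes i: "integrable lborel (%s. ft q s ^ Suc n)"
 shows "AE x in lborel. sum_pdf q (Suc n) x = Re (ift (%s. ft q s ^ Suc n) x)"
proof -
 interpret S: pdf "sum_pdf q (Suc n)" by (rule pdf_sum_pdf)
 have eq: "ft (sum_pdf q (Suc n)) = (%s. ft q s ^ Suc n)" by (rule ext) (rule ft_sum_pdf)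
 show ?thesis using ft_inversion(1)[OF S.q_int S.q_nonneg] i unfolding eq by simp
qed

lemma sum_pdf_inversion:
 assumes i: "integrable lborel (%s. ft q s ^ Suc n)"
 shows "sum_pdf q (Suc (Suc n)) x = Re (ift (%s. ft q s ^ Suc (Suc n)) x)"
proof -
 interpret S: pdf "sum_pdf q (Suc n)" by (rule pdf_sum_pdf)
 let ?g = "%s. ft q s ^ Suc n"
 let ?r = "%x. Re (ift ?g x)"
 have [measurable]: "ift ?g \<in> borel_measurable borel"
  by (rule borel_measurable_continuous_onI[OF ift_continuous[OF i]])
 have "sum_pdf q (Suc (Suc n)) x = (LBINT y. q y * sum_pdf q (Suc n) (x - y))"
  by (simp add: sum_pdf_Suc)
 also have "... = (LBINT z. q (x - z) * sum_pdf q (Suc n) z)"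
  using integral_lborel_reflect[of "%z. q (x - z) * sum_pdf q (Suc n) z" x] by simp
 also have "... = (LBINT z. q (x - z) * ?r z)"
 proof (rule integral_cong_AE)
  show "AE z in lborel. q (x - z) * sum_pdf q (Suc n) z = q (x - z) * ?r z"
   using sum_pdf_inversion_AE[OF i] by eventually_elim simp
 qed measurable
 also have "... = (LBINT y. q y * ?r (x - y))"
 proof -
  have m: "(%z. q (x - z) * ?r z) \<in> borel_measurable borel" by measurable
  show ?thesis using integral_lborel_reflect[OF m, of x] by simp
 qed
 also have "... = Re (LBINT y. q y *\<^sub>R ift ?g (x - y))"
 proof -
  have "integrable lborel (%y. q y *\<^sub>R ift ?g (x - y))"
  proof (rule Bochner_Integration.integrable_bound[where f="%y. q y * ((LBINT s. norm (?g s)) / (2 * pi) ^ DIM(real^'d))"])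
   show "AE y in lborel. norm (q y *\<^sub>R ift ?g (x - y)) \<le> norm (q y * ((LBINT s. norm (?g s)) / (2 * pi) ^ DIM(real^'d)))"
   proof (intro AE_I2)
    fix y
    show "norm (q y *\<^sub>R ift ?g (x - y)) \<le> norm (q y * ((LBINT s. norm (?g s)) / (2 * pi) ^ DIM(real^'d)))"
     unfolding norm_scaleR real_norm_def abs_mult
     by (rule mult_left_mono[OF order_trans[OF norm_ift_le abs_ge_self]]) simp
   qed
   show "(%y. q y *\<^sub>R ift ?g (x - y)) \<in> borel_measurable lborel" by measurable
  qed (intro integrable_mult_left q_int)
  from integral_Re[OF this] show ?thesis by (simp only: scaleR_complex.sel)
 qed
 also have "(LBINT y. q y *\<^sub>R ift ?g (x - y)) = (1 / (2 * pi) ^ DIM(real^'d)) *\<^sub>R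
   (LBINT y. (LBINT s. q y *\<^sub>R (?g s * cis (- (s \<bullet> (x - y))))))"
  unfolding ift_def by (simp only: integral_scaleR_right[symmetric] scaleR_left_commute[of "q _"])
 also have "(LBINT y. (LBINT s. q y *\<^sub>R (?g s * cis (- (s \<bullet> (x - y)))))) =
   (LBINT s. (LBINT y. q y *\<^sub>R (?g s * cis (- (s \<bullet> (x - y))))))"
  by (rule fubini_scaleR_cis[OF q_int i, where K=1, symmetric]) auto
 also have "... = (LBINT s. ft q s ^ Suc (Suc n) * cis (- (s \<bullet> x)))"
 proof (rule Bochner_Integration.integral_cong[OF refl])
  fix s
  have "(LBINT y. q y *\<^sub>R (?g s * cis (- (s \<bullet> (x - y))))) = (LBINT y. (?g s * cis (- (s \<bullet> x))) * (q y *\<^sub>R cis (s \<bullet> y)))"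
  proof (rule Bochner_Integration.integral_cong[OF refl])
   fix y
   have "cis (- (s \<bullet> (x - y))) = cis (- (s \<bullet> x)) * cis (s \<bullet> y)"
    by (simp add: cis_mult inner_diff_right)
   then show "q y *\<^sub>R (?g s * cis (- (s \<bullet> (x - y)))) = (?g s * cis (- (s \<bullet> x))) * (q y *\<^sub>R cis (s \<bullet> y))"
    by (simp add: scaleR_conv_of_real)
  qed
  also have "... = (?g s * cis (- (s \<bullet> x))) * ft q s"
   unfolding ft_def[of q s] by (rule integral_mult_right_zero)
  finally show "(LBINT y. q y *\<^sub>R (?g s * cis (- (s \<bullet> (x - y))))) = ft q s ^ Suc (Suc n) * cis (- (s \<bullet> x))"
   by (simp add: mult_ac)
 qed
 finally show ?thesis by (simp add: ift_def)
qed

lemma integrable_ft_power_mono: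
 assumes i: "integrable lborel (%s. norm (ft q s) ^ n)" and "n \<le> m"
 shows "integrable lborel (%s. norm (ft q s) ^ m)" "integrable lborel (%s. ft q s ^ m)"
proof -
 have le: "norm (ft q s) ^ m \<le> norm (ft q s) ^ n" for s
  using assms(2) pdf_ft_le_1[OF pdf_axioms] by (intro power_decreasing) auto
 show "integrable lborel (%s. norm (ft q s) ^ m)"
  by (rule Bochner_Integration.integrable_bound[OF i]) (use le in auto)
 show "integrable lborel (%s. ft q s ^ m)"
  by (rule Bochner_Integration.integrable_bound[OF i]) (use le in \<open>auto simp: norm_power\<close>)
qed

lemma sum_pdf_bounded:
 assumes i: "integrable lborel (%s. ft q s ^ Suc n)"
 obtains B where "B \<ge> 0" "!!x. sum_pdf q (Suc (Suc n)) x \<le> B"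
proof -
 let ?B = "(LBINT s. norm (ft q s ^ Suc (Suc n))) / (2 * pi) ^ DIM(real^'d)"
 have "sum_pdf q (Suc (Suc n)) x \<le> ?B" for x
  unfolding sum_pdf_inversion[OF i]
  by (rule order_trans[OF complex_Re_le_cmod norm_ift_le])
 moreover have "?B \<ge> 0" by simp
 ultimately show ?thesis using that by blast
qed

lemma sum_pdf_continuous:
 assumes i: "integrable lborel (%s. ft q s ^ Suc n)"
 shows "continuous_on UNIV (sum_pdf q (Suc (Suc n)))"
proof -
 have i1: "integrable lborel (%s. norm (ft q s) ^ Suc n)"
  using integrable_norm[OF i] by (simp only: norm_power)
 have "integrable lborel (%s. ft q s ^ Suc (Suc n))"
  by (rule integrable_ft_power_mono(2)[OF i1]) simp
 then have "continuous_on UNIV (ift (%s. ft q s ^ Suc (Suc n)))" by (rule ift_continuous)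
 then show ?thesis unfolding sum_pdf_inversion[OF i, abs_def] by (intro continuous_intros)
qed

lemma sum_pdf_conv_nn:
 assumes "!!x. sum_pdf q (Suc n) x \<le> B"
 shows "(\<integral>\<^sup>+y. ennreal (q y * sum_pdf q (Suc n) (x - y)) \<partial>lborel) = ennreal (sum_pdf q (Suc (Suc n)) x)"
proof -
 interpret S: pdf "sum_pdf q (Suc n)" by (rule pdf_sum_pdf)
 have i: "integrable lborel (%y. q y * sum_pdf q (Suc n) (x - y))"
  by (rule Bochner_Integration.integrable_bound[where f="%y. q y * B"])
   (use q_int assms in \<open>auto intro!: AE_I2 mult_left_mono order_trans[OF assms abs_ge_self] simp: abs_mult q_nonneg S.q_nonneg\<close>)
 have "sum_pdf q (Suc (Suc n)) x = (LBINT y. q y * sum_pdf q (Suc n) (x - y))"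
  by (simp add: sum_pdf_Suc)
 then show ?thesis using nn_integral_eq_integral[OF i] by (simp add: q_nonneg S.q_nonneg)
qed

end

section \<open>A quantitative gap between a density and its Fourier transform\<close>

lemma ft_rotate:
 fixes f :: "'a::euclidean_space => real"
 assumes f: "integrable lborel f"
 shows "(LBINT x. f x * (1 - cos (s \<bullet> x + \<theta>))) = (LBINT x. f x) - Re (cis \<theta> * ft f s)"
  and "integrable lborel (%x. f x * (1 - cos (s \<bullet> x + \<theta>)))"
proof -
 have [measurable]: "f \<in> borel_measurable borel" using f by auto
 have i: "integrable lborel (%x. f x *\<^sub>R cis (s \<bullet> x))"
  using f by (rule integrable_scaleR_cis) simp
 have c: "f x * cos (s \<bullet> x + \<theta>) = Re (cis \<theta> * (f x *\<^sub>R cis (s \<bullet> x)))" for x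
  by (simp add: cos_add algebra_simps)
 have i1: "integrable lborel (%x. f x * cos (s \<bullet> x + \<theta>))"
  unfolding c by (intro integrable_Re integrable_mult_right i)
 have eq: "f x * (1 - cos (s \<bullet> x + \<theta>)) = f x - f x * cos (s \<bullet> x + \<theta>)" for x by (simp add: algebra_simps)
 show "integrable lborel (%x. f x * (1 - cos (s \<bullet> x + \<theta>)))" unfolding eq using f i1 by simp
 have "(LBINT x. f x * cos (s \<bullet> x + \<theta>)) = Re (LBINT x. cis \<theta> * (f x *\<^sub>R cis (s \<bullet> x)))"
  unfolding c by (rule integral_Re) (intro integrable_mult_right i)
 also have "... = Re (cis \<theta> * ft f s)" unfolding ft_def by (simp only: integral_mult_right_zero)
 finally show "(LBINT x. f x * (1 - cos (s \<bullet> x + \<theta>))) = (LBINT x. f x) - Re (cis \<theta> * ft f s)"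
  unfolding eq using f i1 by simp
qed

definition ft_gap :: "('a::euclidean_space => real) => 'a => real" where
 "ft_gap f s = (LBINT x. f x) - norm (ft f s)"

lemma ft_gap_le:
 assumes f: "integrable lborel f"
 shows "ft_gap f s \<le> (LBINT x. f x * (1 - cos (s \<bullet> x + \<theta>)))"
proof -
 have "Re (cis \<theta> * ft f s) \<le> norm (cis \<theta> * ft f s)" by (rule complex_Re_le_cmod)
 then show ?thesis unfolding ft_rotate(1)[OF f] ft_gap_def by (simp add: norm_mult)
qed

lemma ft_gap_eq:
 assumes f: "integrable lborel f"
 obtains \<theta> where "ft_gap f s = (LBINT x. f x * (1 - cos (s \<bullet> x + \<theta>)))"
proof -
 let ?z = "ft f s"
 have "?z = norm ?z *\<^sub>R cis (Arg ?z)" by (simp add: rcis_def[symmetric] rcis_cmod_Arg scaleR_conv_of_real flip: rcis_def)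
 then have "cis (- Arg ?z) * ?z = cis (- Arg ?z) * (norm ?z *\<^sub>R cis (Arg ?z))" by simp
 also have "... = complex_of_real (norm ?z)" by (simp add: scaleR_conv_of_real cis_mult)
 finally have "Re (cis (- Arg ?z) * ?z) = norm ?z" by simp
 then show ?thesis using that[of "- Arg ?z"] unfolding ft_rotate(1)[OF f] ft_gap_def by simp
qed

lemma ft_gap_mono:
 assumes f: "integrable lborel f" and g: "integrable lborel g" and le: "!!x. g x \<le> f x"
 shows "ft_gap g s \<le> ft_gap f s"
proof -
 obtain \<theta> where t: "ft_gap f s = (LBINT x. f x * (1 - cos (s \<bullet> x + \<theta>)))" by (rule ft_gap_eq[OF f])
 have "ft_gap g s \<le> (LBINT x. g x * (1 - cos (s \<bullet> x + \<theta>)))" by (rule ft_gap_le[OF g])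
 also have "... \<le> (LBINT x. f x * (1 - cos (s \<bullet> x + \<theta>)))"
  by (intro integral_mono ft_rotate f g mult_right_mono le) simp
 finally show ?thesis by (simp add: t)
qed

text \<open>The inequality \<open>1 - cos (2 u) \<le> 4 * (1 - cos u)\<close>, integrated after a rotation of the phase. It
 carries a positive gap from large frequencies down to small ones and shows the quadratic rate there.\<close>

lemma ft_gap_double:
 assumes f: "integrable lborel f" and f0: "!!x. 0 \<le> f x"
 shows "ft_gap f (2 *\<^sub>R s) \<le> 4 * ft_gap f s"
proof -
 obtain \<theta> where t: "ft_gap f s = (LBINT x. f x * (1 - cos (s \<bullet> x + \<theta>)))" by (rule ft_gap_eq[OF f])
 have "ft_gap f (2 *\<^sub>R s) \<le> (LBINT x. f x * (1 - cos ((2 *\<^sub>R s) \<bullet> x + 2 * \<theta>)))" by (rule ft_gap_le[OF f])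
 also have "... \<le> (LBINT x. 4 * (f x * (1 - cos (s \<bullet> x + \<theta>))))"
 proof (intro integral_mono integrable_mult_right ft_rotate f)
  fix x
  let ?u = "s \<bullet> x + \<theta>"
  have "(2 *\<^sub>R s) \<bullet> x + 2 * \<theta> = 2 * ?u" by simp
  then have "1 - cos ((2 *\<^sub>R s) \<bullet> x + 2 * \<theta>) = 2 * (1 + cos ?u) * (1 - cos ?u)"
   by (simp only: cos_double_cos) (simp add: power2_eq_square algebra_simps)
  also have "... \<le> 4 * (1 - cos ?u)" by (intro mult_right_mono) auto
  finally have "f x * (1 - cos ((2 *\<^sub>R s) \<bullet> x + 2 * \<theta>)) \<le> f x * (4 * (1 - cos ?u))"
   by (rule mult_left_mono[OF _ f0])
  then show "f x * (1 - cos ((2 *\<^sub>R s) \<bullet> x + 2 * \<theta>)) \<le> 4 * (f x * (1 - cos ?u))"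
   by (simp only: mult.left_commute[of "f x" 4])
 qed
 also have "... = 4 * ft_gap f s" unfolding t by (rule integral_mult_right_zero)
 finally show ?thesis .
qed

lemma AE_cos_neq_1:
 fixes s :: "'a::euclidean_space"
 assumes "s \<noteq> 0"
 shows "AE x in lborel. cos (s \<bullet> x + \<theta>) \<noteq> 1"
proof -
 have "AE x in lborel. \<forall>k::int. s \<bullet> x \<noteq> real_of_int k * 2 * pi - \<theta>"
  unfolding AE_all_countable using AE_not_hyperplane[OF assms] by blast
 then show ?thesis
 proof eventually_elim
  case (elim x)
  show ?case
  proof
   assume "cos (s \<bullet> x + \<theta>) = 1"
   then obtain k :: int where "s \<bullet> x + \<theta> = real_of_int k * 2 * pi" by (auto simp: cos_one_2pi_int)
   then have "s \<bullet> x = real_of_int k * 2 * pi - \<theta>" by simp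
   with elim show False by blast
  qed
 qed
qed

lemma ft_gap_pos:
 fixes f :: "'a::euclidean_space => real"
 assumes f: "integrable lborel f" and f0: "!!x. 0 \<le> f x" and pos: "0 < (LBINT x. f x)" and s: "s \<noteq> 0"
 shows "0 < ft_gap f s"
proof -
 obtain \<theta> where t: "ft_gap f s = (LBINT x. f x * (1 - cos (s \<bullet> x + \<theta>)))" by (rule ft_gap_eq[OF f])
 have "0 < (LBINT x. (1 - cos (s \<bullet> x + \<theta>)) * f x)"
 proof (rule integral_pos_AE[OF f0 pos])
  show "AE x in lborel. 0 < 1 - cos (s \<bullet> x + \<theta>)"
   using AE_cos_neq_1[OF s] by eventually_elim (simp add: less_le)
  show "integrable lborel (%x. (1 - cos (s \<bullet> x + \<theta>)) * f x)"
   using ft_rotate(2)[OF f, of s \<theta>] by (simp add: mult.commute)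
 qed simp
 then show ?thesis unfolding t by (simp add: mult.commute)
qed

lemma norm_cis_diff_le: "norm (cis a - cis b) \<le> \<bar>a - b\<bar>"
proof -
 have "norm (cis a - cis b) = norm (cis b * (iexp (a - b) - 1))"
  by (simp add: cis_conv_exp right_diff_distrib exp_add[symmetric] algebra_simps)
 also have "... = norm (iexp (a - b) - 1)" by (simp add: norm_mult)
 also have "... \<le> \<bar>a - b\<bar>" using iexp_approx1[of "a - b" 0] by simp
 finally show ?thesis .
qed

lemma ft_lipschitz:
 fixes f :: "'a::euclidean_space => real"
 assumes f: "integrable lborel f" and f0: "!!x. 0 \<le> f x" and fx: "integrable lborel (%x. norm x * f x)"
 shows "norm (ft f s - ft f t) \<le> norm (s - t) * (LBINT x. norm x * f x)"
proof -
 have i: "integrable lborel (%x. f x *\<^sub>R cis (s \<bullet> x))" for s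
  using f by (rule integrable_scaleR_cis) simp
 have "norm (ft f s - ft f t) = norm (LBINT x. f x *\<^sub>R cis (s \<bullet> x) - f x *\<^sub>R cis (t \<bullet> x))"
  unfolding ft_def using i by simp
 also have "... \<le> (LBINT x. norm (f x *\<^sub>R cis (s \<bullet> x) - f x *\<^sub>R cis (t \<bullet> x)))"
  by (rule integral_norm_bound)
 also have "... \<le> (LBINT x. norm (s - t) * (norm x * f x))"
 proof (rule integral_mono')
  show "integrable lborel (%x. norm (s - t) * (norm x * f x))" by (intro integrable_mult_right fx)
  fix x
  have "norm (f x *\<^sub>R cis (s \<bullet> x) - f x *\<^sub>R cis (t \<bullet> x)) = f x * norm (cis (s \<bullet> x) - cis (t \<bullet> x))"
   unfolding scaleR_diff_right[symmetric] using f0 by simp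
  also have "... \<le> f x * \<bar>s \<bullet> x - t \<bullet> x\<bar>" by (intro mult_left_mono norm_cis_diff_le f0)
  also have "... \<le> f x * (norm (s - t) * norm x)"
   unfolding inner_diff_left[symmetric] by (intro mult_left_mono Cauchy_Schwarz_ineq2 f0)
  finally show "norm (f x *\<^sub>R cis (s \<bullet> x) - f x *\<^sub>R cis (t \<bullet> x)) \<le> norm (s - t) * (norm x * f x)" by (simp add: mult_ac)
  show "0 \<le> norm (s - t) * (norm x * f x)" using f0 by simp
 qed
 finally show ?thesis by simp
qed

text \<open>A quantitative Riemann--Lebesgue lemma. For bounded densities the square of the transform is
  integrable, and a Lipschitz function with this property vanishes at infinity.\<close>

lemma ft_decay:
 fixes f :: "'a::euclidean_space => real"
 assumes f: "integrable lborel f" and f0: "!!x. 0 \<le> f x" and f1: "!!x. f x \<le> 1"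
  and fx: "integrable lborel (%x. norm x * f x)" and e: "e > 0"
 obtains R where "!!s. norm s \<ge> R ==> norm (ft f s) < e"
proof -
 have [measurable]: "f \<in> borel_measurable borel" using f by auto
 let ?g = "%s. (norm (ft f s))\<^sup>2"
 have g: "integrable lborel ?g" using plancherel_bound(1)[OF f _ f0, of 1] f1 by auto
 define L where "L = (LBINT x. norm x * f x) + 1"
 have L: "L > 0" unfolding L_def using f0 by (intro add_nonneg_pos) auto
 define \<rho> where "\<rho> = e / (2 * L)"
 have rho: "\<rho> > 0" using e L by (simp add: \<rho>_def)
 define V where "V = measure lborel (ball (0::'a) \<rho>)"
 have V: "V > 0" unfolding V_def using rho by (simp add: content_ball_pos)
 have Vs: "measure lborel (ball s \<rho>) = V" for s :: 'a
  unfolding V_def using rho by (simp add: content_ball)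
 have "(%n. \<integral>s. indicator {s. real n \<le> norm s} s * ?g s \<partial>lborel) \<longlonglongrightarrow> (\<integral>s. 0 \<partial>(lborel::'a measure))"
 proof (rule integral_dominated_convergence[where w="?g"])
  show "AE s in lborel. (%n. indicator {s. real n \<le> norm s} s * ?g s) \<longlonglongrightarrow> 0"
  proof (intro AE_I2)
   fix s :: 'a
   have "\<forall>\<^sub>F n in sequentially. real n > norm s"
    using filterlim_real_sequentially by (simp add: filterlim_at_top_dense)
   then have "\<forall>\<^sub>F n in sequentially. indicator {s. real n \<le> norm s} s * ?g s = 0"
    by eventually_elim simp
   then show "(%n. indicator {s. real n \<le> norm s} s * ?g s) \<longlonglongrightarrow> 0" by (rule tendsto_eventually)
  qed
 qed (use g in \<open>auto simp: indicator_def\<close>)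
 then have lim: "(%n. \<integral>s. indicator {s. real n \<le> norm s} s * ?g s \<partial>lborel) \<longlonglongrightarrow> 0" by simp
 have "(e / 2)\<^sup>2 * V > 0" using e V by simp
 then obtain n where n: "(LBINT s. indicator {s. real n \<le> norm s} s * ?g s) < (e / 2)\<^sup>2 * V"
  using order_tendstoD(2)[OF lim] by (meson eventually_happens sequentially_bot)
 show ?thesis
 proof (rule that[of "real n + \<rho>"], rule ccontr)
  fix s :: 'a assume s: "real n + \<rho> \<le> norm s" and "\<not> norm (ft f s) < e"
  then have es: "e \<le> norm (ft f s)" by simp
  have ge: "e / 2 \<le> norm (ft f t)" if "t \<in> ball s \<rho>" for t
  proof -
   have "norm (ft f s - ft f t) \<le> norm (s - t) * (LBINT x. norm x * f x)" by (rule ft_lipschitz[OF f f0 fx])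
   also have "... \<le> \<rho> * L" using that rho f0 by (intro mult_mono) (auto simp: L_def dist_norm)
   also have "... = e / 2" using L by (simp add: \<rho>_def)
   finally show ?thesis using es norm_triangle_ineq2[of "ft f s" "ft f t"] by linarith
  qed
  have nn: "real n \<le> norm t" if "t \<in> ball s \<rho>" for t
   using that s norm_triangle_ineq2[of s t] by (simp add: dist_norm)
  have "(e / 2)\<^sup>2 * V = (LBINT t. indicator (ball s \<rho>) t * (e / 2)\<^sup>2)"
   using Vs[of s] by simp
  also have "... \<le> (LBINT t. indicator {t. real n \<le> norm t} t * ?g t)"
  proof (rule integral_mono)
   show "integrable lborel (%t. indicator {t. real n \<le> norm t} t * ?g t)"
    using integrable_mult_indicator[OF _ g, of "{t. real n \<le> norm t}"] by simp
   show "integrable lborel (%t. indicator (ball s \<rho>) t * (e / 2)\<^sup>2)"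
    using emeasure_lborel_ball_finite[of s \<rho>] by (intro integrable_mult_left integrable_real_indicator) auto
   fix t :: 'a
   show "indicator (ball s \<rho>) t * (e / 2)\<^sup>2 \<le> indicator {t. real n \<le> norm t} t * ?g t"
   proof (cases "t \<in> ball s \<rho>")
    case True
    have "(e / 2)\<^sup>2 \<le> ?g t" using ge[OF True] e by (intro power_mono) auto
    then show ?thesis using True nn[OF True] by (simp only: indicator_simps mem_Collect_eq)
   qed simp
  qed
  finally show False using n by simp
 qed
qed

text \<open>Near infinity the gap is large by the decay of the transform, on compact sets away from the
  origin by continuity and positivity, and near the origin by repeated doubling.\<close>

lemma ft_gap_lower:
 fixes f :: "'a::euclidean_space => real"
 assumes f: "integrable lborel f" and f0: "!!x. 0 \<le> f x" and f1: "!!x. f x \<le> 1"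
  and fx: "integrable lborel (%x. norm x * f x)" and pos: "0 < (LBINT x. f x)"
 obtains c where "c > 0" "!!s. c * min 1 ((norm s)\<^sup>2) \<le> ft_gap f s"
proof -
 let ?A = "\<integral>x. f x \<partial>lborel"
 obtain R where R: "!!s. norm s \<ge> R ==> norm (ft f s) < ?A / 2"
  using ft_decay[OF f f0 f1 fx, of "?A / 2"] pos by auto
 let ?K = "{s::'a. 1 \<le> norm s} \<inter> cball 0 (max R 1)"
 have cont: "continuous_on UNIV (ft_gap f)"
  unfolding ft_gap_def[abs_def] by (intro continuous_intros ft_continuous[OF f])
 have "closed {s::'a. 1 \<le> norm s}" by (intro closed_Collect_le continuous_intros)
 then have "compact ?K" by (intro closed_Int_compact) auto
 moreover have "?K \<noteq> {}"
 proof -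
  obtain b :: 'a where "b \<in> Basis" using nonempty_Basis by blast
  then have "b \<in> ?K" by simp
  then show ?thesis by blast
 qed
 ultimately obtain s0 where s0: "s0 \<in> ?K" "!!s. s \<in> ?K ==> ft_gap f s0 \<le> ft_gap f s"
  using continuous_attains_inf[of ?K "ft_gap f"] continuous_on_subset[OF cont] by blast
 define c0 where "c0 = min (ft_gap f s0) (?A / 2)"
 have "s0 \<noteq> 0" using s0(1) by auto
 then have c0: "c0 > 0" unfolding c0_def using s0(1) ft_gap_pos[OF f f0 pos, of s0] pos by auto
 have big: "c0 \<le> ft_gap f s" if "1 \<le> norm s" for s
 proof (cases "norm s \<le> max R 1")
  case True
  then show ?thesis using that s0(2)[of s] by (auto simp: c0_def min_le_iff_disj)
 next
  case False
  then have "norm (ft f s) < ?A / 2" by (intro R) auto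
  then have "?A / 2 \<le> ft_gap f s" by (simp add: ft_gap_def)
  then show ?thesis by (simp add: c0_def min_le_iff_disj)
 qed
 have iter: "ft_gap f (2 ^ j *\<^sub>R s) \<le> 4 ^ j * ft_gap f s" for j s
 proof (induction j)
  case (Suc j)
  have "ft_gap f (2 ^ Suc j *\<^sub>R s) \<le> 4 * ft_gap f (2 ^ j *\<^sub>R s)"
   using ft_gap_double[OF f f0, of "2 ^ j *\<^sub>R s"] by simp
  also have "... \<le> 4 * (4 ^ j * ft_gap f s)" using Suc by simp
  finally show ?case by simp
 qed simp
 have main: "c0 / 4 * min 1 ((norm s)\<^sup>2) \<le> ft_gap f s" for s
 proof (cases "1 \<le> norm s")
  case True
  have "c0 / 4 * min 1 ((norm s)\<^sup>2) \<le> c0 * 1" using c0 by (intro mult_mono) auto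
  with big[OF True] show ?thesis by simp
 next
  case False
  show ?thesis
  proof (cases "s = 0")
   case True
   have "ft f 0 = complex_of_real ?A" by (simp add: ft_def scaleR_conv_of_real)
   then show ?thesis using True pos by (simp add: ft_gap_def)
  next
   case s: False
   have "\<exists>j. 1 \<le> 2 ^ j * norm s"
    using real_arch_pow[of 2 "1 / norm s"] s by (auto simp: field_simps intro: less_imp_le)
   then obtain j where j: "1 \<le> 2 ^ j * norm s" and jm: "!!i. 1 \<le> 2 ^ i * norm s ==> j \<le> i"
    using LeastI_ex[of "%j. 1 \<le> 2 ^ j * norm s"] Least_le[of "%j. 1 \<le> 2 ^ j * norm s"] by blast
   have "j \<noteq> 0" using j False by (cases j) auto
   then obtain i where i: "j = Suc i" by (cases j) auto
   then have "\<not> 1 \<le> 2 ^ i * norm s" using jm[of i] by auto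
   then have lt: "2 ^ j * norm s \<le> 2" unfolding i by simp
   have "c0 \<le> ft_gap f (2 ^ j *\<^sub>R s)" using j by (intro big) simp
   also have "... \<le> 4 ^ j * ft_gap f s" by (rule iter)
   finally have g: "c0 \<le> 4 ^ j * ft_gap f s" .
   have "(2 ^ j * norm s)\<^sup>2 \<le> 2\<^sup>2" using lt by (intro power_mono) auto
   then have q: "4 ^ j * (norm s)\<^sup>2 \<le> 4"
    by (simp add: power_mult_distrib power_mult[symmetric] power_even_eq[symmetric] mult.commute[of j] power_mult)
   have "4 ^ j * (c0 / 4 * min 1 ((norm s)\<^sup>2)) \<le> 4 ^ j * (c0 / 4 * (norm s)\<^sup>2)"
    using c0 by (intro mult_left_mono) auto
   also have "... = (4 ^ j * (norm s)\<^sup>2) * (c0 / 4)" by simp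
   also have "... \<le> 4 * (c0 / 4)" using c0 by (intro mult_right_mono q) auto
   also have "... \<le> 4 ^ j * ft_gap f s" using g by simp
   finally show ?thesis by (simp add: mult_le_cancel_left)
  qed
 qed
 show ?thesis using that[of "c0 / 4"] c0 main by simp
qed

section \<open>Uniform control of the tilted densities\<close>

text \<open>What the estimates use of a density with mean \<open>m\<close>: exponential moments, a transform bounded away
 from one quadratically near the origin, and an integrable power of the transform, all with explicit
 constants. The point is that one choice of constants serves all tilted densities near a given one.\<close>

definition regular :: "real => real => real => nat => real^'d => (real^'d => real) => bool" where
 "regular \<eta> c K L m \<pi> \<longleftrightarrow> pdf \<pi> \<and>
   integrable lborel (%x. exp (\<eta> * norm x) * \<pi> x) \<and> (LBINT x. exp (\<eta> * norm x) * \<pi> x) \<le> K \<and>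
   (\<forall>v. (LBINT x. (v \<bullet> (x - m)) * \<pi> x) = 0) \<and>
   (\<forall>s. norm (ft \<pi> s) \<le> 1 - c * min 1 ((norm s)\<^sup>2)) \<and>
   integrable lborel (%s. norm (ft \<pi> s) ^ L) \<and> (LBINT s. norm (ft \<pi> s) ^ L) \<le> K"

context pdf
begin

lemma dominated_ball:
 assumes c: "0 < c" and i: "integrable lborel (%x. exp (t \<bullet> x + c * norm x) * q x)"
 shows "ball t c \<subseteq> interior (mgf_dom q)"
proof (rule interior_maximal[OF _ open_ball])
 show "ball t c \<subseteq> mgf_dom q"
 proof
  fix s assume "s \<in> ball t c"
  then have "norm (s - t) < c" by (simp add: dist_norm norm_minus_commute)
  from mom_dominated[OF c i subexp_const this, of 1] show "s \<in> mgf_dom q"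
   by (simp add: mgf_dom_iff)
 qed
qed

text \<open>To be used for the density \<open>q\<close> of a block of summands. Of \<open>j + 1\<close> blocks, one supplies the
 bound \<open>B\<close> and the other ones carry the exponential weight, at the price of the factor
 \<open>j / (j + 1)\<close> in the exponent.\<close>

lemma weighted_sum_pdf_bound:
 assumes B: "!!x. q x \<le> B" and M: "0 \<le> M"
 shows "\<exists>C\<ge>0. \<forall>\<tau>. integrable lborel (%x. exp (\<tau> \<bullet> x) * q x) \<longrightarrow> mgf q \<tau> \<le> M \<longrightarrow>
   (\<forall>x. exp ((real j / real (Suc j)) * (\<tau> \<bullet> x)) * sum_pdf q (Suc j) x \<le> C)"
proof (induction j)
 case 0
 have "0 \<le> B" using order_trans[OF q_nonneg B] .
 then show ?case using B by (auto simp: sum_pdf_1)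
next
 case (Suc j)
 then obtain C where C: "C \<ge> 0" and IH: "!!\<tau> x. integrable lborel (%x. exp (\<tau> \<bullet> x) * q x) ==> mgf q \<tau> \<le> M ==>
   exp ((real j / real (Suc j)) * (\<tau> \<bullet> x)) * sum_pdf q (Suc j) x \<le> C" by blast
 have B0: "0 \<le> B" using order_trans[OF q_nonneg B] .
 interpret S: pdf "sum_pdf q (Suc j)" by (rule pdf_sum_pdf)
 show ?case
 proof (intro exI[of _ "M * C + B * M ^ Suc j"] conjI allI impI)
  show "0 \<le> M * C + B * M ^ Suc j" using M C B0 by simp
  fix \<tau> x assume i: "integrable lborel (%x. exp (\<tau> \<bullet> x) * q x)" and m: "mgf q \<tau> \<le> M"
  have dom: "\<tau> \<in> mgf_dom q" using i mgf_dom_iff by simp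
  have mp: "mgf q \<tau> > 0" by (rule mgf_pos[OF dom])
  interpret T: pdf "tl q \<tau>" by (rule pdf_tl[OF dom])
  interpret TS: pdf "sum_pdf (tl q \<tau>) (Suc j)" by (rule T.pdf_sum_pdf)
  let ?th = "real (Suc j) / real (Suc (Suc j))" and ?la = "real j / real (Suc j)"
  let ?b = "sum_pdf q (Suc j)"
  have eb: "exp (\<tau> \<bullet> z) * ?b z = mgf q \<tau> ^ Suc j * sum_pdf (tl q \<tau>) (Suc j) z" for z
   unfolding sum_pdf_tl using mp by simp
  have ib: "integrable lborel (%z. exp (\<tau> \<bullet> z) * ?b z)" "(LBINT z. exp (\<tau> \<bullet> z) * ?b z) = mgf q \<tau> ^ Suc j"
   unfolding eb using TS.q_int TS.q_mass by auto
  have ib': "integrable lborel (%y. exp (\<tau> \<bullet> (x - y)) * ?b (x - y))"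
    "(LBINT y. exp (\<tau> \<bullet> (x - y)) * ?b (x - y)) = mgf q \<tau> ^ Suc j"
   using integrable_lborel_reflect[OF ib(1), of x] integral_lborel_reflect[of "%z. exp (\<tau> \<bullet> z) * ?b z" x] ib(2)
   by auto
  have "exp (?th * (\<tau> \<bullet> x)) * sum_pdf q (Suc (Suc j)) x = (LBINT y. exp (?th * (\<tau> \<bullet> x)) * (q y * ?b (x - y)))"
   by (simp add: sum_pdf_Suc)
  also have "... \<le> (LBINT y. C * (exp (\<tau> \<bullet> y) * q y) + B * (exp (\<tau> \<bullet> (x - y)) * ?b (x - y)))"
  proof (rule integral_mono')
   show "integrable lborel (%y. C * (exp (\<tau> \<bullet> y) * q y) + B * (exp (\<tau> \<bullet> (x - y)) * ?b (x - y)))"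
    using i ib' by (intro Bochner_Integration.integrable_add integrable_mult_right)
   fix y
   let ?u = "\<tau> \<bullet> y" and ?v = "\<tau> \<bullet> (x - y)"
   have "?th * (\<tau> \<bullet> x) = ?th * (?u + ?la * ?v) + (1 - ?th) * ?v"
   proof -
    have "\<tau> \<bullet> x = ?u + ?v" by (simp add: inner_diff_right)
    moreover have "?th * ?la = real j / real (Suc (Suc j))"
     by (simp del: of_nat_Suc)
    moreover have "1 - ?th = 1 / real (Suc (Suc j))"
     by (simp add: field_simps)
    ultimately have tx: "\<tau> \<bullet> x = ?u + ?v" and "?th * ?la + (1 - ?th) = ?th"
     by (simp_all add: add_divide_distrib[symmetric])
    then have "?th * ?la * ?v + (1 - ?th) * ?v = ?th * ?v" by (simp only: distrib_right[symmetric])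
    then show ?thesis unfolding tx by (simp only: distrib_left mult.assoc)
   qed
   also have "... \<le> max (?u + ?la * ?v) ?v"
   proof -
    have "?th * (?u + ?la * ?v) + (1 - ?th) * ?v \<le> ?th * max (?u + ?la * ?v) ?v + (1 - ?th) * max (?u + ?la * ?v) ?v"
     by (intro add_mono mult_left_mono) auto
    then show ?thesis by (simp only: distrib_right[symmetric]) simp
   qed
   finally have "exp (?th * (\<tau> \<bullet> x)) \<le> exp (max (?u + ?la * ?v) ?v)" by simp
   also have "... \<le> exp (?u + ?la * ?v) + exp ?v" by (auto simp: max_def)
   finally have "exp (?th * (\<tau> \<bullet> x)) * (q y * ?b (x - y)) \<le> (exp (?u + ?la * ?v) + exp ?v) * (q y * ?b (x - y))"
    by (intro mult_right_mono) (auto simp: q_nonneg S.q_nonneg)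
   also have "... = (exp (?la * ?v) * ?b (x - y)) * (exp ?u * q y) + q y * (exp ?v * ?b (x - y))"
    by (simp add: exp_add algebra_simps)
   also have "... \<le> C * (exp ?u * q y) + B * (exp ?v * ?b (x - y))"
    by (intro add_mono mult_right_mono IH i m B) (auto simp: q_nonneg S.q_nonneg)
   finally show "exp (?th * (\<tau> \<bullet> x)) * (q y * ?b (x - y)) \<le> C * (exp ?u * q y) + B * (exp ?v * ?b (x - y))" .
   show "0 \<le> C * (exp ?u * q y) + B * (exp ?v * ?b (x - y))"
    using C B0 by (simp add: q_nonneg S.q_nonneg)
  qed
  also have "... = C * mgf q \<tau> + B * mgf q \<tau> ^ Suc j"
   using i ib' by (simp add: mgf_eq_mom mom_def)
  also have "... \<le> M * C + B * M ^ Suc j"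
   using mp m C B0 by (intro add_mono mult_left_mono power_mono) (auto simp: mult.commute mult_left_mono)
  finally show "exp (?th * (\<tau> \<bullet> x)) * sum_pdf q (Suc (Suc j)) x \<le> M * C + B * M ^ Suc j" .
 qed
qed

lemma tilted_ft_power_integrable:
 assumes t0: "t0 \<in> interior (mgf_dom q)" and i0: "integrable lborel (%s. ft q s ^ Suc N)"
  and c: "0 < c" and i: "integrable lborel (%x. exp (t0 \<bullet> x + c * norm x) * q x)"
  and mlow: "!!t. t \<in> cball t0 (c / 4) ==> A \<le> mgf q t" "A > 0"
  and mup: "!!t. t \<in> cball t0 (c / 2) ==> mgf q t \<le> I"
 shows "\<exists>L K. \<forall>t\<in>cball t0 (c / 4). integrable lborel (%s. norm (ft (tl q t) s) ^ L) \<and> (LBINT s. norm (ft (tl q t) s) ^ L) \<le> K"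
proof -
 let ?b = "sum_pdf q (Suc (Suc N))"
 interpret b: pdf ?b by (rule pdf_sum_pdf)
 obtain B where B: "B \<ge> 0" "!!x. ?b x \<le> B" using sum_pdf_bounded[OF i0] by blast
 obtain j :: nat where j: "j > 0" "4 * (norm t0 + c) / c < real j"
 proof -
  obtain n where "4 * (norm t0 + c) / c < real n" using reals_Archimedean2 by blast
  then have "4 * (norm t0 + c) / c < real (Suc n)" by linarith
  then show ?thesis using that[of "Suc n"] by blast
 qed
 have I0: "I > 0" using mgf_pos[of t0] interior_dom_dom[OF t0] mup[of t0] c by force
 obtain C where C: "C \<ge> 0" and W: "!!\<tau> x. integrable lborel (%x. exp (\<tau> \<bullet> x) * ?b x) ==> mgf ?b \<tau> \<le> I ^ Suc (Suc N) ==>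
   exp ((real j / real (Suc j)) * (\<tau> \<bullet> x)) * sum_pdf ?b (Suc j) x \<le> C"
  using b.weighted_sum_pdf_bound[of B "I ^ Suc (Suc N)" j, OF B(2)] I0 by auto
 let ?D = "(2 * pi) ^ DIM(real^'d)"
 show ?thesis
 proof (intro exI ballI)
  fix t assume t: "t \<in> cball t0 (c / 4)"
  define \<tau> where "\<tau> = (real (Suc j) / real j) *\<^sub>R t"
  have \<tau>t: "(real j / real (Suc j)) * (\<tau> \<bullet> x) = t \<bullet> x" for x
   using j by (simp add: \<tau>_def)
  have "\<tau> - t = (real (Suc j) / real j - 1) *\<^sub>R t" by (simp add: \<tau>_def scaleR_left_diff_distrib)
  also have "real (Suc j) / real j - 1 = 1 / real j" using j by (simp add: field_simps)
  finally have "\<tau> - t = (1 / real j) *\<^sub>R t" .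
  then have "norm (\<tau> - t) = norm t / real j" by simp
  also have "norm t \<le> norm t0 + c" using t norm_triangle_ineq2[of t t0] c by (simp add: dist_norm norm_minus_commute)
  then have "norm t / real j \<le> (norm t0 + c) / real j" by (intro divide_right_mono) auto
  also have "(norm t0 + c) / real j \<le> c / 4" using j c by (simp add: field_simps)
  finally have "norm (\<tau> - t) \<le> c / 4" .
  then have \<tau>: "\<tau> \<in> cball t0 (c / 2)" using t norm_triangle_ineq[of "\<tau> - t" "t - t0"] by (simp add: dist_norm norm_minus_commute)
  have sub: "cball t0 (c / 2) \<subseteq> interior (mgf_dom q)"
   using dominated_ball[OF c i] c by (auto simp: subset_iff)
  have dom: "t \<in> mgf_dom q" "\<tau> \<in> mgf_dom q"
   using sub t \<tau> interior_dom_dom c by (auto simp: subset_iff)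
  interpret Tt: pdf "tl q t" by (rule pdf_tl[OF dom(1)])
  interpret T\<tau>: pdf "tl q \<tau>" by (rule pdf_tl[OF dom(2)])
  have mp: "mgf q t > 0" "mgf q \<tau> > 0" using mgf_pos dom by auto
  have eb: "exp (s \<bullet> z) * ?b z = mgf q s ^ Suc (Suc N) * sum_pdf (tl q s) (Suc (Suc N)) z" if "mgf q s > 0" for s z
   unfolding sum_pdf_tl using that by simp
  have ib: "integrable lborel (%z. exp (s \<bullet> z) * ?b z) \<and> mgf ?b s = mgf q s ^ Suc (Suc N)" if "s \<in> mgf_dom q" for s
  proof -
   interpret T: pdf "tl q s" by (rule pdf_tl[OF that])
   interpret TS: pdf "sum_pdf (tl q s) (Suc (Suc N))" by (rule T.pdf_sum_pdf)
   show ?thesis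
    unfolding b.mgf_eq_mom mom_def mult_1 eb[OF mgf_pos[OF that]] using TS.q_int TS.q_mass by auto
  qed
  let ?f = "sum_pdf (sum_pdf (tl q t) (Suc (Suc N))) (Suc j)"
  interpret TS: pdf "sum_pdf (tl q t) (Suc (Suc N))" by (rule Tt.pdf_sum_pdf)
  interpret f: pdf ?f by (rule TS.pdf_sum_pdf)
  have tlb: "sum_pdf (tl q t) (Suc (Suc N)) = tl ?b t"
   by (rule ext) (simp only: sum_pdf_tl tl_def[of ?b] conjunct2[OF ib[OF dom(1)]])
  have fb: "?f x \<le> C / A ^ (Suc (Suc N) * Suc j)" for x
  proof -
   have "?f x = exp (t \<bullet> x) * sum_pdf ?b (Suc j) x / mgf q t ^ (Suc (Suc N) * Suc j)"
    unfolding tlb b.sum_pdf_tl conjunct2[OF ib[OF dom(1)]] by (simp only: power_mult) simp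
   also have "... \<le> C / mgf q t ^ (Suc (Suc N) * Suc j)"
   proof (intro divide_right_mono)
    have "mgf ?b \<tau> \<le> I ^ Suc (Suc N)"
     using ib[OF dom(2)] mp mup[OF \<tau>] by (simp only: power_mono less_imp_le)
    then have "exp ((real j / real (Suc j)) * (\<tau> \<bullet> x)) * sum_pdf ?b (Suc j) x \<le> C"
     using ib[OF dom(2)] by (intro W) auto
    then show "exp (t \<bullet> x) * sum_pdf ?b (Suc j) x \<le> C" unfolding \<tau>t .
   qed (use mp in simp)
   also have "... \<le> C / A ^ (Suc (Suc N) * Suc j)"
    using mlow t C by (intro divide_left_mono power_mono mult_pos_pos zero_less_power mp) auto
   finally show ?thesis .
  qed
  have ftf: "ft ?f s = ft (tl q t) s ^ (Suc (Suc N) * Suc j)" for s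
   by (simp only: TS.ft_sum_pdf Tt.ft_sum_pdf power_mult)
  have sq: "(norm (ft ?f s))\<^sup>2 = norm (ft (tl q t) s) ^ (Suc (Suc N) * Suc j * 2)" for s
   unfolding ftf by (simp only: norm_power power_mult)
  show "integrable lborel (%s. norm (ft (tl q t) s) ^ (Suc (Suc N) * Suc j * 2)) \<and>
    (LBINT s. norm (ft (tl q t) s) ^ (Suc (Suc N) * Suc j * 2)) \<le> ?D * (C / A ^ (Suc (Suc N) * Suc j)) * 1"
   using plancherel_bound[OF f.q_int _ f.q_nonneg, of "C / A ^ (Suc (Suc N) * Suc j)"] fb
   unfolding sq f.q_mass by auto
 qed
qed

text \<open>The gap of the transform is inherited from a bounded minorant that is common to all tilted
  densities with parameters in a small ball; the other constants come from one exponential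
  moment at the centre of the ball.\<close>

lemma tilted_regular:
 assumes t0: "t0 \<in> interior (mgf_dom q)" and i0: "integrable lborel (%s. ft q s ^ Suc N)"
 obtains r \<eta> c K L where "r > 0" "\<eta> > 0" "c > 0" "cball t0 r \<subseteq> interior (mgf_dom q)"
  "!!t. t \<in> cball t0 r ==> regular \<eta> c K L (mean_fun q t) (tl q t)"
proof -
 obtain c where c: "c > 0" and i: "integrable lborel (%x. exp (t0 \<bullet> x + c * norm x) * q x)"
  using dominated[OF t0] by blast
 define I where "I = (LBINT x. exp (t0 \<bullet> x + c * norm x) * q x)"
 have I0: "I > 0" unfolding I_def
  by (rule integral_pos_AE[OF q_nonneg _ _ _ i]) (auto simp: q_mass)
 have sub: "ball t0 c \<subseteq> interior (mgf_dom q)" by (rule dominated_ball[OF c i])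
 have up: "exp (t \<bullet> x + e * norm x) \<le> exp (t0 \<bullet> x + c * norm x)" if "norm (t - t0) + e \<le> c" for t x e
 proof -
  have "(t - t0) \<bullet> x \<le> norm (t - t0) * norm x" by (rule norm_cauchy_schwarz)
  then have "t \<bullet> x + e * norm x \<le> t0 \<bullet> x + (norm (t - t0) + e) * norm x" by (simp add: inner_diff_left algebra_simps)
  also have "... \<le> t0 \<bullet> x + c * norm x" using that by (intro add_left_mono mult_right_mono) auto
  finally show ?thesis by simp
 qed
 have low: "exp (t0 \<bullet> x - c * norm x) \<le> exp (t \<bullet> x)" if "norm (t - t0) \<le> c" for t x
 proof -
  have "(t0 - t) \<bullet> x \<le> norm (t0 - t) * norm x" by (rule norm_cauchy_schwarz)
  also have "... \<le> c * norm x" using that by (intro mult_right_mono) (auto simp: norm_minus_commute)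
  finally show ?thesis by (simp add: inner_diff_left)
 qed
 have idom: "integrable lborel (%x. exp (t \<bullet> x + e * norm x) * q x)"
  "(LBINT x. exp (t \<bullet> x + e * norm x) * q x) \<le> I" if "norm (t - t0) + e \<le> c" for t e
 proof -
  have le: "exp (t \<bullet> x + e * norm x) * q x \<le> exp (t0 \<bullet> x + c * norm x) * q x" for x
   by (intro mult_right_mono up that q_nonneg)
  show "integrable lborel (%x. exp (t \<bullet> x + e * norm x) * q x)"
   by (rule Bochner_Integration.integrable_bound[OF i]) (use le in \<open>auto simp: abs_mult q_nonneg\<close>)
  then show "(LBINT x. exp (t \<bullet> x + e * norm x) * q x) \<le> I"
   unfolding I_def by (intro integral_mono i le)
 qed
 have mup: "mgf q t \<le> I" if "norm (t - t0) \<le> c" for t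
  using idom(2)[of t 0] that by (simp add: mgf_eq_mom mom_def)
 have dom: "t \<in> interior (mgf_dom q)" if "t \<in> cball t0 (c / 2)" for t
  using that sub c by (auto simp: subset_iff)
 define D where "D = (%x. min (exp (t0 \<bullet> x - c * norm x) * q x / I) 1)"
 have [measurable]: "D \<in> borel_measurable borel" unfolding D_def by measurable
 have D0: "0 \<le> D x" and D1: "D x \<le> 1" for x using I0 q_nonneg by (auto simp: D_def)
 have Dle: "D x \<le> tl q t x" if t: "t \<in> cball t0 (c / 2)" for x t
 proof -
  have n: "norm (t - t0) \<le> c" using t c by (simp add: dist_norm norm_minus_commute)
  have mp: "mgf q t > 0" using mgf_pos interior_dom_dom dom[OF t] by blast
  have "D x \<le> exp (t0 \<bullet> x - c * norm x) * q x / I" by (simp add: D_def)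
  also have "... \<le> exp (t \<bullet> x) * q x / I" using I0 by (intro divide_right_mono mult_right_mono low n q_nonneg) simp
  also have "... \<le> exp (t \<bullet> x) * q x / mgf q t"
   using mp mup[OF n] q_nonneg I0 by (intro divide_left_mono) auto
  finally show ?thesis by (simp add: tl_def)
 qed
 have t0c: "t0 \<in> cball t0 (c / 2)" using c by simp
 interpret T0: pdf "tl q t0" by (rule pdf_tl[OF interior_dom_dom[OF t0]])
 have Di: "integrable lborel D"
  by (rule Bochner_Integration.integrable_bound[OF T0.q_int]) (use D0 Dle[OF t0c] in \<open>auto intro: order_trans[OF _ abs_ge_self]\<close>)
 have Dx: "integrable lborel (%x. norm x * D x)"
  by (rule Bochner_Integration.integrable_bound[OF tl_integrable[OF t0 subexp_norm]])
   (use D0 Dle[OF t0c] T0.q_nonneg in \<open>auto simp: abs_mult intro!: mult_left_mono\<close>)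
 have Dpos: "0 < (LBINT x. D x)"
 proof (rule ccontr)
  assume "\<not> 0 < (LBINT x. D x)"
  moreover have "0 \<le> (LBINT x. D x)" using D0 by simp
  ultimately have "(LBINT x. D x) = 0" by simp
  then have "AE x in lborel. D x = 0" using integral_nonneg_eq_0_iff_AE[OF Di] D0 by auto
  then have "AE x in lborel. q x = 0"
  proof eventually_elim
   case (elim x)
   then show ?case using I0 by (auto simp: D_def min_def split: if_splits)
  qed
  then have "(LBINT x. q x) = 0" by (rule integral_eq_zero_AE)
  then show False by (simp add: q_mass)
 qed
 obtain g where g: "g > 0" "!!s. g * min 1 ((norm s)\<^sup>2) \<le> ft_gap D s"
  using ft_gap_lower[OF Di D0 D1 Dx Dpos] by blast
 define A where "A = I * (LBINT x. D x)"
 have A0: "A > 0" using I0 Dpos by (simp add: A_def)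
 have mlow: "A \<le> mgf q t" if t: "t \<in> cball t0 (c / 4)" for t
 proof -
  have n: "norm (t - t0) \<le> c" using t c by (simp add: dist_norm norm_minus_commute)
  have it: "integrable lborel (%x. exp (t \<bullet> x) * q x)" using idom(1)[of t 0] n by simp
  have "I * D x \<le> exp (t \<bullet> x) * q x" for x
  proof -
   have "I * D x \<le> I * (exp (t0 \<bullet> x - c * norm x) * q x / I)" using I0 by (intro mult_left_mono) (auto simp: D_def)
   also have "... \<le> exp (t \<bullet> x) * q x" using I0 low[OF n, of x] q_nonneg by (simp add: mult_right_mono)
   finally show ?thesis .
  qed
  then have "(LBINT x. I * D x) \<le> (LBINT x. exp (t \<bullet> x) * q x)" by (intro integral_mono it integrable_mult_right Di)
  then show ?thesis by (simp add: A_def mgf_eq_mom mom_def)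
 qed
 have mup': "mgf q t \<le> I" if "t \<in> cball t0 (c / 2)" for t
  using that c by (intro mup) (simp add: dist_norm norm_minus_commute)
 obtain L K where LK: "!!t. t \<in> cball t0 (c / 4) ==> integrable lborel (%s. norm (ft (tl q t) s) ^ L) \<and> (LBINT s. norm (ft (tl q t) s) ^ L) \<le> K"
  using tilted_ft_power_integrable[OF t0 i0 c i mlow A0 mup'] by blast
 show ?thesis
 proof (rule that[of "c / 4" "c / 4" g])
  show "c / 4 > 0" "c / 4 > 0" "g > 0" using c g by auto
  show "cball t0 (c / 4) \<subseteq> interior (mgf_dom q)" using dom c by (auto simp: subset_iff)
  fix t assume t: "t \<in> cball t0 (c / 4)"
  then have t2: "t \<in> cball t0 (c / 2)" and n: "norm (t - t0) + c / 4 \<le> c"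
   using c by (auto simp: dist_norm norm_minus_commute)
  have mp: "mgf q t > 0" using A0 mlow[OF t] by simp
  interpret T: pdf "tl q t" by (rule pdf_tl[OF interior_dom_dom[OF dom[OF t2]]])
  have eq: "exp (c / 4 * norm x) * tl q t x = exp (t \<bullet> x + c / 4 * norm x) * q x / mgf q t" for x
   by (simp add: tl_def exp_add)
  have 1: "integrable lborel (%x. exp (c / 4 * norm x) * tl q t x)"
   unfolding eq using idom(1)[OF n] by simp
  have "(LBINT x. exp (c / 4 * norm x) * tl q t x) \<le> I / mgf q t"
   unfolding eq using idom(2)[OF n] mp by (simp add: divide_right_mono)
  also have "... \<le> I / A" using mlow[OF t] A0 mp I0 by (intro divide_left_mono) auto
  finally have 2: "(LBINT x. exp (c / 4 * norm x) * tl q t x) \<le> max (I / A) K" by simp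
  have 3: "norm (ft (tl q t) s) \<le> 1 - g * min 1 ((norm s)\<^sup>2)" for s
   using order_trans[OF g(2)[of s] ft_gap_mono[OF T.q_int Di Dle[OF t2], of s]] by (simp add: ft_gap_def T.q_mass)
  show "regular (c / 4) g (max (I / A) K) L (mean_fun q t) (tl q t)"
   unfolding regular_def using 1 2 3 LK[OF t] T.pdf_axioms tl_mean[OF dom[OF t2]] by auto
 qed
qed

end

section \<open>A uniform local limit estimate\<close>

lemma regular_subexp:
 fixes F :: "real^'d => real"
 assumes F: "subexp F" and eta: "\<eta> > 0"
 obtains C where "C \<ge> 0" "!!c K L m \<pi>. regular \<eta> c K L m (\<pi> :: real^'d => real) ==> integrable lborel (%x. F x * \<pi> x)"
  "!!c K L m \<pi>. regular \<eta> c K L m (\<pi> :: real^'d => real) ==> (LBINT x. \<bar>F x\<bar> * \<pi> x) \<le> C * K"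
proof -
 obtain A where A: "A \<ge> 0" "!!x. \<bar>F x\<bar> \<le> A * exp (\<eta> * norm x)" using subexpD[OF F eta] by blast
 have [measurable]: "F \<in> borel_measurable borel" by (rule subexp_measurable[OF F])
 show ?thesis
 proof (rule that[of A])
  fix c K L m and \<pi> :: "real^'d => real" assume r: "regular \<eta> c K L m \<pi>"
  interpret pdf \<pi> using r by (simp add: regular_def)
  have i: "integrable lborel (%x. A * (exp (\<eta> * norm x) * \<pi> x))" using r by (simp add: regular_def)
  have le: "\<bar>F x\<bar> * \<pi> x \<le> A * (exp (\<eta> * norm x) * \<pi> x)" for x
   using mult_right_mono[OF A(2) q_nonneg, of x x] by (simp add: mult.assoc)
  show "integrable lborel (%x. F x * \<pi> x)"
   by (rule Bochner_Integration.integrable_bound[OF i])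
    (use order_trans[OF le abs_ge_self] in \<open>auto simp: abs_mult q_nonneg intro!: AE_I2\<close>)
  have "(LBINT x. \<bar>F x\<bar> * \<pi> x) \<le> (LBINT x. A * (exp (\<eta> * norm x) * \<pi> x))"
   by (rule integral_mono'[OF i le]) (use A q_nonneg in auto)
  also have "... = A * (LBINT x. exp (\<eta> * norm x) * \<pi> x)" by (rule integral_mult_right_zero)
  also have "... \<le> A * K" using r A by (intro mult_left_mono) (auto simp: regular_def)
  finally show "(LBINT x. \<bar>F x\<bar> * \<pi> x) \<le> A * K" .
 qed (rule A)
qed

lemma regular_mean_le:
 assumes eta: "\<eta> > 0"
 obtains C where "C \<ge> 0" "!!c L m \<pi>. regular \<eta> c K L m (\<pi> :: real^'d => real) ==> norm m \<le> C"
proof -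
 obtain C where C: "C \<ge> 0" "!!c K L m \<pi>. regular \<eta> c K L m (\<pi> :: real^'d => real) ==> integrable lborel (%x. norm x * \<pi> x)"
  "!!c K L m \<pi>. regular \<eta> c K L m (\<pi> :: real^'d => real) ==> (LBINT x. \<bar>norm x\<bar> * \<pi> x) \<le> C * K"
  using regular_subexp[OF subexp_norm eta] by blast
 show ?thesis
 proof (rule that[of "C * \<bar>K\<bar>"])
  show "0 \<le> C * \<bar>K\<bar>" using C(1) by simp
  fix c L m and \<pi> :: "real^'d => real" assume r: "regular \<eta> c K L m \<pi>"
  interpret pdf \<pi> using r by (simp add: regular_def)
  have i: "integrable lborel (%x. norm x * \<pi> x)" by (rule C(2)[OF r])
  have iv: "integrable lborel (%x. (m \<bullet> x) * \<pi> x)"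
  proof (rule Bochner_Integration.integrable_bound)
   show "integrable lborel (%x. norm m * (norm x * \<pi> x))" by (intro integrable_mult_right i)
   show "AE x in lborel. norm ((m \<bullet> x) * \<pi> x) \<le> norm (norm m * (norm x * \<pi> x))"
   proof (intro AE_I2)
    fix x
    have "\<bar>m \<bullet> x\<bar> * \<pi> x \<le> (norm m * norm x) * \<pi> x" by (intro mult_right_mono Cauchy_Schwarz_ineq2 q_nonneg)
    then show "norm ((m \<bullet> x) * \<pi> x) \<le> norm (norm m * (norm x * \<pi> x))" by (simp add: abs_mult q_nonneg)
   qed
  qed simp
  have "0 = (LBINT x. (m \<bullet> (x - m)) * \<pi> x)" using r by (simp add: regular_def)
  also have "... = (LBINT x. (m \<bullet> x) * \<pi> x - (m \<bullet> m) * \<pi> x)"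
   by (simp add: inner_diff_right left_diff_distrib)
  also have "... = (LBINT x. (m \<bullet> x) * \<pi> x) - m \<bullet> m" using iv q_int by (simp add: q_mass)
  finally have "m \<bullet> m = (LBINT x. (m \<bullet> x) * \<pi> x)" by simp
  also have "... \<le> (LBINT x. norm m * (norm x * \<pi> x))"
  proof (rule integral_mono[OF iv])
   show "integrable lborel (%x. norm m * (norm x * \<pi> x))" by (intro integrable_mult_right i)
   show "(m \<bullet> x) * \<pi> x \<le> norm m * (norm x * \<pi> x)" for x
    unfolding mult.assoc[symmetric] by (intro mult_right_mono norm_cauchy_schwarz q_nonneg)
  qed
  also have "... \<le> norm m * (C * K)" using C(3)[OF r] by (simp add: mult_left_mono)
  finally have "norm m * norm m \<le> norm m * (C * K)" by (simp add: power2_norm_eq_inner[symmetric] power2_eq_square)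
  then show "norm m \<le> C * \<bar>K\<bar>"
   using C(1) by (cases "m = 0") (auto intro: order_trans[OF _ mult_left_mono[OF abs_ge_self]])
 qed
qed

lemma regular_central_moment:
 assumes eta: "\<eta> > 0"
 obtains C where "C \<ge> 0" "!!c L m \<pi>. regular \<eta> c K L m (\<pi> :: real^'d => real) ==> integrable lborel (%x. norm (x - m) ^ k * \<pi> x)"
  "!!c L m \<pi>. regular \<eta> c K L m (\<pi> :: real^'d => real) ==> (LBINT x. norm (x - m) ^ k * \<pi> x) \<le> C"
proof -
 obtain C0 where C0: "C0 \<ge> 0" "!!c L m \<pi>. regular \<eta> c K L m (\<pi> :: real^'d => real) ==> norm m \<le> C0"
  using regular_mean_le[OF eta, of K] by blast
 let ?F = "%x::real^'d. (norm x + C0) ^ k"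
 have F: "subexp ?F" by (intro subexp_power subexp_add subexp_norm subexp_const)
 obtain C where C: "C \<ge> 0" "!!c K L m \<pi>. regular \<eta> c K L m (\<pi> :: real^'d => real) ==> integrable lborel (%x. ?F x * \<pi> x)"
  "!!c K L m \<pi>. regular \<eta> c K L m (\<pi> :: real^'d => real) ==> (LBINT x. \<bar>?F x\<bar> * \<pi> x) \<le> C * K"
  using regular_subexp[OF F eta] by blast
 show ?thesis
 proof (rule that[of "C * \<bar>K\<bar>"])
  show "0 \<le> C * \<bar>K\<bar>" using C(1) by simp
  fix c L m and \<pi> :: "real^'d => real" assume r: "regular \<eta> c K L m \<pi>"
  interpret pdf \<pi> using r by (simp add: regular_def)
  have le: "norm (x - m) ^ k * \<pi> x \<le> ?F x * \<pi> x" for x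
   using C0(2)[OF r] norm_triangle_ineq4[of x m] by (intro mult_right_mono power_mono q_nonneg) auto
  show i: "integrable lborel (%x. norm (x - m) ^ k * \<pi> x)"
   by (rule Bochner_Integration.integrable_bound[OF C(2)[OF r]])
    (use le q_nonneg C0(1) in \<open>auto simp: abs_mult\<close>)
  have "(LBINT x. norm (x - m) ^ k * \<pi> x) \<le> (LBINT x. ?F x * \<pi> x)"
   by (intro integral_mono i C(2)[OF r] le)
  also have "... \<le> C * K" using C(3)[OF r] C0(1) by simp
  also have "... \<le> C * \<bar>K\<bar>" using C(1) by (intro mult_left_mono) auto
  finally show "(LBINT x. norm (x - m) ^ k * \<pi> x) \<le> C * \<bar>K\<bar>" .
 qed
qed

definition cft :: "(real^'d => real) => real^'d => real^'d => complex" where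
 "cft \<pi> m s = ft \<pi> s * cis (- (s \<bullet> m))"

lemma norm_cft: "norm (cft \<pi> m s) = norm (ft \<pi> s)"
 by (simp add: cft_def norm_mult)

lemma cft_minus: "cft \<pi> m (- s) = cnj (cft \<pi> m s)"
 by (simp add: cft_def ft_minus cis_cnj)

lemma cft_eq: "cft \<pi> m s = (LBINT x. \<pi> x *\<^sub>R cis (s \<bullet> (x - m)))"
proof -
 have "\<pi> x *\<^sub>R cis (s \<bullet> (x - m)) = (\<pi> x *\<^sub>R cis (s \<bullet> x)) * cis (- (s \<bullet> m))" for x
  by (simp add: cis_mult inner_diff_right)
 then show ?thesis unfolding cft_def ft_def by (simp only: integral_mult_left_zero)
qed

lemma norm_iexp_remainder2: "norm (cis u - 1 - \<i> * u) \<le> u\<^sup>2 / 2" for u :: real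
 using iexp_approx1[of u 1] by (simp add: cis_conv_exp power2_eq_square diff_diff_eq)

lemma abs_sin_minus_le: "\<bar>sin u - u\<bar> \<le> \<bar>u\<bar> ^ 3" for u :: real
proof -
 have "norm (cis u - (1 + \<i> * u + (\<i> * u)\<^sup>2 / 2)) \<le> \<bar>u\<bar> ^ 3 / 6"
  using iexp_approx1[of u 2] by (simp add: cis_conv_exp numeral_2_eq_2 numeral_3_eq_3 fact_numeral)
 then have "\<bar>Im (cis u - (1 + \<i> * u + (\<i> * u)\<^sup>2 / 2))\<bar> \<le> \<bar>u\<bar> ^ 3 / 6"
  using abs_Im_le_cmod order_trans by blast
 then have "\<bar>sin u - u\<bar> \<le> \<bar>u\<bar> ^ 3 / 6" by (simp add: power2_eq_square)
 also have "... \<le> \<bar>u\<bar> ^ 3" by simp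
 finally show ?thesis .
qed

lemma cft_expansion:
 assumes eta: "\<eta> > 0"
 obtains C where "C \<ge> 1"
  "!!c L m \<pi> s. regular \<eta> c K L m (\<pi> :: real^'d => real) ==> norm (cft \<pi> m s - 1) \<le> C * (norm s)\<^sup>2"
  "!!c L m \<pi> s. regular \<eta> c K L m (\<pi> :: real^'d => real) ==> \<bar>Im (cft \<pi> m s)\<bar> \<le> C * norm s ^ 3"
proof -
 obtain C2 where C2: "C2 \<ge> 0" "!!c L m \<pi>. regular \<eta> c K L m (\<pi> :: real^'d => real) ==> integrable lborel (%x. norm (x - m) ^ 2 * \<pi> x)"
  "!!c L m \<pi>. regular \<eta> c K L m (\<pi> :: real^'d => real) ==> (LBINT x. norm (x - m) ^ 2 * \<pi> x) \<le> C2"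
  using regular_central_moment[OF eta, of K 2] by blast
 obtain C3 where C3: "C3 \<ge> 0" "!!c L m \<pi>. regular \<eta> c K L m (\<pi> :: real^'d => real) ==> integrable lborel (%x. norm (x - m) ^ 3 * \<pi> x)"
  "!!c L m \<pi>. regular \<eta> c K L m (\<pi> :: real^'d => real) ==> (LBINT x. norm (x - m) ^ 3 * \<pi> x) \<le> C3"
  using regular_central_moment[OF eta, of K 3] by blast
 obtain C1 where "C1 \<ge> 0" and C1: "!!c L m \<pi>. regular \<eta> c K L m (\<pi> :: real^'d => real) ==> integrable lborel (%x. norm (x - m) ^ 1 * \<pi> x)"
  "!!c L m \<pi>. regular \<eta> c K L m (\<pi> :: real^'d => real) ==> (LBINT x. norm (x - m) ^ 1 * \<pi> x) \<le> C1"
  using regular_central_moment[OF eta, of K 1] by blast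
 show ?thesis
 proof (rule that[of "1 + C2 + C3"])
  show "1 \<le> 1 + C2 + C3" using C2(1) C3(1) by simp
  fix c L m and \<pi> :: "real^'d => real" and s assume r: "regular \<eta> c K L m \<pi>"
  interpret pdf \<pi> using r by (simp add: regular_def)
  let ?u = "%x. s \<bullet> (x - m)"
  have ic: "integrable lborel (%x. \<pi> x *\<^sub>R cis (?u x))" using q_int by (rule integrable_scaleR_cis) simp
  have iu: "integrable lborel (%x. ?u x * \<pi> x)"
  proof (rule Bochner_Integration.integrable_bound)
   show "integrable lborel (%x. norm s * (norm (x - m) ^ 1 * \<pi> x))" by (intro integrable_mult_right C1(1)[OF r])
   show "AE x in lborel. norm (?u x * \<pi> x) \<le> norm (norm s * (norm (x - m) ^ 1 * \<pi> x))"
   proof (intro AE_I2)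
    fix x
    have "\<bar>?u x\<bar> * \<pi> x \<le> (norm s * norm (x - m)) * \<pi> x" by (intro mult_right_mono Cauchy_Schwarz_ineq2 q_nonneg)
    then show "norm (?u x * \<pi> x) \<le> norm (norm s * (norm (x - m) ^ 1 * \<pi> x))" by (simp add: abs_mult q_nonneg)
   qed
  qed simp
  have u0: "(LBINT x. ?u x * \<pi> x) = 0" using r by (simp add: regular_def)
  have up: "\<bar>?u x\<bar> ^ k \<le> norm s ^ k * norm (x - m) ^ k" for x k
   unfolding power_mult_distrib[symmetric] by (intro power_mono Cauchy_Schwarz_ineq2) auto
  have eq: "\<pi> x *\<^sub>R (cis (?u x) - 1 - \<i> * ?u x) = \<pi> x *\<^sub>R cis (?u x) - complex_of_real (\<pi> x) - \<i> * complex_of_real (?u x * \<pi> x)" for x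
   by (simp add: scaleR_conv_of_real algebra_simps)
  have "cft \<pi> m s - 1 = (LBINT x. \<pi> x *\<^sub>R (cis (?u x) - 1 - \<i> * ?u x))"
   unfolding eq cft_eq using ic q_int iu by (simp add: u0 q_mass del: of_real_mult)
  also have "norm ... \<le> (LBINT x. norm (\<pi> x *\<^sub>R (cis (?u x) - 1 - \<i> * ?u x)))" by (rule integral_norm_bound)
  also have "... \<le> (LBINT x. (norm s)\<^sup>2 * (norm (x - m) ^ 2 * \<pi> x))"
  proof (rule integral_mono')
   fix x
   have "norm (\<pi> x *\<^sub>R (cis (?u x) - 1 - \<i> * ?u x)) = \<pi> x * norm (cis (?u x) - 1 - \<i> * ?u x)" by (simp add: q_nonneg)
   also have "... \<le> \<pi> x * ((?u x)\<^sup>2 / 2)" by (intro mult_left_mono norm_iexp_remainder2 q_nonneg)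
   also have "... \<le> \<pi> x * ((norm s)\<^sup>2 * norm (x - m) ^ 2)"
   proof (intro mult_left_mono q_nonneg)
    have "(?u x)\<^sup>2 / 2 \<le> (?u x)\<^sup>2" by simp
    also have "... \<le> (norm s)\<^sup>2 * norm (x - m) ^ 2" using up[of x 2] by simp
    finally show "(?u x)\<^sup>2 / 2 \<le> (norm s)\<^sup>2 * norm (x - m) ^ 2" .
   qed
   finally show "norm (\<pi> x *\<^sub>R (cis (?u x) - 1 - \<i> * ?u x)) \<le> (norm s)\<^sup>2 * (norm (x - m) ^ 2 * \<pi> x)"
    by (simp add: mult_ac)
  qed (use C2(2)[OF r] q_nonneg in auto)
  also have "... \<le> (norm s)\<^sup>2 * C2" using C2(3)[OF r] by (simp add: mult_left_mono)
  also have "... \<le> (1 + C2 + C3) * (norm s)\<^sup>2" using C3(1) by (simp add: algebra_simps)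
  finally show "norm (cft \<pi> m s - 1) \<le> (1 + C2 + C3) * (norm s)\<^sup>2" .
  have isin: "integrable lborel (%x. \<pi> x * sin (?u x))"
   using integrable_Im[OF ic] by simp
  have "Im (cft \<pi> m s) = (LBINT x. \<pi> x * sin (?u x))"
   unfolding cft_eq using integral_Im[OF ic] by simp
  also have "... = (LBINT x. \<pi> x * sin (?u x) - ?u x * \<pi> x)" using isin iu u0 by simp
  also have "\<bar>...\<bar> \<le> (LBINT x. norm s ^ 3 * (norm (x - m) ^ 3 * \<pi> x))"
  proof (rule order_trans[OF integral_abs_bound integral_mono'])
   fix x
   have "\<bar>\<pi> x * sin (?u x) - ?u x * \<pi> x\<bar> = \<pi> x * \<bar>sin (?u x) - ?u x\<bar>"
   proof -
    have "\<pi> x * sin (?u x) - ?u x * \<pi> x = \<pi> x * (sin (?u x) - ?u x)" by (simp only: right_diff_distrib mult.commute)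
    then show ?thesis by (simp only: abs_mult abs_of_nonneg[OF q_nonneg])
   qed
   also have "... \<le> \<pi> x * \<bar>?u x\<bar> ^ 3" by (intro mult_left_mono abs_sin_minus_le q_nonneg)
   also have "... \<le> \<pi> x * (norm s ^ 3 * norm (x - m) ^ 3)" by (intro mult_left_mono up q_nonneg)
   finally show "\<bar>\<pi> x * sin (?u x) - ?u x * \<pi> x\<bar> \<le> norm s ^ 3 * (norm (x - m) ^ 3 * \<pi> x)" by (simp add: mult_ac)
  qed (use C3(2)[OF r] q_nonneg in auto)
  also have "... \<le> norm s ^ 3 * C3" using C3(3)[OF r] by (simp add: mult_left_mono)
  also have "... \<le> (1 + C2 + C3) * norm s ^ 3" using C2(1) by (simp add: algebra_simps)
  finally show "\<bar>Im (cft \<pi> m s)\<bar> \<le> (1 + C2 + C3) * norm s ^ 3" .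
 qed
qed

lemma abs_Im_power_le: "\<bar>Im (z ^ n)\<bar> \<le> real n * norm z ^ (n - 1) * \<bar>Im z\<bar>"
proof (induction n)
 case (Suc n)
 have "\<bar>Im (z ^ Suc n)\<bar> \<le> \<bar>Re z\<bar> * \<bar>Im (z ^ n)\<bar> + \<bar>Im z\<bar> * \<bar>Re (z ^ n)\<bar>"
  by (simp add: abs_mult[symmetric] order_trans[OF abs_triangle_ineq])
 also have "... \<le> norm z * (real n * norm z ^ (n - 1) * \<bar>Im z\<bar>) + \<bar>Im z\<bar> * norm z ^ n"
  using Suc abs_Re_le_cmod[of z] abs_Re_le_cmod[of "z ^ n"]
  by (intro add_mono mult_mono) (auto simp: norm_power)
 also have "... = real (Suc n) * norm z ^ (Suc n - 1) * \<bar>Im z\<bar>"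
  by (cases n) (auto simp: algebra_simps)
 finally show ?case .
qed simp

lemma norm_power_diff_Re_le: "norm (z ^ n - complex_of_real (Re z ^ n)) \<le> real n * norm z ^ (n - 1) * \<bar>Im z\<bar>"
proof (induction n)
 case (Suc n)
 have eq: "z ^ Suc n - complex_of_real (Re z ^ Suc n) = z * (z ^ n - complex_of_real (Re z ^ n)) + (z - complex_of_real (Re z)) * complex_of_real (Re z ^ n)"
  by (simp add: algebra_simps)
 have zi: "z - complex_of_real (Re z) = \<i> * complex_of_real (Im z)" by (simp add: complex_eq_iff)
 have "norm (z ^ Suc n - complex_of_real (Re z ^ Suc n)) \<le> norm z * norm (z ^ n - complex_of_real (Re z ^ n)) + \<bar>Im z\<bar> * \<bar>Re z\<bar> ^ n"
  unfolding eq by (rule order_trans[OF norm_triangle_ineq]) (simp add: norm_mult zi power_abs del: of_real_power)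
 also have "... \<le> norm z * (real n * norm z ^ (n - 1) * \<bar>Im z\<bar>) + \<bar>Im z\<bar> * norm z ^ n"
  using Suc abs_Re_le_cmod[of z] by (intro add_mono mult_left_mono power_mono) auto
 also have "... = real (Suc n) * norm z ^ (Suc n - 1) * \<bar>Im z\<bar>"
  by (cases n) (auto simp: algebra_simps)
 finally show ?case .
qed simp

lemma power_le_exp:
 fixes b y :: real
 assumes "b > 0" "y \<ge> 0"
 shows "y ^ k \<le> (real (Suc k) / b) ^ k * exp (b * y)"
proof -
 have "(b * y / real (Suc k)) ^ k \<le> exp (b * y / real (Suc k)) ^ k"
  using assms exp_ge_add_one_self[of "b * y / real (Suc k)"] by (intro power_mono) (linarith, simp)
 also have "... = exp (real k * (b * y / real (Suc k)))" by (rule exp_of_nat_mult[symmetric])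
 also have "... \<le> exp (b * y)" using assms by (simp add: field_simps)
 finally have "(b * y / real (Suc k)) ^ k \<le> exp (b * y)" .
 then have "(real (Suc k) / b) ^ k * (b * y / real (Suc k)) ^ k \<le> (real (Suc k) / b) ^ k * exp (b * y)"
  using assms by (intro mult_left_mono) auto
 then show ?thesis using assms by (simp add: power_mult_distrib[symmetric] del: of_nat_Suc)
qed

lemma gauss_moment_bound:
 assumes a: "a > 0"
 obtains C where "C \<ge> 0"
  "!!n. n > 0 ==> integrable lborel (%s::'a::euclidean_space. norm s ^ k * exp (- (a * n * (norm s)\<^sup>2)))"
  "!!n. n > 0 ==> (LBINT s. norm (s::'a) ^ k * exp (- (a * n * (norm s)\<^sup>2))) \<le> C * (1 / sqrt n) ^ (DIM('a) + k)"
proof -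
 define A where "A = 1 + (real (Suc k) / (a / 2)) ^ k"
 have A: "A \<ge> 1" using a by (simp add: A_def)
 have le: "norm s ^ k * exp (- (a * n * (norm s)\<^sup>2)) \<le> A * (1 / sqrt n) ^ k * exp (- (a * n * (norm s)\<^sup>2) / 2)"
  if n: "n > 0" for n and s :: 'a
 proof -
  let ?y = "sqrt n * norm s"
  have y2: "?y\<^sup>2 = n * (norm s)\<^sup>2" using n by (simp add: power_mult_distrib)
  have b0: "?y ^ k \<le> 1 + (?y\<^sup>2) ^ k"
  proof (cases "?y \<le> 1")
   case True
   then have "?y ^ k \<le> 1" using n by (intro power_le_one) auto
   moreover have "0 \<le> (?y\<^sup>2) ^ k" by simp
   ultimately show ?thesis by linarith
  next
   case False
   then have "1 * ?y \<le> ?y * ?y" by (intro mult_right_mono) auto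
   then have "?y ^ k \<le> (?y\<^sup>2) ^ k" using n by (intro power_mono) (simp_all add: power2_eq_square)
   then show ?thesis by simp
  qed
  have b1: "(?y\<^sup>2) ^ k \<le> (real (Suc k) / (a / 2)) ^ k * exp (a / 2 * ?y\<^sup>2)"
   using a by (intro power_le_exp) auto
  have b2: "1 \<le> exp (a / 2 * ?y\<^sup>2)" using a by simp
  have b3: "?y ^ k \<le> A * exp (a / 2 * ?y\<^sup>2)" unfolding A_def distrib_right using b0 b1 b2 by linarith
  have "a / 2 * ?y\<^sup>2 + - (a * ?y\<^sup>2) = - (a * ?y\<^sup>2) / 2" by linarith
  then have e: "exp (a / 2 * ?y\<^sup>2) * exp (- (a * ?y\<^sup>2)) = exp (- (a * ?y\<^sup>2) / 2)" by (simp only: exp_add[symmetric])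
  have "?y ^ k * exp (- (a * ?y\<^sup>2)) \<le> A * exp (a / 2 * ?y\<^sup>2) * exp (- (a * ?y\<^sup>2))"
   by (rule mult_right_mono[OF b3]) simp
  then have "?y ^ k * exp (- (a * ?y\<^sup>2)) \<le> A * exp (- (a * ?y\<^sup>2) / 2)"
   unfolding mult.assoc e .
  then have "(1 / sqrt n) ^ k * (?y ^ k * exp (- (a * ?y\<^sup>2))) \<le> (1 / sqrt n) ^ k * (A * exp (- (a * ?y\<^sup>2) / 2))"
   using n by (intro mult_left_mono) auto
  moreover have "(1 / sqrt n) ^ k * ?y ^ k = norm s ^ k" using n by (simp add: power_mult_distrib[symmetric])
  ultimately have "norm s ^ k * exp (- (a * ?y\<^sup>2)) \<le> (1 / sqrt n) ^ k * (A * exp (- (a * ?y\<^sup>2) / 2))"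
   by (simp only: mult.assoc[symmetric])
  then show ?thesis unfolding y2 by (simp only: mult.assoc mult.left_commute[of A])
 qed
 define C where "C = A * sqrt (2 * pi / a) ^ DIM('a)"
 have g: "integrable lborel (%s::'a. exp (- (a * n * (norm s)\<^sup>2) / 2))"
  "(LBINT s. exp (- (a * n * (norm (s::'a))\<^sup>2) / 2)) = sqrt (2 * pi / a) ^ DIM('a) * (1 / sqrt n) ^ DIM('a)" if "n > 0" for n
  using gauss_integral[of "a * n", where 'a='a] a that
  by (simp_all add: power_mult_distrib[symmetric] real_sqrt_divide real_sqrt_mult)
 show ?thesis
 proof (rule that[of C])
  show "C \<ge> 0" using A a by (simp add: C_def)
  fix n :: real assume n: "n > 0"
  have i: "integrable lborel (%s::'a. A * (1 / sqrt n) ^ k * exp (- (a * n * (norm s)\<^sup>2) / 2))"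
   using g(1)[OF n] by (rule integrable_mult_right)
  show i2: "integrable lborel (%s::'a. norm s ^ k * exp (- (a * n * (norm s)\<^sup>2)))"
   by (rule Bochner_Integration.integrable_bound[OF i])
    (use order_trans[OF le[OF n] abs_ge_self] in \<open>auto simp: abs_mult intro!: AE_I2\<close>)
  have "(LBINT s. norm (s::'a) ^ k * exp (- (a * n * (norm s)\<^sup>2))) \<le> (LBINT s. A * (1 / sqrt n) ^ k * exp (- (a * n * (norm (s::'a))\<^sup>2) / 2))"
   by (intro integral_mono i i2 le n)
  also have "... = A * (1 / sqrt n) ^ k * (sqrt (2 * pi / a) ^ DIM('a) * (1 / sqrt n) ^ DIM('a))"
   by (simp only: integral_mult_right_zero g(2)[OF n])
  also have "... = C * (1 / sqrt n) ^ (DIM('a) + k)" by (simp add: C_def power_add mult_ac)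
  finally show "(LBINT s. norm (s::'a) ^ k * exp (- (a * n * (norm s)\<^sup>2))) \<le> C * (1 / sqrt n) ^ (DIM('a) + k)" .
 qed
qed

lemma norm_integral_le:
 fixes f :: "'a => 'b::{banach, second_countable_topology}"
 assumes "integrable M g" "!!x. norm (f x) \<le> g x"
 shows "norm (\<integral>x. f x \<partial>M) \<le> (\<integral>x. g x \<partial>M)"
proof (rule order_trans[OF integral_norm_bound integral_mono'[OF assms]])
 show "0 \<le> g x" for x using norm_ge_zero assms(2) by (rule order_trans)
qed

lemma integrable_le:
 fixes f :: "'a => 'b::{banach, second_countable_topology}"
 assumes "integrable M g" "f \<in> borel_measurable M" "!!x. norm (f x) \<le> g x"
 shows "integrable M f"
 using assms(1,2) by (rule Bochner_Integration.integrable_bound) (use order_trans[OF assms(3) abs_ge_self] in auto)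

lemma inv_sqrt_pred_le:
 assumes "(n::nat) \<ge> 2"
 shows "(1 / sqrt (real (n - 1))) ^ p \<le> sqrt 2 ^ p * (1 / sqrt (real n)) ^ p"
proof -
 have "real n \<le> 2 * real (n - 1)" using assms by linarith
 then have "sqrt (real n) \<le> sqrt 2 * sqrt (real (n - 1))" by (simp add: real_sqrt_mult[symmetric] del: real_sqrt_mult)
 then have "1 / sqrt (real (n - 1)) \<le> sqrt 2 * (1 / sqrt (real n))" using assms by (simp add: field_simps)
 then show ?thesis unfolding power_mult_distrib[symmetric] using assms by (intro power_mono) auto
qed

lemma recip_le: "0 < E ==> 0 < x ==> x \<le> R * E ==> 1 / E \<le> R * (1 / x)" for x :: real
 by (simp add: field_simps)

lemma norm_triangle4: "norm (a + b + c + d) \<le> norm a + norm b + norm c + norm d"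
 for a :: "'a::real_normed_vector"
 using norm_triangle_ineq[of "a + b + c" d] norm_triangle_ineq[of "a + b" c] norm_triangle_ineq[of a b] by linarith

lemma cft_measurable [measurable]:
 "\<pi> \<in> borel_measurable borel ==> cft \<pi> m \<in> borel_measurable borel"
 unfolding cft_def[abs_def] by (intro borel_measurable_times ft_measurable cis_measurable) auto

lemma regular_pdf: "regular \<eta> c K L m \<pi> ==> pdf \<pi>"
 by (simp add: regular_def)

lemma regular_cft_le_1: "regular \<eta> c K L m \<pi> ==> norm (cft \<pi> m s) \<le> 1"
 unfolding norm_cft by (rule pdf_ft_le_1[OF regular_pdf])

lemma regular_cft_integrable:
 assumes r: "regular \<eta> c K L m \<pi>" and n: "L \<le> n"
 shows "integrable lborel (%s. norm (cft \<pi> m s) ^ n)" "integrable lborel (%s. cft \<pi> m s ^ n)"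
proof -
 interpret pdf \<pi> by (rule regular_pdf[OF r])
 have i: "integrable lborel (%s. norm (ft \<pi> s) ^ L)" using r by (simp add: regular_def)
 show 1: "integrable lborel (%s. norm (cft \<pi> m s) ^ n)"
  unfolding norm_cft by (rule integrable_ft_power_mono(1)[OF i n])
 show "integrable lborel (%s. cft \<pi> m s ^ n)"
  by (rule Bochner_Integration.integrable_bound[OF 1]) (auto simp: norm_power)
qed

text \<open>By the gap, the power of the transform is at most a Gaussian of width \<open>1 / sqrt n\<close> on the unit ball.\<close>

lemma cft_ball_moment:
 assumes c: "c > 0"
 obtains C where "C \<ge> 0"
  "!!\<eta> K L m \<pi> (\<rho>::real) n. regular \<eta> c K L m (\<pi> :: real^'d => real) ==> \<rho> \<le> 1 ==> n \<ge> 1 ==>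
    integrable lborel (%s. indicator (cball 0 \<rho>) s * (norm s ^ k * norm (cft \<pi> m s) ^ n))"
  "!!\<eta> K L m \<pi> (\<rho>::real) n. regular \<eta> c K L m (\<pi> :: real^'d => real) ==> \<rho> \<le> 1 ==> n \<ge> 1 ==>
    (LBINT s. indicator (cball 0 \<rho>) s * (norm s ^ k * norm (cft \<pi> m s) ^ n)) \<le> C * (1 / sqrt (real n)) ^ (CARD('d) + k)"
proof -
 obtain C where C: "C \<ge> 0"
  "!!n. n > 0 ==> integrable lborel (%s::real^'d. norm s ^ k * exp (- (c * n * (norm s)\<^sup>2)))"
  "!!n. n > 0 ==> (LBINT s. norm (s::real^'d) ^ k * exp (- (c * n * (norm s)\<^sup>2))) \<le> C * (1 / sqrt n) ^ (DIM(real^'d) + k)"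
  using gauss_moment_bound[OF c, where 'a="real^'d" and k=k] by blast
 show ?thesis
 proof (rule that[of C])
  fix \<eta> K L m and \<rho> :: real and n :: nat and \<pi> :: "real^'d => real"
  assume r: "regular \<eta> c K L m \<pi>" and rho: "\<rho> \<le> 1" and n: "n \<ge> 1"
  interpret pdf \<pi> by (rule regular_pdf[OF r])
  have n0: "real n > 0" using n by simp
  have [measurable]: "cball 0 \<rho> \<in> sets (borel :: (real^'d) measure)" by simp
  have le: "indicator (cball 0 \<rho>) s * (norm s ^ k * norm (cft \<pi> m s) ^ n) \<le> norm s ^ k * exp (- (c * real n * (norm s)\<^sup>2))" for s
  proof (cases "s \<in> cball 0 \<rho>")
   case True
   then have "norm s \<le> 1" using rho by simp
   then have "(norm s)\<^sup>2 \<le> 1" by (simp add: power_le_one)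
   then have "norm (cft \<pi> m s) \<le> 1 - c * (norm s)\<^sup>2"
    using r unfolding norm_cft regular_def by (metis min.absorb2)
   also have "... \<le> exp (- (c * (norm s)\<^sup>2))" using exp_ge_add_one_self[of "- (c * (norm s)\<^sup>2)"] by simp
   finally have "norm (cft \<pi> m s) ^ n \<le> exp (- (c * (norm s)\<^sup>2)) ^ n" by (intro power_mono) auto
   also have "... = exp (- (c * real n * (norm s)\<^sup>2))" by (simp add: exp_of_nat_mult[symmetric] mult_ac)
   finally show ?thesis using True by (simp add: mult_left_mono)
  qed simp
  show "integrable lborel (%s. indicator (cball 0 \<rho>) s * (norm s ^ k * norm (cft \<pi> m s) ^ n))"
   by (rule Bochner_Integration.integrable_bound[OF C(2)[OF n0]]) (use le in \<open>auto simp: abs_mult\<close>)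
  have "(LBINT s. indicator (cball 0 \<rho>) s * (norm s ^ k * norm (cft \<pi> m s) ^ n)) \<le> (LBINT s. norm (s::real^'d) ^ k * exp (- (c * real n * (norm s)\<^sup>2)))"
   by (rule integral_mono'[OF C(2)[OF n0] le]) simp
  also have "... \<le> C * (1 / sqrt (real n)) ^ (CARD('d) + k)" using C(3)[OF n0] by simp
  finally show "(LBINT s. indicator (cball 0 \<rho>) s * (norm s ^ k * norm (cft \<pi> m s) ^ n)) \<le> C * (1 / sqrt (real n)) ^ (CARD('d) + k)" .
 qed (rule C)
qed

text \<open>Outside a ball the transform is bounded by a constant less than one, so its powers decay
  geometrically, faster than any power of \<open>n\<close>.\<close>

lemma cft_tail:
 assumes c: "c > 0" and rho: "0 < \<rho>" "\<rho> \<le> 1"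
 obtains C where "C \<ge> 0"
  "!!\<eta> m \<pi> n. regular \<eta> c K L m (\<pi> :: real^'d => real) ==> n \<ge> L ==> n \<ge> 1 ==>
    (LBINT s. indicator (- cball 0 \<rho>) s * norm (cft \<pi> m s) ^ n) \<le> C * (1 / sqrt (real n)) ^ p"
proof -
 define b where "b = c * \<rho>\<^sup>2"
 have b: "b > 0" using c rho by (simp add: b_def)
 define C where "C = \<bar>K\<bar> * (exp (b * real L) * (real (Suc p) / b) ^ p)"
 show ?thesis
 proof (rule that[of C])
  show "C \<ge> 0" using b by (simp add: C_def)
  fix \<eta> m and n :: nat and \<pi> :: "real^'d => real"
  assume r: "regular \<eta> c K L m \<pi>" and n: "n \<ge> L" "n \<ge> 1"
  interpret pdf \<pi> by (rule regular_pdf[OF r])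
  have i: "integrable lborel (%s. norm (cft \<pi> m s) ^ L)" by (rule regular_cft_integrable[OF r]) simp
  have le: "indicator (- cball 0 \<rho>) s * norm (cft \<pi> m s) ^ n \<le> exp (- b * real (n - L)) * norm (cft \<pi> m s) ^ L" for s
  proof (cases "s \<in> cball 0 \<rho>")
   case False
   then have "\<rho>\<^sup>2 \<le> (norm s)\<^sup>2" using rho by (intro power_mono) auto
   moreover have "\<rho>\<^sup>2 \<le> 1" using rho by (simp add: power_le_one)
   ultimately have "b \<le> c * min 1 ((norm s)\<^sup>2)" unfolding b_def using c by (intro mult_left_mono) auto
   then have "norm (cft \<pi> m s) \<le> 1 - b" using r unfolding norm_cft regular_def by (meson diff_left_mono order_trans)
   also have "... \<le> exp (- b)" using exp_ge_add_one_self[of "- b"] by simp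
   finally have "norm (cft \<pi> m s) ^ (n - L) \<le> exp (- b) ^ (n - L)" by (intro power_mono) auto
   also have "... = exp (- b * real (n - L))" by (simp add: exp_of_nat_mult[symmetric] mult.commute)
   finally have "norm (cft \<pi> m s) ^ (n - L) * norm (cft \<pi> m s) ^ L \<le> exp (- b * real (n - L)) * norm (cft \<pi> m s) ^ L"
    by (intro mult_right_mono) auto
   then show ?thesis using False n by (simp add: power_add[symmetric])
  qed simp
  have "(LBINT s. indicator (- cball 0 \<rho>) s * norm (cft \<pi> m s) ^ n) \<le> (LBINT s. exp (- b * real (n - L)) * norm (cft \<pi> m s) ^ L)"
   by (rule integral_mono'[OF integrable_mult_right[OF i] le]) simp
  also have "... = exp (- b * real (n - L)) * (LBINT s. norm (cft \<pi> m s) ^ L)" by (rule integral_mult_right_zero)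
  also have "... \<le> exp (- b * real (n - L)) * \<bar>K\<bar>"
   using r unfolding norm_cft regular_def by (intro mult_left_mono) auto
  also have "exp (- b * real (n - L)) = exp (b * real L) * exp (- (b * real n))"
   using n by (simp add: exp_add[symmetric] of_nat_diff algebra_simps)
  also have "exp (- (b * real n)) \<le> (real (Suc p) / b) ^ p * (1 / sqrt (real n)) ^ p"
  proof -
   have "real n ^ p \<le> (real (Suc p) / b) ^ p * exp (b * real n)" by (rule power_le_exp[OF b]) simp
   then have "exp (- (b * real n)) \<le> (real (Suc p) / b) ^ p * (1 / real n) ^ p"
    using n recip_le[of "exp (b * real n)" "real n ^ p" "(real (Suc p) / b) ^ p"]
    by (simp add: exp_minus power_one_over inverse_eq_divide del: of_nat_Suc)
   also have "... \<le> (real (Suc p) / b) ^ p * (1 / sqrt (real n)) ^ p"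
   proof (intro mult_left_mono power_mono divide_left_mono)
    have "sqrt (real n) * 1 \<le> sqrt (real n) * sqrt (real n)" using n by (intro mult_left_mono) auto
    then show "sqrt (real n) \<le> real n" by simp
   qed (use n b in auto)
   finally show ?thesis .
  qed
  finally show "(LBINT s. indicator (- cball 0 \<rho>) s * norm (cft \<pi> m s) ^ n) \<le> C * (1 / sqrt (real n)) ^ p"
   by (simp add: C_def mult_ac mult_left_mono mult_right_mono)
 qed
qed

text \<open>The ball is symmetric and \<open>s \<bullet> w\<close> is odd, so that only the odd part of the power contributes.
 This part comes from the imaginary part, which is of third order for a centred density.\<close>

lemma cft_odd_part:
 assumes r: "regular \<eta> c K L m (\<pi> :: real^'d => real)"
  and i: "integrable lborel (%s. indicator (cball 0 \<rho>) s * (norm s ^ 1 * norm (cft \<pi> m s) ^ n))"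
  and i4: "integrable lborel (%s. indicator (cball 0 \<rho>) s * (norm s ^ 4 * norm (cft \<pi> m s) ^ (n - 1)))"
  and im: "!!s. \<bar>Im (cft \<pi> m s)\<bar> \<le> C * norm s ^ 3"
 shows "norm (LBINT s. indicator (cball 0 \<rho>) s *\<^sub>R (cft \<pi> m s ^ n * complex_of_real (s \<bullet> w)))
  \<le> norm w * (real n * C * (LBINT s. indicator (cball 0 \<rho>) s * (norm s ^ 4 * norm (cft \<pi> m s) ^ (n - 1))))"
proof -
 interpret pdf \<pi> by (rule regular_pdf[OF r])
 have [measurable]: "cball 0 \<rho> \<in> sets (borel :: (real^'d) measure)" by simp
 let ?f = "%s. indicator (cball 0 \<rho>) s *\<^sub>R (cft \<pi> m s ^ n * complex_of_real (s \<bullet> w))"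
 have fi: "integrable lborel ?f"
 proof (rule Bochner_Integration.integrable_bound)
  show "integrable lborel (%s. norm w * (indicator (cball 0 \<rho>) s * (norm s ^ 1 * norm (cft \<pi> m s) ^ n)))"
   by (intro integrable_mult_right i)
  show "AE s in lborel. norm (?f s) \<le> norm (norm w * (indicator (cball 0 \<rho>) s * (norm s ^ 1 * norm (cft \<pi> m s) ^ n)))"
  proof (intro AE_I2)
   fix s
   have "norm (cft \<pi> m s) ^ n * \<bar>s \<bullet> w\<bar> \<le> norm (cft \<pi> m s) ^ n * (norm s * norm w)"
    by (intro mult_left_mono Cauchy_Schwarz_ineq2) auto
   then show "norm (?f s) \<le> norm (norm w * (indicator (cball 0 \<rho>) s * (norm s ^ 1 * norm (cft \<pi> m s) ^ n)))"
    by (cases "s \<in> cball 0 \<rho>") (auto simp: norm_mult norm_power abs_mult mult_ac)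
  qed
 qed measurable
 have "(LBINT s. ?f s) = (LBINT s. ?f (- s))" by (rule lborel_integrable_reflect(2)[OF fi, symmetric])
 also have "... = (LBINT s. - cnj (?f s))"
  by (intro Bochner_Integration.integral_cong refl) (simp add: cft_minus indicator_def)
 also have "... = - cnj (LBINT s. ?f s)"
  by (simp only: Bochner_Integration.integral_minus Bochner_Integration.integral_cnj)
 finally have "Re (LBINT s. ?f s) = Re (- cnj (LBINT s. ?f s))" by (rule arg_cong)
 then have "Re (LBINT s. ?f s) = 0" by simp
 then have "norm (LBINT s. ?f s) = \<bar>Im (LBINT s. ?f s)\<bar>" by (simp add: cmod_def)
 also have "Im (LBINT s. ?f s) = (LBINT s. Im (?f s))" by (rule integral_Im[OF fi, symmetric])
 also have "\<bar>...\<bar> \<le> (LBINT s. norm w * (real n * C * (indicator (cball 0 \<rho>) s * (norm s ^ 4 * norm (cft \<pi> m s) ^ (n - 1)))))"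
  unfolding real_norm_def[symmetric]
 proof (rule norm_integral_le)
  show "integrable lborel (%s. norm w * (real n * C * (indicator (cball 0 \<rho>) s * (norm s ^ 4 * norm (cft \<pi> m s) ^ (n - 1)))))"
   by (intro integrable_mult_right i4)
  fix s
  show "norm (Im (?f s)) \<le> norm w * (real n * C * (indicator (cball 0 \<rho>) s * (norm s ^ 4 * norm (cft \<pi> m s) ^ (n - 1))))"
  proof (cases "s \<in> cball 0 \<rho>")
   case True
   have "norm (Im (?f s)) = \<bar>Im (cft \<pi> m s ^ n)\<bar> * \<bar>s \<bullet> w\<bar>" using True by (simp add: abs_mult)
   also have "... \<le> (real n * norm (cft \<pi> m s) ^ (n - 1) * \<bar>Im (cft \<pi> m s)\<bar>) * (norm s * norm w)"
    by (intro mult_mono abs_Im_power_le Cauchy_Schwarz_ineq2) auto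
   also have "... \<le> (real n * norm (cft \<pi> m s) ^ (n - 1) * (C * norm s ^ 3)) * (norm s * norm w)"
    by (intro mult_right_mono mult_left_mono im) auto
   also have "... = norm w * (real n * C * (norm s ^ 4 * norm (cft \<pi> m s) ^ (n - 1)))"
    by (simp add: numeral_eq_Suc mult_ac)
   finally show ?thesis using True by simp
  qed simp
 qed
 also have "... = norm w * (real n * C * (LBINT s. indicator (cball 0 \<rho>) s * (norm s ^ 4 * norm (cft \<pi> m s) ^ (n - 1))))"
  by simp
 finally show ?thesis .
qed

text \<open>By Fourier inversion this integral is, up to a constant, the difference of the two densities in
  the local limit theorem. Writing \<open>cis (s \<bullet> w) - cft\<close> as a linear term plus a quadratic error,
 the linear term is odd and contributes only at the order of the error.\<close>

lemma llt_numerator: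
 assumes c: "c > 0" and eta: "\<eta> > 0"
 obtains C where "C \<ge> 0"
  "!!m \<pi> n w. regular \<eta> c K L m (\<pi> :: real^'d => real) ==> n \<ge> L ==> n \<ge> 2 ==>
    norm (LBINT s. cft \<pi> m s ^ n * (cis (s \<bullet> w) - cft \<pi> m s)) \<le> C * (1 + (norm w)\<^sup>2) * (1 / sqrt (real n)) ^ (CARD('d) + 2)"
proof -
 obtain A where A: "A \<ge> 1"
  "!!c L m \<pi> s. regular \<eta> c K L m (\<pi> :: real^'d => real) ==> norm (cft \<pi> m s - 1) \<le> A * (norm s)\<^sup>2"
  "!!c L m \<pi> s. regular \<eta> c K L m (\<pi> :: real^'d => real) ==> \<bar>Im (cft \<pi> m s)\<bar> \<le> A * norm s ^ 3"
  using cft_expansion[OF eta, of K] by blast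
 obtain C1 where C1: "C1 \<ge> 0"
  "!!\<eta> K L m \<pi> (\<rho>::real) n. regular \<eta> c K L m (\<pi> :: real^'d => real) ==> \<rho> \<le> 1 ==> n \<ge> 1 ==>
    integrable lborel (%s. indicator (cball 0 \<rho>) s * (norm s ^ 1 * norm (cft \<pi> m s) ^ n))"
  "!!\<eta> K L m \<pi> (\<rho>::real) n. regular \<eta> c K L m (\<pi> :: real^'d => real) ==> \<rho> \<le> 1 ==> n \<ge> 1 ==>
    (LBINT s. indicator (cball 0 \<rho>) s * (norm s ^ 1 * norm (cft \<pi> m s) ^ n)) \<le> C1 * (1 / sqrt (real n)) ^ (CARD('d) + 1)"
  using cft_ball_moment[OF c, where k=1 and 'd='d] by blast
 obtain C2 where C2: "C2 \<ge> 0"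
  "!!\<eta> K L m \<pi> (\<rho>::real) n. regular \<eta> c K L m (\<pi> :: real^'d => real) ==> \<rho> \<le> 1 ==> n \<ge> 1 ==>
    integrable lborel (%s. indicator (cball 0 \<rho>) s * (norm s ^ 2 * norm (cft \<pi> m s) ^ n))"
  "!!\<eta> K L m \<pi> (\<rho>::real) n. regular \<eta> c K L m (\<pi> :: real^'d => real) ==> \<rho> \<le> 1 ==> n \<ge> 1 ==>
    (LBINT s. indicator (cball 0 \<rho>) s * (norm s ^ 2 * norm (cft \<pi> m s) ^ n)) \<le> C2 * (1 / sqrt (real n)) ^ (CARD('d) + 2)"
  using cft_ball_moment[OF c, where k=2 and 'd='d] by blast
 obtain C4 where C4: "C4 \<ge> 0"
  "!!\<eta> K L m \<pi> (\<rho>::real) n. regular \<eta> c K L m (\<pi> :: real^'d => real) ==> \<rho> \<le> 1 ==> n \<ge> 1 ==>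
    integrable lborel (%s. indicator (cball 0 \<rho>) s * (norm s ^ 4 * norm (cft \<pi> m s) ^ n))"
  "!!\<eta> K L m \<pi> (\<rho>::real) n. regular \<eta> c K L m (\<pi> :: real^'d => real) ==> \<rho> \<le> 1 ==> n \<ge> 1 ==>
    (LBINT s. indicator (cball 0 \<rho>) s * (norm s ^ 4 * norm (cft \<pi> m s) ^ n)) \<le> C4 * (1 / sqrt (real n)) ^ (CARD('d) + 4)"
  using cft_ball_moment[OF c, where k=4 and 'd='d] by blast
 obtain CT where CT: "CT \<ge> 0"
  "!!\<eta> m \<pi> n. regular \<eta> c K L m (\<pi> :: real^'d => real) ==> n \<ge> L ==> n \<ge> 1 ==>
    (LBINT s. indicator (- cball 0 1) s * norm (cft \<pi> m s) ^ n) \<le> CT * (1 / sqrt (real n)) ^ (CARD('d) + 2)"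
  using cft_tail[OF c zero_less_one order_refl, where K=K and L=L and p="CARD('d) + 2" and 'd='d] by blast
 define D4 where "D4 = A * (C4 * sqrt 2 ^ (CARD('d) + 4))"
 define C where "C = C2 + D4 + A * C2 + 2 * CT"
 have D4: "D4 \<ge> 0" using A(1) C4(1) by (simp add: D4_def)
 have AC: "0 \<le> A * C2" using A(1) C2(1) by simp
 show ?thesis
 proof (rule that[of C])
  show "C \<ge> 0" using C2(1) D4 AC CT(1) by (simp add: C_def)
  fix m w and n :: nat and \<pi> :: "real^'d => real"
  assume r: "regular \<eta> c K L m \<pi>" and n: "n \<ge> L" "n \<ge> 2"
  have n1: "n \<ge> 1" "n - 1 \<ge> 1" using n by auto
  interpret pdf \<pi> by (rule regular_pdf[OF r])
  let ?ph = "cft \<pi> m" and ?B = "cball (0::real^'d) 1"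
  have [measurable]: "?B \<in> sets (borel :: (real^'d) measure)" "- ?B \<in> sets (borel :: (real^'d) measure)" by auto
  let ?nu = "(1 / sqrt (real n)) ^ (CARD('d) + 2)"
  have nu: "?nu \<ge> 0" by simp
  let ?f1 = "%s. indicator ?B s *\<^sub>R (?ph s ^ n * (cis (s \<bullet> w) - 1 - \<i> * (s \<bullet> w)))"
  let ?f2 = "%s. indicator ?B s *\<^sub>R (?ph s ^ n * complex_of_real (s \<bullet> w))"
  let ?f3 = "%s. indicator ?B s *\<^sub>R (?ph s ^ n * (1 - ?ph s))"
  let ?f4 = "%s. indicator (- ?B) s *\<^sub>R (?ph s ^ n * (cis (s \<bullet> w) - ?ph s))"
  have M2: "integrable lborel (%s. indicator ?B s * (norm s ^ 2 * norm (?ph s) ^ n))" by (rule C2(2)[OF r _ n1(1)]) simp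
  have b1: "norm (?f1 s) \<le> (norm w)\<^sup>2 * (indicator ?B s * (norm s ^ 2 * norm (?ph s) ^ n))" for s
  proof -
   have "norm (cis (s \<bullet> w) - 1 - \<i> * (s \<bullet> w)) \<le> (s \<bullet> w)\<^sup>2 / 2" by (rule norm_iexp_remainder2)
   also have "... \<le> \<bar>s \<bullet> w\<bar>\<^sup>2" by simp
   also have "... \<le> (norm s * norm w)\<^sup>2" by (intro power_mono Cauchy_Schwarz_ineq2) auto
   finally have "norm (?ph s) ^ n * norm (cis (s \<bullet> w) - 1 - \<i> * (s \<bullet> w)) \<le> norm (?ph s) ^ n * (norm s * norm w)\<^sup>2"
    by (intro mult_left_mono) auto
   then show ?thesis by (cases "s \<in> ?B") (auto simp: norm_mult norm_power power_mult_distrib mult_ac)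
  qed
  have b3: "norm (?f3 s) \<le> A * (indicator ?B s * (norm s ^ 2 * norm (?ph s) ^ n))" for s
  proof -
   have "norm (?ph s) ^ n * norm (1 - ?ph s) \<le> norm (?ph s) ^ n * (A * (norm s)\<^sup>2)"
    using A(2)[OF r, of s] by (intro mult_left_mono) (auto simp: norm_minus_commute)
   then show ?thesis by (cases "s \<in> ?B") (auto simp: norm_mult norm_power mult_ac)
  qed
  have M4: "integrable lborel (%s. 2 * (indicator (- ?B) s * norm (?ph s) ^ n))"
   using integrable_mult_indicator[OF _ regular_cft_integrable(1)[OF r n(1)], of "- ?B"] by simp
  have b4: "norm (?f4 s) \<le> 2 * (indicator (- ?B) s * norm (?ph s) ^ n)" for s
  proof -
   have "norm (cis (s \<bullet> w) - ?ph s) \<le> 2"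
    using norm_triangle_ineq4[of "cis (s \<bullet> w)" "?ph s"] regular_cft_le_1[OF r, of s] by simp
   then have "norm (?ph s) ^ n * norm (cis (s \<bullet> w) - ?ph s) \<le> norm (?ph s) ^ n * 2" by (intro mult_left_mono) auto
   then show ?thesis by (cases "s \<in> ?B") (auto simp: norm_mult norm_power mult_ac)
  qed
  have i1: "integrable lborel ?f1"
   by (rule integrable_le[OF integrable_mult_right[OF M2] _ b1]) measurable
  have i3: "integrable lborel ?f3"
   by (rule integrable_le[OF integrable_mult_right[OF M2] _ b3]) measurable
  have i4: "integrable lborel ?f4"
   by (rule integrable_le[OF M4 _ b4]) measurable
  have I1: "integrable lborel (%s. indicator ?B s * (norm s ^ 1 * norm (?ph s) ^ n))" by (rule C1(2)[OF r _ n1(1)]) simp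
  have I4: "integrable lborel (%s. indicator ?B s * (norm s ^ 4 * norm (?ph s) ^ (n - 1)))" by (rule C4(2)[OF r _ n1(2)]) simp
  have all: "integrable lborel (%s. ?ph s ^ n * (cis (s \<bullet> w) - ?ph s))"
  proof (rule Bochner_Integration.integrable_bound)
   show "integrable lborel (%s. 2 * norm (?ph s) ^ n)" by (intro integrable_mult_right regular_cft_integrable(1)[OF r n(1)])
   show "AE s in lborel. norm (?ph s ^ n * (cis (s \<bullet> w) - ?ph s)) \<le> norm (2 * norm (?ph s) ^ n)"
   proof (intro AE_I2)
    fix s
    have "norm (cis (s \<bullet> w) - ?ph s) \<le> 2"
     using norm_triangle_ineq4[of "cis (s \<bullet> w)" "?ph s"] regular_cft_le_1[OF r, of s] by simp
    then have "norm (?ph s) ^ n * norm (cis (s \<bullet> w) - ?ph s) \<le> norm (?ph s) ^ n * 2" by (intro mult_left_mono) auto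
    then show "norm (?ph s ^ n * (cis (s \<bullet> w) - ?ph s)) \<le> norm (2 * norm (?ph s) ^ n)"
     by (simp add: norm_mult norm_power)
   qed
  qed measurable
  have i2: "integrable lborel (%s. \<i> * ?f2 s)"
  proof -
   have "\<i> * ?f2 s = ?ph s ^ n * (cis (s \<bullet> w) - ?ph s) - ?f1 s - ?f3 s - ?f4 s" for s
    by (cases "s \<in> ?B") (auto simp: algebra_simps)
   then show ?thesis using all i1 i3 i4 by simp
  qed
  have "?ph s ^ n * (cis (s \<bullet> w) - ?ph s) = ?f1 s + \<i> * ?f2 s + ?f3 s + ?f4 s" for s
   by (cases "s \<in> ?B") (auto simp: algebra_simps)
  then have "(LBINT s. ?ph s ^ n * (cis (s \<bullet> w) - ?ph s)) = (LBINT s. ?f1 s + \<i> * ?f2 s + ?f3 s + ?f4 s)" by simp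
  also have "... = (LBINT s. ?f1 s) + (LBINT s. \<i> * ?f2 s) + (LBINT s. ?f3 s) + (LBINT s. ?f4 s)"
   using i1 i2 i3 i4 by (simp only: Bochner_Integration.integral_add Bochner_Integration.integrable_add)
  also have "(LBINT s. \<i> * ?f2 s) = \<i> * (LBINT s. ?f2 s)" by (rule integral_mult_right_zero)
  finally have split: "(LBINT s. ?ph s ^ n * (cis (s \<bullet> w) - ?ph s)) =
    (LBINT s. ?f1 s) + \<i> * (LBINT s. ?f2 s) + (LBINT s. ?f3 s) + (LBINT s. ?f4 s)" .
  have ni: "norm (\<i> * z) = norm z" for z :: complex by (simp add: norm_mult)
  have e1: "norm (LBINT s. ?f1 s) \<le> (norm w)\<^sup>2 * (C2 * ?nu)"
  proof -
   have "norm (LBINT s. ?f1 s) \<le> (LBINT s. (norm w)\<^sup>2 * (indicator ?B s * (norm s ^ 2 * norm (?ph s) ^ n)))"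
    by (rule norm_integral_le[OF integrable_mult_right[OF M2] b1])
   also have "... = (norm w)\<^sup>2 * (LBINT s. indicator ?B s * (norm s ^ 2 * norm (?ph s) ^ n))" by (rule integral_mult_right_zero)
   also have "... \<le> (norm w)\<^sup>2 * (C2 * ?nu)" by (intro mult_left_mono C2(3)[OF r _ n1(1)]) auto
   finally show ?thesis .
  qed
  have e3: "norm (LBINT s. ?f3 s) \<le> A * (C2 * ?nu)"
  proof -
   have "norm (LBINT s. ?f3 s) \<le> (LBINT s. A * (indicator ?B s * (norm s ^ 2 * norm (?ph s) ^ n)))"
    by (rule norm_integral_le[OF integrable_mult_right[OF M2] b3])
   also have "... = A * (LBINT s. indicator ?B s * (norm s ^ 2 * norm (?ph s) ^ n))" by (rule integral_mult_right_zero)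
   also have "... \<le> A * (C2 * ?nu)" using A(1) by (intro mult_left_mono C2(3)[OF r _ n1(1)]) auto
   finally show ?thesis .
  qed
  have e4: "norm (LBINT s. ?f4 s) \<le> 2 * (CT * ?nu)"
  proof -
   have "norm (LBINT s. ?f4 s) \<le> (LBINT s. 2 * (indicator (- ?B) s * norm (?ph s) ^ n))"
    by (rule norm_integral_le[OF M4 b4])
   also have "... = 2 * (LBINT s. indicator (- ?B) s * norm (?ph s) ^ n)" by (rule integral_mult_right_zero)
   also have "... \<le> 2 * (CT * ?nu)" by (intro mult_left_mono CT(2)[OF r n(1) n1(1)]) auto
   finally show ?thesis .
  qed
  have e2: "norm (LBINT s. ?f2 s) \<le> norm w * (D4 * ?nu)"
  proof -
   have "norm (LBINT s. ?f2 s) \<le> norm w * (real n * A * (LBINT s. indicator ?B s * (norm s ^ 4 * norm (?ph s) ^ (n - 1))))"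
    by (rule cft_odd_part[OF r I1 I4 A(3)[OF r]])
   also have "... \<le> norm w * (real n * A * (C4 * (1 / sqrt (real (n - 1))) ^ (CARD('d) + 4)))"
    using A(1) by (intro mult_left_mono C4(3)[OF r _ n1(2)]) auto
   also have "... \<le> norm w * (real n * A * (C4 * (sqrt 2 ^ (CARD('d) + 4) * (1 / sqrt (real n)) ^ (CARD('d) + 4))))"
    using A(1) C4(1) n by (intro mult_left_mono inv_sqrt_pred_le) auto
   also have "(1 / sqrt (real n)) ^ (CARD('d) + 4) = ?nu * (1 / real n)"
   proof -
    have "CARD('d) + 4 = (CARD('d) + 2) + 2" by simp
    then have "(1 / sqrt (real n)) ^ (CARD('d) + 4) = ?nu * (1 / sqrt (real n)) ^ 2"
     by (simp only: power_add[of _ "CARD('d) + 2" 2])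
    moreover have "(1 / sqrt (real n)) ^ 2 = 1 / real n" by (simp add: power_divide)
    ultimately show ?thesis by (simp only:)
   qed
   finally show ?thesis using n by (simp add: D4_def)
  qed
  have *: "norm (LBINT s. ?ph s ^ n * (cis (s \<bullet> w) - ?ph s)) \<le>
    (norm w)\<^sup>2 * (C2 * ?nu) + norm w * (D4 * ?nu) + A * (C2 * ?nu) + 2 * (CT * ?nu)"
  proof -
   have "norm (LBINT s. ?ph s ^ n * (cis (s \<bullet> w) - ?ph s)) \<le> norm (LBINT s. ?f1 s) + norm (\<i> * (LBINT s. ?f2 s))
     + norm (LBINT s. ?f3 s) + norm (LBINT s. ?f4 s)"
    unfolding split by (rule norm_triangle4)
   then show ?thesis using e1 e2 e3 e4 unfolding ni by linarith
  qed
  have w1: "norm w \<le> 1 + (norm w)\<^sup>2"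
  proof -
   have "0 \<le> (norm w - 1)\<^sup>2" by simp
   then have "2 * norm w \<le> 1 + (norm w)\<^sup>2" by (simp add: power2_eq_square algebra_simps)
   then show ?thesis using norm_ge_zero[of w] by linarith
  qed
  have "(norm w)\<^sup>2 * (C2 * ?nu) + norm w * (D4 * ?nu) + A * (C2 * ?nu) + 2 * (CT * ?nu) \<le>
    (1 + (norm w)\<^sup>2) * (C2 * ?nu) + (1 + (norm w)\<^sup>2) * (D4 * ?nu) + (1 + (norm w)\<^sup>2) * (A * (C2 * ?nu)) + (1 + (norm w)\<^sup>2) * (2 * (CT * ?nu))"
  proof (intro add_mono mult_right_mono w1)
   show "A * (C2 * ?nu) \<le> (1 + (norm w)\<^sup>2) * (A * (C2 * ?nu))"
    using mult_right_mono[of 1 "1 + (norm w)\<^sup>2" "A * (C2 * ?nu)"] A(1) C2(1) by simp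
   show "2 * (CT * ?nu) \<le> (1 + (norm w)\<^sup>2) * (2 * (CT * ?nu))"
    using mult_right_mono[of 1 "1 + (norm w)\<^sup>2" "2 * (CT * ?nu)"] CT(1) by simp
  qed (use C2(1) D4 in auto)
  also have "... = C * (1 + (norm w)\<^sup>2) * ?nu"
  proof -
   have "W * (C2 * x) + W * (D4 * x) + W * (A * (C2 * x)) + W * (2 * (CT * x)) = C * W * x" for W x
    by (simp add: C_def algebra_simps)
   then show ?thesis .
  qed
  finally show "norm (LBINT s. ?ph s ^ n * (cis (s \<bullet> w) - ?ph s)) \<le> C * (1 + (norm w)\<^sup>2) * ?nu"
   using * by linarith
 qed
qed

text \<open>Near the origin the power of the transform is close to the power of its real part. The latter is
  nonnegative there, and at least one half on a ball of radius of order \<open>1 / sqrt n\<close>, whose volume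
 gives the lower bound.\<close>

lemma llt_denominator:
 assumes c: "c > 0" and eta: "\<eta> > 0"
 obtains v N where "v > 0" "!!m \<pi> n. regular \<eta> c K L m (\<pi> :: real^'d => real) ==> n \<ge> N ==>
    v * (1 / sqrt (real n)) ^ CARD('d) \<le> Re (LBINT s. cft \<pi> m s ^ n)"
proof -
 obtain A where A: "A \<ge> 1"
  "!!c L m \<pi> s. regular \<eta> c K L m (\<pi> :: real^'d => real) ==> norm (cft \<pi> m s - 1) \<le> A * (norm s)\<^sup>2"
  "!!c L m \<pi> s. regular \<eta> c K L m (\<pi> :: real^'d => real) ==> \<bar>Im (cft \<pi> m s)\<bar> \<le> A * norm s ^ 3"
  using cft_expansion[OF eta, of K] by blast
 define \<rho> where "\<rho> = 1 / sqrt A"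
 have rho: "0 < \<rho>" "\<rho> \<le> 1" "A * \<rho>\<^sup>2 = 1" using A(1) by (auto simp: \<rho>_def power_divide)
 obtain C3 where C3: "C3 \<ge> 0"
  "!!\<eta> K L m \<pi> (\<rho>::real) n. regular \<eta> c K L m (\<pi> :: real^'d => real) ==> \<rho> \<le> 1 ==> n \<ge> 1 ==>
    integrable lborel (%s. indicator (cball 0 \<rho>) s * (norm s ^ 3 * norm (cft \<pi> m s) ^ n))"
  "!!\<eta> K L m \<pi> (\<rho>::real) n. regular \<eta> c K L m (\<pi> :: real^'d => real) ==> \<rho> \<le> 1 ==> n \<ge> 1 ==>
    (LBINT s. indicator (cball 0 \<rho>) s * (norm s ^ 3 * norm (cft \<pi> m s) ^ n)) \<le> C3 * (1 / sqrt (real n)) ^ (CARD('d) + 3)"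
  using cft_ball_moment[OF c, where k=3 and 'd='d] by blast
 obtain CT where CT: "CT \<ge> 0"
  "!!\<eta> m \<pi> n. regular \<eta> c K L m (\<pi> :: real^'d => real) ==> n \<ge> L ==> n \<ge> 1 ==>
    (LBINT s. indicator (- cball 0 \<rho>) s * norm (cft \<pi> m s) ^ n) \<le> CT * (1 / sqrt (real n)) ^ (CARD('d) + 1)"
  using cft_tail[OF c rho(1,2), where K=K and L=L and p="CARD('d) + 1" and 'd='d] by blast
 define V where "V = unit_ball_vol (real CARD('d)) * (\<rho> / sqrt 2) ^ CARD('d)"
 have V: "V > 0" unfolding V_def using rho by (intro mult_pos_pos unit_ball_vol_pos zero_less_power) auto
 define E where "E = A * (C3 * sqrt 2 ^ (CARD('d) + 3)) + CT"
 have E: "E \<ge> 0" using A(1) C3(1) CT(1) by (simp add: E_def)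
 obtain N0 :: nat where N0: "(4 * E / V)\<^sup>2 < real N0" using reals_Archimedean2 by blast
 show ?thesis
 proof (rule that[of "V / 4" "max (max L 2) N0"])
  show "V / 4 > 0" using V by simp
  fix m and n :: nat and \<pi> :: "real^'d => real"
  assume r: "regular \<eta> c K L m \<pi>" and "max (max L 2) N0 \<le> n"
  then have n: "n \<ge> L" "n \<ge> 2" "n \<ge> N0" by auto
  have n1: "n \<ge> 1" "n - 1 \<ge> 1" using n by auto
  interpret pdf \<pi> by (rule regular_pdf[OF r])
  let ?ph = "cft \<pi> m" and ?B = "cball (0::real^'d) \<rho>" and ?b = "cball (0::real^'d) (\<rho> / sqrt (2 * real n))"
  have [measurable]: "?B \<in> sets (borel :: (real^'d) measure)" "- ?B \<in> sets (borel :: (real^'d) measure)"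
   "?b \<in> sets (borel :: (real^'d) measure)" by auto
  let ?nu = "1 / sqrt (real n)"
  let ?g1 = "%s. indicator ?b s * (1/2) :: real"
  let ?g2 = "%s. real n * A * (indicator ?B s * (norm s ^ 3 * norm (?ph s) ^ (n - 1)))"
  let ?g3 = "%s. indicator (- ?B) s * norm (?ph s) ^ n"
  have bB: "s \<in> ?B" if "s \<in> ?b" for s
  proof -
   have "1 \<le> sqrt (2 * real n)" using n1 by (simp add: real_le_rsqrt)
   then have "\<rho> / sqrt (2 * real n) \<le> \<rho> / 1" using rho by (intro divide_left_mono) auto
   then show ?thesis using that by simp
  qed
  have pt: "?g1 s - ?g2 s - ?g3 s \<le> Re (?ph s ^ n)" for s
  proof (cases "s \<in> ?B")
   case False
   have "- norm (?ph s ^ n) \<le> Re (?ph s ^ n)" using abs_Re_le_cmod[of "?ph s ^ n"] by linarith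
   moreover have "s \<notin> ?b" using False bB[of s] by blast
   ultimately show ?thesis using False by (simp add: norm_power indicator_def)
  next
   case True
   have "norm (?ph s ^ n - complex_of_real (Re (?ph s) ^ n)) \<le> real n * norm (?ph s) ^ (n - 1) * \<bar>Im (?ph s)\<bar>"
    by (rule norm_power_diff_Re_le)
   also have "... \<le> real n * norm (?ph s) ^ (n - 1) * (A * norm s ^ 3)" by (intro mult_left_mono A(3)[OF r]) auto
   also have "... = ?g2 s" using True by simp
   finally have "\<bar>Re (?ph s ^ n - complex_of_real (Re (?ph s) ^ n))\<bar> \<le> ?g2 s" by (rule order_trans[OF abs_Re_le_cmod])
   then have d: "Re (?ph s) ^ n - ?g2 s \<le> Re (?ph s ^ n)" by simp
   have "\<bar>Re (?ph s - 1)\<bar> \<le> A * (norm s)\<^sup>2" by (rule order_trans[OF abs_Re_le_cmod A(2)[OF r]])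
   then have re: "1 - A * (norm s)\<^sup>2 \<le> Re (?ph s)" by simp
   have "A * (norm s)\<^sup>2 \<le> A * \<rho>\<^sup>2" using True A(1) by (intro mult_left_mono power_mono) auto
   then have re0: "0 \<le> Re (?ph s)" using re rho(3) by linarith
   have "?g1 s \<le> Re (?ph s) ^ n"
   proof (cases "s \<in> ?b")
    case b: True
    have "(norm s)\<^sup>2 \<le> (\<rho> / sqrt (2 * real n))\<^sup>2" using b by (intro power_mono) auto
    then have "A * (norm s)\<^sup>2 \<le> A * (\<rho> / sqrt (2 * real n))\<^sup>2" using A(1) by (intro mult_left_mono) auto
    also have "... = (A * \<rho>\<^sup>2) / (2 * real n)" by (simp add: power_divide)
    finally have As: "A * (norm s)\<^sup>2 \<le> 1 / (2 * real n)" using rho(3) by simp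
    have "1 + real n * (- (1 / (2 * real n))) \<le> (1 + (- (1 / (2 * real n)))) ^ n"
     using n1 by (intro Bernoulli_inequality) (simp add: field_simps)
    also have "... \<le> Re (?ph s) ^ n"
     using re As n1 by (intro power_mono) (linarith, simp add: field_simps)
    finally show ?thesis using b n1 by simp
   qed (use re0 in simp)
   then show ?thesis using d True by simp
  qed
  have i1: "integrable lborel ?g1"
   using emeasure_lborel_cball_finite[of "0::real^'d" "\<rho> / sqrt (2 * real n)"] by (intro integrable_mult_left integrable_real_indicator) auto
  have i2: "integrable lborel ?g2" by (intro integrable_mult_right C3(2)[OF r rho(2) n1(2)])
  have i3: "integrable lborel ?g3"
   using integrable_mult_indicator[OF _ regular_cft_integrable(1)[OF r n(1)], of "- ?B"] by simp
  have ip: "integrable lborel (%s. ?ph s ^ n)" by (rule regular_cft_integrable(2)[OF r n(1)])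
  have "(LBINT s. ?g1 s - ?g2 s - ?g3 s) \<le> (LBINT s. Re (?ph s ^ n))"
   by (intro integral_mono Bochner_Integration.integrable_diff i1 i2 i3 integrable_Re ip pt)
  also have "(LBINT s. ?g1 s - ?g2 s - ?g3 s) = (LBINT s. ?g1 s) - (LBINT s. ?g2 s) - (LBINT s. ?g3 s)"
   using i1 i2 i3 by (simp only: Bochner_Integration.integral_diff Bochner_Integration.integrable_diff)
  also have "(LBINT s. Re (?ph s ^ n)) = Re (LBINT s. ?ph s ^ n)" by (rule integral_Re[OF ip])
  finally have main: "(LBINT s. ?g1 s) - (LBINT s. ?g2 s) - (LBINT s. ?g3 s) \<le> Re (LBINT s. ?ph s ^ n)" .
  have e1: "(LBINT s. ?g1 s) = V / 2 * ?nu ^ CARD('d)"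
  proof -
   have "(LBINT s. ?g1 s) = measure lborel ?b * (1/2)" by simp
   also have "... = (unit_ball_vol (real CARD('d)) * (\<rho> / sqrt (2 * real n)) ^ CARD('d)) * (1/2)"
    using rho by (subst content_cball) auto
   also have "... = V / 2 * ?nu ^ CARD('d)"
   proof -
    have rr: "\<rho> / sqrt (2 * real n) = \<rho> / sqrt 2 * ?nu" by (simp add: real_sqrt_mult)
    show ?thesis unfolding rr V_def power_mult_distrib by simp
   qed
   finally show ?thesis .
  qed
  have e2: "(LBINT s. ?g2 s) \<le> A * (C3 * sqrt 2 ^ (CARD('d) + 3)) * ?nu ^ (CARD('d) + 1)"
  proof -
   have "(LBINT s. ?g2 s) = real n * A * (LBINT s. indicator ?B s * (norm s ^ 3 * norm (?ph s) ^ (n - 1)))"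
    by (rule integral_mult_right_zero)
   also have "... \<le> real n * A * (C3 * (1 / sqrt (real (n - 1))) ^ (CARD('d) + 3))"
    using A(1) by (intro mult_left_mono C3(3)[OF r rho(2) n1(2)]) auto
   also have "... \<le> real n * A * (C3 * (sqrt 2 ^ (CARD('d) + 3) * ?nu ^ (CARD('d) + 3)))"
    using A(1) C3(1) n by (intro mult_left_mono inv_sqrt_pred_le) auto
   also have "?nu ^ (CARD('d) + 3) = ?nu ^ (CARD('d) + 1) * (1 / real n)"
   proof -
    have "CARD('d) + 3 = (CARD('d) + 1) + 2" by simp
    then have "?nu ^ (CARD('d) + 3) = ?nu ^ (CARD('d) + 1) * ?nu ^ 2"
     by (simp only: power_add[of _ "CARD('d) + 1" 2])
    moreover have "?nu ^ 2 = 1 / real n" by (simp add: power_divide)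
    ultimately show ?thesis by (simp only:)
   qed
   finally show ?thesis using n1 by (simp add: mult_ac)
  qed
  have e3: "(LBINT s. ?g3 s) \<le> CT * ?nu ^ (CARD('d) + 1)" by (rule CT(2)[OF r n(1) n1(1)])
  have "V / 4 * ?nu ^ CARD('d) \<le> (V / 2 - E * ?nu) * ?nu ^ CARD('d)"
  proof (intro mult_right_mono)
   have "(4 * E / V)\<^sup>2 \<le> real n" using N0 n(3) by linarith
   then have "4 * E / V \<le> sqrt (real n)" by (rule real_le_rsqrt)
   then have "4 * E \<le> V * sqrt (real n)" using V by (simp add: field_simps)
   then have "4 * E * ?nu \<le> V" using n1 by (simp add: field_simps)
   then show "V / 4 \<le> V / 2 - E * ?nu" by linarith
  qed simp
  also have "... = V / 2 * ?nu ^ CARD('d) - A * (C3 * sqrt 2 ^ (CARD('d) + 3)) * ?nu ^ (CARD('d) + 1) - CT * ?nu ^ (CARD('d) + 1)"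
   unfolding E_def by (simp add: algebra_simps)
  also have "... \<le> Re (LBINT s. ?ph s ^ n)" using main e1 e2 e3 by linarith
  finally show "V / 4 * ?nu ^ CARD('d) \<le> Re (LBINT s. ?ph s ^ n)" .
 qed
qed

lemma sum_pdf_cft:
 fixes \<pi> :: "real^'d => real"
 assumes r: "regular \<eta> c K L m \<pi>" and n: "L + 2 \<le> n"
 shows "sum_pdf \<pi> n y = Re (LBINT s. cft \<pi> m s ^ n * cis (s \<bullet> (real n *\<^sub>R m - y))) / (2 * pi) ^ CARD('d)"
proof -
 interpret pdf \<pi> by (rule regular_pdf[OF r])
 obtain l where l: "n = Suc (Suc l)" using n by (cases n; cases "n - 1") auto
 have iL: "integrable lborel (%s. norm (ft \<pi> s) ^ L)" using r by (simp add: regular_def)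
 have i: "integrable lborel (%s. ft \<pi> s ^ Suc l)" by (rule integrable_ft_power_mono(2)[OF iL]) (use n l in simp)
 have eq: "ft \<pi> s ^ n * cis (- (s \<bullet> y)) = cft \<pi> m s ^ n * cis (s \<bullet> (real n *\<^sub>R m - y))" for s
 proof -
  have "cft \<pi> m s ^ n * cis (s \<bullet> (real n *\<^sub>R m - y)) = ft \<pi> s ^ n * (cis (- (s \<bullet> m)) ^ n * cis (s \<bullet> (real n *\<^sub>R m - y)))"
   by (simp add: cft_def power_mult_distrib)
  also have "cis (- (s \<bullet> m)) ^ n * cis (s \<bullet> (real n *\<^sub>R m - y)) = cis (- (s \<bullet> y))"
  proof -
   have p: "cis (- (s \<bullet> m)) ^ n = cis (real n * (- (s \<bullet> m)))" by (rule Complex.DeMoivre)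
   have a: "real n * (- (s \<bullet> m)) + s \<bullet> (real n *\<^sub>R m - y) = - (s \<bullet> y)" by (simp add: inner_diff_right)
   show ?thesis unfolding p cis_mult a by (rule refl)
  qed
  finally show ?thesis by simp
 qed
 show ?thesis
  using sum_pdf_inversion[OF i, of y] unfolding l[symmetric] ift_def eq by simp
qed

text \<open>Conditioning on the sum changes the law of one summand by this ratio. Its relative deviation
  from one is of order \<open>1 / n\<close> in the mean square, and not merely \<open>1 / sqrt n\<close>, because the
 conditioning point is the mean. Squares are summable, which is what makes the product
 of these ratios along a path close to one.\<close>

lemma local_limit:
 assumes c: "c > 0" and eta: "\<eta> > 0"
 obtains C N where "C \<ge> 0"
  "!!m \<pi> n. regular \<eta> c K L m (\<pi> :: real^'d => real) ==> n \<ge> N ==> 0 < sum_pdf \<pi> (Suc n) (real (Suc n) *\<^sub>R m)"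
  "!!m \<pi> n. regular \<eta> c K L m (\<pi> :: real^'d => real) ==> n \<ge> N ==>
    integrable lborel (%x. \<pi> x * (sum_pdf \<pi> n (real (Suc n) *\<^sub>R m - x) / sum_pdf \<pi> (Suc n) (real (Suc n) *\<^sub>R m) - 1)\<^sup>2)"
  "!!m \<pi> n. regular \<eta> c K L m (\<pi> :: real^'d => real) ==> n \<ge> N ==>
    (LBINT x. \<pi> x * (sum_pdf \<pi> n (real (Suc n) *\<^sub>R m - x) / sum_pdf \<pi> (Suc n) (real (Suc n) *\<^sub>R m) - 1)\<^sup>2) \<le> C / (real n)\<^sup>2"
proof -
 obtain A where A: "A \<ge> 0"
  "!!m \<pi> n w. regular \<eta> c K L m (\<pi> :: real^'d => real) ==> n \<ge> L ==> n \<ge> 2 ==>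
    norm (LBINT s. cft \<pi> m s ^ n * (cis (s \<bullet> w) - cft \<pi> m s)) \<le> A * (1 + (norm w)\<^sup>2) * (1 / sqrt (real n)) ^ (CARD('d) + 2)"
  using llt_numerator[OF c eta, where K=K and L=L and 'd='d] by blast
 obtain v N0 where v: "v > 0" "!!m \<pi> n. regular \<eta> c K L m (\<pi> :: real^'d => real) ==> n \<ge> N0 ==>
    v * (1 / sqrt (real n)) ^ CARD('d) \<le> Re (LBINT s. cft \<pi> m s ^ n)"
  using llt_denominator[OF c eta, where K=K and L=L and 'd='d] by blast
 obtain M2 where M2: "M2 \<ge> 0" "!!c L m \<pi>. regular \<eta> c K L m (\<pi> :: real^'d => real) ==> integrable lborel (%x. norm (x - m) ^ 4 * \<pi> x)"
  "!!c L m \<pi>. regular \<eta> c K L m (\<pi> :: real^'d => real) ==> (LBINT x. norm (x - m) ^ 4 * \<pi> x) \<le> M2"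
  using regular_central_moment[OF eta, where K=K and k=4 and 'd='d] by blast
 define B where "B = A * sqrt 2 ^ CARD('d) / v"
 have B: "B \<ge> 0" using A(1) v(1) by (simp add: B_def)
 show ?thesis
 proof (rule that[of "B\<^sup>2 * (2 + 2 * M2)" "max (L + 2) N0"])
  show "0 \<le> B\<^sup>2 * (2 + 2 * M2)" using M2(1) by simp
  fix m and n :: nat and \<pi> :: "real^'d => real"
  assume r: "regular \<eta> c K L m \<pi>" and "max (L + 2) N0 \<le> n"
  then have n: "n \<ge> L" "n \<ge> 2" "n \<ge> N0" "L + 2 \<le> n" "L + 2 \<le> Suc n" "N0 \<le> Suc n" by auto
  interpret pdf \<pi> by (rule regular_pdf[OF r])
  let ?D = "(2 * pi) ^ CARD('d) :: real"
  let ?Z = "Re (LBINT s. cft \<pi> m s ^ Suc n)"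
  let ?u = "%x. sum_pdf \<pi> n (real (Suc n) *\<^sub>R m - x) / sum_pdf \<pi> (Suc n) (real (Suc n) *\<^sub>R m)"
  have Zlow: "v * (1 / sqrt (real (Suc n))) ^ CARD('d) \<le> ?Z" by (rule v(2)[OF r n(6)])
  have "0 < v * (1 / sqrt (real (Suc n))) ^ CARD('d)" using v(1) by simp
  then have Z: "?Z > 0" using Zlow by (rule less_le_trans)
  have S: "sum_pdf \<pi> (Suc n) (real (Suc n) *\<^sub>R m) = ?Z / ?D"
   unfolding sum_pdf_cft[OF r n(5)] by simp
  then show "0 < sum_pdf \<pi> (Suc n) (real (Suc n) *\<^sub>R m)" using Z by simp
  have U: "sum_pdf \<pi> n (real (Suc n) *\<^sub>R m - x) = Re (LBINT s. cft \<pi> m s ^ n * cis (s \<bullet> (x - m))) / ?D" for x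
  proof -
   have h: "real n *\<^sub>R m - (real (Suc n) *\<^sub>R m - x) = x - m" by (simp add: scaleR_add_left)
   show ?thesis unfolding sum_pdf_cft[OF r n(4)] h by (rule refl)
  qed
  have ratio: "(1 / sqrt (real n)) ^ CARD('d) \<le> sqrt 2 ^ CARD('d) * (1 / sqrt (real (Suc n))) ^ CARD('d)"
   using inv_sqrt_pred_le[of "Suc n"] n by simp
  have pt: "\<bar>?u x - 1\<bar> \<le> B / real n * (1 + (norm (x - m))\<^sup>2)" for x
  proof -
   have ic: "integrable lborel (%s. cft \<pi> m s ^ n * cis (s \<bullet> (x - m)))"
    by (rule integrable_le[OF regular_cft_integrable(1)[OF r n(1)]]) (auto simp: norm_mult norm_power)
   have ip: "integrable lborel (%s. cft \<pi> m s ^ Suc n)" by (rule regular_cft_integrable(2)[OF r]) (use n in simp)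
   have d1: "?u x - 1 = (Re (LBINT s. cft \<pi> m s ^ n * cis (s \<bullet> (x - m))) - ?Z) / ?Z"
    unfolding U S using Z by (simp add: diff_divide_distrib)
   have d2: "Re (LBINT s. cft \<pi> m s ^ n * cis (s \<bullet> (x - m))) - ?Z = Re (LBINT s. cft \<pi> m s ^ n * (cis (s \<bullet> (x - m)) - cft \<pi> m s))"
    using Bochner_Integration.integral_diff[OF ic ip] by (simp add: right_diff_distrib mult.commute)
   have "\<bar>?u x - 1\<bar> \<le> norm (LBINT s. cft \<pi> m s ^ n * (cis (s \<bullet> (x - m)) - cft \<pi> m s)) / ?Z"
    unfolding d1 d2 abs_divide using Z by (simp only: abs_of_pos) (intro divide_right_mono abs_Re_le_cmod, simp)
   also have "... \<le> (A * (1 + (norm (x - m))\<^sup>2) * (1 / sqrt (real n)) ^ (CARD('d) + 2)) / ?Z"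
    using Z by (intro divide_right_mono A(2)[OF r n(1,2)]) auto
   also have "... \<le> (A * (1 + (norm (x - m))\<^sup>2) * (1 / sqrt (real n)) ^ (CARD('d) + 2)) / (v * (1 / sqrt (real (Suc n))) ^ CARD('d))"
    using v(1) Z A(1) by (intro divide_left_mono Zlow mult_pos_pos) auto
   also have "(1 / sqrt (real n)) ^ (CARD('d) + 2) = (1 / sqrt (real n)) ^ CARD('d) * (1 / real n)"
    by (simp only: power_add) (simp add: power_divide)
   also have "(A * (1 + (norm (x - m))\<^sup>2) * ((1 / sqrt (real n)) ^ CARD('d) * (1 / real n))) / (v * (1 / sqrt (real (Suc n))) ^ CARD('d)) \<le>
     (A * (1 + (norm (x - m))\<^sup>2) * ((sqrt 2 ^ CARD('d) * (1 / sqrt (real (Suc n))) ^ CARD('d)) * (1 / real n))) / (v * (1 / sqrt (real (Suc n))) ^ CARD('d))"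
    using v(1) A(1) by (intro divide_right_mono mult_left_mono mult_right_mono ratio) auto
   also have "... = B / real n * (1 + (norm (x - m))\<^sup>2)"
    unfolding B_def by (simp add: power_divide mult_ac del: of_nat_Suc)
   finally show ?thesis .
  qed
  have pt2: "\<pi> x * (?u x - 1)\<^sup>2 \<le> (B / real n)\<^sup>2 * (2 * \<pi> x + 2 * (norm (x - m) ^ 4 * \<pi> x))" for x
  proof -
   have "(?u x - 1)\<^sup>2 \<le> (B / real n * (1 + (norm (x - m))\<^sup>2))\<^sup>2"
    using pt[of x] by (metis abs_ge_zero power2_abs power_mono)
   also have "... \<le> (B / real n)\<^sup>2 * (2 + 2 * norm (x - m) ^ 4)"
   proof -
    have "0 \<le> (1 - (norm (x - m))\<^sup>2)\<^sup>2" by simp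
    then have "(1 + (norm (x - m))\<^sup>2)\<^sup>2 \<le> 2 + 2 * norm (x - m) ^ 4"
     by (simp add: power2_eq_square power4_eq_xxxx algebra_simps)
    then show ?thesis unfolding power_mult_distrib by (intro mult_left_mono) auto
   qed
   finally have "\<pi> x * (?u x - 1)\<^sup>2 \<le> \<pi> x * ((B / real n)\<^sup>2 * (2 + 2 * norm (x - m) ^ 4))" by (rule mult_left_mono[OF _ q_nonneg])
   then show ?thesis by (simp add: algebra_simps)
  qed
  have ib: "integrable lborel (%x. (B / real n)\<^sup>2 * (2 * \<pi> x + 2 * (norm (x - m) ^ 4 * \<pi> x)))"
   using M2(2)[OF r] q_int by (intro integrable_mult_right Bochner_Integration.integrable_add) auto
  have sm: "sum_pdf \<pi> n \<in> borel_measurable borel" by (rule sum_pdf_measurable) simp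
  show "integrable lborel (%x. \<pi> x * (?u x - 1)\<^sup>2)"
  proof (rule integrable_le[OF ib])
   note sm[measurable]
   show "(%x. \<pi> x * (?u x - 1)\<^sup>2) \<in> borel_measurable lborel" by measurable
   show "norm (\<pi> x * (?u x - 1)\<^sup>2) \<le> (B / real n)\<^sup>2 * (2 * \<pi> x + 2 * (norm (x - m) ^ 4 * \<pi> x))" for x
    using pt2[of x] by (simp only: real_norm_def abs_mult abs_of_nonneg[OF q_nonneg] abs_power2)
  qed
  have "(LBINT x. \<pi> x * (?u x - 1)\<^sup>2) \<le> (LBINT x. (B / real n)\<^sup>2 * (2 * \<pi> x + 2 * (norm (x - m) ^ 4 * \<pi> x)))"
   by (rule integral_mono'[OF ib pt2]) (use q_nonneg in auto)
  also have "... = (B / real n)\<^sup>2 * (2 + 2 * (LBINT x. norm (x - m) ^ 4 * \<pi> x))"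
   using M2(2)[OF r] q_int by (simp add: q_mass)
  also have "... \<le> (B / real n)\<^sup>2 * (2 + 2 * M2)" using M2(3)[OF r] by (intro mult_left_mono) auto
  also have "... = B\<^sup>2 * (2 + 2 * M2) / (real n)\<^sup>2" by (simp add: power_divide)
  finally show "(LBINT x. \<pi> x * (?u x - 1)\<^sup>2) \<le> B\<^sup>2 * (2 + 2 * M2) / (real n)\<^sup>2" .
 qed
qed

section \<open>The approximating kernel\<close>

lemma matrix_inv_both:
 fixes A :: "real^'n^'n"
 assumes "invertible A"
 shows "A ** matrix_inv A = mat 1" "matrix_inv A ** A = mat 1"
 using someI_ex[OF assms[unfolded invertible_def]] unfolding matrix_inv_def by auto

lemma matrix_inv_eqI:
 fixes A B :: "real^'n^'n"
 assumes "A ** B = mat 1" "B ** A = mat 1"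
 shows "matrix_inv A = B"
proof -
 have "invertible A" using assms unfolding invertible_def by blast
 then have "matrix_inv A ** A = mat 1" by (rule matrix_inv_both)
 then have "matrix_inv A ** A ** B = B" by simp
 then show ?thesis using assms by (simp add: matrix_mul_assoc[symmetric])
qed

lemma pos_def_invertible:
 fixes A :: "real^'n^'n"
 assumes "!!v. v \<noteq> 0 ==> 0 < v \<bullet> (A *v v)"
 shows "invertible A"
proof -
 have "\<forall>x. A *v x = 0 \<longrightarrow> x = 0" using assms by (metis inner_zero_right less_irrefl)
 then show ?thesis unfolding invertible_left_inverse matrix_left_invertible_ker .
qed

lemma symmetric_dot:
 fixes A :: "real^'n^'n"
 assumes "transpose A = A"
 shows "(A *v x) \<bullet> y = x \<bullet> (A *v y)"
 by (metis assms dot_lmul_matrix transpose_matrix_vector)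

lemma matrix_inv_scaleR:
 fixes A :: "real^'n^'n"
 assumes "invertible A" "c \<noteq> 0"
 shows "matrix_inv (c *\<^sub>R A) = (1 / c) *\<^sub>R matrix_inv A" "invertible (c *\<^sub>R A)"
proof -
 have 1: "(c *\<^sub>R A) ** ((1 / c) *\<^sub>R matrix_inv A) = mat 1"
  using assms by (simp add: matrix_scalar_ac scalar_matrix_assoc[symmetric] matrix_inv_both)
 have 2: "((1 / c) *\<^sub>R matrix_inv A) ** (c *\<^sub>R A) = mat 1"
  using assms by (simp add: matrix_scalar_ac scalar_matrix_assoc[symmetric] matrix_inv_both)
 show "matrix_inv (c *\<^sub>R A) = (1 / c) *\<^sub>R matrix_inv A" using 1 2 by (rule matrix_inv_eqI)
 show "invertible (c *\<^sub>R A)" using 1 2 unfolding invertible_def by blast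
qed

text \<open>Completing the square: up to a constant factor, the normal density with covariance \<open>N \<kappa>\<close>
 that the kernel uses is a small perturbation of an exponential weight.\<close>

lemma mvn_density_complete_square:
 fixes \<kappa> :: "real^'n^'n"
 assumes sym: "transpose \<kappa> = \<kappa>" and pd: "!!v. v \<noteq> 0 ==> 0 < v \<bullet> (\<kappa> *v v)" and N: "N > 0"
 defines "\<beta> \<equiv> N *\<^sub>R \<kappa>"
 obtains k B where "k \<noteq> 0" "!!z. mvn_density (\<beta> *v \<alpha> + a) \<beta> z = k * exp (\<alpha> \<bullet> (z - a) - ((z - a) \<bullet> (matrix_inv \<kappa> *v (z - a))) / (2 * N))"
  "!!z. exp (\<alpha> \<bullet> (z - a) - ((z - a) \<bullet> (matrix_inv \<kappa> *v (z - a))) / (2 * N)) \<le> B"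
proof -
 have inv: "invertible \<kappa>" by (rule pos_def_invertible[OF pd])
 have bi: "matrix_inv \<beta> = (1 / N) *\<^sub>R matrix_inv \<kappa>" and binv: "invertible \<beta>"
  unfolding \<beta>_def using matrix_inv_scaleR[OF inv, of N] N by auto
 have bsym: "transpose \<beta> = \<beta>" unfolding \<beta>_def by (simp add: transpose_scalar sym)
 have bb: "\<beta> *v (matrix_inv \<beta> *v x) = x" "matrix_inv \<beta> *v (\<beta> *v x) = x" for x
  using matrix_inv_both[OF binv] by (simp_all add: matrix_vector_mul_assoc)
 let ?Q = "%w. w \<bullet> (matrix_inv \<beta> *v w)"
 have Qk: "?Q w = (w \<bullet> (matrix_inv \<kappa> *v w)) / N" for w
  unfolding bi by (simp add: scaleR_matrix_vector_assoc[symmetric])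
 have ex: "?Q (z - (\<beta> *v \<alpha> + a)) = ?Q (z - a) - 2 * (\<alpha> \<bullet> (z - a)) + \<alpha> \<bullet> (\<beta> *v \<alpha>)" for z
 proof -
  let ?w = "z - a"
  have "z - (\<beta> *v \<alpha> + a) = ?w - \<beta> *v \<alpha>" by simp
  moreover have "?Q (?w - \<beta> *v \<alpha>) = ?Q ?w - ?w \<bullet> \<alpha> - (\<beta> *v \<alpha>) \<bullet> (matrix_inv \<beta> *v ?w) + (\<beta> *v \<alpha>) \<bullet> \<alpha>"
   by (simp add: matrix_vector_mult_diff_distrib inner_diff_left inner_diff_right bb)
  moreover have "(\<beta> *v \<alpha>) \<bullet> (matrix_inv \<beta> *v ?w) = \<alpha> \<bullet> ?w"
   unfolding symmetric_dot[OF bsym] bb ..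
  ultimately show ?thesis by (simp only: inner_commute[of ?w \<alpha>] inner_commute[of "\<beta> *v \<alpha>" \<alpha>])
 qed
 have Q0: "0 \<le> ?Q w" for w
 proof -
  have "?Q w = (\<beta> *v (matrix_inv \<beta> *v w)) \<bullet> (matrix_inv \<beta> *v w)" by (simp add: bb)
  also have "... = N * ((matrix_inv \<beta> *v w) \<bullet> (\<kappa> *v (matrix_inv \<beta> *v w)))"
   unfolding \<beta>_def by (simp add: scaleR_matrix_vector_assoc[symmetric] inner_commute)
  also have "... \<ge> 0" using pd[of "matrix_inv \<beta> *v w"] N by (cases "matrix_inv \<beta> *v w = 0") auto
  finally show ?thesis .
 qed
 let ?X = "%z. \<alpha> \<bullet> (z - a) - ((z - a) \<bullet> (matrix_inv \<kappa> *v (z - a))) / (2 * N)"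
 have X: "- ?Q (z - (\<beta> *v \<alpha> + a)) / 2 = ?X z - (\<alpha> \<bullet> (\<beta> *v \<alpha>)) / 2" for z
 proof -
  have "- ?Q (z - (\<beta> *v \<alpha> + a)) / 2 = - (?Q (z - a) - 2 * (\<alpha> \<bullet> (z - a)) + \<alpha> \<bullet> (\<beta> *v \<alpha>)) / 2" by (simp only: ex)
  also have "... = ?X z - (\<alpha> \<bullet> (\<beta> *v \<alpha>)) / 2" unfolding Qk by (simp add: field_simps)
  finally show ?thesis .
 qed
 let ?s = "sqrt ((2 * pi) ^ CARD('n) * det \<beta>)"
 have s: "?s \<noteq> 0" using binv by (simp add: invertible_det_nz)
 show ?thesis
 proof (rule that[of "exp (- (\<alpha> \<bullet> (\<beta> *v \<alpha>)) / 2) / ?s" "exp ((\<alpha> \<bullet> (\<beta> *v \<alpha>)) / 2)"])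
  show "exp (- (\<alpha> \<bullet> (\<beta> *v \<alpha>)) / 2) / ?s \<noteq> 0" using s by simp
  fix z
  have "mvn_density (\<beta> *v \<alpha> + a) \<beta> z = exp (?X z - (\<alpha> \<bullet> (\<beta> *v \<alpha>)) / 2) / ?s"
   unfolding mvn_density_def X ..
  also have "exp (?X z - (\<alpha> \<bullet> (\<beta> *v \<alpha>)) / 2) = exp (- (\<alpha> \<bullet> (\<beta> *v \<alpha>)) / 2) * exp (?X z)"
   by (simp add: exp_add[symmetric])
  finally show "mvn_density (\<beta> *v \<alpha> + a) \<beta> z = exp (- (\<alpha> \<bullet> (\<beta> *v \<alpha>)) / 2) / ?s * exp (?X z)" by simp
  have "?X z \<le> (\<alpha> \<bullet> (\<beta> *v \<alpha>)) / 2" using X[of z] Q0[of "z - (\<beta> *v \<alpha> + a)"] by linarith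
  then show "exp (?X z) \<le> exp ((\<alpha> \<bullet> (\<beta> *v \<alpha>)) / 2)" by simp
 qed
qed

definition gam :: "(real^'d => real) => real^'d => real^'d" where
 "gam q t = (\<chi> l. \<Sum>j\<in>UNIV. cumulant3 (tl q t) j j l)"

text \<open>The exponent left of the normal density after completing the square, relative to the tilted density.\<close>

definition gexp :: "(real^'d => real) => real^'d => real => real^'d => real^'d => real" where
 "gexp q t N a z = (let \<iota> = matrix_inv (cumulant2 (tl q t)) in
   ((1 / (2 * N)) *\<^sub>R ((\<iota> ** \<iota>) *v gam q t)) \<bullet> (z - a) - ((z - a) \<bullet> (\<iota> *v (z - a))) / (2 * N))"

definition gden :: "(real^'d => real) => real^'d => real => real^'d => real" where
 "gden q t N a = (LBINT z. exp (gexp q t N a z) * tl q t z)"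

context pdf
begin

lemma cumulant2_pos_def:
 assumes t: "t \<in> interior (mgf_dom q)" and v: "v \<noteq> 0"
 shows "0 < v \<bullet> (cumulant2 (tl q t) *v v)"
proof -
 interpret T: pdf "tl q t" by (rule pdf_tl[OF interior_dom_dom[OF t]])
 have "subexp (%x. (v \<bullet> x + - (v \<bullet> mean_fun q t))\<^sup>2)"
  by (intro subexp_power subexp_add subexp_inner subexp_const)
 then have i: "integrable lborel (%x. (v \<bullet> (x - mean_fun q t))\<^sup>2 * tl q t x)"
  using tl_integrable[OF t] by (simp add: inner_diff_right)
 show ?thesis
  unfolding cumulant2_quadratic[OF t]
 proof (rule integral_pos_AE[OF T.q_nonneg _ _ _ i])
  show "AE x in lborel. 0 < (v \<bullet> (x - mean_fun q t))\<^sup>2"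
   using AE_not_hyperplane[OF v, of "v \<bullet> mean_fun q t"]
   by eventually_elim (simp add: inner_diff_right)
 qed (simp_all add: T.q_mass)
qed

text \<open>The linear part of the exponent of the normal density contains \<open>tilt q m \<bullet> x\<close>, which turns \<open>q\<close>
 into the tilted density; the remaining factor is a perturbation of order \<open>1 / N\<close>.\<close>

lemma g_kernel_props:
 assumes t: "tilt q (m_val n a y i) \<in> interior (mgf_dom q)" and N: "N > 0" "N = real n - real i - 1"
 defines "t \<equiv> tilt q (m_val n a y i)"
 shows "g_kernel q n a y i x = exp (gexp q t N a x) * tl q t x / gden q t N a"
  and "integrable lborel (%z. exp (gexp q t N a z) * tl q t z)"
  and "0 < gden q t N a"
proof -
 have t': "t \<in> interior (mgf_dom q)" using t by (simp add: t_def)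
 interpret T: pdf "tl q t" by (rule pdf_tl[OF interior_dom_dom[OF t']])
 have mp: "mgf q t > 0" by (rule mgf_pos[OF interior_dom_dom[OF t']])
 let ?ka = "cumulant2 (tl q t)"
 let ?i = "matrix_inv ?ka"
 let ?th = "(1 / (2 * N)) *\<^sub>R ((?i ** ?i) *v gam q t)"
 let ?al = "t + ?th"
 let ?be = "N *\<^sub>R ?ka"
 let ?X = "%z. ?al \<bullet> (z - a) - ((z - a) \<bullet> (?i *v (z - a))) / (2 * N)"
 obtain k B where k: "k \<noteq> 0" and mv: "!!z. mvn_density (?be *v ?al + a) ?be z = k * exp (?X z)"
  and B: "!!z. exp (?X z) \<le> B"
  using mvn_density_complete_square[OF cumulant2_symmetric[OF t'] cumulant2_pos_def[OF t'] N(1), of ?al a] by blast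
 have eX: "exp (?X z) * q z = (mgf q t * exp (- (t \<bullet> a))) * (exp (gexp q t N a z) * tl q t z)" for z
 proof -
  have "?X z = (t \<bullet> z) + (- (t \<bullet> a)) + gexp q t N a z"
   unfolding gexp_def Let_def by (simp add: inner_add_left inner_diff_right)
  then have "exp (?X z) = exp (t \<bullet> z) * exp (- (t \<bullet> a)) * exp (gexp q t N a z)" by (simp only: exp_add)
  then show ?thesis using mp by (simp add: tl_def)
 qed
 have [measurable]: "(*v) ?i \<in> borel_measurable borel"
  by (intro borel_measurable_continuous_onI linear_continuous_on matrix_vector_mul_bounded_linear)
 have iX: "integrable lborel (%z. exp (?X z) * q z)"
  by (rule integrable_le[of _ "%z. B * q z"]) (use q_int B q_nonneg in \<open>auto simp: abs_mult intro!: mult_right_mono\<close>)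
 have c0: "mgf q t * exp (- (t \<bullet> a)) \<noteq> 0" using mp by simp
 show i: "integrable lborel (%z. exp (gexp q t N a z) * tl q t z)"
 proof -
  have "exp (gexp q t N a z) * tl q t z = (1 / (mgf q t * exp (- (t \<bullet> a)))) * (exp (?X z) * q z)" for z
   unfolding eX using c0 by simp
  then show ?thesis using integrable_mult_right[OF iX, of "1 / (mgf q t * exp (- (t \<bullet> a)))"] by (simp only:)
 qed
 show "0 < gden q t N a" unfolding gden_def
  by (rule integral_pos_AE[OF T.q_nonneg _ _ _ i]) (auto simp: T.q_mass)
 have h: "mvn_density (?be *v ?al + a) ?be z * q z = (k * (mgf q t * exp (- (t \<bullet> a)))) * (exp (gexp q t N a z) * tl q t z)" for z
  unfolding mv mult.assoc eX by simp
 have int: "(LBINT z. mvn_density (?be *v ?al + a) ?be z * q z) = (k * (mgf q t * exp (- (t \<bullet> a)))) * gden q t N a"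
  unfolding h gden_def by (rule integral_mult_right_zero)
 have "g_kernel q n a y i x = 1 / (LBINT z. mvn_density (?be *v ?al + a) ?be z * q z) * (mvn_density (?be *v ?al + a) ?be x * q x)"
  unfolding g_kernel_def Let_def tilted_eq_tl t_def[symmetric] gam_def[symmetric] N(2)[symmetric] by (rule refl)
 also have "... = exp (gexp q t N a x) * tl q t x / gden q t N a"
  unfolding int unfolding h using k c0 by (simp add: field_simps)
 finally show "g_kernel q n a y i x = exp (gexp q t N a x) * tl q t x / gden q t N a" .
qed

lemma ev_abs_le:
 assumes t: "t \<in> interior (mgf_dom q)" and F: "subexp F" and le: "!!x. \<bar>F x\<bar> \<le> norm x ^ k"
  and M: "(LBINT x. norm x ^ k * tl q t x) \<le> M"
 shows "\<bar>ev t F\<bar> \<le> M"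
proof -
 interpret T: pdf "tl q t" by (rule pdf_tl[OF interior_dom_dom[OF t]])
 have "\<bar>ev t F\<bar> \<le> (LBINT x. norm x ^ k * tl q t x)"
  unfolding ev_eq real_norm_def[symmetric]
  by (rule norm_integral_le[OF tl_integrable[OF t subexp_power[OF subexp_norm]]])
   (use le T.q_nonneg in \<open>auto simp: abs_mult intro!: mult_right_mono\<close>)
 with M show ?thesis by simp
qed

lemma gam_bounded:
 assumes t: "t \<in> interior (mgf_dom q)" and M: "!!k. k \<le> 3 ==> (LBINT x. norm x ^ k * tl q t x) \<le> M" and M1: "M \<ge> 1"
 shows "norm (gam q t) \<le> real CARD('d) * (real CARD('d) * (M + 3 * M * M + 2 * M * (M + M * M)))"
proof -
 have c: "\<bar>x $ j\<bar> \<le> norm x" for x :: "real^'d" and j by (rule component_le_norm_cart)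
 have e1: "\<bar>ev t (%x. x $ j)\<bar> \<le> M" for j
  by (rule ev_abs_le[OF t subexp_component _ M, of j 1]) (use c in auto)
 have c2: "\<bar>x $ j * x $ l\<bar> \<le> norm x ^ 2" for x :: "real^'d" and j l
  unfolding abs_mult power2_eq_square by (intro mult_mono c) auto
 have e2: "\<bar>ev t (%x. x $ j * x $ l)\<bar> \<le> M" for j l
  by (rule ev_abs_le[OF t _ c2 M]) (auto intro!: subexp_mult subexp_component)
 have c3: "\<bar>x $ j * x $ l * x $ m\<bar> \<le> norm x ^ 3" for x :: "real^'d" and j l m
 proof -
  have "\<bar>x $ j * x $ l\<bar> * \<bar>x $ m\<bar> \<le> norm x ^ 2 * norm x" by (intro mult_mono c c2) auto
  then show ?thesis unfolding abs_mult[symmetric] by (simp add: numeral_eq_Suc mult_ac)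
 qed
 have e3: "\<bar>ev t (%x. x $ j * x $ l * x $ m)\<bar> \<le> M" for j l m
  by (rule ev_abs_le[OF t _ c3 M]) (auto intro!: subexp_mult subexp_component)
 have p: "\<bar>u * v\<bar> \<le> M * M" if "\<bar>u\<bar> \<le> M" "\<bar>v\<bar> \<le> M" for u v :: real
  unfolding abs_mult using that M1 by (intro mult_mono) auto
 have cum: "\<bar>cumulant3 (tl q t) j l m\<bar> \<le> M + 3 * M * M + 2 * M * (M + M * M)" for j l m
 proof -
  let ?a = "ev t (%x. x $ m * x $ l * x $ j)" and ?b = "ev t (%x. x $ m * x $ l) * ev t (%x. x $ j)"
  let ?c = "ev t (%x. x $ m * x $ j) * ev t (%x. x $ l)" and ?d = "ev t (%x. x $ m) * ev t (%x. x $ l * x $ j)"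
  let ?f = "ev t (%x. x $ m * x $ l) - ev t (%x. x $ m) * ev t (%x. x $ l)"
  have f: "\<bar>?f\<bar> \<le> M + M * M"
   using abs_triangle_ineq4[of "ev t (%x. x $ m * x $ l)" "ev t (%x. x $ m) * ev t (%x. x $ l)"] e2[of m l] p[OF e1[of m] e1[of l]] by linarith
  have g: "\<bar>ev t (%x. x $ j) * ?f\<bar> \<le> M * (M + M * M)" unfolding abs_mult by (intro mult_mono e1 f) (use M1 in auto)
  have eq: "cumulant3 (tl q t) j l m = ?a + ?b - ?c - ?d - 2 * (ev t (%x. x $ j) * ?f)"
   unfolding cumulant3_tl[OF t] by simp
  have mm: "3 * M * M = M * M + M * M + M * M" "2 * M * (M + M * M) = 2 * (M * (M + M * M))" by simp_all
  show ?thesis unfolding eq mm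
   using e3[of m l j] p[OF e2[of m l] e1[of j]] p[OF e2[of m j] e1[of l]] p[OF e1[of m] e2[of l j]] g
   unfolding abs_le_iff by linarith
 qed
 have "norm (gam q t) \<le> (\<Sum>l\<in>UNIV. \<bar>gam q t $ l\<bar>)" by (rule norm_le_l1_cart)
 also have "... \<le> (\<Sum>l\<in>(UNIV::'d set). real CARD('d) * (M + 3 * M * M + 2 * M * (M + M * M)))"
 proof (rule sum_mono)
  fix l
  have "\<bar>gam q t $ l\<bar> \<le> (\<Sum>j\<in>UNIV. \<bar>cumulant3 (tl q t) j j l\<bar>)" unfolding gam_def by simp
  also have "... \<le> (\<Sum>j\<in>(UNIV::'d set). M + 3 * M * M + 2 * M * (M + M * M))" by (intro sum_mono cum)
  finally show "\<bar>gam q t $ l\<bar> \<le> real CARD('d) * (M + 3 * M * M + 2 * M * (M + M * M))" by simp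
 qed
 finally show ?thesis by simp
qed

end

context pdf
begin

lemma cumulant2_lower:
 assumes t: "t \<in> interior (mgf_dom q)" and r: "regular \<eta> c K L m (tl q t)"
 shows "2 * c * (norm v)\<^sup>2 \<le> v \<bullet> (cumulant2 (tl q t) *v v)"
proof (cases "v = 0")
 case False
 interpret T: pdf "tl q t" by (rule pdf_tl[OF interior_dom_dom[OF t]])
 let ?u = "(1 / norm v) *\<^sub>R v" and ?ka = "cumulant2 (tl q t)"
 have nu: "norm ?u = 1" using False by simp
 have vu: "v = norm v *\<^sub>R ?u" using False by simp
 let ?m = "mean_fun q t"
 have "subexp (%x. (?u \<bullet> x + - (?u \<bullet> ?m))\<^sup>2)"
  by (intro subexp_power subexp_add subexp_inner subexp_const)
 then have i: "integrable lborel (%x. (?u \<bullet> (x - ?m))\<^sup>2 * tl q t x)"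
  using tl_integrable[OF t] by (simp add: inner_diff_right)
 have "norm (ft (tl q t) ?u) \<le> 1 - c * min 1 ((norm ?u)\<^sup>2)" using r unfolding regular_def by blast
 then have "c \<le> ft_gap (tl q t) ?u" unfolding ft_gap_def T.q_mass nu by simp
 also have "... \<le> (LBINT x. tl q t x * (1 - cos (?u \<bullet> x + - (?u \<bullet> ?m))))"
  by (rule ft_gap_le[OF T.q_int])
 also have "... \<le> (LBINT x. (1/2) * ((?u \<bullet> (x - ?m))\<^sup>2 * tl q t x))"
 proof (rule integral_mono'[OF integrable_mult_right[OF i]])
  fix x
  let ?y = "?u \<bullet> (x - ?m)"
  have y: "?u \<bullet> x + - (?u \<bullet> ?m) = ?y" by (simp only: inner_diff_right)
  have "1 - ?y\<^sup>2 / 2 \<le> cos ?y" using abs_Re_le_cmod[of "cis ?y - 1 - \<i> * ?y"] norm_iexp_remainder2[of ?y] by (simp add: abs_le_iff)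
  then have "tl q t x * (1 - cos ?y) \<le> tl q t x * (?y\<^sup>2 / 2)" by (intro mult_left_mono T.q_nonneg) simp
  then show "tl q t x * (1 - cos (?u \<bullet> x + - (?u \<bullet> ?m))) \<le> (1/2) * (?y\<^sup>2 * tl q t x)"
   unfolding y by (simp add: mult.commute)
 qed (simp add: T.q_nonneg)
 also have "... = (1/2) * (?u \<bullet> (?ka *v ?u))" unfolding cumulant2_quadratic[OF t] by (rule integral_mult_right_zero)
 finally have "2 * c \<le> ?u \<bullet> (?ka *v ?u)" by simp
 then have "(norm v)\<^sup>2 * (2 * c) \<le> (norm v)\<^sup>2 * (?u \<bullet> (?ka *v ?u))" by (intro mult_left_mono) auto
 also have "... = (norm v *\<^sub>R ?u) \<bullet> (?ka *v (norm v *\<^sub>R ?u))"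
 proof -
  have "s\<^sup>2 * (u \<bullet> (?ka *v u)) = (s *\<^sub>R u) \<bullet> (?ka *v (s *\<^sub>R u))" for s u
   by (simp add: matrix_vector_mult_scaleR power2_eq_square)
  then show ?thesis .
 qed
 also have "... = v \<bullet> (?ka *v v)" by (simp only: vu[symmetric])
 finally show ?thesis by (simp add: mult_ac)
qed simp

lemma gexp_bounds:
 assumes t: "t \<in> interior (mgf_dom q)" and c: "c > 0" and r: "regular \<eta> c K L m (tl q t)"
  and G: "norm (gam q t) \<le> G" and a: "norm a \<le> A" and N: "N > 0"
 defines "H \<equiv> (G / (2 * c)\<^sup>2 + 1 / (2 * c)) * (1 + A) * (1 + A)"
 shows "\<bar>gexp q t N a z\<bar> \<le> H / N * (1 + norm z)\<^sup>2" and "gexp q t N a z \<le> H / N * (1 + norm z)"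
proof -
 let ?ka = "cumulant2 (tl q t)"
 let ?i = "matrix_inv ?ka"
 have inv: "invertible ?ka" by (rule pos_def_invertible[OF cumulant2_pos_def[OF t]])
 have A0: "A \<ge> 0" using a norm_ge_zero order_trans by blast
 have G0: "G \<ge> 0" using G norm_ge_zero order_trans by blast
 have ki: "?ka *v (?i *v w) = w" for w using matrix_inv_both[OF inv] by (simp add: matrix_vector_mul_assoc)
 have pos: "2 * c * (norm (?i *v w))\<^sup>2 \<le> (?i *v w) \<bullet> w" for w
  using cumulant2_lower[OF t r, of "?i *v w"] by (simp add: ki)
 have nb: "norm (?i *v w) \<le> norm w / (2 * c)" for w
 proof (cases "?i *v w = 0")
  case False
  have "2 * c * norm (?i *v w) * norm (?i *v w) \<le> norm w * norm (?i *v w)"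
   using pos[of w] norm_cauchy_schwarz[of "?i *v w" w] by (simp add: power2_eq_square mult_ac)
  then have "2 * c * norm (?i *v w) \<le> norm w" using False by simp
  then show ?thesis using c by (simp add: field_simps)
 qed (use c in simp)
 let ?th = "(1 / (2 * N)) *\<^sub>R ((?i ** ?i) *v gam q t)"
 let ?w = "z - a"
 have "norm (?i *v (?i *v gam q t)) \<le> norm (?i *v gam q t) / (2 * c)" by (rule nb)
 also have "... \<le> norm (gam q t) / (2 * c) / (2 * c)" using c nb[of "gam q t"] by (intro divide_right_mono) auto
 also have "... \<le> G / (2 * c) / (2 * c)" using c G by (intro divide_right_mono) auto
 also have "... = G / (2 * c)\<^sup>2" by (simp add: power2_eq_square)
 finally have h: "norm ((?i ** ?i) *v gam q t) \<le> G / (2 * c)\<^sup>2" unfolding matrix_vector_mul_assoc .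
 have "norm ?th = norm ((?i ** ?i) *v gam q t) / (2 * N)" using N by simp
 also have "... \<le> G / (2 * c)\<^sup>2 / (2 * N)" using N by (intro divide_right_mono h) auto
 also have "... \<le> G / (2 * c)\<^sup>2 / N" using N G0 by (intro divide_left_mono) auto
 finally have th: "norm ?th \<le> G / (2 * c)\<^sup>2 / N" .
 have w: "norm ?w \<le> (1 + A) * (1 + norm z)"
 proof -
  have "norm ?w \<le> norm z + A" using norm_triangle_ineq4[of z a] a by linarith
  also have "... \<le> (1 + A) * (1 + norm z)" using A0 by (simp add: algebra_simps)
  finally show ?thesis .
 qed
 have z1: "1 \<le> (1 + A) * (1 + norm z)"
  using mult_mono[of 1 "1 + A" 1 "1 + norm z"] A0 by simp
 have lin: "\<bar>?th \<bullet> ?w\<bar> \<le> G / (2 * c)\<^sup>2 / N * ((1 + A) * (1 + norm z))"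
  by (rule order_trans[OF Cauchy_Schwarz_ineq2 mult_mono[OF th w]]) (use G0 N in auto)
 have quad0: "0 \<le> ?w \<bullet> (?i *v ?w)" using pos[of ?w] c by (simp add: inner_commute order_trans[rotated])
 have quad: "?w \<bullet> (?i *v ?w) \<le> ((1 + A) * (1 + norm z))\<^sup>2 / (2 * c)"
 proof -
  have "?w \<bullet> (?i *v ?w) \<le> norm ?w * norm (?i *v ?w)" by (rule norm_cauchy_schwarz)
  also have "... \<le> norm ?w * (norm ?w / (2 * c))" by (intro mult_left_mono nb) auto
  also have "... = (norm ?w)\<^sup>2 / (2 * c)" by (simp add: power2_eq_square)
  also have "... \<le> ((1 + A) * (1 + norm z))\<^sup>2 / (2 * c)" using c by (intro divide_right_mono power_mono w) auto
  finally show ?thesis .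
 qed
 have q2: "\<bar>(?w \<bullet> (?i *v ?w)) / (2 * N)\<bar> \<le> 1 / (2 * c) / N * ((1 + A) * (1 + norm z))\<^sup>2"
 proof -
  have "\<bar>(?w \<bullet> (?i *v ?w)) / (2 * N)\<bar> = (?w \<bullet> (?i *v ?w)) / (2 * N)" using quad0 N by simp
  also have "... \<le> (?w \<bullet> (?i *v ?w)) / N" using quad0 N by (intro divide_left_mono) auto
  also have "... \<le> ((1 + A) * (1 + norm z))\<^sup>2 / (2 * c) / N" using N by (intro divide_right_mono quad) auto
  finally show ?thesis by simp
 qed
 have ge: "gexp q t N a z = ?th \<bullet> ?w - (?w \<bullet> (?i *v ?w)) / (2 * N)"
  unfolding gexp_def Let_def by simp
 define Y where "Y = (1 + A) * (1 + norm z)"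
 have Y: "1 \<le> Y" "Y \<le> Y\<^sup>2" using z1 mult_left_mono[of 1 Y Y] by (auto simp: Y_def power2_eq_square)
 have g0: "0 \<le> G / (2 * c)\<^sup>2 / N" using G0 N by simp
 have c0: "0 \<le> 1 / (2 * c) / N" using c N by simp
 have "\<bar>gexp q t N a z\<bar> \<le> G / (2 * c)\<^sup>2 / N * Y + 1 / (2 * c) / N * Y\<^sup>2"
  unfolding ge Y_def using lin q2 abs_triangle_ineq4[of "?th \<bullet> ?w" "(?w \<bullet> (?i *v ?w)) / (2 * N)"] by linarith
 also have "... \<le> G / (2 * c)\<^sup>2 / N * Y\<^sup>2 + 1 / (2 * c) / N * Y\<^sup>2"
  by (intro add_right_mono mult_left_mono Y g0)
 also have "... = H / N * (1 + norm z)\<^sup>2"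
 proof -
  have "g / N * (x * y)\<^sup>2 + k / N * (x * y)\<^sup>2 = ((g + k) * x * x) / N * y\<^sup>2" for g k x y
   by (simp add: power2_eq_square add_divide_distrib algebra_simps)
  then show ?thesis unfolding H_def Y_def .
 qed
 finally show "\<bar>gexp q t N a z\<bar> \<le> H / N * (1 + norm z)\<^sup>2" .
 have "0 \<le> (?w \<bullet> (?i *v ?w)) / (2 * N)" using quad0 N by simp
 then have "gexp q t N a z \<le> G / (2 * c)\<^sup>2 / N * Y"
  unfolding ge Y_def using lin by linarith
 also have "... \<le> (G / (2 * c)\<^sup>2 / N + 1 / (2 * c) / N) * Y"
  using c0 Y by (intro mult_right_mono) auto
 also have "... \<le> (G / (2 * c)\<^sup>2 / N + 1 / (2 * c) / N) * Y * (1 + A)"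
  using c0 g0 Y A0 mult_left_mono[of 1 "1 + A" "(G / (2 * c)\<^sup>2 / N + 1 / (2 * c) / N) * Y"] by simp
 also have "... = H / N * (1 + norm z)"
 proof -
  have "(g / N + k / N) * (x * y) * x = ((g + k) * x * x) / N * y" for g k x y
   by (simp add: add_divide_distrib algebra_simps)
  then show ?thesis unfolding H_def Y_def .
 qed
 finally show "gexp q t N a z \<le> H / N * (1 + norm z)" .
qed

lemma square_integral_le:
 assumes i: "integrable lborel (%x. f x * q x)" and i2: "integrable lborel (%x. (f x)\<^sup>2 * q x)"
 shows "(LBINT x. f x * q x)\<^sup>2 \<le> (LBINT x. (f x)\<^sup>2 * q x)"
proof -
 let ?m = "\<integral>x. f x * q x \<partial>lborel"
 have eq: "(f x - ?m)\<^sup>2 * q x = (f x)\<^sup>2 * q x - 2 * ?m * (f x * q x) + ?m\<^sup>2 * q x" for x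
  by (simp add: power2_eq_square algebra_simps)
 have "0 \<le> (LBINT x. (f x - ?m)\<^sup>2 * q x)" by (simp add: q_nonneg)
 also have "... = (LBINT x. (f x)\<^sup>2 * q x) - 2 * ?m * ?m + ?m\<^sup>2"
  unfolding eq using i i2 q_int by (simp add: q_mass)
 finally show ?thesis by (simp add: power2_eq_square)
qed

end

lemma regular_norm_moments:
 assumes eta: "\<eta> > 0"
 obtains M where "M \<ge> 1" "!!k c L m \<pi>. k \<le> 3 ==> regular \<eta> c K L m (\<pi> :: real^'d => real) ==> (LBINT x. norm x ^ k * \<pi> x) \<le> M"
proof -
 have F: "subexp (%x::real^'d. (1 + norm x) ^ 3)" by (intro subexp_power subexp_add subexp_norm subexp_const)
 obtain C where C: "C \<ge> 0" "!!c K L m \<pi>. regular \<eta> c K L m (\<pi> :: real^'d => real) ==> integrable lborel (%x. (1 + norm x) ^ 3 * \<pi> x)"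
  "!!c K L m \<pi>. regular \<eta> c K L m (\<pi> :: real^'d => real) ==> (LBINT x. \<bar>(1 + norm x) ^ 3\<bar> * \<pi> x) \<le> C * K"
  using regular_subexp[OF F eta] by blast
 show ?thesis
 proof (rule that[of "max 1 (C * K)"])
  fix k c L m and \<pi> :: "real^'d => real" assume k: "k \<le> (3::nat)" and r: "regular \<eta> c K L m \<pi>"
  interpret pdf \<pi> by (rule regular_pdf[OF r])
  have "(LBINT x. norm x ^ k * \<pi> x) \<le> (LBINT x. (1 + norm x) ^ 3 * \<pi> x)"
  proof (rule integral_mono'[OF C(2)[OF r]])
   fix x :: "real^'d"
   have "norm x ^ k \<le> (1 + norm x) ^ k" by (intro power_mono) auto
   also have "... \<le> (1 + norm x) ^ 3" using k by (intro power_increasing) auto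
   finally show "norm x ^ k * \<pi> x \<le> (1 + norm x) ^ 3 * \<pi> x" by (intro mult_right_mono q_nonneg)
  qed (simp add: q_nonneg)
  then show "(LBINT x. norm x ^ k * \<pi> x) \<le> max 1 (C * K)" using C(3)[OF r] by simp
 qed simp
qed

context pdf
begin

text \<open>The exponent \<open>gexp\<close> is bounded by a multiple of \<open>(1 + norm z)\<^sup>2 / N\<close>, and from above even with
 \<open>1 + norm z\<close> in place of its square, since the quadratic form is negative. Hence
 the exponential moments of the tilted density control the mean square.\<close>

lemma kernel_ratio:
 assumes c: "c > 0" and eta: "\<eta> > 0"
 obtains C N0 where "C \<ge> 0"
  "!!t m N a. t \<in> interior (mgf_dom q) ==> regular \<eta> c K L m (tl q t) ==> norm a \<le> A ==> N \<ge> N0 ==>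
    integrable lborel (%x. exp (gexp q t N a x) * tl q t x) ==>
    integrable lborel (%x. tl q t x * (exp (gexp q t N a x) / gden q t N a - 1)\<^sup>2) \<and>
    (LBINT x. tl q t x * (exp (gexp q t N a x) / gden q t N a - 1)\<^sup>2) \<le> C / N\<^sup>2"
proof -
 obtain M where M: "M \<ge> 1" "!!k c L m \<pi>. k \<le> 3 ==> regular \<eta> c K L m (\<pi> :: real^'d => real) ==> (LBINT x. norm x ^ k * \<pi> x) \<le> M"
  using regular_norm_moments[OF eta, where K=K and 'd='d] by blast
 define G where "G = real CARD('d) * (real CARD('d) * (M + 3 * M * M + 2 * M * (M + M * M)))"
 define A' where "A' = max 0 A"
 define H where "H = (G / (2 * c)\<^sup>2 + 1 / (2 * c)) * (1 + A') * (1 + A')"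
 have G0: "G \<ge> 0" using M(1) by (simp add: G_def)
 have "0 < 1 + A'" by (simp add: A'_def)
 moreover have "0 < G / (2 * c)\<^sup>2 + 1 / (2 * c)" using c G0 by (intro add_nonneg_pos) auto
 ultimately have H0: "H > 0" unfolding H_def by simp
 have F: "subexp (%x::real^'d. (1 + norm x) ^ 4)" by (intro subexp_power subexp_add subexp_norm subexp_const)
 obtain B where B: "B \<ge> 0" "!!x::real^'d. \<bar>(1 + norm x) ^ 4\<bar> \<le> B * exp (\<eta> / 2 * norm x)"
  using subexpD[OF F, of "\<eta> / 2"] eta by auto
 define S where "S = H\<^sup>2 * (B * exp (\<eta> / 2) * \<bar>K\<bar>)"
 have S: "S \<ge> 0" using B by (simp add: S_def)
 show ?thesis
 proof (rule that[of "16 * S" "max (4 * H / \<eta>) (max 1 (2 * sqrt S))"])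
  show "0 \<le> 16 * S" using S by simp
  fix t m N a
  assume t: "t \<in> interior (mgf_dom q)" and r: "regular \<eta> c K L m (tl q t)" and a: "norm a \<le> A"
   and N: "max (4 * H / \<eta>) (max 1 (2 * sqrt S)) \<le> N"
   and iE: "integrable lborel (%x. exp (gexp q t N a x) * tl q t x)"
  have N1: "N \<ge> 1" "4 * H / \<eta> \<le> N" "2 * sqrt S \<le> N" using N by auto
  interpret T: pdf "tl q t" by (rule pdf_tl[OF interior_dom_dom[OF t]])
  have G: "norm (gam q t) \<le> G" unfolding G_def by (rule gam_bounded[OF t M(2)[OF _ r] M(1)])
  have a': "norm a \<le> A'" using a by (simp add: A'_def)
  have N0: "N > 0" using N1 by simp
  let ?E = "%x. exp (gexp q t N a x)"
  have Em: "(%x. ?E x * tl q t x) \<in> borel_measurable borel" using iE by auto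
  have gm[measurable]: "(%x. gexp q t N a x) \<in> borel_measurable borel"
  proof -
   have [measurable]: "(*v) (matrix_inv (cumulant2 (tl q t))) \<in> borel_measurable borel"
    by (intro borel_measurable_continuous_onI linear_continuous_on matrix_vector_mul_bounded_linear)
   show ?thesis unfolding gexp_def Let_def by measurable
  qed
  have pt: "(?E x - 1)\<^sup>2 \<le> (H / N)\<^sup>2 * (B * exp (\<eta> / 2)) * exp (\<eta> * norm x)" for x
  proof -
   let ?x = "gexp q t N a x"
   have b: "\<bar>?x\<bar> \<le> H / N * (1 + norm x)\<^sup>2" "?x \<le> H / N * (1 + norm x)"
    using gexp_bounds[OF t c r G a' N0, of x] unfolding H_def by auto
   have "\<bar>exp ?x - 1\<bar> \<le> \<bar>?x\<bar> * exp (max 0 ?x)"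
   proof (cases "?x \<ge> 0")
    case True
    then show ?thesis using abs_exp_minus_one_le[of ?x] by (simp add: max_def)
   next
    case False
    then have "\<bar>exp ?x - 1\<bar> = 1 - exp ?x" "\<bar>?x\<bar> = - ?x" "max 0 ?x = 0" by simp_all
    then show ?thesis using exp_ge_add_one_self[of ?x] by (simp only: exp_zero mult_1_right)
   qed
   also have "... \<le> (H / N * (1 + norm x)\<^sup>2) * exp (H / N * (1 + norm x))"
    using b H0 N0 by (intro mult_mono) auto
   finally have "(?E x - 1)\<^sup>2 \<le> ((H / N * (1 + norm x)\<^sup>2) * exp (H / N * (1 + norm x)))\<^sup>2"
    by (metis abs_ge_zero power2_abs power_mono)
   also have "... = (H / N)\<^sup>2 * (1 + norm x) ^ 4 * exp (2 * (H / N * (1 + norm x)))"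
    by (simp only: power_mult_distrib power_mult[symmetric] exp_double) simp
   also have "... \<le> (H / N)\<^sup>2 * (B * exp (\<eta> / 2 * norm x)) * exp (\<eta> / 2 * (1 + norm x))"
   proof (intro mult_mono mult_left_mono)
    show "(1 + norm x) ^ 4 \<le> B * exp (\<eta> / 2 * norm x)" using B(2)[of x] by simp
    have "H / N \<le> \<eta> / 4" using N1(2) N0 eta by (simp add: field_simps)
    then have "2 * (H / N * (1 + norm x)) \<le> 2 * (\<eta> / 4 * (1 + norm x))" by (intro mult_left_mono mult_right_mono) auto
    then show "exp (2 * (H / N * (1 + norm x))) \<le> exp (\<eta> / 2 * (1 + norm x))" by simp
   qed (use B in auto)
   also have "... = (H / N)\<^sup>2 * (B * exp (\<eta> / 2)) * exp (\<eta> * norm x)"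
   proof -
    have "exp (\<eta> / 2 * norm x) * exp (\<eta> / 2 * (1 + norm x)) = exp (\<eta> / 2) * exp (\<eta> * norm x)"
     by (simp add: exp_add[symmetric] field_simps)
    then show ?thesis by (simp only: mult.assoc)
   qed
   finally show ?thesis .
  qed
  have iK: "integrable lborel (%x. (H / N)\<^sup>2 * (B * exp (\<eta> / 2)) * (exp (\<eta> * norm x) * tl q t x))"
   using r by (intro integrable_mult_right) (simp add: regular_def)
  have pt2: "(?E x - 1)\<^sup>2 * tl q t x \<le> (H / N)\<^sup>2 * (B * exp (\<eta> / 2)) * (exp (\<eta> * norm x) * tl q t x)" for x
   using mult_right_mono[OF pt T.q_nonneg] by (simp add: mult.assoc)
  have i2: "integrable lborel (%x. (?E x - 1)\<^sup>2 * tl q t x)"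
   by (rule integrable_le[OF iK]) (use pt2 T.q_nonneg in \<open>auto simp: abs_mult\<close>)
  have d2: "(LBINT x. (?E x - 1)\<^sup>2 * tl q t x) \<le> S / N\<^sup>2"
  proof -
   have "(LBINT x. (?E x - 1)\<^sup>2 * tl q t x) \<le> (LBINT x. (H / N)\<^sup>2 * (B * exp (\<eta> / 2)) * (exp (\<eta> * norm x) * tl q t x))"
    by (rule integral_mono[OF i2 iK pt2])
   also have "... = (H / N)\<^sup>2 * (B * exp (\<eta> / 2)) * (LBINT x. exp (\<eta> * norm x) * tl q t x)" by (rule integral_mult_right_zero)
   also have "... \<le> (H / N)\<^sup>2 * (B * exp (\<eta> / 2)) * \<bar>K\<bar>" using r B by (intro mult_left_mono) (auto simp: regular_def)
   also have "... = S / N\<^sup>2" by (simp add: S_def power_divide)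
   finally show ?thesis .
  qed
  let ?V = "gden q t N a"
  have i1: "integrable lborel (%x. (?E x - 1) * tl q t x)"
   using iE T.q_int by (simp add: left_diff_distrib)
  have "?V - 1 = (LBINT x. (?E x - 1) * tl q t x)"
   unfolding gden_def using iE T.q_int by (simp add: left_diff_distrib T.q_mass)
  then have V2: "(?V - 1)\<^sup>2 \<le> S / N\<^sup>2"
   using T.square_integral_le[OF i1 i2] d2 by simp
  have "S / N\<^sup>2 \<le> 1 / 4"
  proof -
   have "(2 * sqrt S)\<^sup>2 \<le> N\<^sup>2" using N1 S by (intro power_mono) auto
   then have "4 * S \<le> N\<^sup>2" using S by (simp add: power_mult_distrib)
   then show ?thesis using N0 by (simp add: field_simps)
  qed
  with V2 have "(?V - 1)\<^sup>2 \<le> 1 / 4" by (rule order_trans)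
  also have "(1::real) / 4 = (1 / 2)\<^sup>2" by (simp add: power2_eq_square)
  finally have "(?V - 1)\<^sup>2 \<le> (1 / 2)\<^sup>2" .
  then have "\<bar>?V - 1\<bar> \<le> 1 / 2" unfolding abs_le_square_iff[symmetric] by simp
  then have V: "?V \<ge> 1 / 2" by linarith
  have pt3: "tl q t x * (?E x / ?V - 1)\<^sup>2 \<le> 8 * ((?E x - 1)\<^sup>2 * tl q t x) + 8 * (?V - 1)\<^sup>2 * tl q t x" for x
  proof -
   have "(?E x / ?V - 1)\<^sup>2 = ((?E x - 1) - (?V - 1))\<^sup>2 / ?V\<^sup>2" using V by (simp add: power_divide[symmetric] diff_divide_distrib)
   also have "... \<le> ((?E x - 1) - (?V - 1))\<^sup>2 / (1/2)\<^sup>2" using V by (intro divide_left_mono power_mono) auto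
   also have "... = 4 * ((?E x - 1) - (?V - 1))\<^sup>2" by (simp add: power2_eq_square)
   also have "... \<le> 4 * (2 * (?E x - 1)\<^sup>2 + 2 * (?V - 1)\<^sup>2)"
   proof (intro mult_left_mono)
    have "0 \<le> ((?E x - 1) + (?V - 1))\<^sup>2" by simp
    then show "((?E x - 1) - (?V - 1))\<^sup>2 \<le> 2 * (?E x - 1)\<^sup>2 + 2 * (?V - 1)\<^sup>2"
     by (simp add: power2_eq_square algebra_simps)
   qed simp
   finally have "tl q t x * (?E x / ?V - 1)\<^sup>2 \<le> tl q t x * (4 * (2 * (?E x - 1)\<^sup>2 + 2 * (?V - 1)\<^sup>2))"
    by (rule mult_left_mono[OF _ T.q_nonneg])
   also have "... = 8 * ((?E x - 1)\<^sup>2 * tl q t x) + 8 * (?V - 1)\<^sup>2 * tl q t x" by (simp add: distrib_left)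
   finally show ?thesis .
  qed
  have ib: "integrable lborel (%x. 8 * ((?E x - 1)\<^sup>2 * tl q t x) + 8 * (?V - 1)\<^sup>2 * tl q t x)"
   using i2 T.q_int by simp
  have i3: "integrable lborel (%x. tl q t x * (?E x / ?V - 1)\<^sup>2)"
   by (rule integrable_le[OF ib]) (use pt3 T.q_nonneg in \<open>auto simp: abs_mult\<close>)
  have "(LBINT x. tl q t x * (?E x / ?V - 1)\<^sup>2) \<le> (LBINT x. 8 * ((?E x - 1)\<^sup>2 * tl q t x) + 8 * (?V - 1)\<^sup>2 * tl q t x)"
   by (rule integral_mono[OF i3 ib pt3])
  also have "... = 8 * (LBINT x. (?E x - 1)\<^sup>2 * tl q t x) + 8 * (?V - 1)\<^sup>2"
   using i2 T.q_int by (simp add: T.q_mass)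
  also have "... \<le> 8 * (S / N\<^sup>2) + 8 * (S / N\<^sup>2)" using d2 V2 by linarith
  finally have "(LBINT x. tl q t x * (?E x / ?V - 1)\<^sup>2) \<le> 16 * S / N\<^sup>2" by simp
  with i3 show "integrable lborel (%x. tl q t x * (?E x / ?V - 1)\<^sup>2) \<and> (LBINT x. tl q t x * (?E x / ?V - 1)\<^sup>2) \<le> 16 * S / N\<^sup>2"
   by blast
 qed
qed

end

section \<open>The limit of the conditioning points is a mean of the family\<close>

primrec msum :: "'a::real_vector set => nat => 'a set" where
 "msum A 0 = {0}"
| "msum A (Suc n) = {x + y | x y. x \<in> A \<and> y \<in> msum A n}"

lemma msum_add: "x \<in> msum A i ==> y \<in> msum A j ==> x + y \<in> msum A (i + j)"
proof (induction i arbitrary: x)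
 case (Suc i)
 then obtain u v where u: "u \<in> A" "v \<in> msum A i" "x = u + v" by auto
 have "v + y \<in> msum A (i + j)" by (rule Suc.IH[OF u(2) Suc.prems(2)])
 then show ?case using u by (auto simp: add.assoc)
qed simp

lemma msum_scale: "z \<in> msum A m ==> real n *\<^sub>R z \<in> msum A (n * m)"
proof (induction n)
 case (Suc n)
 then show ?case using msum_add[of z A m "real n *\<^sub>R z" "n * m"] by (simp add: scaleR_add_left)
qed simp

lemma msum_single: "x \<in> A ==> real n *\<^sub>R x \<in> msum A n"
 using msum_scale[of x A 1 n] by simp

lemma msum_sum: "finite F ==> F \<subseteq> A ==> (\<Sum>x\<in>F. real (n x) *\<^sub>R x) \<in> msum A (\<Sum>x\<in>F. n x)"
 by (induction F rule: finite_induct) (auto intro: msum_add msum_single)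

lemma msum_path: "z \<in> msum A i ==> \<exists>y. (\<forall>j\<in>{1..i}. y j \<in> A) \<and> (\<Sum>j=1..i. y j) = z"
proof (induction i arbitrary: z)
 case (Suc i)
 then obtain u v where u: "u \<in> A" "v \<in> msum A i" "z = u + v" by auto
 obtain y where y: "\<forall>j\<in>{1..i}. y j \<in> A" "(\<Sum>j=1..i. y j) = v" using Suc.IH[OF u(2)] by blast
 have "(\<Sum>j=1..i. (y(Suc i := u)) j) = (\<Sum>j=1..i. y j)" by (intro sum.cong) auto
 then have "(\<Sum>j=1..Suc i. (y(Suc i := u)) j) = z" using y u by simp
 moreover have "\<forall>j\<in>{1..Suc i}. (y(Suc i := u)) j \<in> A" using y u by auto
 ultimately show ?case by blast
qed simp

text \<open>A point inside the convex hull of \<open>A\<close> is close to the averages of many points of \<open>A\<close>;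
 if some sumset of \<open>A\<close> contains a ball, the rounding error can be absorbed.\<close>

lemma msum_large:
 fixes A :: "'a::euclidean_space set"
 assumes F: "finite F" "F \<subseteq> A" and ball: "ball c \<rho> \<subseteq> msum A m" "\<rho> > 0"
 obtains L where "!!i v. L * m < i ==> (1 / real (i - L * m)) *\<^sub>R (v - real L *\<^sub>R c) \<in> convex hull F ==> v \<in> msum A i"
proof (cases "F = {}")
 case True
 then show ?thesis using that[of 0] by simp
next
 case False
 then obtain x0 where x0: "x0 \<in> F" by blast
 define K where "K = (\<Sum>x\<in>F. norm x) + real (card F) * norm x0"
 obtain L :: nat where L: "K / \<rho> < real L" using reals_Archimedean2 by blast
 have K0: "K \<ge> 0" unfolding K_def by (intro add_nonneg_nonneg sum_nonneg) auto
 have L0: "L > 0"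
 proof -
  have "0 \<le> K / \<rho>" using K0 ball(2) by simp
  then show ?thesis using L by linarith
 qed
 show ?thesis
 proof (rule that[of L])
  fix i v assume i: "L * m < i" and "(1 / real (i - L * m)) *\<^sub>R (v - real L *\<^sub>R c) \<in> convex hull F"
  then obtain wt where l: "!!x. x \<in> F ==> 0 \<le> wt x" "sum wt F = 1"
   "(\<Sum>x\<in>F. wt x *\<^sub>R x) = (1 / real (i - L * m)) *\<^sub>R (v - real L *\<^sub>R c)"
   unfolding convex_hull_finite[OF F(1)] by auto
  define I where "I = i - L * m"
  have I: "I > 0" using i by (simp add: I_def)
  define n where "n = (%x. nat \<lfloor>real I * wt x\<rfloor>)"
  have nx: "real (n x) \<le> real I * wt x" "real I * wt x - 1 \<le> real (n x)" if "x \<in> F" for x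
   using l(1)[OF that] unfolding n_def by (auto simp: of_nat_nat)
  have sI: "(\<Sum>x\<in>F. real I * wt x) = real I" using l(2) by (simp add: sum_distrib_left[symmetric])
  have "real (\<Sum>x\<in>F. n x) \<le> (\<Sum>x\<in>F. real I * wt x)" unfolding of_nat_sum by (intro sum_mono nx)
  then have nI: "(\<Sum>x\<in>F. n x) \<le> I" unfolding sI by (simp only: of_nat_le_iff)
  define D where "D = I - (\<Sum>x\<in>F. n x)"
  have "(\<Sum>x\<in>F. real I * wt x - 1) \<le> real (\<Sum>x\<in>F. n x)" unfolding of_nat_sum by (intro sum_mono nx)
  then have D: "real D \<le> real (card F)" unfolding D_def using nI by (simp add: sum_subtractf sI of_nat_diff)
  define e where "e = v - real L *\<^sub>R c - (\<Sum>x\<in>F. real (n x) *\<^sub>R x) - real D *\<^sub>R x0"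
  have vl: "v - real L *\<^sub>R c = (\<Sum>x\<in>F. (real I * wt x) *\<^sub>R x)"
  proof -
   have "(\<Sum>x\<in>F. (real I * wt x) *\<^sub>R x) = real I *\<^sub>R (\<Sum>x\<in>F. wt x *\<^sub>R x)" by (simp add: scaleR_sum_right)
   then show ?thesis unfolding l(3) I_def[symmetric] using I by simp
  qed
  have "e = (\<Sum>x\<in>F. (real I * wt x - real (n x)) *\<^sub>R x) - real D *\<^sub>R x0"
   unfolding e_def vl by (simp add: scaleR_left_diff_distrib sum_subtractf)
  then have "norm e \<le> norm (\<Sum>x\<in>F. (real I * wt x - real (n x)) *\<^sub>R x) + norm (real D *\<^sub>R x0)"
   by (simp only: norm_triangle_ineq4)
  also have "... \<le> (\<Sum>x\<in>F. norm x) + real (card F) * norm x0"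
  proof (rule add_mono)
   have "norm (\<Sum>x\<in>F. (real I * wt x - real (n x)) *\<^sub>R x) \<le> (\<Sum>x\<in>F. norm ((real I * wt x - real (n x)) *\<^sub>R x))" by (rule norm_sum)
   also have "... \<le> (\<Sum>x\<in>F. norm x)"
   proof (rule sum_mono)
    fix x assume "x \<in> F"
    then have "\<bar>real I * wt x - real (n x)\<bar> \<le> 1" using nx[of x] by linarith
    then show "norm ((real I * wt x - real (n x)) *\<^sub>R x) \<le> norm x" by (simp add: mult_left_le_one_le)
   qed
   finally show "norm (\<Sum>x\<in>F. (real I * wt x - real (n x)) *\<^sub>R x) \<le> (\<Sum>x\<in>F. norm x)" .
   show "norm (real D *\<^sub>R x0) \<le> real (card F) * norm x0" using D by (simp add: mult_right_mono)
  qed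
  also have "... < real L * \<rho>" using L ball(2) unfolding K_def[symmetric] by (simp add: pos_divide_less_eq)
  finally have e: "norm e < real L * \<rho>" .
  have "c + (1 / real L) *\<^sub>R e \<in> ball c \<rho>" using e L0 by (simp add: dist_norm field_simps)
  then have "c + (1 / real L) *\<^sub>R e \<in> msum A m" using ball(1) by blast
  then have 1: "real L *\<^sub>R (c + (1 / real L) *\<^sub>R e) \<in> msum A (L * m)" by (rule msum_scale)
  have 2: "(\<Sum>x\<in>F. real (n x) *\<^sub>R x) \<in> msum A (\<Sum>x\<in>F. n x)" by (rule msum_sum[OF F])
  have 3: "real D *\<^sub>R x0 \<in> msum A D" using x0 F by (intro msum_single) auto
  have "real L *\<^sub>R (c + (1 / real L) *\<^sub>R e) + ((\<Sum>x\<in>F. real (n x) *\<^sub>R x) + real D *\<^sub>R x0) \<in> msum A (L * m + ((\<Sum>x\<in>F. n x) + D))"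
   by (intro msum_add 1 2 3)
  moreover have "real L *\<^sub>R (c + (1 / real L) *\<^sub>R e) + ((\<Sum>x\<in>F. real (n x) *\<^sub>R x) + real D *\<^sub>R x0) = v"
   using L0 by (simp add: e_def scaleR_add_right)
  moreover have "L * m + ((\<Sum>x\<in>F. n x) + D) = i" using nI i by (simp add: D_def I_def)
  ultimately show "v \<in> msum A i" by simp
 qed
qed

lemma interior_convex_hull_finite_subset:
 fixes A :: "'a::euclidean_space set"
 assumes "z \<in> interior (convex hull A)"
 obtains F where "finite F" "F \<subseteq> A" "z \<in> interior (convex hull F)"
proof -
 obtain e where e: "e > 0" "cball z e \<subseteq> convex hull A" using assms by (auto simp: mem_interior_cball)
 define d where "d = e / real DIM('a)"
 have d: "d > 0" using e by (simp add: d_def)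
 obtain S where S: "finite S" "cbox (z - (\<Sum>i\<in>Basis. d *\<^sub>R i)) (z + (\<Sum>i\<in>Basis. d *\<^sub>R i)) = convex hull S"
  using cube_convex_hull[OF d] by blast
 have sub: "cbox (z - (\<Sum>i\<in>Basis. d *\<^sub>R i)) (z + (\<Sum>i\<in>Basis. d *\<^sub>R i)) \<subseteq> cball z e"
 proof
  fix x assume x: "x \<in> cbox (z - (\<Sum>i\<in>Basis. d *\<^sub>R i)) (z + (\<Sum>i\<in>Basis. d *\<^sub>R i))"
  have "norm (x - z) \<le> (\<Sum>b\<in>Basis. \<bar>(x - z) \<bullet> b\<bar>)" by (rule norm_le_l1)
  also have "... \<le> (\<Sum>b\<in>(Basis::'a set). d)"
  proof (rule sum_mono)
   fix b :: 'a assume b: "b \<in> Basis"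
   have "(z - (\<Sum>i\<in>Basis. d *\<^sub>R i)) \<bullet> b \<le> x \<bullet> b" "x \<bullet> b \<le> (z + (\<Sum>i\<in>Basis. d *\<^sub>R i)) \<bullet> b"
    using x b by (auto simp: mem_box)
   moreover have "(\<Sum>i\<in>Basis. d *\<^sub>R i) \<bullet> b = d" using b by (simp add: inner_sum_left inner_Basis if_distrib cong: if_cong)
   ultimately show "\<bar>(x - z) \<bullet> b\<bar> \<le> d" by (simp add: inner_diff_left inner_add_left abs_le_iff)
  qed
  also have "... = e" by (simp add: d_def)
  finally show "x \<in> cball z e" by (simp add: dist_norm norm_minus_commute)
 qed
 have "\<forall>s\<in>S. \<exists>G. finite G \<and> G \<subseteq> A \<and> s \<in> convex hull G"
 proof
  fix s assume "s \<in> S"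
  then have "s \<in> convex hull A" using S(2) sub e(2) hull_inc[of s S convex] by blast
  then obtain G u where G: "finite G" "G \<subseteq> A" "\<forall>x\<in>G. 0 \<le> u x" "sum u G = 1" "(\<Sum>v\<in>G. u v *\<^sub>R v) = s"
   unfolding convex_hull_explicit by auto
  then have "s \<in> convex hull G" unfolding convex_hull_finite[OF G(1)] by blast
  with G show "\<exists>G. finite G \<and> G \<subseteq> A \<and> s \<in> convex hull G" by blast
 qed
 then obtain G where G: "!!s. s \<in> S ==> finite (G s) \<and> G s \<subseteq> A \<and> s \<in> convex hull (G s)" by metis
 show ?thesis
 proof (rule that[of "\<Union>s\<in>S. G s"])
  show "finite (\<Union>s\<in>S. G s)" "(\<Union>s\<in>S. G s) \<subseteq> A" using S G by auto
  have "S \<subseteq> convex hull (\<Union>s\<in>S. G s)" using G hull_mono[of _ "\<Union>s\<in>S. G s" convex] by blast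
  then have "convex hull S \<subseteq> convex hull (\<Union>s\<in>S. G s)" by (rule hull_minimal) simp
  then have "interior (cbox (z - (\<Sum>i\<in>Basis. d *\<^sub>R i)) (z + (\<Sum>i\<in>Basis. d *\<^sub>R i))) \<subseteq> interior (convex hull (\<Union>s\<in>S. G s))"
   unfolding S(2) by (rule interior_mono)
  moreover have "z \<in> interior (cbox (z - (\<Sum>i\<in>Basis. d *\<^sub>R i)) (z + (\<Sum>i\<in>Basis. d *\<^sub>R i)))"
   using d by (auto simp: interior_cbox mem_box inner_diff_left inner_add_left inner_sum_left inner_Basis if_distrib cong: if_cong)
  ultimately show "z \<in> interior (convex hull (\<Union>s\<in>S. G s))" by blast
 qed
qed

context pdf
begin

lemma pos_not_hyperplane: "u \<noteq> 0 ==> \<exists>x. 0 < q x \<and> u \<bullet> x \<noteq> b"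
proof (rule ccontr)
 assume u: "u \<noteq> 0" and "\<not> (\<exists>x. 0 < q x \<and> u \<bullet> x \<noteq> b)"
 then have z: "!!x. u \<bullet> x \<noteq> b ==> q x = 0" using q_nonneg by (metis order_less_le)
 have "AE x in lborel. q x = 0" using AE_not_hyperplane[OF u, of b] by eventually_elim (rule z)
 then have "(LBINT x. q x) = 0" by (rule integral_eq_zero_AE)
 then show False by (simp add: q_mass)
qed

text \<open>A mean lies strictly on one side of every hyperplane that supports the density, since
  hyperplanes are null sets.\<close>

lemma mrange_halfspace:
 assumes u: "u \<noteq> 0" and h: "!!x. 0 < q x ==> b \<le> u \<bullet> x" and \<alpha>: "\<alpha> \<in> mrange"
 shows "b < u \<bullet> \<alpha>"
proof -
 obtain t where t: "t \<in> interior (mgf_dom q)" and m: "\<alpha> = mean_fun q t" using \<alpha> by (auto simp: mrange_def)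
 interpret T: pdf "tl q t" by (rule pdf_tl[OF interior_dom_dom[OF t]])
 have i: "integrable lborel (%x. (u \<bullet> x + - b) * tl q t x)"
  by (intro tl_integrable[OF t] subexp_add subexp_inner subexp_const)
 have eq: "\<bar>u \<bullet> x - b\<bar> * tl q t x = (u \<bullet> x + - b) * tl q t x" for x
  using h[of x] q_nonneg[of x] by (cases "q x = 0") (auto simp: tl_def)
 have "0 < (LBINT x. \<bar>u \<bullet> x - b\<bar> * tl q t x)"
 proof (rule integral_pos_AE[OF T.q_nonneg])
  show "AE x in lborel. 0 < \<bar>u \<bullet> x - b\<bar>" using AE_not_hyperplane[OF u, of b] by eventually_elim simp
  show "integrable lborel (%x. \<bar>u \<bullet> x - b\<bar> * tl q t x)" unfolding eq by (rule i)
 qed (simp_all add: T.q_mass)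
 also have "... = (LBINT x. (u \<bullet> x) * tl q t x - b * tl q t x)" unfolding eq by (simp add: left_diff_distrib distrib_right)
 also have "... = u \<bullet> \<alpha> - b"
  using tl_integrable[OF t subexp_inner, of u] T.q_int by (simp add: T.q_mass tl_integral m inner_mean_fun[OF t])
 finally show ?thesis by simp
qed

lemma sum_pdf_pos_msum: "0 < sum_pdf q (Suc l) x ==> x \<in> msum {x. 0 < q x} (Suc l)"
proof (induction l arbitrary: x)
 case 0
 then have "0 < q x" by (simp add: sum_pdf_1)
 then show ?case by force
next
 case (Suc l)
 interpret S: pdf "sum_pdf q (Suc l)" by (rule pdf_sum_pdf)
 have "0 < (LBINT y. q y * sum_pdf q (Suc l) (x - y))" using Suc.prems by (simp add: sum_pdf_Suc)
 have "\<exists>y. q y * sum_pdf q (Suc l) (x - y) \<noteq> 0"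
 proof (rule ccontr)
  assume "\<not> ?thesis"
  then have "(%y. q y * sum_pdf q (Suc l) (x - y)) = (%_. 0)" by (auto simp: fun_eq_iff)
  then have "(LBINT y. q y * sum_pdf q (Suc l) (x - y)) = 0" by (simp only: integral_zero)
  then show False using \<open>0 < (LBINT y. q y * sum_pdf q (Suc l) (x - y))\<close> by simp
 qed
 then obtain y where "q y \<noteq> 0" "sum_pdf q (Suc l) (x - y) \<noteq> 0" by auto
 then have "0 < q y" "0 < sum_pdf q (Suc l) (x - y)" using q_nonneg S.q_nonneg by (simp_all add: less_le)
 then have "0 < q y \<and> x - y \<in> msum {x. 0 < q x} (Suc l)" using Suc.IH by simp
 then have "y + (x - y) \<in> msum {x. 0 < q x} (Suc (Suc l))" unfolding msum.simps(2)[of _ "Suc l"] by blast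
 then show ?case by simp
qed

lemma inner_m_val:
 assumes "i < n"
 shows "u \<bullet> m_val n a y i = (real n * (u \<bullet> a) - u \<bullet> (\<Sum>j=1..i. y j)) / (real n - real i)"
proof -
 have "u \<bullet> m_val n a y i = (real n / (real n - real i)) * (u \<bullet> a - (u \<bullet> (\<Sum>j=1..i. y j)) / real n)"
  unfolding m_val_def by (simp add: inner_diff_right)
 also have "... = (real n * (u \<bullet> a) - u \<bullet> (\<Sum>j=1..i. y j)) / (real n - real i)"
  using assms by (simp add: field_simps)
 finally show ?thesis .
qed

text \<open>It must be excluded that the conditioning points approach the boundary of the set of means. The
  limit is inside the convex hull of \<open>{x. 0 < q x}\<close>: otherwise a separating hyperplane would give
 a point \<open>x0\<close> such that repeating it almost \<open>n\<close> times drives \<open>m_val\<close> out of the half-space that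
 contains all means. But then the limit is itself a value of \<open>m_val\<close> on an
 admissible path of length \<open>k n - 1\<close>, for some large \<open>n\<close>, and hence a mean.\<close>

lemma limit_in_mrange:
 assumes inv: "integrable lborel (%s. ft q s ^ Suc N0)"
  and a: "a \<longlonglongrightarrow> astar"
  and k_less: "!!n. n \<ge> 1 ==> k n < n"
  and k_ratio: "(%n. real (k n) / real n) \<longlonglongrightarrow> 1"
  and am: "!!n. n \<ge> 1 ==> a n \<in> mrange"
  and mm: "!!n i y. n \<ge> 1 ==> i \<in> {1..<k n} ==> (\<forall>j\<in>{1..i}. q (y j) > 0) ==> m_val n (a n) y i \<in> mrange"
 shows "astar \<in> mrange"
proof -
 let ?A = "{x. 0 < q x}"
 have inv_n: "(%n. 1 / real n) \<longlonglongrightarrow> 0" by (rule lim_1_over_n)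
 have shift: "(%n. (real (k n) - c) / real n) \<longlonglongrightarrow> 1" for c
 proof -
  have "(%n. real (k n) / real n - c * (1 / real n)) \<longlonglongrightarrow> 1 - c * 0" by (intro tendsto_intros k_ratio inv_n)
  then show ?thesis by (simp add: diff_divide_distrib)
 qed
 have kinf: "filterlim (%n. real (k n)) at_top sequentially"
 proof -
  have "filterlim (%n. real (k n) / real n * real n) at_top sequentially"
   by (rule filterlim_tendsto_pos_mult_at_top[OF k_ratio _ filterlim_real_sequentially]) simp
  moreover have ev: "\<forall>\<^sub>F n in sequentially. real (k n) / real n * real n = real (k n)"
   using eventually_gt_at_top[of 0] by eventually_elim simp
  ultimately show ?thesis using filterlim_cong[OF refl refl ev, THEN iffD1] by blast
 qed
 have kbig: "\<forall>\<^sub>F n in sequentially. k n > c" for c :: nat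
  using filterlim_at_top_dense[THEN iffD1, OF kinf, rule_format, of "real c"] by simp
 have star: "astar \<in> interior (convex hull ?A)"
 proof (rule ccontr)
  assume no: "astar \<notin> interior (convex hull ?A)"
  have ne: "interior (convex hull ?A) \<noteq> {}"
  proof
   assume "interior (convex hull ?A) = {}"
   then obtain u b where u: "u \<noteq> 0" "convex hull ?A \<subseteq> {x. u \<bullet> x = b}"
    by (rule empty_interior_subset_hyperplane[OF convex_convex_hull])
   then show False using pos_not_hyperplane[OF u(1), of b] hull_subset[of ?A convex] by blast
  qed
  obtain u b where u: "u \<noteq> 0" "u \<bullet> astar \<le> b" "!!x. x \<in> interior (convex hull ?A) ==> b \<le> u \<bullet> x"
  proof -
   have "\<exists>u b. u \<noteq> 0 \<and> (\<forall>x\<in>{astar}. u \<bullet> x \<le> b) \<and> (\<forall>x\<in>interior (convex hull ?A). b \<le> u \<bullet> x)"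
    by (rule separating_hyperplane_sets) (use ne no in \<open>simp_all add: convex_interior\<close>)
   then show ?thesis using that by blast
  qed
  have "closure (interior (convex hull ?A)) \<subseteq> {x. b \<le> u \<bullet> x}"
   using u(3) by (intro closure_minimal closed_halfspace_ge) auto
  then have cl: "closure (convex hull ?A) \<subseteq> {x. b \<le> u \<bullet> x}"
   using convex_closure_interior[OF convex_convex_hull ne] by simp
  have h: "u \<bullet> astar \<le> u \<bullet> x" if "0 < q x" for x
  proof -
   have "x \<in> closure (convex hull ?A)" using that hull_subset[of ?A convex] closure_subset by blast
   then show ?thesis using cl u(2) by auto
  qed
  obtain x0 where x0: "0 < q x0" "u \<bullet> x0 \<noteq> u \<bullet> astar" using pos_not_hyperplane[OF u(1)] by blast
  define \<eta> where "\<eta> = u \<bullet> x0 - u \<bullet> astar"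
  have eta: "\<eta> > 0" using h[OF x0(1)] x0(2) by (simp add: \<eta>_def)
  have "\<forall>\<^sub>F n in sequentially. (real (k n) - 1) / real n * \<eta> \<le> u \<bullet> a n - u \<bullet> astar"
   using kbig[of 1] eventually_ge_at_top[of 1]
  proof eventually_elim
   case (elim n)
   let ?i = "k n - 1"
   have i: "?i \<in> {1..<k n}" "?i < n" using elim k_less[of n] by auto
   have "m_val n (a n) (%_. x0) ?i \<in> mrange" using elim i x0 by (intro mm) auto
   then have "u \<bullet> astar < u \<bullet> m_val n (a n) (%_. x0) ?i" using mrange_halfspace[OF u(1), of "u \<bullet> astar"] h by blast
   also have "... = (real n * (u \<bullet> a n) - real ?i * (u \<bullet> x0)) / (real n - real ?i)"
    unfolding inner_m_val[OF i(2)] sum_constant_scaleR by simp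
   finally have "u \<bullet> astar * (real n - real ?i) < real n * (u \<bullet> a n) - real ?i * (u \<bullet> x0)"
    using i(2) by (simp add: pos_less_divide_eq)
   then have "real ?i * \<eta> \<le> real n * (u \<bullet> a n - u \<bullet> astar)" by (simp add: \<eta>_def algebra_simps)
   then have "real ?i * \<eta> / real n \<le> u \<bullet> a n - u \<bullet> astar" using elim by (simp add: divide_le_eq mult.commute)
   then show ?case using elim by (simp add: of_nat_diff)
  qed
  moreover have "(%n. (real (k n) - 1) / real n * \<eta>) \<longlonglongrightarrow> 1 * \<eta>" by (intro tendsto_intros shift)
  moreover have "(%n. u \<bullet> a n - u \<bullet> astar) \<longlonglongrightarrow> u \<bullet> astar - u \<bullet> astar" by (intro tendsto_intros a)
  ultimately have "1 * \<eta> \<le> u \<bullet> astar - u \<bullet> astar"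
   by (intro tendsto_le[OF sequentially_bot]) auto
  then show False using eta by simp
 qed
 obtain F where F: "finite F" "F \<subseteq> ?A" "astar \<in> interior (convex hull F)"
  using interior_convex_hull_finite_subset[OF star] by blast
 define m where "m = Suc (Suc N0)"
 interpret S: pdf "sum_pdf q m" unfolding m_def by (rule pdf_sum_pdf)
 have "\<exists>c. 0 < sum_pdf q m c"
 proof (rule ccontr)
  assume "\<not> ?thesis"
  then have "sum_pdf q m x = 0" for x using S.q_nonneg[of x] by (simp add: not_less order_antisym)
  then have "(LBINT x. sum_pdf q m x) = 0" by simp
  then show False using S.q_mass by simp
 qed
 then obtain c where c: "0 < sum_pdf q m c" by blast
 have "open {x. 0 < sum_pdf q m x}"
  using sum_pdf_continuous[OF inv] unfolding m_def[symmetric]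
  by (intro open_Collect_less continuous_on_const)
 then obtain \<rho> where rho: "\<rho> > 0" "ball c \<rho> \<subseteq> {x. 0 < sum_pdf q m x}" using c openE by blast
 then have ball: "ball c \<rho> \<subseteq> msum ?A m" using sum_pdf_pos_msum[of "Suc N0", folded m_def] by blast
 obtain L where L: "!!i v. L * m < i ==> (1 / real (i - L * m)) *\<^sub>R (v - real L *\<^sub>R c) \<in> convex hull F ==> v \<in> msum ?A i"
  using msum_large[OF F(1,2) ball rho(1)] by blast
 let ?C = "1 + real (L * m)"
 let ?v = "%n. real n *\<^sub>R a n - (real n - (real (k n) - 1)) *\<^sub>R astar"
 let ?w = "%n. (1 / (real (k n) - ?C)) *\<^sub>R (?v n - real L *\<^sub>R c)"
 have r1: "(%n. real n / (real (k n) - ?C)) \<longlonglongrightarrow> 1"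
 proof -
  have "(%n. 1 / ((real (k n) - ?C) / real n)) \<longlonglongrightarrow> 1 / 1" by (intro tendsto_intros shift) simp
  then show ?thesis by simp
 qed
 have r0: "(%n. 1 / (real (k n) - ?C)) \<longlonglongrightarrow> 0"
 proof -
  have "(%n. real n / (real (k n) - ?C) * (1 / real n)) \<longlonglongrightarrow> 1 * 0" by (intro tendsto_intros r1 inv_n)
  moreover have "\<forall>\<^sub>F n in sequentially. real n / (real (k n) - ?C) * (1 / real n) = 1 / (real (k n) - ?C)"
   using eventually_gt_at_top[of 0] by eventually_elim simp
  ultimately have "(%n. 1 / (real (k n) - ?C)) \<longlonglongrightarrow> 1 * 0" by (rule Lim_transform_eventually)
  then show ?thesis by simp
 qed
 have "(%n. (real n / (real (k n) - ?C)) *\<^sub>R (a n - astar) + (1 / (real (k n) - ?C)) *\<^sub>R (real (L * m) *\<^sub>R astar - real L *\<^sub>R c) + astar)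
   \<longlonglongrightarrow> 1 *\<^sub>R (astar - astar) + 0 *\<^sub>R (real (L * m) *\<^sub>R astar - real L *\<^sub>R c) + astar"
  by (intro tendsto_intros r1 r0 a)
 moreover have "\<forall>\<^sub>F n in sequentially. (real n / (real (k n) - ?C)) *\<^sub>R (a n - astar) + (1 / (real (k n) - ?C)) *\<^sub>R (real (L * m) *\<^sub>R astar - real L *\<^sub>R c) + astar = ?w n"
  using kbig[of "1 + L * m"]
 proof eventually_elim
  case (elim n)
  let ?d = "real (k n) - ?C"
  have "real (1 + L * m) < real (k n)" using elim by (simp only: of_nat_less_iff)
  then have d: "?d \<noteq> 0" by simp
  have da: "(1 / ?d) *\<^sub>R (?d *\<^sub>R astar) = astar" using d by simp
  have e1: "(real n / ?d) *\<^sub>R (a n - astar) + (1 / ?d) *\<^sub>R (real (L * m) *\<^sub>R astar - real L *\<^sub>R c) + astar =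
   (1 / ?d) *\<^sub>R (real n *\<^sub>R (a n - astar) + (real (L * m) *\<^sub>R astar - real L *\<^sub>R c) + ?d *\<^sub>R astar)"
   unfolding scaleR_add_right[of "1 / ?d"] da by simp
  have e2: "real n *\<^sub>R (a n - astar) + (real (L * m) *\<^sub>R astar - real L *\<^sub>R c) + ?d *\<^sub>R astar = ?v n - real L *\<^sub>R c"
   by (simp add: scaleR_diff_left scaleR_diff_right scaleR_add_left)
  show ?case unfolding e1 e2 ..
 qed
 ultimately have "?w \<longlonglongrightarrow> 1 *\<^sub>R (astar - astar) + 0 *\<^sub>R (real (L * m) *\<^sub>R astar - real L *\<^sub>R c) + astar"
  by (rule Lim_transform_eventually)
 moreover have "1 *\<^sub>R (astar - astar) + 0 *\<^sub>R (real (L * m) *\<^sub>R astar - real L *\<^sub>R c) + astar = astar" by simp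
 ultimately have wl: "?w \<longlonglongrightarrow> astar" by (simp only:)
 have ev: "\<forall>\<^sub>F n in sequentially. ?w n \<in> interior (convex hull F)"
  by (rule topological_tendstoD[OF wl open_interior F(3)])
 have "\<forall>\<^sub>F n in sequentially. n \<ge> 1 \<and> k n > 1 + L * m \<and> ?w n \<in> interior (convex hull F)"
  using ev kbig[of "1 + L * m"] eventually_ge_at_top[of 1] by eventually_elim simp
 then obtain n where n: "n \<ge> 1" "k n > 1 + L * m" "?w n \<in> interior (convex hull F)"
  using eventually_happens'[OF sequentially_bot] by blast
 let ?i = "k n - 1"
 have i: "L * m < ?i" "?i \<in> {1..<k n}" "?i < n" using n(1,2) k_less[OF n(1)] by auto
 have ri: "real (?i - L * m) = real (k n) - ?C" "real ?i = real (k n) - 1" using n(1,2) by (simp_all add: of_nat_diff)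
 have "(1 / real (?i - L * m)) *\<^sub>R (?v n - real L *\<^sub>R c) \<in> convex hull F"
  unfolding ri(1) by (rule subsetD[OF interior_subset n(3)])
 then have "?v n \<in> msum ?A ?i" by (rule L[OF i(1)])
 then obtain y where y: "\<forall>j\<in>{1..?i}. y j \<in> ?A" "(\<Sum>j=1..?i. y j) = ?v n" using msum_path by blast
 have "m_val n (a n) y ?i \<in> mrange" by (rule mm[OF n(1) i(2)]) (use y(1) in blast)
 moreover have "m_val n (a n) y ?i = astar"
 proof -
  have ne: "real n \<noteq> 0" "real n - real ?i \<noteq> 0" using n(1) i(3) by simp_all
  have "a n - (1 / real n) *\<^sub>R ?v n = ((real n - real ?i) / real n) *\<^sub>R astar"
   unfolding ri(2) scaleR_diff_right scaleR_scaleR using ne(1) by simp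
  then have "m_val n (a n) y ?i = (real n / (real n - real ?i)) *\<^sub>R (((real n - real ?i) / real n) *\<^sub>R astar)"
   unfolding m_val_def y(2) by (simp only:)
  also have "... = astar" unfolding scaleR_scaleR using ne by simp
  finally show ?thesis .
 qed
 ultimately show ?thesis by simp
qed

end

section \<open>Kernels and changes of measure along paths\<close>

abbreviation paths :: "nat => (nat => 'b::euclidean_space) measure" where
 "paths k \<equiv> PiM {1..k} (%_. lborel)"

lemma nn_integral_paths_Suc:
 assumes f[measurable]: "f \<in> borel_measurable (paths (Suc k))"
 shows "(\<integral>\<^sup>+y. f y \<partial>(paths (Suc k) :: (nat => 'b::euclidean_space) measure)) =
  (\<integral>\<^sup>+y. (\<integral>\<^sup>+x. f (y(Suc k := x)) \<partial>lborel) \<partial>paths k)"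
proof -
 interpret product_sigma_finite "%_::nat. lborel :: 'b measure" ..
 have eq: "{1..Suc k} = insert (Suc k) {1..k}" by auto
 show ?thesis using product_nn_integral_insert[of "{1..k}" "Suc k" f] f unfolding eq by simp
qed

lemma measurable_path_update:
 assumes "y \<in> space (paths j)"
 shows "(%x. y(Suc j := x)) \<in> measurable lborel (paths (Suc j) :: (nat => 'b::euclidean_space) measure)"
proof -
 have eq: "{1..Suc j} = insert (Suc j) {1..j}" by auto
 show ?thesis unfolding eq by (rule measurable_component_update[OF assms]) simp
qed

lemma nn_integral_path_kernel:
 fixes \<kappa> :: "nat => (nat => 'b::euclidean_space) => ennreal"
 assumes mk: "!!i j. 1 \<le> i ==> i \<le> j ==> \<kappa> i \<in> borel_measurable (paths j)"
  and mT[measurable]: "\<Theta> \<in> borel_measurable (paths (Suc j))"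
  and adapted: "!!i j y x. i < j ==> \<kappa> i (y(j := x)) = \<kappa> i y"
 shows "(\<integral>\<^sup>+y. (\<Prod>i=1..Suc j. \<kappa> i y) * \<Theta> y \<partial>paths (Suc j)) =
  (\<integral>\<^sup>+y. (\<Prod>i=1..j. \<kappa> i y) * (\<integral>\<^sup>+x. \<kappa> (Suc j) (y(Suc j := x)) * \<Theta> (y(Suc j := x)) \<partial>lborel) \<partial>paths j)"
proof -
 have "(%y. (\<Prod>i=1..Suc j. \<kappa> i y) * \<Theta> y) \<in> borel_measurable (paths (Suc j))"
  by (intro borel_measurable_times_ennreal mT borel_measurable_prod_ennreal mk) auto
 note nn_integral_paths_Suc[OF this]
 also have "(\<integral>\<^sup>+y. (\<integral>\<^sup>+x. (\<Prod>i=1..Suc j. \<kappa> i (y(Suc j := x))) * \<Theta> (y(Suc j := x)) \<partial>lborel) \<partial>paths j) =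
  (\<integral>\<^sup>+y. (\<Prod>i=1..j. \<kappa> i y) * (\<integral>\<^sup>+x. \<kappa> (Suc j) (y(Suc j := x)) * \<Theta> (y(Suc j := x)) \<partial>lborel) \<partial>paths j)"
 proof (rule nn_integral_cong)
  fix y :: "nat => 'b" assume y: "y \<in> space (paths j)"
  have pr: "(\<Prod>i=1..Suc j. \<kappa> i (y(Suc j := x))) = (\<Prod>i=1..j. \<kappa> i y) * \<kappa> (Suc j) (y(Suc j := x))" for x
  proof -
   have "(\<Prod>i=1..j. \<kappa> i (y(Suc j := x))) = (\<Prod>i=1..j. \<kappa> i y)" by (intro prod.cong refl adapted) auto
   then show ?thesis by simp
  qed
  have mm: "(%x. \<kappa> (Suc j) (y(Suc j := x)) * \<Theta> (y(Suc j := x))) \<in> borel_measurable lborel"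
   by (intro borel_measurable_times_ennreal measurable_compose[OF measurable_path_update[OF y]] mT mk) auto
  show "(\<integral>\<^sup>+x. (\<Prod>i=1..Suc j. \<kappa> i (y(Suc j := x))) * \<Theta> (y(Suc j := x)) \<partial>lborel) =
   (\<Prod>i=1..j. \<kappa> i y) * (\<integral>\<^sup>+x. \<kappa> (Suc j) (y(Suc j := x)) * \<Theta> (y(Suc j := x)) \<partial>lborel)"
   unfolding pr mult.assoc by (rule nn_integral_cmult[OF mm])
 qed
 finally show ?thesis .
qed

text \<open>A potential that each kernel increases at most by a factor has, along the whole path, at most
  the product of these factors.  With equality in the steps this is the preservation of mass.\<close>

lemma nn_integral_path_le:
 fixes \<kappa> \<Theta> :: "nat => (nat => 'b::euclidean_space) => ennreal"
 assumes mk: "!!i j. 1 \<le> i ==> i \<le> j ==> \<kappa> i \<in> borel_measurable (paths j)"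
  and mT: "!!j. \<Theta> j \<in> borel_measurable (paths j)"
  and adapted: "!!i j y x. i < j ==> \<kappa> i (y(j := x)) = \<kappa> i y"
  and step: "!!j y. j < k ==> (\<integral>\<^sup>+x. \<kappa> (Suc j) (y(Suc j := x)) * \<Theta> (Suc j) (y(Suc j := x)) \<partial>lborel)
   \<le> c (Suc j) * \<Theta> j y"
 shows "j \<le> k ==> (\<integral>\<^sup>+y. (\<Prod>i=1..j. \<kappa> i y) * \<Theta> j y \<partial>paths j) \<le> (\<Prod>i=1..j. c i) * \<Theta> 0 (%_. undefined)"
proof (induction j)
 case 0
 interpret product_sigma_finite "%_::nat. lborel :: 'b measure" ..
 show ?case by (simp add: nn_integral_empty)
next
 case (Suc j)
 have mp: "(%y. (\<Prod>i=1..j. \<kappa> i y) * \<Theta> j y) \<in> borel_measurable (paths j)"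
  by (intro borel_measurable_times_ennreal mT borel_measurable_prod_ennreal mk) auto
 have "(\<integral>\<^sup>+y. (\<Prod>i=1..Suc j. \<kappa> i y) * \<Theta> (Suc j) y \<partial>paths (Suc j)) =
  (\<integral>\<^sup>+y. (\<Prod>i=1..j. \<kappa> i y) * (\<integral>\<^sup>+x. \<kappa> (Suc j) (y(Suc j := x)) * \<Theta> (Suc j) (y(Suc j := x)) \<partial>lborel) \<partial>paths j)"
  by (rule nn_integral_path_kernel[OF mk mT adapted])
 also have "... \<le> (\<integral>\<^sup>+y. c (Suc j) * ((\<Prod>i=1..j. \<kappa> i y) * \<Theta> j y) \<partial>paths j)"
 proof (rule nn_integral_mono)
  fix y :: "nat => 'b"
  show "(\<Prod>i=1..j. \<kappa> i y) * (\<integral>\<^sup>+x. \<kappa> (Suc j) (y(Suc j := x)) * \<Theta> (Suc j) (y(Suc j := x)) \<partial>lborel)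
   \<le> c (Suc j) * ((\<Prod>i=1..j. \<kappa> i y) * \<Theta> j y)"
   using mult_left_mono[OF step[of j y], of "\<Prod>i=1..j. \<kappa> i y"] Suc.prems by (simp add: mult.left_commute)
 qed
 also have "... = c (Suc j) * (\<integral>\<^sup>+y. (\<Prod>i=1..j. \<kappa> i y) * \<Theta> j y \<partial>paths j)" by (rule nn_integral_cmult[OF mp])
 also have "... \<le> c (Suc j) * ((\<Prod>i=1..j. c i) * \<Theta> 0 (%_. undefined))"
  using Suc by (intro mult_left_mono) auto
 also have "... = (\<Prod>i=1..Suc j. c i) * \<Theta> 0 (%_. undefined)" by (simp add: mult_ac)
 finally show ?case .
qed

lemma nn_integral_path_eq:
 fixes \<kappa> \<Theta> :: "nat => (nat => 'b::euclidean_space) => ennreal"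
 assumes mk: "!!i j. 1 \<le> i ==> i \<le> j ==> \<kappa> i \<in> borel_measurable (paths j)"
  and mT: "!!j. \<Theta> j \<in> borel_measurable (paths j)"
  and adapted: "!!i j y x. i < j ==> \<kappa> i (y(j := x)) = \<kappa> i y"
  and step: "!!j y. j < k ==> (\<integral>\<^sup>+x. \<kappa> (Suc j) (y(Suc j := x)) * \<Theta> (Suc j) (y(Suc j := x)) \<partial>lborel) = \<Theta> j y"
 shows "j \<le> k ==> (\<integral>\<^sup>+y. (\<Prod>i=1..j. \<kappa> i y) * \<Theta> j y \<partial>paths j) = \<Theta> 0 (%_. undefined)"
proof (induction j)
 case 0
 interpret product_sigma_finite "%_::nat. lborel :: 'b measure" ..
 show ?case by (simp add: nn_integral_empty)
next
 case (Suc j)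
 have "(\<integral>\<^sup>+y. (\<Prod>i=1..Suc j. \<kappa> i y) * \<Theta> (Suc j) y \<partial>paths (Suc j)) =
  (\<integral>\<^sup>+y. (\<Prod>i=1..j. \<kappa> i y) * (\<integral>\<^sup>+x. \<kappa> (Suc j) (y(Suc j := x)) * \<Theta> (Suc j) (y(Suc j := x)) \<partial>lborel) \<partial>paths j)"
  by (rule nn_integral_path_kernel[OF mk mT adapted])
 also have "... = (\<integral>\<^sup>+y. (\<Prod>i=1..j. \<kappa> i y) * \<Theta> j y \<partial>paths j)"
  using Suc.prems by (intro nn_integral_cong) (simp add: step)
 also have "... = \<Theta> 0 (%_. undefined)" using Suc by simp
 finally show ?case .
qed

lemma nn_integral_real:
 assumes "!!x. 0 \<le> f x" "f \<in> borel_measurable M" "(\<integral>\<^sup>+x. ennreal (f x) \<partial>M) \<le> ennreal c" "0 \<le> c"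
 shows "integrable M f" "integral\<^sup>L M f \<le> c"
proof -
 show i: "integrable M f"
  using assms by (intro integrableI_nonneg) (auto intro: le_less_trans)
 have "ennreal (integral\<^sup>L M f) \<le> ennreal c"
  using nn_integral_eq_integral[OF i] assms by simp
 then show "integral\<^sup>L M f \<le> c" using assms(4) by simp
qed

text \<open>Changes of measure whose relative density has small variance are close in total variation.
  The two densities agree with \<open>\<tau> VP\<close> and \<open>\<tau> VG\<close> only outside a set \<open>B\<close>; since they have the same
 total mass as these, they give \<open>B\<close> the same mass, too.\<close>

lemma law_le_reference:
 fixes \<tau> V f :: "'a => real"
 assumes m[measurable]: "\<tau> \<in> borel_measurable M" "V \<in> borel_measurable M" "f \<in> borel_measurable M"
  and nn: "!!x. 0 \<le> \<tau> x" "!!x. 0 \<le> V x" "!!x. 0 \<le> f x"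
  and t1: "integrable M \<tau>" and tV: "integrable M (%x. \<tau> x * V x)" "(\<integral>x. \<tau> x * V x \<partial>M) = 1"
  and tV2: "integrable M (%x. \<tau> x * (V x - 1)\<^sup>2)" "(\<integral>x. \<tau> x * (V x - 1)\<^sup>2 \<partial>M) \<le> e"
  and t1m: "(\<integral>x. \<tau> x \<partial>M) = 1"
  and f1: "integrable M f" "(\<integral>x. f x \<partial>M) = 1"
  and B[measurable]: "B \<in> sets M" and b: "(\<integral>x. \<tau> x * indicator B x \<partial>M) \<le> b"
  and off: "!!x. x \<in> space M ==> x \<notin> B ==> f x = \<tau> x * V x"
  and A[measurable]: "A \<in> sets M" and h: "0 < (h::real)"
 shows "(\<integral>x. f x * indicator A x \<partial>M) \<le> (\<integral>x. \<tau> x * indicator A x \<partial>M) + b + h + e / h"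
proof -
 have ii: "integrable M (%x. g x * indicator S x)" if "integrable M g" "S \<in> sets M" for g :: "'a => real" and S
  using integrable_mult_indicator[OF that(2,1)] by (simp add: mult.commute)
 have "(\<integral>x. f x * indicator A x \<partial>M) \<le> (\<integral>x. f x + (\<tau> x * V x * indicator (A \<union> B) x - \<tau> x * V x) \<partial>M)"
 proof (rule integral_mono)
  show "integrable M (%x. f x * indicator A x)" by (rule ii[OF f1(1) A])
  show "integrable M (%x. f x + (\<tau> x * V x * indicator (A \<union> B) x - \<tau> x * V x))"
   by (intro Bochner_Integration.integrable_add Bochner_Integration.integrable_diff f1 tV ii) measurable
  show "f x * indicator A x \<le> f x + (\<tau> x * V x * indicator (A \<union> B) x - \<tau> x * V x)" if "x \<in> space M" for x
   using off[OF that] nn[of x] by (cases "x \<in> B"; cases "x \<in> A") auto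
 qed
 also have "... = (\<integral>x. \<tau> x * V x * indicator (A \<union> B) x \<partial>M)"
  using f1 tV ii[OF tV(1), of "A \<union> B"] by simp
 also have "... \<le> (\<integral>x. (\<tau> x * indicator A x + \<tau> x * indicator B x) + (h * \<tau> x + \<tau> x * (V x - 1)\<^sup>2 / h) \<partial>M)"
 proof (rule integral_mono)
  show "integrable M (%x. \<tau> x * V x * indicator (A \<union> B) x)" by (rule ii[OF tV(1)]) simp
  show "integrable M (%x. (\<tau> x * indicator A x + \<tau> x * indicator B x) + (h * \<tau> x + \<tau> x * (V x - 1)\<^sup>2 / h))"
   by (intro Bochner_Integration.integrable_add ii integrable_mult_right integrable_divide t1 tV2 A B)
  fix x
  have "V x - 1 \<le> h + (V x - 1)\<^sup>2 / h"
  proof (cases "V x - 1 \<le> h")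
   case True then show ?thesis using h by (simp add: add_increasing2)
  next
   case False
   then have "(V x - 1) * h \<le> (V x - 1) * (V x - 1)" using h by (intro mult_left_mono) auto
   then have "V x - 1 \<le> (V x - 1)\<^sup>2 / h" using h by (simp add: pos_le_divide_eq power2_eq_square)
   then show ?thesis using h by simp
  qed
  then have "\<tau> x * V x \<le> \<tau> x * (1 + (h + (V x - 1)\<^sup>2 / h))" by (intro mult_left_mono nn) auto
  then have *: "\<tau> x * V x \<le> \<tau> x + (h * \<tau> x + \<tau> x * (V x - 1)\<^sup>2 / h)" by (simp add: algebra_simps)
  have "0 \<le> h * \<tau> x + \<tau> x * (V x - 1)\<^sup>2 / h" using h nn by simp
  with * show "\<tau> x * V x * indicator (A \<union> B) x
   \<le> (\<tau> x * indicator A x + \<tau> x * indicator B x) + (h * \<tau> x + \<tau> x * (V x - 1)\<^sup>2 / h)"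
   using nn(1)[of x] by (cases "x \<in> A"; cases "x \<in> B") auto
 qed
 also have "... = (\<integral>x. \<tau> x * indicator A x \<partial>M) + (\<integral>x. \<tau> x * indicator B x \<partial>M) + (h + (\<integral>x. \<tau> x * (V x - 1)\<^sup>2 \<partial>M) / h)"
  using ii[OF t1 A] ii[OF t1 B] t1 tV2 t1m by simp
 also have "... \<le> (\<integral>x. \<tau> x * indicator A x \<partial>M) + b + (h + e / h)"
  using b tV2(2) h by (intro add_mono divide_right_mono) auto
 finally show ?thesis by simp
qed

lemma variance_markov:
 fixes \<tau> V :: "'a => real"
 assumes m[measurable]: "\<tau> \<in> borel_measurable M" "V \<in> borel_measurable M" and nn: "!!x. 0 \<le> \<tau> x"
  and tV2: "integrable M (%x. \<tau> x * (V x - 1)\<^sup>2)" "(\<integral>x. \<tau> x * (V x - 1)\<^sup>2 \<partial>M) \<le> e"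
  and t1: "integrable M \<tau>" and h: "0 < (h::real)"
 shows "(\<integral>x. \<tau> x * indicator {x\<in>space M. h < \<bar>V x - 1\<bar>} x \<partial>M) \<le> e / h\<^sup>2"
proof -
 have "(\<integral>x. \<tau> x * indicator {x\<in>space M. h < \<bar>V x - 1\<bar>} x \<partial>M) \<le> (\<integral>x. \<tau> x * (V x - 1)\<^sup>2 / h\<^sup>2 \<partial>M)"
 proof (rule integral_mono)
  show "integrable M (%x. \<tau> x * indicator {x\<in>space M. h < \<bar>V x - 1\<bar>} x)"
   using integrable_mult_indicator[OF _ t1, of "{x\<in>space M. h < \<bar>V x - 1\<bar>}"] by (simp add: mult.commute)
  show "integrable M (%x. \<tau> x * (V x - 1)\<^sup>2 / h\<^sup>2)" by (intro integrable_divide tV2)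
  fix x
  have "h\<^sup>2 \<le> (V x - 1)\<^sup>2" if "h < \<bar>V x - 1\<bar>"
   using that h by (simp add: abs_le_square_iff[symmetric])
  then have "h < \<bar>V x - 1\<bar> ==> 1 \<le> (V x - 1)\<^sup>2 / h\<^sup>2" using h by (simp add: pos_le_divide_eq)
  then have "h < \<bar>V x - 1\<bar> ==> \<tau> x * 1 \<le> \<tau> x * ((V x - 1)\<^sup>2 / h\<^sup>2)" using nn by (intro mult_left_mono) auto
  then show "\<tau> x * indicator {x\<in>space M. h < \<bar>V x - 1\<bar>} x \<le> \<tau> x * (V x - 1)\<^sup>2 / h\<^sup>2"
   using nn[of x] h by (auto simp: indicator_def)
 qed
 also have "... \<le> e / h\<^sup>2" using tV2(2) h by (simp add: divide_right_mono)
 finally show ?thesis .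
qed

text \<open>Where both changes of measure are within \<open>h\<close> of one, their quotient is within \<open>4 * h\<close> of one.
 The exceptional set is small under \<open>\<tau>\<close> by Markov's inequality, hence also under the two laws.\<close>

lemma ratio_deviation:
 fixes \<tau> VP VG fP fG :: "'a => real"
 assumes m[measurable]: "\<tau> \<in> borel_measurable M" "VP \<in> borel_measurable M" "VG \<in> borel_measurable M"
   "fP \<in> borel_measurable M" "fG \<in> borel_measurable M"
  and nn: "!!x. 0 \<le> \<tau> x" "!!x. 0 \<le> VP x" "!!x. 0 \<le> VG x" "!!x. 0 \<le> fP x" "!!x. 0 \<le> fG x"
  and t1: "integrable M \<tau>" "(\<integral>x. \<tau> x \<partial>M) = 1"
  and P: "integrable M (%x. \<tau> x * VP x)" "(\<integral>x. \<tau> x * VP x \<partial>M) = 1"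
   "integrable M (%x. \<tau> x * (VP x - 1)\<^sup>2)" "(\<integral>x. \<tau> x * (VP x - 1)\<^sup>2 \<partial>M) \<le> e"
  and G: "integrable M (%x. \<tau> x * VG x)" "(\<integral>x. \<tau> x * VG x \<partial>M) = 1"
   "integrable M (%x. \<tau> x * (VG x - 1)\<^sup>2)" "(\<integral>x. \<tau> x * (VG x - 1)\<^sup>2 \<partial>M) \<le> e"
  and f1: "integrable M fP" "(\<integral>x. fP x \<partial>M) = 1" "integrable M fG" "(\<integral>x. fG x \<partial>M) = 1"
  and B[measurable]: "B \<in> sets M" and b: "(\<integral>x. \<tau> x * indicator B x \<partial>M) \<le> b"
  and off: "!!x. x \<in> space M ==> x \<notin> B ==> fP x = \<tau> x * VP x"
   "!!x. x \<in> space M ==> x \<notin> B ==> fG x = \<tau> x * VG x"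
  and h: "0 < (h::real)" "h \<le> 1/2" "4 * h \<le> \<rho>"
 defines "D \<equiv> {x\<in>space M. \<rho> < \<bar>fP x / fG x - 1\<bar>}"
 shows "(\<integral>x. fP x * indicator D x \<partial>M) \<le> 2 * b + 2 * (e / h\<^sup>2) + h + e / h"
  "(\<integral>x. fG x * indicator D x \<partial>M) \<le> 2 * b + 2 * (e / h\<^sup>2) + h + e / h"
proof -
 have D[measurable]: "D \<in> sets M" unfolding D_def by measurable
 let ?SP = "{x\<in>space M. h < \<bar>VP x - 1\<bar>}" and ?SG = "{x\<in>space M. h < \<bar>VG x - 1\<bar>}"
 have ii: "integrable M (%x. g x * indicator S x)" if "integrable M g" "S \<in> sets M" for g :: "'a => real" and S
  using integrable_mult_indicator[OF that(2,1)] by (simp add: mult.commute)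
 have S: "?SP \<in> sets M" "?SG \<in> sets M" by measurable
 have "(\<integral>x. \<tau> x * indicator D x \<partial>M) \<le> (\<integral>x. \<tau> x * indicator B x + (\<tau> x * indicator ?SP x + \<tau> x * indicator ?SG x) \<partial>M)"
 proof (rule integral_mono)
  show "integrable M (%x. \<tau> x * indicator D x)" by (rule ii[OF t1(1) D])
  show "integrable M (%x. \<tau> x * indicator B x + (\<tau> x * indicator ?SP x + \<tau> x * indicator ?SG x))"
   by (intro Bochner_Integration.integrable_add ii t1 B S)
  fix x assume x: "x \<in> space M"
  have "x \<in> B \<or> x \<in> ?SP \<or> x \<in> ?SG" if xD: "x \<in> D" and pos: "\<tau> x \<noteq> 0"
  proof (rule ccontr)
   assume no: "\<not> ?thesis"
   then have v: "\<bar>VP x - 1\<bar> \<le> h" "\<bar>VG x - 1\<bar> \<le> h" using x by auto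
   have "fP x / fG x = VP x / VG x" using off[OF x] no pos by simp
   then have "fP x / fG x - 1 = (VP x - VG x) / VG x" using v h by (simp add: diff_divide_distrib)
   moreover have "\<bar>VP x - VG x\<bar> \<le> \<rho> * VG x"
   proof -
    have "\<bar>VP x - VG x\<bar> \<le> 2 * h" using v by linarith
    also have "... = 4 * h * (1/2)" by simp
    also have "... \<le> \<rho> * VG x" using v h by (intro mult_mono) linarith+
    finally show ?thesis .
   qed
   ultimately have "\<bar>fP x / fG x - 1\<bar> \<le> \<rho>" using v h by (simp add: abs_divide pos_divide_le_eq)
   then show False using xD by (simp add: D_def)
  qed
  then show "\<tau> x * indicator D x \<le> \<tau> x * indicator B x + (\<tau> x * indicator ?SP x + \<tau> x * indicator ?SG x)"
   using nn(1)[of x] x by (auto simp: indicator_def split: if_splits)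
 qed
 also have "... = (\<integral>x. \<tau> x * indicator B x \<partial>M) + ((\<integral>x. \<tau> x * indicator ?SP x \<partial>M) + (\<integral>x. \<tau> x * indicator ?SG x \<partial>M))"
  using ii[OF t1(1) B] ii[OF t1(1) S(1)] ii[OF t1(1) S(2)] by simp
 also have "... \<le> b + (e / h\<^sup>2 + e / h\<^sup>2)"
  by (intro add_mono b variance_markov[OF m(1,2) nn(1) P(3,4) t1(1) h(1)] variance_markov[OF m(1,3) nn(1) G(3,4) t1(1) h(1)])
 finally have T: "(\<integral>x. \<tau> x * indicator D x \<partial>M) \<le> b + 2 * (e / h\<^sup>2)" by simp
 show "(\<integral>x. fP x * indicator D x \<partial>M) \<le> 2 * b + 2 * (e / h\<^sup>2) + h + e / h"
  using law_le_reference[OF m(1,2,4) nn(1,2,4) t1(1) P t1(2) f1(1,2) B b off(1) D h(1)] T by simp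
 show "(\<integral>x. fG x * indicator D x \<partial>M) \<le> 2 * b + 2 * (e / h\<^sup>2) + h + e / h"
  using law_le_reference[OF m(1,3,5) nn(1,3,5) t1(1) G t1(2) f1(3,4) B b off(2) D h(1)] T by simp
qed

text \<open>One step with relative density \<open>v\<close> multiplies the second moment by \<open>1\<close> plus its variance.\<close>

lemma second_moment_step:
 fixes \<pi> v :: "'a => real"
 assumes "!!x. 0 \<le> \<pi> x" "integrable M \<pi>" "(\<integral>x. \<pi> x \<partial>M) = 1"
  and "integrable M (%x. \<pi> x * v x)" "(\<integral>x. \<pi> x * v x \<partial>M) = 1"
  and "integrable M (%x. \<pi> x * (v x - 1)\<^sup>2)" "(\<integral>x. \<pi> x * (v x - 1)\<^sup>2 \<partial>M) \<le> c" "0 \<le> c"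
 shows "(\<integral>\<^sup>+x. ennreal (\<pi> x * (v x)\<^sup>2) \<partial>M) \<le> ennreal (1 + c)"
proof -
 have eq: "\<pi> x * (v x)\<^sup>2 = \<pi> x * (v x - 1)\<^sup>2 + (2 * (\<pi> x * v x) - \<pi> x)" for x
  by (simp add: power2_eq_square algebra_simps)
 have i: "integrable M (%x. \<pi> x * (v x)\<^sup>2)" unfolding eq using assms by simp
 have "(\<integral>x. \<pi> x * (v x)\<^sup>2 \<partial>M) = (\<integral>x. \<pi> x * (v x - 1)\<^sup>2 \<partial>M) + 1" unfolding eq using assms by simp
 then show ?thesis using assms by (subst nn_integral_eq_integral[OF i]) (auto intro!: ennreal_leI)
qed

text \<open>The product of the ratios along a path has mean one and small variance under the product of
  the kernels.\<close>

lemma path_variance: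
 fixes \<kappa> v :: "nat => (nat => 'b::euclidean_space) => real"
 assumes mk: "!!i j. 1 \<le> i ==> i \<le> j ==> \<kappa> i \<in> borel_measurable (paths j)"
  and mv: "!!i j. 1 \<le> i ==> i \<le> j ==> v i \<in> borel_measurable (paths j)"
  and ak: "!!i j y x. i < j ==> \<kappa> i (y(j := x)) = \<kappa> i y"
  and av: "!!i j y x. i < j ==> v i (y(j := x)) = v i y"
  and nn: "!!i y. 0 \<le> \<kappa> i y" "!!i y. 0 \<le> v i y"
  and k1: "!!j y. j < k ==> integrable lborel (%x. \<kappa> (Suc j) (y(Suc j := x)))"
    "!!j y. j < k ==> (LBINT x. \<kappa> (Suc j) (y(Suc j := x))) = 1"
  and v1: "!!j y. j < k ==> integrable lborel (%x. \<kappa> (Suc j) (y(Suc j := x)) * v (Suc j) (y(Suc j := x)))"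
    "!!j y. j < k ==> (LBINT x. \<kappa> (Suc j) (y(Suc j := x)) * v (Suc j) (y(Suc j := x))) = 1"
  and v2: "!!j y. j < k ==> integrable lborel (%x. \<kappa> (Suc j) (y(Suc j := x)) * (v (Suc j) (y(Suc j := x)) - 1)\<^sup>2)"
    "!!j y. j < k ==> (LBINT x. \<kappa> (Suc j) (y(Suc j := x)) * (v (Suc j) (y(Suc j := x)) - 1)\<^sup>2) \<le> c (Suc j)"
  and c: "!!i. 0 \<le> c i"
 defines "\<tau> \<equiv> %y. \<Prod>i=1..k. \<kappa> i y" and "V \<equiv> %y. \<Prod>i=1..k. v i y"
 shows "integrable (paths k) \<tau>" "(\<integral>y. \<tau> y \<partial>paths k) = 1"
  "integrable (paths k) (%y. \<tau> y * V y)" "(\<integral>y. \<tau> y * V y \<partial>paths k) = 1"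
  "integrable (paths k) (%y. \<tau> y * (V y - 1)\<^sup>2)" "(\<integral>y. \<tau> y * (V y - 1)\<^sup>2 \<partial>paths k) \<le> (\<Prod>i=1..k. 1 + c i) - 1"
proof -
 have tm[measurable]: "\<tau> \<in> borel_measurable (paths k)" unfolding \<tau>_def by (intro borel_measurable_prod mk) auto
 have Vm[measurable]: "V \<in> borel_measurable (paths k)" unfolding V_def by (intro borel_measurable_prod mv) auto
 have t0: "0 \<le> \<tau> y" for y unfolding \<tau>_def by (intro prod_nonneg) (simp add: nn)
 have V0: "0 \<le> V y" for y unfolding V_def by (intro prod_nonneg) (simp add: nn)
 have one: "(\<integral>\<^sup>+y. (\<Prod>i=1..k. ennreal (\<kappa> i y * w i y)) \<partial>paths k) = 1"
  if "!!i j. 1 \<le> i ==> i \<le> j ==> w i \<in> borel_measurable (paths j)" "!!i j y x. i < j ==> w i (y(j := x)) = w i y"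
   "!!j y. j < k ==> (\<integral>\<^sup>+x. ennreal (\<kappa> (Suc j) (y(Suc j := x)) * w (Suc j) (y(Suc j := x))) \<partial>lborel) = 1"
  for w :: "nat => (nat => 'b) => real"
  using nn_integral_path_eq[of "%i y. ennreal (\<kappa> i y * w i y)" "%_ _. 1" k k] mk that ak by simp
 have s1: "(\<integral>\<^sup>+x. ennreal (\<kappa> (Suc j) (y(Suc j := x)) * v (Suc j) (y(Suc j := x))) \<partial>lborel) = 1" if "j < k" for j y
  by (subst nn_integral_eq_integral[OF v1(1)[OF that]]) (simp_all add: nn v1(2)[OF that])
 have s0: "(\<integral>\<^sup>+x. ennreal (\<kappa> (Suc j) (y(Suc j := x))) \<partial>lborel) = 1" if "j < k" for j y
  by (subst nn_integral_eq_integral[OF k1(1)[OF that]]) (simp_all add: nn k1(2)[OF that])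
 have n0: "(\<integral>\<^sup>+y. ennreal (\<tau> y) \<partial>paths k) = 1"
  using one[of "%_ _. 1"] s0 by (simp add: \<tau>_def prod_ennreal nn)
 have n1: "(\<integral>\<^sup>+y. ennreal (\<tau> y * V y) \<partial>paths k) = 1"
  using one[of v] mv av s1 by (simp add: \<tau>_def V_def prod.distrib[symmetric] prod_ennreal nn)
 have P1: "(\<Prod>i=1..k. ennreal (\<kappa> i y * (v i y)\<^sup>2)) = ennreal (\<tau> y * (V y)\<^sup>2)" for y
  by (subst prod_ennreal) (simp_all add: nn \<tau>_def V_def prod_power_distrib prod.distrib)
 have P2: "(\<Prod>i=1..k. ennreal (1 + c i)) = ennreal (\<Prod>i=1..k. 1 + c i)"
  by (rule prod_ennreal) (simp add: c)
 have "(\<integral>\<^sup>+y. (\<Prod>i=1..k. ennreal (\<kappa> i y * (v i y)\<^sup>2)) * 1 \<partial>paths k) \<le> (\<Prod>i=1..k. ennreal (1 + c i)) * 1"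
 proof (rule nn_integral_path_le[where \<Theta>="%_ _. 1" and k=k and c="%i. ennreal (1 + c i)"])
  show "(\<integral>\<^sup>+x. ennreal (\<kappa> (Suc j) (y(Suc j := x)) * (v (Suc j) (y(Suc j := x)))\<^sup>2) * 1 \<partial>lborel) \<le> ennreal (1 + c (Suc j)) * 1"
   if "j < k" for j y
   using second_moment_step[OF nn(1) k1[OF that] v1[OF that] v2[OF that] c] by simp
 qed (use mk mv ak av in auto)
 then have n2: "(\<integral>\<^sup>+y. ennreal (\<tau> y * (V y)\<^sup>2) \<partial>paths k) \<le> ennreal (\<Prod>i=1..k. 1 + c i)"
  unfolding mult_1_right P1 P2 .
 have C0: "0 \<le> (\<Prod>i=1..k. 1 + c i)" by (intro prod_nonneg) (simp add: c)
 show i0: "integrable (paths k) \<tau>" by (rule nn_integral_real(1)[OF t0 tm, where c=1]) (simp_all only: n0 ennreal_1 order_refl zero_le_one)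
 show e0: "(\<integral>y. \<tau> y \<partial>paths k) = 1" using nn_integral_eq_integral[OF i0] n0 t0 by simp
 have mtv: "(%y. \<tau> y * V y) \<in> borel_measurable (paths k)" and mtv2: "(%y. \<tau> y * (V y)\<^sup>2) \<in> borel_measurable (paths k)" by measurable
 have p1: "0 \<le> \<tau> y * V y" "0 \<le> \<tau> y * (V y)\<^sup>2" for y using t0 V0 by simp_all
 show i1: "integrable (paths k) (%y. \<tau> y * V y)" by (rule nn_integral_real(1)[OF p1(1) mtv, where c=1]) (simp_all only: n1 ennreal_1 order_refl zero_le_one)
 show e1: "(\<integral>y. \<tau> y * V y \<partial>paths k) = 1" using nn_integral_eq_integral[OF i1] n1 p1 by simp
 note i2 = nn_integral_real[OF p1(2) mtv2 n2 C0]
 have eq: "\<tau> y * (V y - 1)\<^sup>2 = \<tau> y * (V y)\<^sup>2 - (2 * (\<tau> y * V y) - \<tau> y)" for y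
  by (simp add: power2_eq_square algebra_simps)
 show "integrable (paths k) (%y. \<tau> y * (V y - 1)\<^sup>2)" unfolding eq using i0 i1 i2 by simp
 show "(\<integral>y. \<tau> y * (V y - 1)\<^sup>2 \<partial>paths k) \<le> (\<Prod>i=1..k. 1 + c i) - 1"
  unfolding eq using i0 i1 i2 e0 e1 by simp
qed

lemma prod_le_of_sum:
 fixes c :: "nat => real"
 assumes "!!i. 0 \<le> c i" "(\<Sum>i\<in>I. c i) \<le> s" "s \<le> 1" "finite I"
 shows "(\<Prod>i\<in>I. 1 + c i) \<le> 1 + 2 * s"
proof -
 have "(\<Prod>i\<in>I. 1 + c i) \<le> (\<Prod>i\<in>I. exp (c i))" using assms by (intro prod_mono) auto
 also have "... = exp (\<Sum>i\<in>I. c i)" using assms by (simp add: exp_sum)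
 also have "... \<le> exp s" using assms by simp
 also have "... \<le> 1 + s + s\<^sup>2" using assms by (intro exp_bound) (auto intro: order_trans[OF sum_nonneg])
 also have "... \<le> 1 + 2 * s"
 proof -
  have "0 \<le> s" using assms by (auto intro: order_trans[OF sum_nonneg])
  then show ?thesis using assms(3) mult_left_le[of s s] by (simp add: power2_eq_square)
 qed
 finally show ?thesis .
qed

text \<open>Comparison with the telescoping sum of \<open>2 / (n - i) - 2 / (n - i + 1)\<close>.\<close>

lemma sum_inverse_squares_tail:
 assumes "k < n"
 shows "(\<Sum>i=1..k. 1 / (real (n - i))\<^sup>2) \<le> 2 / real (n - k)"
proof -
 have "j \<le> k ==> (\<Sum>i=1..j. 1 / (real (n - i))\<^sup>2) \<le> 2 / real (n - j)" for j
 proof (induction j)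
  case (Suc j)
  let ?N = "real (n - Suc j)"
  have N: "real (n - j) = ?N + 1" "?N \<ge> 1" using Suc.prems assms by auto
  have "2 / (?N + 1) + 1 / ?N\<^sup>2 \<le> 2 / ?N"
  proof -
   have "2 / ?N - 2 / (?N + 1) = 2 / (?N * (?N + 1))" using N by (simp add: field_simps)
   moreover have "1 / ?N\<^sup>2 \<le> 2 / (?N * (?N + 1))"
   proof -
    define z where "z = ?N"
    have z: "z \<ge> 1" using N unfolding z_def by simp
    have "2 / (z * (2 * z)) \<le> 2 / (z * (z + 1))" using z by (intro divide_left_mono mult_left_mono mult_pos_pos) auto
    then show ?thesis using z unfolding z_def[symmetric] by (simp add: power2_eq_square)
   qed
   ultimately show ?thesis by linarith
  qed
  then show ?case using Suc N by simp
 qed simp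
 then show ?thesis by blast
qed

section \<open>The densities as products of kernels\<close>

lemma continuous_on_det:
 fixes A :: "'a::topological_space => real^'n^'n"
 assumes "!!i j. continuous_on S (%x. A x $ i $ j)"
 shows "continuous_on S (%x. det (A x))"
 unfolding det_def by (intro continuous_intros assms)

text \<open>The entries of the inverse are rational functions of the matrix; this gives continuity.\<close>

lemma matrix_inv_cramer:
 fixes A :: "real^'n^'n"
 assumes "invertible A"
 shows "matrix_inv A $ i $ j = det (\<chi> r k. if k = i then axis j 1 $ r else A $ r $ k) / det A"
proof -
 have "A *v (matrix_inv A *v axis j 1) = axis j 1"
  using matrix_inv_both(1)[OF assms] by (simp add: matrix_vector_mul_assoc)
 then have "matrix_inv A *v axis j 1 = (\<chi> k. det (\<chi> r l. if l = k then axis j 1 $ r else A $ r $ l) / det A)"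
  using cramer[of A "matrix_inv A *v axis j 1" "axis j 1"] assms invertible_det_nz by blast
 then have "(matrix_inv A *v axis j 1) $ i = det (\<chi> r l. if l = i then axis j 1 $ r else A $ r $ l) / det A" by simp
 then show ?thesis by (simp add: matrix_vector_mult_basis column_def)
qed

lemma measurable_vec_nth [measurable]: "(%x::real^'d. x $ i) \<in> borel_measurable borel"
 by (rule subexp_measurable[OF subexp_component])

context pdf
begin

lemma continuous_on_mgf: "continuous_on (interior (mgf_dom q)) (mgf q)"
 using mom_continuous[OF subexp_const[of 1]] unfolding mgf_eq_mom[abs_def] .

lemma continuous_on_ev:
 assumes "subexp F"
 shows "continuous_on (interior (mgf_dom q)) (%t. ev t F)"
proof -
 have "ev t F = mom q F t / mgf q t" for t unfolding ev_eq by (rule tl_integral)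
 then show ?thesis
  using mgf_pos[OF interior_dom_dom] by (auto intro!: continuous_on_divide mom_continuous[OF assms] continuous_on_mgf simp: less_imp_neq[THEN not_sym])
qed

lemma continuous_on_gam: "continuous_on (interior (mgf_dom q)) (%t. gam q t $ l)"
proof -
 have "continuous_on (interior (mgf_dom q)) (%t. \<Sum>j\<in>UNIV. ev t (%x. x $ l * x $ j * x $ j) + ev t (%x. x $ l * x $ j) * ev t (%x. x $ j)
   - ev t (%x. x $ l * x $ j) * ev t (%x. x $ j) - ev t (%x. x $ l) * ev t (%x. x $ j * x $ j)
   - 2 * ev t (%x. x $ j) * (ev t (%x. x $ l * x $ j) - ev t (%x. x $ l) * ev t (%x. x $ j)))"
  by (intro continuous_intros continuous_on_ev subexp_mult subexp_component)
 then show ?thesis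
  by (rule continuous_on_eq) (simp add: gam_def cumulant3_tl)
qed

lemma continuous_on_cumulant2: "continuous_on (interior (mgf_dom q)) (%t. cumulant2 (tl q t) $ j $ l)"
proof -
 have "continuous_on (interior (mgf_dom q)) (%t. (mom q (%x. x $ l * x $ j) t * mom q (%_. 1) t - mom q (%x. x $ l) t * mom q (%x. x $ j) t)
    / (mom q (%_. 1) t * mom q (%_. 1) t))"
  using mom_one_pos
  by (intro continuous_intros mom_continuous subexp_mult subexp_component subexp_const) force
 then show ?thesis by (rule continuous_on_eq) (simp add: cumulant2_tl)
qed

lemma cumulant2_invertible: "t \<in> interior (mgf_dom q) ==> invertible (cumulant2 (tl q t))"
 using pos_def_invertible cumulant2_pos_def by blast

lemma continuous_on_matrix_inv_cumulant2:
 "continuous_on (interior (mgf_dom q)) (%t. matrix_inv (cumulant2 (tl q t)) $ i $ j)"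
proof -
 have "continuous_on (interior (mgf_dom q))
   (%t. det (\<chi> r k. if k = i then axis j 1 $ r else cumulant2 (tl q t) $ r $ k) / det (cumulant2 (tl q t)))"
 proof (intro continuous_on_divide continuous_on_det continuous_on_cumulant2 ballI)
  show "continuous_on (interior (mgf_dom q)) (%t. (\<chi> r k. if k = i then axis j 1 $ r else cumulant2 (tl q t) $ r $ k) $ ra $ ja)" for ra ja
   by (cases "ja = i") (simp_all add: continuous_on_cumulant2)
  show "det (cumulant2 (tl q t)) \<noteq> 0" if "t \<in> interior (mgf_dom q)" for t
   using cumulant2_invertible[OF that] invertible_det_nz by blast
 qed
 then show ?thesis by (rule continuous_on_eq) (simp add: matrix_inv_cramer[OF cumulant2_invertible])
qed

lemma measurable_tilt [measurable]: "tilt q \<in> borel_measurable borel"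
 using measurable_tilt_comp[OF continuous_on_id] by (simp add: id_def)

lemma measurable_mgf_tilt [measurable]: "(%\<alpha>. mgf q (tilt q \<alpha>)) \<in> borel_measurable borel"
 by (rule measurable_tilt_comp[OF continuous_on_mgf])

lemma measurable_tl_tilt [measurable]:
 "(%(m, x). tl q (tilt q m) x) \<in> borel_measurable (borel \<Otimes>\<^sub>M borel)"
 unfolding tl_def using q_meas by measurable

lemma measurable_gexp_tilt [measurable]:
 "(%(m, x). gexp q (tilt q m) N a x) \<in> borel_measurable (borel \<Otimes>\<^sub>M borel)"
proof -
 define I where "I = (%m i j. matrix_inv (cumulant2 (tl q (tilt q m))) $ i $ j)"
 define G where "G = (%m j. gam q (tilt q m) $ j)"
 have I[measurable]: "(%m. I m i j) \<in> borel_measurable borel" for i j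
  unfolding I_def by (rule measurable_tilt_comp[OF continuous_on_matrix_inv_cumulant2])
 have G[measurable]: "(%m. G m j) \<in> borel_measurable borel" for j
  unfolding G_def by (rule measurable_tilt_comp[OF continuous_on_gam])
 have eq: "gexp q (tilt q m) N a x = (1 / (2 * N)) * (\<Sum>i\<in>UNIV. (\<Sum>j\<in>UNIV. (\<Sum>k\<in>UNIV. I m i k * I m k j) * G m j) * (x - a) $ i)
  - (\<Sum>i\<in>UNIV. (x - a) $ i * (\<Sum>j\<in>UNIV. I m i j * (x - a) $ j)) / (2 * N)" for m x
  unfolding gexp_def Let_def inner_scaleR_left by (simp add: inner_vec_def matrix_vector_mult_def matrix_matrix_mult_def I_def G_def)
 show ?thesis unfolding eq by measurable
qed

lemma measurable_gden_tilt [measurable]: "(%m. gden q (tilt q m) N a) \<in> borel_measurable borel"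
 unfolding gden_def by (rule lborel.borel_measurable_lebesgue_integral) measurable

text \<open>The ratio in \<open>local_limit\<close> for the tilted density, written by means of \<open>q\<close>: this form telescopes
 along a path.\<close>

definition urat :: "nat => real^'d => real^'d => real" where
 "urat N m x = mgf q (tilt q m) * exp (- (tilt q m \<bullet> x)) *
   (sum_pdf q N (real (Suc N) *\<^sub>R m - x) / sum_pdf q (Suc N) (real (Suc N) *\<^sub>R m))"

text \<open>The density of the approximating kernel relative to the tilted density.\<close>

definition wrat :: "nat => real^'d => real^'d => real^'d => real" where
 "wrat N a m x = exp (gexp q (tilt q m) (real N) a x) / gden q (tilt q m) (real N) a"

lemma measurable_urat [measurable]: "(%(m, x). urat N m x) \<in> borel_measurable (borel \<Otimes>\<^sub>M borel)"
proof -
 have [measurable]: "sum_pdf q k \<in> borel_measurable borel" for k by (rule sum_pdf_measurable[OF q_meas])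
 show ?thesis unfolding urat_def by measurable
qed

lemma measurable_wrat [measurable]: "(%(m, x). wrat N a m x) \<in> borel_measurable (borel \<Otimes>\<^sub>M borel)"
 unfolding wrat_def by measurable

text \<open>The tilting factors cancel: conditioning an exponential family on the sum removes the parameter.\<close>

lemma tl_urat:
 assumes "t \<in> mgf_dom q" "t = tilt q m"
 shows "tl q t x * urat N m x = q x * sum_pdf q N (real (Suc N) *\<^sub>R m - x) / sum_pdf q (Suc N) (real (Suc N) *\<^sub>R m)"
 using mgf_pos[OF assms(1)] unfolding tl_def urat_def assms(2) by (simp add: exp_minus field_simps)

lemma urat_eq:
 assumes "t \<in> mgf_dom q" "t = tilt q m" "N > 0"
 shows "urat N m x = sum_pdf (tl q t) N (real (Suc N) *\<^sub>R m - x) / sum_pdf (tl q t) (Suc N) (real (Suc N) *\<^sub>R m)"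
proof -
 obtain N' where N: "N = Suc N'" using assms(3) gr0_implies_Suc by blast
 let ?z = "real (Suc N) *\<^sub>R m"
 have g: "mgf q t > 0" by (rule mgf_pos[OF assms(1)])
 have e: "exp (t \<bullet> (?z - x)) = exp (t \<bullet> ?z) * exp (- (t \<bullet> x))"
  by (simp add: inner_diff_right exp_diff exp_minus divide_inverse)
 have "sum_pdf (tl q t) N (?z - x) = exp (t \<bullet> (?z - x)) / mgf q t ^ N * sum_pdf q N (?z - x)"
  unfolding N by (rule sum_pdf_tl)
 moreover have "sum_pdf (tl q t) (Suc N) ?z = exp (t \<bullet> ?z) / mgf q t ^ Suc N * sum_pdf q (Suc N) ?z" by (rule sum_pdf_tl)
 moreover have "(E * X / g ^ N * S) / (E / g ^ Suc N * U) = g * X * (S / U)" if "g > 0" "E > 0" for E X g S U :: real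
  using that by (simp add: field_simps)
 ultimately show ?thesis unfolding urat_def assms(2)[symmetric] e using g by simp
qed

end

lemma m_val_update: "i < j ==> m_val n a (y(j := x)) i = m_val n a y i"
 unfolding m_val_def by (intro arg_cong2[where f=scaleR] arg_cong2[where f=minus] sum.cong refl) auto

lemma m_val_0: "n \<ge> 1 ==> m_val n a y 0 = a"
 by (simp add: m_val_def)

lemma m_val_scaled: "i < n ==> (real n - real i) *\<^sub>R m_val n a y i = real n *\<^sub>R a - (\<Sum>j=1..i. y j)"
 by (simp add: m_val_def scaleR_diff_right)

lemma m_val_Suc:
 assumes "Suc j < n"
 shows "m_val n a y (Suc j) = m_val n a y j - (1 / real (n - Suc j)) *\<^sub>R (y (Suc j) - m_val n a y j)"
proof -
 let ?N = "real (n - Suc j)"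
 have N: "?N \<noteq> 0" "real n - real (Suc j) = ?N" "real n - real j = ?N + 1" using assms by auto
 have "?N *\<^sub>R m_val n a y (Suc j) = (?N + 1) *\<^sub>R m_val n a y j - y (Suc j)"
  using m_val_scaled[OF assms, of a y] m_val_scaled[of j n a y] assms unfolding N(2,3) by simp
 then have "?N *\<^sub>R m_val n a y (Suc j) = ?N *\<^sub>R m_val n a y j - (y (Suc j) - m_val n a y j)"
  by (simp add: scaleR_add_left)
 then have "(1 / ?N) *\<^sub>R (?N *\<^sub>R m_val n a y (Suc j)) = (1 / ?N) *\<^sub>R (?N *\<^sub>R m_val n a y j - (y (Suc j) - m_val n a y j))"
  by (simp only:)
 then show ?thesis using N(1) by (simp add: scaleR_diff_right)
qed

lemma measurable_m_val: "i \<le> j ==> (%y. m_val n a y i) \<in> borel_measurable (paths j :: (nat => real^'d) measure)"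
 unfolding m_val_def
 by (intro borel_measurable_scaleR borel_measurable_diff borel_measurable_const borel_measurable_sum
   measurable_component_singleton[where M="%_. lborel", THEN measurable_compose, where g="%x. x"]) auto

lemma measurable_path_component: "1 \<le> i ==> i \<le> j ==> (%y. y i) \<in> borel_measurable (paths j :: (nat => real^'d) measure)"
 using measurable_component_singleton[of i "{1..j}" "%_. lborel :: (real^'d) measure"] by simp

lemma measurable_path_fun:
 assumes "(%(m, x). f m x) \<in> borel_measurable (borel \<Otimes>\<^sub>M borel)" and "1 \<le> i" "i \<le> j"
 shows "(%y. f (m_val n a y (i - 1)) (y i)) \<in> borel_measurable (paths j :: (nat => real^'d) measure)"
proof -
 have "(%y. (m_val n a y (i - 1), y i)) \<in> measurable (paths j) (borel \<Otimes>\<^sub>M borel :: ((real^'d) \<times> (real^'d)) measure)"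
  using assms(2,3) by (intro measurable_Pair measurable_m_val measurable_path_component) auto
 from measurable_compose[OF this assms(1)] show ?thesis by simp
qed

context pdf
begin

lemma gexp_integrable:
 assumes m: "m \<in> mrange" and N: "N \<ge> 1"
 shows "integrable lborel (%z. exp (gexp q (tilt q m) (real N) a z) * tl q (tilt q m) z)"
  and "0 < gden q (tilt q m) (real N) a"
proof -
 define n where "n = N + 2"
 define s where "s = real n *\<^sub>R a - (real n - 1) *\<^sub>R m"
 \<comment> \<open>Every point of the range is the value of \<open>m_val\<close> on a suitable path of length one.\<close>
 have "(real n - real 1) *\<^sub>R m_val n a (%_. s) 1 = (real n - real 1) *\<^sub>R m"
  by (subst m_val_scaled) (simp_all add: s_def n_def)
 then have mv: "m_val n a (%_. s) 1 = m" by (simp add: n_def)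
 note g = g_kernel_props[of n a "%_. s" 1 "real N", unfolded mv]
 show "integrable lborel (%z. exp (gexp q (tilt q m) (real N) a z) * tl q (tilt q m) z)"
  by (rule g(2)) (use tilt_props(1)[OF m] N in \<open>simp_all add: n_def\<close>)
 show "0 < gden q (tilt q m) (real N) a"
  by (rule g(3)) (use tilt_props(1)[OF m] N in \<open>simp_all add: n_def\<close>)
qed

lemma tl_tilt_mass:
 assumes m: "m \<in> mrange"
 shows "integrable lborel (tl q (tilt q m))" "(LBINT x. tl q (tilt q m) x) = 1" "0 \<le> tl q (tilt q m) x"
proof -
 interpret T: pdf "tl q (tilt q m)" by (rule pdf_tl[OF interior_dom_dom[OF tilt_props(1)[OF m]]])
 show "integrable lborel (tl q (tilt q m))" "(LBINT x. tl q (tilt q m) x) = 1" "0 \<le> tl q (tilt q m) x"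
  by (rule T.q_int T.q_mass T.q_nonneg)+
qed

lemma tl_wrat_mass:
 assumes m: "m \<in> mrange" and N: "N \<ge> 1"
 shows "integrable lborel (%x. tl q (tilt q m) x * wrat N a m x)" "(LBINT x. tl q (tilt q m) x * wrat N a m x) = 1"
proof -
 have eq: "tl q (tilt q m) x * wrat N a m x = exp (gexp q (tilt q m) (real N) a x) * tl q (tilt q m) x / gden q (tilt q m) (real N) a" for x
  unfolding wrat_def by (simp only: times_divide_eq_right mult.commute)
 show "integrable lborel (%x. tl q (tilt q m) x * wrat N a m x)"
  unfolding eq by (intro integrable_divide gexp_integrable[OF m N])
 have "(LBINT x. exp (gexp q (tilt q m) (real N) a x) * tl q (tilt q m) x / gden q (tilt q m) (real N) a)
   = gden q (tilt q m) (real N) a / gden q (tilt q m) (real N) a"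
  unfolding integral_divide_zero gden_def ..
 then show "(LBINT x. tl q (tilt q m) x * wrat N a m x) = 1"
  unfolding eq using gexp_integrable(2)[OF m N, of a] by simp
qed

lemma tl_urat_mass:
 assumes m: "m \<in> mrange" and N: "N \<ge> 1" and B: "!!x. sum_pdf q N x \<le> B"
  and pos: "0 < sum_pdf q (Suc N) (real (Suc N) *\<^sub>R m)"
 shows "integrable lborel (%x. tl q (tilt q m) x * urat N m x)" "(LBINT x. tl q (tilt q m) x * urat N m x) = 1"
proof -
 let ?z = "real (Suc N) *\<^sub>R m"
 obtain N' where N': "N = Suc N'" using N by (cases N) auto
 have [measurable]: "sum_pdf q k \<in> borel_measurable borel" for k by (rule sum_pdf_measurable[OF q_meas])
 have nn: "(\<integral>\<^sup>+y. ennreal (q y * sum_pdf q N (?z - y)) \<partial>lborel) = ennreal (sum_pdf q (Suc N) ?z)"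
  using sum_pdf_conv_nn[of N' B ?z] B unfolding N' by blast
 have i: "integrable lborel (%y. q y * sum_pdf q N (?z - y))"
 proof (rule integrableI_nonneg)
  show "AE y in lborel. 0 \<le> q y * sum_pdf q N (?z - y)"
   by (intro AE_I2 mult_nonneg_nonneg q_nonneg sum_pdf_nonneg)
 qed (use q_meas nn in simp_all)
 have v: "(LBINT y. q y * sum_pdf q N (?z - y)) = sum_pdf q (Suc N) ?z"
  using sum_pdf_Suc[of N q ?z] N by simp
 note eq = tl_urat[OF interior_dom_dom[OF tilt_props(1)[OF m]] refl]
 show "integrable lborel (%x. tl q (tilt q m) x * urat N m x)" unfolding eq by (intro integrable_divide i)
 show "(LBINT x. tl q (tilt q m) x * urat N m x) = 1" unfolding eq integral_divide_zero v using pos by simp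
qed

text \<open>The kernels of the approximating density, replaced by \<open>q\<close> where the tilting equation has no
 solution, so that they are probability densities at every point.\<close>

definition gker :: "nat => real^'d => nat => real^'d => real^'d => real" where
 "gker n a i m x = (if m \<in> mrange then tl q (tilt q m) x * (if i = 1 then 1 else wrat (n - i) a m x) else q x)"

lemma gker_mass:
 assumes "i < n"
 shows "(\<integral>\<^sup>+x. ennreal (gker n a i m x) \<partial>lborel) = 1"
proof -
 have N: "n - i \<ge> 1" using assms by simp
 have "0 \<le> wrat (n - i) a m x" if "m \<in> mrange" for x
  using gexp_integrable(2)[OF that N, of a] by (simp add: wrat_def)
 then have nn: "0 \<le> gker n a i m x" for x
  by (simp add: gker_def tl_tilt_mass(3) q_nonneg)
 have "integrable lborel (gker n a i m) \<and> (LBINT x. gker n a i m x) = 1"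
 proof (cases "m \<in> mrange")
  case True
  show ?thesis
   using tl_tilt_mass[OF True] tl_wrat_mass[OF True N, of a] True unfolding gker_def[abs_def] by (cases "i = 1") simp_all
 next
  case False
  then show ?thesis using q_int q_mass unfolding gker_def[abs_def] by simp
 qed
 then show ?thesis using nn_integral_eq_integral[of lborel "gker n a i m"] nn by simp
qed

lemma gker_pos:
 assumes "i < n" "0 < q x"
 shows "0 < gker n a i m x"
proof -
 have N: "n - i \<ge> 1" using assms by simp
 have "0 < tl q (tilt q m) x" if "m \<in> mrange"
  unfolding tl_def using mgf_pos[OF interior_dom_dom[OF tilt_props(1)[OF that]]] assms by simp
 moreover have "0 < wrat (n - i) a m x" if "m \<in> mrange"
  unfolding wrat_def using gexp_integrable(2)[OF that N, of a] by simp
 ultimately show ?thesis using assms by (auto simp: gker_def)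
qed

lemma gker_zero: "q x = 0 ==> gker n a i m x = 0"
 by (simp add: gker_def tl_def)

lemma gker_nonneg: "i < n ==> 0 \<le> gker n a i m x"
 using gker_pos[of i n x a m] gker_zero[of x n a i m] q_nonneg[of x] by (cases "q x = 0") auto

lemma measurable_gker: "(%(m, x). gker n a i m x) \<in> borel_measurable (borel \<Otimes>\<^sub>M borel)"
proof -
 have [measurable]: "mrange \<in> sets borel" by (rule borel_open[OF open_mrange])
 show ?thesis unfolding gker_def using q_meas by (cases "i = 1") simp_all
qed

text \<open>On paths through zeros of the density both products vanish, so the kernels may be replaced
  by \<open>q\<close> wherever the tilting equation has no solution.\<close>

lemma g_pdf_eq:
 assumes k: "1 \<le> k" "k < n" and a: "a \<in> mrange"
  and adm: "!!i y. i \<in> {1..<k} ==> (\<forall>j\<in>{1..i}. q (y j) > 0) ==> m_val n a y i \<in> mrange"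
 shows "g_pdf q n k a y = (\<Prod>i=1..k. gker n a i (m_val n a y (i - 1)) (y i))"
proof -
 let ?G = "%i. gker n a i (m_val n a y (i - 1)) (y i)"
 have "(\<Prod>i=1..k. ?G i) = (\<Prod>i\<in>{1..<Suc k}. ?G i)" by (simp add: atLeastLessThanSuc_atLeastAtMost)
 also have "... = ?G 1 * (\<Prod>i\<in>{Suc 1..<Suc k}. ?G i)" using k by (intro prod.atLeast_Suc_lessThan) auto
 also have "(\<Prod>i\<in>{Suc 1..<Suc k}. ?G i) = (\<Prod>i\<in>{1..<k}. ?G (Suc i))" by (rule prod.shift_bounds_Suc_ivl)
 finally have R: "(\<Prod>i=1..k. ?G i) = ?G 1 * (\<Prod>i\<in>{1..<k}. ?G (Suc i))" .
 have n: "n \<ge> 1" using k by simp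
 have G1: "?G 1 = tilted q a (y 1)" using a m_val_0[OF n, of a y] by (simp add: gker_def tilted_eq_tl)
 show ?thesis
 proof (cases "\<forall>j\<in>{1..<k}. q (y j) > 0")
  case True
  have "(\<Prod>i\<in>{1..<k}. ?G (Suc i)) = (\<Prod>i=1..<k. g_kernel q n a y i (y (i + 1)))"
  proof (rule prod.cong[OF refl])
   fix i assume i: "i \<in> {1..<k}"
   have m: "m_val n a y i \<in> mrange" using True i by (intro adm) auto
   have N: "real (n - Suc i) = real n - real i - 1" "real (n - Suc i) > 0" using i k by auto
   show "?G (Suc i) = g_kernel q n a y i (y (i + 1))"
    unfolding g_kernel_props(1)[OF tilt_props(1)[OF m] N(2,1)] using m i by (simp add: gker_def wrat_def)
  qed
  then show ?thesis unfolding R G1 g_pdf_def by simp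
 next
  case False
  then obtain j where j': "j \<in> {1..<k}" "\<not> 0 < q (y j)" by blast
  then have j: "j \<in> {1..<k}" "q (y j) = 0" using q_nonneg[of "y j"] by simp_all
  have "?G j = 0" by (rule gker_zero[OF j(2)])
  then have "(\<Prod>i=1..k. ?G i) = 0" using j by (intro prod_zero bexI[of _ j]) auto
  moreover have "g_pdf q n k a y = 0"
  proof (cases "j = 1")
   case True
   then show ?thesis using j by (simp add: g_pdf_def tilted_def)
  next
   case False
   then have "j - 1 \<in> {1..<k}" "g_kernel q n a y (j - 1) (y (j - 1 + 1)) = 0" using j by (auto simp: g_kernel_def Let_def)
   then have "(\<Prod>i=1..<k. g_kernel q n a y i (y (i + 1))) = 0" by (intro prod_zero) auto
   then show ?thesis by (simp add: g_pdf_def)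
  qed
  ultimately show ?thesis by simp
 qed
qed

lemma g_pdf_props:
 assumes k: "1 \<le> k" "k < n" and a: "a \<in> mrange"
  and adm: "!!i y. i \<in> {1..<k} ==> (\<forall>j\<in>{1..i}. q (y j) > 0) ==> m_val n a y i \<in> mrange"
 shows "g_pdf q n k a \<in> borel_measurable (paths k)" "(\<integral>\<^sup>+y. ennreal (g_pdf q n k a y) \<partial>paths k) = 1"
  "0 \<le> g_pdf q n k a y" "(\<forall>j\<in>{1..k}. 0 < q (y j)) ==> 0 < g_pdf q n k a y"
  "(\<exists>j\<in>{1..k}. q (y j) = 0) ==> g_pdf q n k a y = 0"
proof -
 have eq: "g_pdf q n k a y = (\<Prod>i=1..k. gker n a i (m_val n a y (i - 1)) (y i))" for y
  by (rule g_pdf_eq[OF k a]) (rule adm)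
 have "(%y. \<Prod>i=1..k. gker n a i (m_val n a y (i - 1)) (y i)) \<in> borel_measurable (paths k)"
  by (intro borel_measurable_prod measurable_path_fun measurable_gker) auto
 then show "g_pdf q n k a \<in> borel_measurable (paths k)" unfolding eq[abs_def] .
 show "0 \<le> g_pdf q n k a y" unfolding eq using k by (intro prod_nonneg gker_nonneg) auto
 show "0 < g_pdf q n k a y" if "\<forall>j\<in>{1..k}. 0 < q (y j)" unfolding eq using k that by (intro prod_pos gker_pos) auto
 show "g_pdf q n k a y = 0" if z: "\<exists>j\<in>{1..k}. q (y j) = 0"
 proof -
  obtain j where j: "j \<in> {1..k}" "q (y j) = 0" using z by blast
  have "gker n a j (m_val n a y (j - 1)) (y j) = 0" by (rule gker_zero[OF j(2)])
  then show ?thesis unfolding eq using j by (intro prod_zero bexI[of _ j]) auto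
 qed
 have "(\<integral>\<^sup>+y. (\<Prod>i=1..k. ennreal (gker n a i (m_val n a y (i - 1)) (y i))) * 1 \<partial>paths k) = 1"
 proof (rule nn_integral_path_eq[where \<Theta>="%_ _. 1" and k=k])
  show "(%y. ennreal (gker n a i (m_val n a y (i - 1)) (y i))) \<in> borel_measurable (paths j)" if "1 \<le> i" "i \<le> j" for i j
   by (intro measurable_compose[OF measurable_path_fun[OF measurable_gker that]] measurable_ennreal)
  show "ennreal (gker n a i (m_val n a (y(j := x)) (i - 1)) ((y(j := x)) i)) = ennreal (gker n a i (m_val n a y (i - 1)) (y i))"
   if "i < j" for i j y x using that by (simp add: m_val_update)
  show "(\<integral>\<^sup>+x. ennreal (gker n a (Suc j) (m_val n a (y(Suc j := x)) (Suc j - 1)) ((y(Suc j := x)) (Suc j))) * 1 \<partial>lborel) = 1"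
   if "j < k" for j y
   using gker_mass[of "Suc j" n a "m_val n a y j"] that k by (simp add: m_val_update)
 qed simp_all
 moreover have "(\<Prod>i=1..k. ennreal (gker n a i (m_val n a y (i - 1)) (y i))) = ennreal (g_pdf q n k a y)" for y
  unfolding eq using k by (intro prod_ennreal gker_nonneg) auto
 ultimately show "(\<integral>\<^sup>+y. ennreal (g_pdf q n k a y) \<partial>paths k) = 1" by simp
qed

lemma measurable_path_sum: "(%y. \<Sum>i=1..j. y i) \<in> borel_measurable (paths j :: (nat => real^'d) measure)"
 by (intro borel_measurable_sum measurable_path_component) auto

lemma cond_pdf_props:
 assumes k: "1 \<le> k" "k < n" and bdd: "!!N. n - k \<le> N ==> \<exists>B. \<forall>x. sum_pdf q N x \<le> B"
  and pos: "0 < sum_pdf q n (real n *\<^sub>R a)"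
 shows "cond_pdf q n k a \<in> borel_measurable (paths k)" "(\<integral>\<^sup>+y. ennreal (cond_pdf q n k a y) \<partial>paths k) = 1"
  "0 \<le> cond_pdf q n k a y" "(\<exists>j\<in>{1..k}. q (y j) = 0) ==> cond_pdf q n k a y = 0"
proof -
 have [measurable]: "sum_pdf q N \<in> borel_measurable borel" for N by (rule sum_pdf_measurable[OF q_meas])
 have qy: "(%y. q (y i)) \<in> borel_measurable (paths j)" if "1 \<le> i" "i \<le> j" for i j
  using measurable_compose[OF measurable_path_component[OF that] q_meas] .
 have Sm: "(%y. sum_pdf q N (s - (\<Sum>i=1..j. y i))) \<in> borel_measurable (paths j)" for N s j
  by (rule measurable_compose[OF borel_measurable_diff[OF borel_measurable_const measurable_path_sum]]) measurable
 let ?z = "real n *\<^sub>R a"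
 show m: "cond_pdf q n k a \<in> borel_measurable (paths k)"
  unfolding cond_pdf_def[abs_def] joint_pdf_def
  by (intro borel_measurable_divide borel_measurable_times borel_measurable_const borel_measurable_prod qy Sm) auto
 show nn: "0 \<le> cond_pdf q n k a y" for y
  unfolding cond_pdf_def joint_pdf_def using q_nonneg pos sum_pdf_nonneg[OF q_nonneg]
  by (intro divide_nonneg_nonneg mult_nonneg_nonneg prod_nonneg) auto
 show "cond_pdf q n k a y = 0" if "\<exists>j\<in>{1..k}. q (y j) = 0"
 proof -
  have "(\<Prod>i=1..k. q (y i)) = 0" using that by (intro prod_zero) auto
  then show ?thesis unfolding cond_pdf_def joint_pdf_def by simp
 qed
 have "(\<integral>\<^sup>+y. (\<Prod>i=1..k. ennreal (q (y i))) * ennreal (sum_pdf q (n - k) (?z - (\<Sum>i=1..k. y i))) \<partial>paths k)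
  = ennreal (sum_pdf q (n - 0) (?z - (\<Sum>i\<in>{1..0::nat}. undefined)))"
 proof (rule nn_integral_path_eq[where \<Theta>="%j y. ennreal (sum_pdf q (n - j) (?z - (\<Sum>i=1..j. y i)))" and k=k])
  show "(%y. ennreal (q (y i))) \<in> borel_measurable (paths j)" if "1 \<le> i" "i \<le> j" for i j
   by (intro measurable_compose[OF qy[OF that]] measurable_ennreal)
  show "(%y. ennreal (sum_pdf q (n - j) (?z - (\<Sum>i=1..j. y i)))) \<in> borel_measurable (paths j)" for j
   by (intro measurable_compose[OF Sm] measurable_ennreal)
  show "ennreal (q ((y(j := x)) i)) = ennreal (q (y i))" if "i < j" for i j :: nat and y x using that by simp
  fix j and y :: "nat => real^'d" assume j: "j < k"
  obtain N where N: "n - Suc j = Suc N" using j k by (metis Suc_diff_Suc less_trans_Suc order_less_trans zero_less_diff gr0_implies_Suc)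
  have nj: "n - j = Suc (Suc N)" using N by simp
  have "n - k \<le> Suc N" unfolding N[symmetric] using j by simp
  then obtain B where B: "!!x. sum_pdf q (Suc N) x \<le> B" using bdd by blast
  have s: "(\<Sum>i=1..Suc j. (y(Suc j := x)) i) = (\<Sum>i=1..j. y i) + x" for x
  proof -
   have "(\<Sum>i=1..j. (y(Suc j := x)) i) = (\<Sum>i=1..j. y i)" by (intro sum.cong) auto
   then show ?thesis by simp
  qed
  show "(\<integral>\<^sup>+x. ennreal (q ((y(Suc j := x)) (Suc j))) * ennreal (sum_pdf q (n - Suc j) (?z - (\<Sum>i=1..Suc j. (y(Suc j := x)) i))) \<partial>lborel)
   = ennreal (sum_pdf q (n - j) (?z - (\<Sum>i=1..j. y i)))"
   unfolding s N nj sum_pdf_conv_nn[OF B, symmetric]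
   by (intro nn_integral_cong) (simp add: ennreal_mult q_nonneg sum_pdf_nonneg diff_diff_eq)
 qed simp
 then have tot: "(\<integral>\<^sup>+y. (\<Prod>i=1..k. ennreal (q (y i))) * ennreal (sum_pdf q (n - k) (?z - (\<Sum>i=1..k. y i))) \<partial>paths k)
  = ennreal (sum_pdf q n ?z)" by simp
 have e: "ennreal (cond_pdf q n k a y) = (\<Prod>i=1..k. ennreal (q (y i))) * ennreal (sum_pdf q (n - k) (?z - (\<Sum>i=1..k. y i))) / ennreal (sum_pdf q n ?z)" for y
 proof -
  have "(\<Prod>i=1..k. ennreal (q (y i))) = ennreal (\<Prod>i=1..k. q (y i))" by (rule prod_ennreal) (simp add: q_nonneg)
  then show ?thesis
   unfolding cond_pdf_def joint_pdf_def using pos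
   by (simp add: ennreal_mult[symmetric] divide_ennreal prod_nonneg q_nonneg sum_pdf_nonneg)
 qed
 have mm: "(%y. (\<Prod>i=1..k. ennreal (q (y i))) * ennreal (sum_pdf q (n - k) (?z - (\<Sum>i=1..k. y i)))) \<in> borel_measurable (paths k)"
  by (intro borel_measurable_times_ennreal borel_measurable_prod_ennreal measurable_compose[OF qy] measurable_compose[OF Sm] measurable_ennreal) auto
 show "(\<integral>\<^sup>+y. ennreal (cond_pdf q n k a y) \<partial>paths k) = 1"
  unfolding e nn_integral_divide[OF mm] tot using pos by (simp add: ennreal_divide_self less_imp_neq[THEN not_sym])
qed

end

section \<open>The reference chain near the limit point\<close>

text \<open>One set of constants for all means in a ball around the limit of the conditioning points.\<close>

locale near_point = pdf q for q :: "real^'d => real" +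
 fixes astar :: "real^'d" and \<delta> C A M :: real and N1 :: nat
 assumes delta: "\<delta> > 0" and csts: "C \<ge> 0" "M \<ge> 0" "N1 \<ge> 1"
  and near: "m \<in> cball astar \<delta> ==> m \<in> mrange"
  and bdd: "N \<ge> N1 ==> \<exists>B. \<forall>x. sum_pdf q N x \<le> B"
  and pos: "m \<in> cball astar \<delta> ==> N \<ge> N1 ==> 0 < sum_pdf q (Suc N) (real (Suc N) *\<^sub>R m)"
  and urat_var: "m \<in> cball astar \<delta> ==> N \<ge> N1 ==>
    integrable lborel (%x. tl q (tilt q m) x * (urat N m x - 1)\<^sup>2) \<and>
    (LBINT x. tl q (tilt q m) x * (urat N m x - 1)\<^sup>2) \<le> C / (real N)\<^sup>2"
  and wrat_var: "m \<in> cball astar \<delta> ==> N \<ge> N1 ==> norm a \<le> A ==>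
    integrable lborel (%x. tl q (tilt q m) x * (wrat N a m x - 1)\<^sup>2) \<and>
    (LBINT x. tl q (tilt q m) x * (wrat N a m x - 1)\<^sup>2) \<le> C / (real N)\<^sup>2"
  and second_moment: "m \<in> cball astar \<delta> ==>
    integrable lborel (%x. (norm (x - m))\<^sup>2 * tl q (tilt q m) x) \<and>
    (LBINT x. (norm (x - m))\<^sup>2 * tl q (tilt q m) x) \<le> M"

lemma (in pdf) near_point_exists:
 assumes inv: "integrable lborel (%s. ft q s ^ Suc N0)" and astar: "astar \<in> mrange"
 shows "\<exists>\<delta> C M N1. near_point q astar \<delta> C A M N1"
proof -
 define t0 where "t0 = tilt q astar"
 have t0: "t0 \<in> interior (mgf_dom q)" "mean_fun q t0 = astar" unfolding t0_def by (rule tilt_props[OF astar])+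
 obtain r \<eta> c K L where r: "r > 0" "\<eta> > 0" "c > 0" "cball t0 r \<subseteq> interior (mgf_dom q)"
  and reg: "!!t. t \<in> cball t0 r ==> regular \<eta> c K L (mean_fun q t) (tl q t)"
  using tilted_regular[OF t0(1) inv] by blast
 obtain C1 Na where C1: "C1 \<ge> 0"
  and posL: "!!m \<pi> n. regular \<eta> c K L m (\<pi> :: real^'d => real) ==> n \<ge> Na ==> 0 < sum_pdf \<pi> (Suc n) (real (Suc n) *\<^sub>R m)"
  and intL: "!!m \<pi> n. regular \<eta> c K L m (\<pi> :: real^'d => real) ==> n \<ge> Na ==>
    integrable lborel (%x. \<pi> x * (sum_pdf \<pi> n (real (Suc n) *\<^sub>R m - x) / sum_pdf \<pi> (Suc n) (real (Suc n) *\<^sub>R m) - 1)\<^sup>2)"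
  and leL: "!!m \<pi> n. regular \<eta> c K L m (\<pi> :: real^'d => real) ==> n \<ge> Na ==>
    (LBINT x. \<pi> x * (sum_pdf \<pi> n (real (Suc n) *\<^sub>R m - x) / sum_pdf \<pi> (Suc n) (real (Suc n) *\<^sub>R m) - 1)\<^sup>2) \<le> C1 / (real n)\<^sup>2"
  using local_limit[where 'd='d, OF r(3,2), of K L] by blast
 obtain C2 Nb where C2: "C2 \<ge> 0"
  and ker: "!!t m N a. t \<in> interior (mgf_dom q) ==> regular \<eta> c K L m (tl q t) ==> norm a \<le> A ==> N \<ge> Nb ==>
    integrable lborel (%x. exp (gexp q t N a x) * tl q t x) ==>
    integrable lborel (%x. tl q t x * (exp (gexp q t N a x) / gden q t N a - 1)\<^sup>2) \<and>
    (LBINT x. tl q t x * (exp (gexp q t N a x) / gden q t N a - 1)\<^sup>2) \<le> C2 / N\<^sup>2"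
  using kernel_ratio[OF r(3,2), of K L A] by blast
 obtain M where M: "M \<ge> 0"
  and mom: "!!c L m \<pi>. regular \<eta> c K L m (\<pi> :: real^'d => real) ==> integrable lborel (%x. norm (x - m) ^ 2 * \<pi> x)"
   "!!c L m \<pi>. regular \<eta> c K L m (\<pi> :: real^'d => real) ==> (LBINT x. norm (x - m) ^ 2 * \<pi> x) \<le> M"
  using regular_central_moment[where 'd='d, OF r(2), of K 2] by blast
 have "open (mean_fun q ` ball t0 r)" by (intro mean_fun_open subset_trans[OF ball_subset_cball r(4)]) simp
 moreover have "astar \<in> mean_fun q ` ball t0 r" using t0(2) r(1) by (auto intro!: image_eqI[of _ _ t0])
 ultimately obtain \<delta> where d: "\<delta> > 0" "cball astar \<delta> \<subseteq> mean_fun q ` ball t0 r"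
  unfolding open_contains_cball by blast
 have K: "m \<in> mrange" "regular \<eta> c K L m (tl q (tilt q m))" if mK: "m \<in> cball astar \<delta>" for m
 proof -
  obtain t where t: "t \<in> ball t0 r" "m = mean_fun q t" using d(2) mK by blast
  have tc: "t \<in> cball t0 r" using t(1) ball_subset_cball by blast
  then have ti: "t \<in> interior (mgf_dom q)" using r(4) by blast
  show "m \<in> mrange" unfolding t(2) mrange_def using ti by blast
  show "regular \<eta> c K L m (tl q (tilt q m))" unfolding t(2) tilt_mean_fun[OF ti] by (rule reg[OF tc])
 qed
 define N1 where "N1 = max Na (max (nat \<lceil>Nb\<rceil>) (N0 + 2))"
 have N1: "N \<ge> Na" "real N \<ge> Nb" "N \<ge> N0 + 2" if "N \<ge> N1" for N
 proof -
  have "nat \<lceil>Nb\<rceil> \<le> N" using that by (simp add: N1_def)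
  then show "real N \<ge> Nb" by (simp add: nat_le_iff ceiling_le_iff)
 qed (use that in \<open>simp_all add: N1_def\<close>)
 have inv': "integrable lborel (%s. norm (ft q s) ^ Suc N0)" using integrable_norm[OF inv] by (simp only: norm_power)
 have CC: "C1 / (real N)\<^sup>2 \<le> max C1 C2 / (real N)\<^sup>2" "C2 / (real N)\<^sup>2 \<le> max C1 C2 / (real N)\<^sup>2" for N
  by (intro divide_right_mono; simp)+
 have "near_point q astar \<delta> (max C1 C2) A M N1"
 proof
  show "\<delta> > 0" "max C1 C2 \<ge> 0" "M \<ge> 0" "N1 \<ge> 1" using d C1 M by (simp_all add: N1_def)
 next
  fix m assume m: "m \<in> cball astar \<delta>"
  note ti = tilt_props(1)[OF K(1)[OF m]]
  show "m \<in> mrange" by (rule K(1)[OF m])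
  show "integrable lborel (%x. (norm (x - m))\<^sup>2 * tl q (tilt q m) x) \<and>
    (LBINT x. (norm (x - m))\<^sup>2 * tl q (tilt q m) x) \<le> M"
   using mom[OF K(2)[OF m]] by blast
  fix N assume "N \<ge> N1"
  note N = N1[OF this]
  have N0: "N > 0" using N(3) by simp
  have "0 < sum_pdf (tl q (tilt q m)) (Suc N) (real (Suc N) *\<^sub>R m)" by (rule posL[OF K(2)[OF m] N(1)])
  moreover have "0 < exp (tilt q m \<bullet> (real (Suc N) *\<^sub>R m)) / mgf q (tilt q m) ^ Suc N"
   by (intro divide_pos_pos zero_less_power mgf_pos interior_dom_dom[OF ti]) simp
  ultimately show "0 < sum_pdf q (Suc N) (real (Suc N) *\<^sub>R m)"
   unfolding sum_pdf_tl by (rule zero_less_mult_pos)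
  note ur = urat_eq[OF interior_dom_dom[OF ti] refl N0]
  show "integrable lborel (%x. tl q (tilt q m) x * (urat N m x - 1)\<^sup>2) \<and>
    (LBINT x. tl q (tilt q m) x * (urat N m x - 1)\<^sup>2) \<le> max C1 C2 / (real N)\<^sup>2"
   unfolding ur by (rule conjI[OF intL[OF K(2)[OF m] N(1)] order_trans[OF leL[OF K(2)[OF m] N(1)] CC(1)]])
  fix a :: "real^'d" assume a: "norm a \<le> A"
  have "integrable lborel (%z. exp (gexp q (tilt q m) (real N) a z) * tl q (tilt q m) z)"
   by (rule gexp_integrable(1)[OF K(1)[OF m]]) (use N0 in simp)
  note k2 = ker[OF ti K(2)[OF m] a N(2) this]
  show "integrable lborel (%x. tl q (tilt q m) x * (wrat N a m x - 1)\<^sup>2) \<and>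
    (LBINT x. tl q (tilt q m) x * (wrat N a m x - 1)\<^sup>2) \<le> max C1 C2 / (real N)\<^sup>2"
   unfolding wrat_def by (rule conjI[OF k2[THEN conjunct1] order_trans[OF k2[THEN conjunct2] CC(2)]])
 next
  fix N assume "N \<ge> N1"
  note N = N1[OF this]
  obtain l where l: "N = Suc (Suc l)" "N0 \<le> l"
  proof
   show "N = Suc (Suc (N - 2))" "N0 \<le> N - 2" using N(3) by simp_all
  qed
  have "integrable lborel (%s. ft q s ^ Suc l)" by (rule integrable_ft_power_mono(2)[OF inv']) (use l in simp)
  then show "\<exists>B. \<forall>x. sum_pdf q N x \<le> B" unfolding l(1) using sum_pdf_bounded by blast
 qed
 then show ?thesis by blast
qed

context near_point
begin

abbreviation "K \<equiv> cball astar \<delta>"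

text \<open>The reference chain draws from the tilted density whose mean is the current \<open>m_val\<close>, as long as this
 mean stays in the ball, and from \<open>q\<close> afterwards.\<close>

definition tk :: "real^'d => real^'d => real" where
 "tk m x = (if m \<in> K then tl q (tilt q m) x else q x)"

definition uk :: "nat => real^'d => real^'d => real" where
 "uk N m x = (if m \<in> K then urat N m x else 1)"

definition wk :: "nat => nat => real^'d => real^'d => real^'d => real" where
 "wk n i a m x = (if m \<in> K \<and> i \<noteq> 1 then wrat (n - i) a m x else 1)"

lemma K_borel [measurable]: "K \<in> sets borel"
 by simp

lemma measurable_tk: "(%(m, x). tk m x) \<in> borel_measurable (borel \<Otimes>\<^sub>M borel)"
 unfolding tk_def using q_meas by measurable

lemma measurable_uk: "(%(m, x). uk N m x) \<in> borel_measurable (borel \<Otimes>\<^sub>M borel)"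
 unfolding uk_def by measurable

lemma measurable_wk: "(%(m, x). wk n i a m x) \<in> borel_measurable (borel \<Otimes>\<^sub>M borel)"
 unfolding wk_def by (cases "i = 1") simp_all

lemma tk_mass: "integrable lborel (tk m)" "(LBINT x. tk m x) = 1" "0 \<le> tk m x"
 using tl_tilt_mass[OF near, of m] q_int q_mass q_nonneg unfolding tk_def[abs_def] by (cases "m \<in> K"; simp)+

lemma uk_nonneg: "0 \<le> uk N m x"
proof (cases "m \<in> K")
 case True
 have S: "0 \<le> sum_pdf q l z" for l z by (rule sum_pdf_nonneg) (rule q_nonneg)
 have g: "0 \<le> mgf q (tilt q m)" by (rule less_imp_le[OF mgf_pos[OF interior_dom_dom[OF tilt_props(1)[OF near[OF True]]]]])
 have "0 \<le> urat N m x" unfolding urat_def by (intro mult_nonneg_nonneg divide_nonneg_nonneg S g exp_ge_zero)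
 then show ?thesis using True by (simp only: uk_def if_True)
next
 case False
 then show ?thesis by (simp only: uk_def if_False zero_le_one)
qed

lemma wk_nonneg: "0 \<le> wk n i a m x"
proof (cases "m \<in> K \<and> i \<noteq> 1")
 case True
 then have m: "m \<in> K" by blast
 have "0 \<le> gden q (tilt q m) N a" for N
  unfolding gden_def by (intro integral_nonneg_AE AE_I2 mult_nonneg_nonneg tl_tilt_mass(3) near m exp_ge_zero)
 then have "0 \<le> wrat (n - i) a m x" unfolding wrat_def by (intro divide_nonneg_nonneg exp_ge_zero)
 then show ?thesis unfolding wk_def if_P[OF True] .
next
 case False
 then show ?thesis unfolding wk_def if_not_P[OF False] by simp
qed

lemma uk_step:
 assumes N: "N \<ge> N1"
 shows "integrable lborel (%x. tk m x * uk N m x)" "(LBINT x. tk m x * uk N m x) = 1"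
  "integrable lborel (%x. tk m x * (uk N m x - 1)\<^sup>2)" "(LBINT x. tk m x * (uk N m x - 1)\<^sup>2) \<le> C / (real N)\<^sup>2"
proof -
 have N': "N \<ge> 1" using N csts by simp
 obtain B where B: "!!x. sum_pdf q N x \<le> B" using bdd[OF N] by blast
 have c: "0 \<le> C / (real N)\<^sup>2" using csts by simp
 have "integrable lborel (%x. tk m x * uk N m x) \<and> (LBINT x. tk m x * uk N m x) = 1 \<and>
  integrable lborel (%x. tk m x * (uk N m x - 1)\<^sup>2) \<and> (LBINT x. tk m x * (uk N m x - 1)\<^sup>2) \<le> C / (real N)\<^sup>2"
 proof (cases "m \<in> K")
  case True
  show ?thesis unfolding uk_def tk_def if_P[OF True]
   by (intro conjI tl_urat_mass[OF near[OF True] N' B pos[OF True N]] urat_var[OF True N, THEN conjunct1] urat_var[OF True N, THEN conjunct2])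
 next
  case False
  show ?thesis unfolding uk_def tk_def if_not_P[OF False] using q_int q_mass c by simp
 qed
 then show "integrable lborel (%x. tk m x * uk N m x)" "(LBINT x. tk m x * uk N m x) = 1"
  "integrable lborel (%x. tk m x * (uk N m x - 1)\<^sup>2)" "(LBINT x. tk m x * (uk N m x - 1)\<^sup>2) \<le> C / (real N)\<^sup>2"
  by blast+
qed

lemma wk_step:
 assumes N: "n - i \<ge> N1" and a: "norm a \<le> A"
 shows "integrable lborel (%x. tk m x * wk n i a m x)" "(LBINT x. tk m x * wk n i a m x) = 1"
  "integrable lborel (%x. tk m x * (wk n i a m x - 1)\<^sup>2)" "(LBINT x. tk m x * (wk n i a m x - 1)\<^sup>2) \<le> C / (real (n - i))\<^sup>2"
proof -
 have N': "n - i \<ge> 1" using N csts by simp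
 have c: "0 \<le> C / (real (n - i))\<^sup>2" using csts by simp
 have "integrable lborel (%x. tk m x * wk n i a m x) \<and> (LBINT x. tk m x * wk n i a m x) = 1 \<and>
  integrable lborel (%x. tk m x * (wk n i a m x - 1)\<^sup>2) \<and> (LBINT x. tk m x * (wk n i a m x - 1)\<^sup>2) \<le> C / (real (n - i))\<^sup>2"
 proof (cases "m \<in> K \<and> i \<noteq> 1")
  case True
  then have m: "m \<in> K" by blast
  show ?thesis unfolding wk_def tk_def if_P[OF True] if_P[OF m]
   by (intro conjI tl_wrat_mass[OF near[OF m] N'] wrat_var[OF m N a, THEN conjunct1] wrat_var[OF m N a, THEN conjunct2])
 next
  case False
  show ?thesis unfolding wk_def if_not_P[OF False] using tk_mass(1,2)[of m] c by simp
 qed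
 then show "integrable lborel (%x. tk m x * wk n i a m x)" "(LBINT x. tk m x * wk n i a m x) = 1"
  "integrable lborel (%x. tk m x * (wk n i a m x - 1)\<^sup>2)" "(LBINT x. tk m x * (wk n i a m x - 1)\<^sup>2) \<le> C / (real (n - i))\<^sup>2"
  by blast+
qed

definition exited :: "nat => real^'d => nat => (nat => real^'d) => bool" where
 "exited n a j y \<longleftrightarrow> (\<exists>i\<le>j. m_val n a y i \<notin> K)"

text \<open>The squared distance of the current mean from the limit, in units of \<open>\<delta>\<^sup>2\<close>, frozen at one after the
 exit from the ball; the additional \<open>1\<close> turns the additive growth per step into a factor.\<close>

definition potential :: "nat => real^'d => nat => (nat => real^'d) => real" where
 "potential n a j y = (if exited n a j y then 2 else 1 + (norm (m_val n a y j - astar))\<^sup>2 / \<delta>\<^sup>2)"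

lemma measurable_exited: "j \<le> l ==> {y \<in> space (paths l). exited n a j y} \<in> sets (paths l)"
proof -
 assume jl: "j \<le> l"
 have "{y \<in> space (paths l). m_val n a y i \<notin> K} \<in> sets (paths l)" if "i \<le> j" for i
  using measurable_sets[OF measurable_m_val[of i l n a], of "- K"] that jl by (simp add: vimage_def Int_def conj_commute)
 then have "(\<Union>i\<in>{..j}. {y \<in> space (paths l). m_val n a y i \<notin> K}) \<in> sets (paths l)" by (intro sets.finite_UN) auto
 moreover have "{y \<in> space (paths l). exited n a j y} = (\<Union>i\<in>{..j}. {y \<in> space (paths l). m_val n a y i \<notin> K})"
  unfolding exited_def by auto
 ultimately show ?thesis by simp
qed

lemma measurable_potential: "potential n a j \<in> borel_measurable (paths j)"
proof -
 have [measurable]: "(%y. m_val n a y j) \<in> borel_measurable (paths j)" by (rule measurable_m_val) simp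
 show ?thesis unfolding potential_def[abs_def]
  by (intro measurable_If measurable_exited order_refl) measurable
qed

lemma norm_minus_scaleR_square:
 "(norm (u - s *\<^sub>R v))\<^sup>2 = (norm u)\<^sup>2 - 2 * s * (u \<bullet> v) + s\<^sup>2 * (norm v)\<^sup>2" for u v :: "real^'d"
 unfolding power2_norm_eq_inner inner_diff_left inner_diff_right inner_scaleR_left inner_scaleR_right inner_commute[of v u]
 by (simp add: power2_eq_square algebra_simps)

lemma two_le_mult: "0 \<le> c ==> 2 \<le> (1 + c) * (2::real)"
 by simp

lemma expand_step: "T * (1 + (P - B * I + Q / N) / d) = T * (1 + P / d) - (B / d) * (I * T) + (Q * T) / N / (d::real)"
 by (simp add: divide_inverse algebra_simps)

text \<open>The reference chain makes \<open>m_val\<close> a martingale: the step is centred at the current mean and is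
 divided by the number of remaining summands.\<close>

lemma potential_step:
 assumes j: "Suc j < n"
 shows "(\<integral>\<^sup>+x. ennreal (tk (m_val n a y j) x) * ennreal (potential n a (Suc j) (y(Suc j := x))) \<partial>lborel)
  \<le> ennreal (1 + M / \<delta>\<^sup>2 / (real (n - Suc j))\<^sup>2) * ennreal (potential n a j y)"
proof -
 let ?m = "m_val n a y j" and ?N = "real (n - Suc j)"
 have ex: "exited n a (Suc j) (y(Suc j := x)) \<longleftrightarrow> exited n a j y \<or> m_val n a (y(Suc j := x)) (Suc j) \<notin> K" for x
 proof -
  have 1: "(\<exists>i\<le>j. m_val n a (y(Suc j := x)) i \<notin> K) \<longleftrightarrow> exited n a j y"
   unfolding exited_def by (simp add: m_val_update cong: conj_cong)
  have 2: "(\<exists>i\<le>Suc j. P i) \<longleftrightarrow> (\<exists>i\<le>j. P i) \<or> P (Suc j)" for P by (auto simp: le_Suc_eq)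
  show ?thesis unfolding exited_def[of n a "Suc j"] 2 by (simp only: 1)
 qed
 have N: "?N \<ge> 1" using j by simp
 have c0: "0 \<le> M / \<delta>\<^sup>2 / ?N\<^sup>2" using csts by simp
 have p0: "0 \<le> potential n a j y" "1 \<le> potential n a j y" for j y by (simp_all add: potential_def)
 show ?thesis
 proof (cases "exited n a j y")
  case True
  have pe: "potential n a j y = 2" "potential n a (Suc j) (y(Suc j := x)) = 2" for x
   using True ex by (simp_all add: potential_def)
  have le: "2 \<le> (1 + M / \<delta>\<^sup>2 / ?N\<^sup>2) * 2" by (rule two_le_mult[OF c0])
  have "(\<integral>\<^sup>+x. ennreal (tk ?m x) * ennreal 2 \<partial>lborel) = (\<integral>\<^sup>+x. ennreal (tk ?m x) \<partial>lborel) * ennreal 2"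
   using tk_mass(1)[of ?m] by (intro nn_integral_multc) simp
  moreover have "(\<integral>\<^sup>+x. ennreal (tk ?m x) \<partial>lborel) = 1"
   using nn_integral_eq_integral[OF tk_mass(1)[of ?m]] tk_mass(2,3) by simp
  moreover have "ennreal ((1 + M / \<delta>\<^sup>2 / ?N\<^sup>2) * 2) = ennreal (1 + M / \<delta>\<^sup>2 / ?N\<^sup>2) * ennreal 2"
   by (rule ennreal_mult) (use c0 in auto)
  ultimately show ?thesis unfolding pe using ennreal_leI[OF le] by (simp only: mult_1)
 next
  case False
  then have m: "?m \<in> K" by (auto simp: exited_def)
  let ?D = "%x. (norm (?m - astar))\<^sup>2 - (2 / ?N) * ((?m - astar) \<bullet> (x - ?m)) + (norm (x - ?m))\<^sup>2 / ?N\<^sup>2"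
  let ?h = "%x. tk ?m x * (1 + (norm (?m - astar))\<^sup>2 / \<delta>\<^sup>2) - (2 / ?N / \<delta>\<^sup>2) * (((?m - astar) \<bullet> (x - ?m)) * tk ?m x)
    + ((norm (x - ?m))\<^sup>2 * tk ?m x) / ?N\<^sup>2 / \<delta>\<^sup>2"
  have nD: "(norm (m_val n a (y(Suc j := x)) (Suc j) - astar))\<^sup>2 = ?D x" for x
  proof -
   have mS: "m_val n a (y(Suc j := x)) (Suc j) = ?m - (1 / ?N) *\<^sub>R (x - ?m)"
    unfolding m_val_Suc[OF j, of a "y(Suc j := x)"] m_val_update[OF lessI] fun_upd_same ..
   have e: "?m - (1 / ?N) *\<^sub>R (x - ?m) - astar = (?m - astar) - (1 / ?N) *\<^sub>R (x - ?m)" by (simp only: diff_diff_add add.commute)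
   have c: "2 * (1 / ?N) = 2 / ?N" "(1 / ?N)\<^sup>2 * z = z / ?N\<^sup>2" for z :: real by (simp_all only: times_divide_eq_right mult_1_right power_divide power_one times_divide_eq_left mult_1)
   show ?thesis by (simp only: mS e norm_minus_scaleR_square c)
  qed
  have bd: "potential n a (Suc j) (y(Suc j := x)) \<le> 1 + ?D x / \<delta>\<^sup>2" for x
  proof (cases "exited n a (Suc j) (y(Suc j := x))")
   case True
   then have "m_val n a (y(Suc j := x)) (Suc j) \<notin> K" using ex False by blast
   then have "\<delta> \<le> norm (m_val n a (y(Suc j := x)) (Suc j) - astar)" by (simp add: dist_norm norm_minus_commute)
   then have "\<delta>\<^sup>2 \<le> (norm (m_val n a (y(Suc j := x)) (Suc j) - astar))\<^sup>2" using delta by (intro power_mono) auto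
   then have "1 \<le> (norm (m_val n a (y(Suc j := x)) (Suc j) - astar))\<^sup>2 / \<delta>\<^sup>2" using delta by (simp add: pos_le_divide_eq)
   then have "1 \<le> ?D x / \<delta>\<^sup>2" unfolding nD .
   then show ?thesis using True by (simp add: potential_def)
  next
   case False
   then show ?thesis by (simp add: potential_def nD)
  qed
  have tke: "tk ?m = tl q (tilt q ?m)" using m by (simp add: tk_def[abs_def])
  have ti: "tilt q ?m \<in> interior (mgf_dom q)" "mean_fun q (tilt q ?m) = ?m" using tilt_props[OF near[OF m]] by auto
  have i1: "integrable lborel (%x. ((?m - astar) \<bullet> (x - ?m)) * tk ?m x)"
  proof -
   have "integrable lborel (%x. ((?m - astar) \<bullet> x + - ((?m - astar) \<bullet> ?m)) * tl q (tilt q ?m) x)"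
    by (intro tl_integrable[OF ti(1)] subexp_add subexp_inner subexp_const)
   then show ?thesis unfolding tke by (simp add: inner_diff_right)
  qed
  have e1: "(LBINT x. ((?m - astar) \<bullet> (x - ?m)) * tk ?m x) = 0"
   unfolding tke by (rule tl_mean[OF ti(1), unfolded ti(2)])
  have i2: "integrable lborel (%x. (norm (x - ?m))\<^sup>2 * tk ?m x)" "(LBINT x. (norm (x - ?m))\<^sup>2 * tk ?m x) \<le> M"
   unfolding tke by (rule second_moment[OF m, THEN conjunct1] second_moment[OF m, THEN conjunct2])+
  have j1: "integrable lborel (%x. tk ?m x * (1 + (norm (?m - astar))\<^sup>2 / \<delta>\<^sup>2))" by (intro integrable_mult_left tk_mass)
  have j2: "integrable lborel (%x. (2 / ?N / \<delta>\<^sup>2) * (((?m - astar) \<bullet> (x - ?m)) * tk ?m x))" by (intro integrable_mult_right i1)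
  have j3: "integrable lborel (%x. ((norm (x - ?m))\<^sup>2 * tk ?m x) / ?N\<^sup>2 / \<delta>\<^sup>2)" by (intro integrable_divide i2(1))
  note j12 = Bochner_Integration.integrable_diff[OF j1 j2]
  have ih: "integrable lborel ?h" by (rule Bochner_Integration.integrable_add[OF j12 j3])
  have hv: "integral\<^sup>L lborel ?h = (1 + (norm (?m - astar))\<^sup>2 / \<delta>\<^sup>2) + (LBINT x. (norm (x - ?m))\<^sup>2 * tk ?m x) / ?N\<^sup>2 / \<delta>\<^sup>2"
   unfolding Bochner_Integration.integral_add[OF j12 j3] Bochner_Integration.integral_diff[OF j1 j2]
    integral_mult_left_zero integral_mult_right_zero integral_divide_zero e1 tk_mass(2) by (simp only: mult_1 mult_zero_right diff_zero)
  have le: "tk ?m x * potential n a (Suc j) (y(Suc j := x)) \<le> ?h x" for x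
  proof -
   have "tk ?m x * potential n a (Suc j) (y(Suc j := x)) \<le> tk ?m x * (1 + ?D x / \<delta>\<^sup>2)" by (intro mult_left_mono bd tk_mass)
   then show ?thesis unfolding expand_step .
  qed
  have h0: "0 \<le> ?h x" for x by (rule order_trans[OF mult_nonneg_nonneg[OF tk_mass(3) p0(1)] le])
  have "(\<integral>\<^sup>+x. ennreal (tk ?m x) * ennreal (potential n a (Suc j) (y(Suc j := x))) \<partial>lborel) \<le> (\<integral>\<^sup>+x. ennreal (?h x) \<partial>lborel)"
   by (intro nn_integral_mono) (subst ennreal_mult[symmetric], rule tk_mass(3), rule p0(1), rule ennreal_leI[OF le])
  also have "... = ennreal (integral\<^sup>L lborel ?h)" by (intro nn_integral_eq_integral[OF ih] AE_I2 h0)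
  also have "... \<le> ennreal ((1 + M / \<delta>\<^sup>2 / ?N\<^sup>2) * potential n a j y)"
  proof (rule ennreal_leI)
   have "integral\<^sup>L lborel ?h \<le> potential n a j y + M / ?N\<^sup>2 / \<delta>\<^sup>2"
    unfolding hv potential_def if_not_P[OF False] by (intro add_mono order_refl divide_right_mono i2(2)) simp_all
   also have "... \<le> (1 + M / \<delta>\<^sup>2 / ?N\<^sup>2) * potential n a j y"
   proof -
    have "M / ?N\<^sup>2 / \<delta>\<^sup>2 = M / \<delta>\<^sup>2 / ?N\<^sup>2 * 1" by (simp add: mult.commute)
    also have "... \<le> M / \<delta>\<^sup>2 / ?N\<^sup>2 * potential n a j y" by (rule mult_left_mono[OF p0(2) c0])
    finally show ?thesis by (simp only: distrib_right mult_1 add_left_mono)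
   qed
   finally show "integral\<^sup>L lborel ?h \<le> (1 + M / \<delta>\<^sup>2 / ?N\<^sup>2) * potential n a j y" .
  qed
  also have "... = ennreal (1 + M / \<delta>\<^sup>2 / ?N\<^sup>2) * ennreal (potential n a j y)"
   using c0 p0 by (intro ennreal_mult) auto
  finally show ?thesis .
 qed
qed

end

context near_point
begin

definition tau :: "nat => real^'d => nat => (nat => real^'d) => real" where
 "tau n a k y = (\<Prod>i=1..k. tk (m_val n a y (i - 1)) (y i))"

definition VP :: "nat => real^'d => nat => (nat => real^'d) => real" where
 "VP n a k y = (\<Prod>i=1..k. uk (n - i) (m_val n a y (i - 1)) (y i))"

definition VG :: "nat => real^'d => nat => (nat => real^'d) => real" where
 "VG n a k y = (\<Prod>i=1..k. wk n i a (m_val n a y (i - 1)) (y i))"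

lemma last_step: "m_val n a (y(Suc j := x)) (Suc j - 1) = m_val n a y j" "(y(Suc j := x)) (Suc j) = x"
 by (simp_all add: m_val_update)

lemma earlier_step:
 assumes "i < j"
 shows "m_val n a (y(j := x)) (i - 1) = m_val n a y (i - 1)" "(y(j := x)) i = y i"
 using assms by (simp_all add: m_val_update)

lemma variance_product_le:
 assumes k: "k < n" and c: "0 \<le> c" "2 * c \<le> real (n - k)"
 shows "(\<Prod>i=1..k. 1 + c / (real (n - i))\<^sup>2) \<le> 1 + 4 * c / real (n - k)"
proof -
 have "(\<Sum>i=1..k. c / (real (n - i))\<^sup>2) = c * (\<Sum>i=1..k. 1 / (real (n - i))\<^sup>2)" by (simp add: sum_distrib_left)
 also have "... \<le> c * (2 / real (n - k))" by (rule mult_left_mono[OF sum_inverse_squares_tail[OF k] c(1)])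
 finally have s: "(\<Sum>i=1..k. c / (real (n - i))\<^sup>2) \<le> c * (2 / real (n - k))" .
 have "c * (2 / real (n - k)) \<le> 1" using k c by (simp add: pos_divide_le_eq mult.commute)
 from prod_le_of_sum[OF _ s this] show ?thesis using c by simp
qed

lemma tau_VP:
 assumes k: "k < n" "N1 \<le> n - k" and c: "2 * C \<le> real (n - k)"
 shows "integrable (paths k) (tau n a k)" "(\<integral>y. tau n a k y \<partial>paths k) = 1"
  "integrable (paths k) (%y. tau n a k y * VP n a k y)" "(\<integral>y. tau n a k y * VP n a k y \<partial>paths k) = 1"
  "integrable (paths k) (%y. tau n a k y * (VP n a k y - 1)\<^sup>2)"
  "(\<integral>y. tau n a k y * (VP n a k y - 1)\<^sup>2 \<partial>paths k) \<le> 4 * C / real (n - k)"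
proof -
 let ?\<kappa> = "%i y. tk (m_val n a y (i - 1)) (y i)" and ?v = "%i y. uk (n - i) (m_val n a y (i - 1)) (y i)"
 have N: "N1 \<le> n - Suc j" if "j < k" for j using that k by simp
 have PV: "integrable (paths k) (%y. \<Prod>i=1..k. ?\<kappa> i y) \<and> (\<integral>y. (\<Prod>i=1..k. ?\<kappa> i y) \<partial>paths k) = 1 \<and>
  integrable (paths k) (%y. (\<Prod>i=1..k. ?\<kappa> i y) * (\<Prod>i=1..k. ?v i y)) \<and>
  (\<integral>y. (\<Prod>i=1..k. ?\<kappa> i y) * (\<Prod>i=1..k. ?v i y) \<partial>paths k) = 1 \<and>
  integrable (paths k) (%y. (\<Prod>i=1..k. ?\<kappa> i y) * ((\<Prod>i=1..k. ?v i y) - 1)\<^sup>2) \<and>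
  (\<integral>y. (\<Prod>i=1..k. ?\<kappa> i y) * ((\<Prod>i=1..k. ?v i y) - 1)\<^sup>2 \<partial>paths k) \<le> (\<Prod>i=1..k. 1 + C / (real (n - i))\<^sup>2) - 1"
  (is ?P)
 proof -
  have mk: "?\<kappa> i \<in> borel_measurable (paths j)" if "1 \<le> i" "i \<le> j" for i j
   by (rule measurable_path_fun[OF measurable_tk that])
  have mv: "?v i \<in> borel_measurable (paths j)" if "1 \<le> i" "i \<le> j" for i j
   by (rule measurable_path_fun[OF measurable_uk that])
  have ak: "?\<kappa> i (y(j := x)) = ?\<kappa> i y" if "i < j" for i j y x unfolding earlier_step[OF that] ..
  have av: "?v i (y(j := x)) = ?v i y" if "i < j" for i j y x unfolding earlier_step[OF that] ..
  have c0: "0 \<le> C / (real (n - i))\<^sup>2" for i using csts by simp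
  note pv = path_variance[of ?\<kappa> ?v k "%i. C / (real (n - i))\<^sup>2", OF mk mv ak av tk_mass(3) uk_nonneg, unfolded last_step,
    OF _ _ _ _ _ _ tk_mass(1) tk_mass(2) uk_step(1)[OF N] uk_step(2)[OF N] uk_step(3)[OF N] uk_step(4)[OF N] c0]
  show ?P by (intro conjI pv; assumption)
 qed
 have c1: "(\<Prod>i=1..k. 1 + C / (real (n - i))\<^sup>2) - 1 \<le> 4 * C / real (n - k)"
  using variance_product_le[OF k(1) csts(1) c] by (simp only: diff_le_eq add.commute)
 from PV show "integrable (paths k) (tau n a k)" "(\<integral>y. tau n a k y \<partial>paths k) = 1"
  "integrable (paths k) (%y. tau n a k y * VP n a k y)" "(\<integral>y. tau n a k y * VP n a k y \<partial>paths k) = 1"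
  "integrable (paths k) (%y. tau n a k y * (VP n a k y - 1)\<^sup>2)"
  unfolding tau_def[abs_def] VP_def by blast+
 show "(\<integral>y. tau n a k y * (VP n a k y - 1)\<^sup>2 \<partial>paths k) \<le> 4 * C / real (n - k)"
  unfolding tau_def VP_def by (rule order_trans[OF _ c1]) (use PV in blast)
qed

lemma tau_VG:
 assumes k: "k < n" "N1 \<le> n - k" and c: "2 * C \<le> real (n - k)" and a: "norm a \<le> A"
 shows "integrable (paths k) (%y. tau n a k y * VG n a k y)" "(\<integral>y. tau n a k y * VG n a k y \<partial>paths k) = 1"
  "integrable (paths k) (%y. tau n a k y * (VG n a k y - 1)\<^sup>2)"
  "(\<integral>y. tau n a k y * (VG n a k y - 1)\<^sup>2 \<partial>paths k) \<le> 4 * C / real (n - k)"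
proof -
 let ?\<kappa> = "%i y. tk (m_val n a y (i - 1)) (y i)" and ?v = "%i y. wk n i a (m_val n a y (i - 1)) (y i)"
 have N: "N1 \<le> n - Suc j" if "j < k" for j using that k by simp
 have PV: "integrable (paths k) (%y. (\<Prod>i=1..k. ?\<kappa> i y) * (\<Prod>i=1..k. ?v i y)) \<and>
  (\<integral>y. (\<Prod>i=1..k. ?\<kappa> i y) * (\<Prod>i=1..k. ?v i y) \<partial>paths k) = 1 \<and>
  integrable (paths k) (%y. (\<Prod>i=1..k. ?\<kappa> i y) * ((\<Prod>i=1..k. ?v i y) - 1)\<^sup>2) \<and>
  (\<integral>y. (\<Prod>i=1..k. ?\<kappa> i y) * ((\<Prod>i=1..k. ?v i y) - 1)\<^sup>2 \<partial>paths k) \<le> (\<Prod>i=1..k. 1 + C / (real (n - i))\<^sup>2) - 1"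
  (is ?P)
 proof -
  have mk: "?\<kappa> i \<in> borel_measurable (paths j)" if "1 \<le> i" "i \<le> j" for i j
   by (rule measurable_path_fun[OF measurable_tk that])
  have mv: "?v i \<in> borel_measurable (paths j)" if "1 \<le> i" "i \<le> j" for i j
   by (rule measurable_path_fun[OF measurable_wk that])
  have ak: "?\<kappa> i (y(j := x)) = ?\<kappa> i y" if "i < j" for i j y x unfolding earlier_step[OF that] ..
  have av: "?v i (y(j := x)) = ?v i y" if "i < j" for i j y x unfolding earlier_step[OF that] ..
  have c0: "0 \<le> C / (real (n - i))\<^sup>2" for i using csts by simp
  note pv = path_variance[of ?\<kappa> ?v k "%i. C / (real (n - i))\<^sup>2", OF mk mv ak av tk_mass(3) wk_nonneg, unfolded last_step,
    OF _ _ _ _ _ _ tk_mass(1) tk_mass(2) wk_step(1)[OF N a] wk_step(2)[OF N a] wk_step(3)[OF N a] wk_step(4)[OF N a] c0]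
  show ?P by (intro conjI pv; assumption)
 qed
 have c1: "(\<Prod>i=1..k. 1 + C / (real (n - i))\<^sup>2) - 1 \<le> 4 * C / real (n - k)"
  using variance_product_le[OF k(1) csts(1) c] by (simp only: diff_le_eq add.commute)
 from PV show "integrable (paths k) (%y. tau n a k y * VG n a k y)" "(\<integral>y. tau n a k y * VG n a k y \<partial>paths k) = 1"
  "integrable (paths k) (%y. tau n a k y * (VG n a k y - 1)\<^sup>2)"
  unfolding tau_def[abs_def] VG_def by blast+
 show "(\<integral>y. tau n a k y * (VG n a k y - 1)\<^sup>2 \<partial>paths k) \<le> 4 * C / real (n - k)"
  unfolding tau_def VG_def by (rule order_trans[OF _ c1]) (use PV in blast)
qed

lemma measurable_tau: "tau n a k \<in> borel_measurable (paths k)"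
 unfolding tau_def[abs_def] by (intro borel_measurable_prod measurable_path_fun measurable_tk) auto

lemma measurable_VP: "VP n a k \<in> borel_measurable (paths k)"
 unfolding VP_def[abs_def] by (intro borel_measurable_prod measurable_path_fun measurable_uk) auto

lemma measurable_VG: "VG n a k \<in> borel_measurable (paths k)"
 unfolding VG_def[abs_def] by (intro borel_measurable_prod measurable_path_fun measurable_wk) auto

lemma tau_nonneg: "0 \<le> tau n a k y" unfolding tau_def by (intro prod_nonneg) (simp add: tk_mass)
lemma VP_nonneg: "0 \<le> VP n a k y" unfolding VP_def by (intro prod_nonneg) (simp add: uk_nonneg)
lemma VG_nonneg: "0 \<le> VG n a k y" unfolding VG_def by (intro prod_nonneg) (simp add: wk_nonneg)

lemma potential_ge: "1 \<le> potential n a j y" "exited n a j y ==> 2 \<le> potential n a j y"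
 by (simp_all add: potential_def)

text \<open>A maximal inequality for the martingale \<open>m_val\<close>, by means of the potential.\<close>

lemma tau_exited_le:
 assumes k: "k < n" "N1 \<le> n - k" and c: "2 * C \<le> real (n - k)" "2 * (M / \<delta>\<^sup>2) \<le> real (n - k)"
  and a: "a \<in> K"
 defines "B \<equiv> {y \<in> space (paths k). exited n a k y}"
 shows "(\<integral>y. tau n a k y * indicator B y \<partial>paths k)
  \<le> (1 + 4 * (M / \<delta>\<^sup>2) / real (n - k)) * (1 + (norm (a - astar))\<^sup>2 / \<delta>\<^sup>2) - 1"
proof -
 have n: "n \<ge> 1" using k by simp
 have M0: "0 \<le> M / \<delta>\<^sup>2" using csts by simp
 have B: "B \<in> sets (paths k)" unfolding B_def by (rule measurable_exited) simp
 let ?b = "1 + (norm (a - astar))\<^sup>2 / \<delta>\<^sup>2" and ?P = "\<Prod>i=1..k. 1 + M / \<delta>\<^sup>2 / (real (n - i))\<^sup>2"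
 have q0: "0 \<le> 1 + M / \<delta>\<^sup>2 / (real (n - i))\<^sup>2" for i
  by (intro add_nonneg_nonneg divide_nonneg_nonneg csts) simp_all
 have P0: "0 \<le> ?P" by (intro prod_nonneg q0)
 have b0: "0 \<le> ?b" by simp
 have p0: "0 \<le> potential n a j y" for j y using potential_ge(1)[of n a j y] by simp
 have "(\<integral>\<^sup>+y. (\<Prod>i=1..k. ennreal (tk (m_val n a y (i - 1)) (y i))) * ennreal (potential n a k y) \<partial>paths k)
  \<le> (\<Prod>i=1..k. ennreal (1 + M / \<delta>\<^sup>2 / (real (n - i))\<^sup>2)) * ennreal (potential n a 0 (%_. undefined))"
 proof (rule nn_integral_path_le[where \<Theta>="%j y. ennreal (potential n a j y)" and k=k and c="%i. ennreal (1 + M / \<delta>\<^sup>2 / (real (n - i))\<^sup>2)"])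
  show "(%y. ennreal (tk (m_val n a y (i - 1)) (y i))) \<in> borel_measurable (paths j)" if "1 \<le> i" "i \<le> j" for i j
   by (intro measurable_compose[OF measurable_path_fun[OF measurable_tk that]] measurable_ennreal)
  show "(%y. ennreal (potential n a j y)) \<in> borel_measurable (paths j)" for j
   by (intro measurable_compose[OF measurable_potential] measurable_ennreal)
  show "ennreal (tk (m_val n a (y(j := x)) (i - 1)) ((y(j := x)) i)) = ennreal (tk (m_val n a y (i - 1)) (y i))"
   if "i < j" for i j y x unfolding earlier_step[OF that] ..
  show "(\<integral>\<^sup>+x. ennreal (tk (m_val n a (y(Suc j := x)) (Suc j - 1)) ((y(Suc j := x)) (Suc j))) * ennreal (potential n a (Suc j) (y(Suc j := x))) \<partial>lborel)
   \<le> ennreal (1 + M / \<delta>\<^sup>2 / (real (n - Suc j))\<^sup>2) * ennreal (potential n a j y)" if "j < k" for j y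
   unfolding last_step by (rule potential_step) (use that k in simp)
 qed simp
 moreover have "(\<Prod>i=1..k. ennreal (tk (m_val n a y (i - 1)) (y i))) = ennreal (tau n a k y)" for y
  unfolding tau_def by (rule prod_ennreal) (rule tk_mass(3))
 moreover have "(\<Prod>i=1..k. ennreal (1 + M / \<delta>\<^sup>2 / (real (n - i))\<^sup>2)) = ennreal ?P"
  by (rule prod_ennreal) (rule q0)
 moreover have "potential n a 0 (%_. undefined) = ?b"
  using a m_val_0[OF n, of a "%_. undefined"] by (simp add: potential_def exited_def)
 ultimately have "(\<integral>\<^sup>+y. ennreal (tau n a k y) * ennreal (potential n a k y) \<partial>paths k) \<le> ennreal ?P * ennreal ?b"
  by (simp only:)
 then have nn: "(\<integral>\<^sup>+y. ennreal (tau n a k y * potential n a k y) \<partial>paths k) \<le> ennreal (?P * ?b)"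
  by (simp only: ennreal_mult[OF tau_nonneg p0] ennreal_mult[OF P0 b0])
 have tp0: "0 \<le> tau n a k y * potential n a k y" for y by (intro mult_nonneg_nonneg tau_nonneg p0)
 have tpm: "(%y. tau n a k y * potential n a k y) \<in> borel_measurable (paths k)"
  by (intro borel_measurable_times measurable_tau measurable_potential)
 note tp = nn_integral_real[OF tp0 tpm nn mult_nonneg_nonneg[OF P0 b0]]
 note t1 = tau_VP(1,2)[OF k c(1), of a]
 have iB: "integrable (paths k) (%y. tau n a k y * indicator B y)"
  using integrable_mult_indicator[OF B t1(1)] by (simp add: mult.commute)
 have "(\<integral>y. tau n a k y + tau n a k y * indicator B y \<partial>paths k) \<le> (\<integral>y. tau n a k y * potential n a k y \<partial>paths k)"
 proof (rule integral_mono[OF Bochner_Integration.integrable_add[OF t1(1) iB] tp(1)])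
  fix y
  show "tau n a k y + tau n a k y * indicator B y \<le> tau n a k y * potential n a k y"
  proof (cases "y \<in> B")
   case True
   then have "tau n a k y * 2 \<le> tau n a k y * potential n a k y" by (intro mult_left_mono potential_ge tau_nonneg) (simp add: B_def)
   then show ?thesis using True by simp
  next
   case False
   have "tau n a k y * 1 \<le> tau n a k y * potential n a k y" by (intro mult_left_mono potential_ge tau_nonneg)
   then show ?thesis using False by simp
  qed
 qed
 then have "1 + (\<integral>y. tau n a k y * indicator B y \<partial>paths k) \<le> (\<integral>y. tau n a k y * potential n a k y \<partial>paths k)"
  unfolding Bochner_Integration.integral_add[OF t1(1) iB] t1(2) .
 moreover have "?P * ?b \<le> (1 + 4 * (M / \<delta>\<^sup>2) / real (n - k)) * ?b"
  by (rule mult_right_mono[OF variance_product_le[OF k(1) M0 c(2)] b0])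
 ultimately show ?thesis using tp(2) by linarith
qed

text \<open>The product of the conditioning ratios telescopes to the quotient of the densities of the
  remaining and the total sum.\<close>

lemma cond_pdf_eq_tau_VP:
 assumes k: "k < n" "N1 \<le> n - k" "1 \<le> k" and y: "\<not> exited n a k y"
 shows "cond_pdf q n k a y = tau n a k y * VP n a k y"
proof -
 define \<Phi> where "\<Phi> = (%j. sum_pdf q (n - j) (real n *\<^sub>R a - (\<Sum>i=1..j. y i)))"
 have m: "m_val n a y j \<in> K" if "j \<le> k" for j using y that by (auto simp: exited_def)
 have z: "real (Suc (n - Suc j)) *\<^sub>R m_val n a y j = real n *\<^sub>R a - (\<Sum>i=1..j. y i)" "Suc (n - Suc j) = n - j" if "j < k" for j
 proof -
  show e: "Suc (n - Suc j) = n - j" using that k by simp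
  have "real (n - j) = real n - real j" using that k by (simp add: of_nat_diff)
  then show "real (Suc (n - Suc j)) *\<^sub>R m_val n a y j = real n *\<^sub>R a - (\<Sum>i=1..j. y i)"
   unfolding e using m_val_scaled[of j n a y] that k by simp
 qed
 have pos\<Phi>: "0 < \<Phi> j" if jk: "j < k" for j
 proof -
  have "0 < sum_pdf q (Suc (n - Suc j)) (real (Suc (n - Suc j)) *\<^sub>R m_val n a y j)"
   by (rule pos[OF m]) (use jk k in simp_all)
  then show ?thesis unfolding \<Phi>_def z(1)[OF jk] unfolding z(2)[OF jk] .
 qed
 have step: "tk (m_val n a y j) (y (Suc j)) * uk (n - Suc j) (m_val n a y j) (y (Suc j)) = q (y (Suc j)) * \<Phi> (Suc j) / \<Phi> j"
  if "j < k" for j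
 proof -
  have mj: "m_val n a y j \<in> K" using m that by simp
  have "real n *\<^sub>R a - (\<Sum>i=1..j. y i) - y (Suc j) = real n *\<^sub>R a - (\<Sum>i=1..Suc j. y i)" by (simp add: diff_diff_add)
  then show ?thesis
   using tl_urat[OF interior_dom_dom[OF tilt_props(1)[OF near[OF mj]]] refl, of "y (Suc j)" "n - Suc j"] mj
   unfolding z(1)[OF that] unfolding z(2)[OF that] by (simp only: tk_def uk_def \<Phi>_def if_True)
 qed
 have "j \<le> k ==> (\<Prod>i=1..j. tk (m_val n a y (i - 1)) (y i)) * (\<Prod>i=1..j. uk (n - i) (m_val n a y (i - 1)) (y i)) =
   (\<Prod>i=1..j. q (y i)) * \<Phi> j / \<Phi> 0" for j
 proof (induction j)
  case 0
  show ?case using pos\<Phi>[of 0] k(3) by simp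
 next
  case (Suc j)
  have jk: "j < k" using Suc.prems by simp
  let ?T = "\<Prod>i=1..j. tk (m_val n a y (i - 1)) (y i)" and ?U = "\<Prod>i=1..j. uk (n - i) (m_val n a y (i - 1)) (y i)"
  have "(\<Prod>i=1..Suc j. tk (m_val n a y (i - 1)) (y i)) * (\<Prod>i=1..Suc j. uk (n - i) (m_val n a y (i - 1)) (y i)) =
   (?T * ?U) * (tk (m_val n a y j) (y (Suc j)) * uk (n - Suc j) (m_val n a y j) (y (Suc j)))"
   by (simp add: mult_ac)
  also have "... = ((\<Prod>i=1..j. q (y i)) * \<Phi> j / \<Phi> 0) * (q (y (Suc j)) * \<Phi> (Suc j) / \<Phi> j)"
   using Suc.IH jk step[OF jk] by (simp only: less_imp_le)
  also have "... = (\<Prod>i=1..Suc j. q (y i)) * \<Phi> (Suc j) / \<Phi> 0"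
   using pos\<Phi>[OF jk] by simp
  finally show ?case .
 qed
 from this[OF order_refl] show ?thesis by (simp add: tau_def VP_def cond_pdf_def joint_pdf_def \<Phi>_def)
qed

lemma g_pdf_eq_tau_VG:
 assumes k: "1 \<le> k" "k < n" and a: "a \<in> mrange"
  and adm: "!!i y. i \<in> {1..<k} ==> (\<forall>j\<in>{1..i}. q (y j) > 0) ==> m_val n a y i \<in> mrange"
  and y: "\<not> exited n a k y"
 shows "g_pdf q n k a y = tau n a k y * VG n a k y"
proof -
 have "g_pdf q n k a y = (\<Prod>i=1..k. gker n a i (m_val n a y (i - 1)) (y i))" by (rule g_pdf_eq[OF k a]) (rule adm)
 also have "... = (\<Prod>i=1..k. tk (m_val n a y (i - 1)) (y i) * wk n i a (m_val n a y (i - 1)) (y i))"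
 proof (rule prod.cong[OF refl])
  fix i assume i: "i \<in> {1..k}"
  have "m_val n a y (i - 1) \<in> K" using y i by (auto simp: exited_def)
  then show "gker n a i (m_val n a y (i - 1)) (y i) = tk (m_val n a y (i - 1)) (y i) * wk n i a (m_val n a y (i - 1)) (y i)"
   using near[of "m_val n a y (i - 1)"] unfolding gker_def tk_def wk_def by (cases "i = 1") simp_all
 qed
 finally show ?thesis unfolding tau_def VG_def prod.distrib .
qed

lemma path_deviation:
 assumes k: "1 \<le> k" "k < n" "N1 \<le> n - k" and c: "2 * C \<le> real (n - k)" "2 * (M / \<delta>\<^sup>2) \<le> real (n - k)"
  and a: "a \<in> K" "norm a \<le> A"
  and adm: "!!i y. i \<in> {1..<k} ==> (\<forall>j\<in>{1..i}. q (y j) > 0) ==> m_val n a y i \<in> mrange"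
  and h: "0 < (h::real)" "h \<le> 1/2" "4 * h \<le> \<rho>"
 defines "D \<equiv> {y\<in>space (paths k). \<rho> < \<bar>cond_pdf q n k a y / g_pdf q n k a y - 1\<bar>}"
  and "b \<equiv> (1 + 4 * (M / \<delta>\<^sup>2) / real (n - k)) * (1 + (norm (a - astar))\<^sup>2 / \<delta>\<^sup>2) - 1" and "e \<equiv> 4 * C / real (n - k)"
 shows "(\<integral>y. cond_pdf q n k a y * indicator D y \<partial>paths k) \<le> 2 * b + 2 * (e / h\<^sup>2) + h + e / h"
  "(\<integral>y. g_pdf q n k a y * indicator D y \<partial>paths k) \<le> 2 * b + 2 * (e / h\<^sup>2) + h + e / h"
  "integrable (paths k) (cond_pdf q n k a)" "integrable (paths k) (g_pdf q n k a)"
  "(\<integral>\<^sup>+y. ennreal (cond_pdf q n k a y) \<partial>paths k) = 1" "(\<integral>\<^sup>+y. ennreal (g_pdf q n k a y) \<partial>paths k) = 1"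
  "0 \<le> cond_pdf q n k a y" "0 \<le> g_pdf q n k a y" "g_pdf q n k a y = 0 ==> cond_pdf q n k a y = 0"
proof -
 have ar: "a \<in> mrange" by (rule near[OF a(1)])
 have posn: "0 < sum_pdf q n (real n *\<^sub>R a)"
  using pos[OF a(1), of "n - 1"] k by simp
 have bd: "\<exists>B. \<forall>x. sum_pdf q N x \<le> B" if "n - k \<le> N" for N using bdd[of N] that k by simp
 note cp = cond_pdf_props[OF k(1,2) bd posn]
 have gp: "g_pdf q n k a \<in> borel_measurable (paths k)" "(\<integral>\<^sup>+y. ennreal (g_pdf q n k a y) \<partial>paths k) = 1"
  "!!y. 0 \<le> g_pdf q n k a y"
  by (rule g_pdf_props(1)[OF k(1,2) ar adm], assumption+) (rule g_pdf_props(2)[OF k(1,2) ar adm], assumption+, rule g_pdf_props(3)[OF k(1,2) ar adm], assumption+)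
 have one: "integrable (paths k) f \<and> (\<integral>y. f y \<partial>paths k) = 1"
  if "f \<in> borel_measurable (paths k)" "(\<integral>\<^sup>+y. ennreal (f y) \<partial>paths k) = 1" "!!y. 0 \<le> f y" for f :: "(nat => real^'d) => real"
 proof -
  have i: "integrable (paths k) f" using that by (intro integrableI_nonneg) auto
  have "ennreal (\<integral>y. f y \<partial>paths k) = 1" using nn_integral_eq_integral[OF i] that by simp
  then show ?thesis using i by simp
 qed
 note P = one[OF cp(1,2,3)] and G = one[OF gp]
 show "integrable (paths k) (cond_pdf q n k a)" "integrable (paths k) (g_pdf q n k a)" using P G by blast+
 show "(\<integral>\<^sup>+y. ennreal (cond_pdf q n k a y) \<partial>paths k) = 1" by (rule cp(2))
 show "(\<integral>\<^sup>+y. ennreal (g_pdf q n k a y) \<partial>paths k) = 1" by (rule gp(2))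
 show "0 \<le> cond_pdf q n k a y" by (rule cp(3))
 show "0 \<le> g_pdf q n k a y" by (rule gp(3))
 show "cond_pdf q n k a y = 0" if g0: "g_pdf q n k a y = 0"
 proof -
  have "\<not> (\<forall>j\<in>{1..k}. 0 < q (y j))"
  proof
   assume "\<forall>j\<in>{1..k}. 0 < q (y j)"
   then have "0 < g_pdf q n k a y" by (rule g_pdf_props(4)[OF k(1,2) ar adm, rotated 2])
   then show False using g0 by simp
  qed
  then obtain j where j: "j \<in> {1..k}" "\<not> 0 < q (y j)" by blast
  then have "q (y j) = 0" using q_nonneg[of "y j"] by simp
  then show ?thesis using j(1) cp(4) by blast
 qed
 let ?B = "{y \<in> space (paths k). exited n a k y}"
 have Bm: "?B \<in> sets (paths k)" by (rule measurable_exited) simp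
 note tP = tau_VP[OF k(2,3) c(1), of a] and tG = tau_VG[OF k(2,3) c(1) a(2)]
 have offP: "cond_pdf q n k a y = tau n a k y * VP n a k y" if "y \<in> space (paths k)" "y \<notin> ?B" for y
  by (rule cond_pdf_eq_tau_VP[OF k(2,3,1)]) (use that in blast)
 have offG: "g_pdf q n k a y = tau n a k y * VG n a k y" if "y \<in> space (paths k)" "y \<notin> ?B" for y
  by (rule g_pdf_eq_tau_VG[OF k(1,2) ar adm]) (use that in blast)+
 note rd = ratio_deviation[OF measurable_tau measurable_VP measurable_VG cp(1) gp(1) tau_nonneg VP_nonneg VG_nonneg cp(3) gp(3)
   tP tG P[THEN conjunct1] P[THEN conjunct2] G[THEN conjunct1] G[THEN conjunct2] Bm tau_exited_le[OF k(2,3) c a(1)] offP offG h]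
 show "(\<integral>y. cond_pdf q n k a y * indicator D y \<partial>paths k) \<le> 2 * b + 2 * (e / h\<^sup>2) + h + e / h"
  unfolding D_def b_def e_def by (rule rd(1))
 show "(\<integral>y. g_pdf q n k a y * indicator D y \<partial>paths k) \<le> 2 * b + 2 * (e / h\<^sup>2) + h + e / h"
  unfolding D_def b_def e_def by (rule rd(2))
qed

text \<open>At zeros of the approximating density some factor \<open>q (y j)\<close> vanishes, and then the conditional
 density vanishes, too. So the product form of the equation holds at every point.\<close>

lemma path_law_deviation:
 assumes k: "1 \<le> k" "k < n" "N1 \<le> n - k" and c: "2 * C \<le> real (n - k)" "2 * (M / \<delta>\<^sup>2) \<le> real (n - k)"
  and a: "a \<in> K" "norm a \<le> A"
  and adm: "!!i y. i \<in> {1..<k} ==> (\<forall>j\<in>{1..i}. q (y j) > 0) ==> m_val n a y i \<in> mrange"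
  and f: "f \<in> {cond_pdf q n k a, g_pdf q n k a}"
 defines "R \<equiv> %y. cond_pdf q n k a y / g_pdf q n k a y - 1"
  and "b \<equiv> (1 + 4 * (M / \<delta>\<^sup>2) / real (n - k)) * (1 + (norm (a - astar))\<^sup>2 / \<delta>\<^sup>2) - 1" and "e \<equiv> 4 * C / real (n - k)"
 shows "prob_space (path_law k f)" "R \<in> borel_measurable (path_law k f)"
  "cond_pdf q n k a y = g_pdf q n k a y * (1 + R y)"
  "0 < (h::real) ==> h \<le> 1/2 ==> 4 * h \<le> \<rho> ==>
   measure (path_law k f) {y \<in> space (path_law k f). \<rho> < \<bar>R y\<bar>} \<le> 2 * b + 2 * (e / h\<^sup>2) + h + e / h"
proof -
 note pd = path_deviation[OF k c a adm]
 have p0: "0 < (1/2::real)" "(1/2::real) \<le> 1/2" "4 * (1/2::real) \<le> 2" by simp_all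
 have iC: "integrable (paths k) (cond_pdf q n k a)" by (rule pd(3)[OF _ _ p0])
 have iG: "integrable (paths k) (g_pdf q n k a)" by (rule pd(4)[OF _ _ p0])
 have mC: "(\<integral>\<^sup>+y. ennreal (cond_pdf q n k a y) \<partial>paths k) = 1" by (rule pd(5)[OF _ _ p0])
 have mG: "(\<integral>\<^sup>+y. ennreal (g_pdf q n k a y) \<partial>paths k) = 1" by (rule pd(6)[OF _ _ p0])
 have nC: "0 \<le> cond_pdf q n k a y" for y by (rule pd(7)[OF _ _ p0])
 have nG: "0 \<le> g_pdf q n k a y" for y by (rule pd(8)[OF _ _ p0])
 have zC: "cond_pdf q n k a y = 0" if "g_pdf q n k a y = 0" for y by (rule pd(9)[OF _ _ p0 that])
 have fi: "integrable (paths k) f" and fm: "(\<integral>\<^sup>+y. ennreal (f y) \<partial>paths k) = 1" and fn: "!!y. 0 \<le> f y"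
  using f iC iG mC mG nC nG by auto
 have fb[measurable]: "f \<in> borel_measurable (paths k)" using fi by simp
 have [measurable]: "cond_pdf q n k a \<in> borel_measurable (paths k)" "g_pdf q n k a \<in> borel_measurable (paths k)"
  using iC iG by simp_all
 have Rm: "R \<in> borel_measurable (paths k)" unfolding R_def by measurable
 have L: "path_law k f = density (paths k) (%y. ennreal (f y))" by (simp add: path_law_def)
 show "R \<in> borel_measurable (path_law k f)" unfolding L using Rm by simp
 show "cond_pdf q n k a y = g_pdf q n k a y * (1 + R y)"
  using zC by (cases "g_pdf q n k a y = 0") (simp_all add: R_def)
 show "prob_space (path_law k f)"
 proof (rule prob_spaceI)
  have "emeasure (path_law k f) (space (paths k)) = (\<integral>\<^sup>+y. ennreal (f y) * indicator (space (paths k)) y \<partial>paths k)"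
   unfolding L by (rule emeasure_density) measurable
  also have "... = (\<integral>\<^sup>+y. ennreal (f y) \<partial>paths k)" by (intro nn_integral_cong) simp
  finally show "emeasure (path_law k f) (space (path_law k f)) = 1"
   unfolding L space_density using fm by simp
 qed
 assume h: "0 < h" "h \<le> 1/2" "4 * h \<le> \<rho>"
 let ?D = "{y \<in> space (paths k). \<rho> < \<bar>R y\<bar>}"
 have D: "?D \<in> sets (paths k)" using Rm by measurable
 have iD: "integrable (paths k) (%y. f y * indicator ?D y)"
  using integrable_mult_indicator[OF D fi] by (simp add: mult.commute)
 have "emeasure (path_law k f) ?D = (\<integral>\<^sup>+y. ennreal (f y) * indicator ?D y \<partial>paths k)"
  unfolding L by (rule emeasure_density[OF _ D]) measurable
 also have "... = (\<integral>\<^sup>+y. ennreal (f y * indicator ?D y) \<partial>paths k)"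
  by (intro nn_integral_cong) (simp split: split_indicator)
 also have "... = ennreal (\<integral>y. f y * indicator ?D y \<partial>paths k)"
  by (rule nn_integral_eq_integral[OF iD]) (simp add: fn)
 finally have "measure (path_law k f) ?D = (\<integral>y. f y * indicator ?D y \<partial>paths k)"
  unfolding measure_def by (simp add: integral_nonneg_AE fn)
 moreover have "(\<integral>y. f y * indicator ?D y \<partial>paths k) \<le> 2 * b + 2 * (e / h\<^sup>2) + h + e / h"
 proof -
  have C: "(\<integral>y. cond_pdf q n k a y * indicator ?D y \<partial>paths k) \<le> 2 * b + 2 * (e / h\<^sup>2) + h + e / h"
   unfolding R_def b_def e_def by (rule pd(1)[OF _ _ h])
  have G: "(\<integral>y. g_pdf q n k a y * indicator ?D y \<partial>paths k) \<le> 2 * b + 2 * (e / h\<^sup>2) + h + e / h"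
   unfolding R_def b_def e_def by (rule pd(2)[OF _ _ h])
  have "f = cond_pdf q n k a \<or> f = g_pdf q n k a" using f by blast
  then show ?thesis
  proof
   assume fe: "f = cond_pdf q n k a"
   show ?thesis unfolding fe by (rule C)
  next
   assume fe: "f = g_pdf q n k a"
   show ?thesis unfolding fe by (rule G)
  qed
 qed
 ultimately show "measure (path_law k f) {y \<in> space (path_law k f). \<rho> < \<bar>R y\<bar>} \<le> 2 * b + 2 * (e / h\<^sup>2) + h + e / h"
  unfolding L space_density by simp
qed

end

section \<open>The relative error is negligible\<close>

lemma pdf_of_distributed:
 assumes M: "prob_space M" and d: "distributed M lborel X (%x. ennreal (p x))" and nn: "\<forall>x. 0 \<le> p x"
 shows "pdf (p :: real^'d => real)"
proof -
 interpret M: prob_space M by (rule M)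
 have m: "p \<in> borel_measurable borel" using distributed_real_measurable[OF _ d] nn by simp
 interpret D: prob_space "density lborel (%x. ennreal (p x))"
  using M.prob_space_distr[OF distributed_measurable[OF d]] distributed_distr_eq_density[OF d] by simp
 have mass: "(\<integral>\<^sup>+x. ennreal (p x) \<partial>lborel) = 1"
  using D.emeasure_space_1 m by (simp add: emeasure_density)
 have i: "integrable lborel p" using m mass nn by (intro integrableI_nonneg) auto
 have "(LBINT x. p x) = 1" using nn_integral_eq_integral[OF i] mass nn by simp
 then show ?thesis using m nn i by unfold_locales auto
qed

text \<open>The transform is bounded by one, so higher powers are smaller.\<close>

lemma (in pdf) integrable_ft_power_of_Lr:
 assumes r: "r \<ge> 1" and i: "integrable lborel (%t. norm (cf q t) powr r)"
 shows "\<exists>N. integrable lborel (%s. ft q s ^ Suc N)"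
proof -
 have fm: "ft q \<in> borel_measurable borel" using q_meas by measurable
 have "integrable lborel (%s. ft q s ^ Suc (nat \<lceil>r\<rceil>))"
 proof (rule Bochner_Integration.integrable_bound[OF i])
  show "(%s. ft q s ^ Suc (nat \<lceil>r\<rceil>)) \<in> borel_measurable lborel" using fm by simp
  have "norm (ft q s ^ Suc (nat \<lceil>r\<rceil>)) \<le> norm (norm (cf q s) powr r)" for s
  proof (cases "ft q s = 0")
   case False
   have n: "0 < norm (ft q s)" "norm (ft q s) \<le> 1" using False pdf_ft_le_1[OF pdf_axioms] by simp_all
   have "r \<le> real (Suc (nat \<lceil>r\<rceil>))" by linarith
   then have "norm (ft q s) powr real (Suc (nat \<lceil>r\<rceil>)) \<le> norm (ft q s) powr r" using n by (intro powr_mono') auto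
   then show ?thesis unfolding cf_eq_ft norm_power powr_realpow[OF n(1)] by simp
  qed simp
  then show "AE s in lborel. norm (ft q s ^ Suc (nat \<lceil>r\<rceil>)) \<le> norm (norm (cf q s) powr r)" by simp
 qed
 then show ?thesis by blast
qed

text \<open>Here \<open>g\<close> is the number of remaining summands and \<open>r\<close> the size of the error to be reached. The
 second moments are of order \<open>1 / g\<close>, so that errors of size \<open>r\<close> are rare if \<open>r\<^sup>2 * g\<close> is large.\<close>

lemma deviation_bound_tendsto:
 fixes g r \<beta> :: "nat => real" and C M' d :: real
 assumes g: "filterlim g at_top sequentially" and rg: "filterlim (%n. (r n)\<^sup>2 * g n) at_top sequentially"
  and r0: "r \<longlonglongrightarrow> 0" and rpos: "\<forall>\<^sub>F n in sequentially. 0 < r n" and \<beta>: "\<beta> \<longlonglongrightarrow> 0" and d: "0 < d" and C: "0 \<le> C"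
 defines "h \<equiv> %n. min (d * r n / 4) (1/2)"
 shows "(%n. 2 * ((1 + 4 * M' / g n) * (1 + \<beta> n) - 1) + 2 * (4 * C / g n / (h n)\<^sup>2) + h n + 4 * C / g n / h n) \<longlonglongrightarrow> 0"
proof -
 have inv: "(%n. c / f n) \<longlonglongrightarrow> 0" if "filterlim f at_top sequentially" for c and f :: "nat => real"
  by (rule tendsto_divide_0[OF tendsto_const filterlim_at_top_imp_at_infinity[OF that]])
 have "h \<longlonglongrightarrow> min (d * 0 / 4) (1/2)" unfolding h_def by (intro tendsto_intros r0) simp
 then have h0: "h \<longlonglongrightarrow> 0" by simp
 have hpos: "\<forall>\<^sub>F n in sequentially. 0 < h n" using rpos by eventually_elim (use d in \<open>simp add: h_def\<close>)
 have gpos: "\<forall>\<^sub>F n in sequentially. 0 < g n" using g by (simp add: filterlim_at_top_dense)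
 have e2: "(%n. 4 * C / g n / (h n)\<^sup>2) \<longlonglongrightarrow> 0"
 proof (rule tendsto_sandwich[OF _ _ tendsto_const])
  show "(%n. (64 * C / d\<^sup>2) / ((r n)\<^sup>2 * g n) + (16 * C) / g n) \<longlonglongrightarrow> 0"
  proof -
   have "(%n. (64 * C / d\<^sup>2) / ((r n)\<^sup>2 * g n) + (16 * C) / g n) \<longlonglongrightarrow> 0 + 0"
    by (intro tendsto_add inv[OF rg] inv[OF g])
   then show ?thesis by (simp only: add_0)
  qed
  show "\<forall>\<^sub>F n in sequentially. 0 \<le> 4 * C / g n / (h n)\<^sup>2" using gpos by eventually_elim (use C in simp)
  show "\<forall>\<^sub>F n in sequentially. 4 * C / g n / (h n)\<^sup>2 \<le> (64 * C / d\<^sup>2) / ((r n)\<^sup>2 * g n) + (16 * C) / g n"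
   using gpos rpos
  proof eventually_elim
   case (elim n)
   have t1: "0 \<le> (64 * C / d\<^sup>2) / ((r n)\<^sup>2 * g n)" and t2: "0 \<le> (16 * C) / g n" using elim C by simp_all
   show ?case
   proof (cases "d * r n / 4 \<le> 1/2")
    case True
    then have hn: "h n = d * r n / 4" by (simp add: h_def)
    have "4 * C / g n / (h n)\<^sup>2 = (64 * C / d\<^sup>2) / ((r n)\<^sup>2 * g n)"
     unfolding hn using elim d by (simp add: power2_eq_square)
    then show ?thesis using t2 by (simp only: le_add_same_cancel1)
   next
    case False
    then have hn: "h n = 1/2" by (simp add: h_def)
    have "4 * C / g n / (h n)\<^sup>2 = (16 * C) / g n" unfolding hn by (simp add: power2_eq_square)
    then show ?thesis using t1 by (simp only: le_add_same_cancel2)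
   qed
  qed
 qed
 have e1: "(%n. 4 * C / g n / h n) \<longlonglongrightarrow> 0"
 proof -
  have "(%n. (4 * C / g n / (h n)\<^sup>2) * h n) \<longlonglongrightarrow> 0 * 0" by (rule tendsto_mult[OF e2 h0])
  moreover have "\<forall>\<^sub>F n in sequentially. (4 * C / g n / (h n)\<^sup>2) * h n = 4 * C / g n / h n"
   using hpos by eventually_elim (simp add: power2_eq_square)
  ultimately have "(%n. 4 * C / g n / h n) \<longlonglongrightarrow> 0 * 0" by (rule Lim_transform_eventually)
  then show ?thesis by simp
 qed
 have "(%n. 2 * ((1 + 4 * M' / g n) * (1 + \<beta> n) - 1) + 2 * (4 * C / g n / (h n)\<^sup>2) + h n + 4 * C / g n / h n)
   \<longlonglongrightarrow> 2 * ((1 + 0) * (1 + 0) - 1) + 2 * 0 + 0 + 0"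
  by (intro tendsto_add tendsto_mult tendsto_diff tendsto_const e1 e2 h0 \<beta> inv[OF g])
 then show ?thesis by simp
qed

theorem theorem1:
  fixes M :: "'w measure" and X :: "nat \<Rightarrow> 'w \<Rightarrow> real^'d" and p :: "real^'d \<Rightarrow> real"
    and a :: "nat \<Rightarrow> real^'d" and k :: "nat \<Rightarrow> nat" and \<epsilon> :: "nat \<Rightarrow> real" and r :: real
  assumes dim: "CARD('d) > 1"
    and prob: "prob_space M"
    and indep: "prob_space.indep_vars M (\<lambda>_. borel) X {1..}"
    and p_nonneg: "\<forall>x. 0 \<le> p x"
    and density: "\<forall>i\<ge>1. distributed M lborel (X i) (\<lambda>x. ennreal (p x))"
    and a_conv: "convergent a"
    and k_less: "\<forall>n\<ge>1. k n < n"
    and k_ratio: "(\<lambda>n. real (k n) / real n) \<longlonglongrightarrow> 1"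
    and k_gap: "filterlim (\<lambda>n. n - k n) at_top sequentially"
    and r_ge: "r \<ge> 1"
    and cf_Lr: "integrable lborel (\<lambda>t. norm (cf p t) powr r)"
    and mgf_fin: "0 \<in> interior (mgf_dom p)"
    and tilt_a: "\<forall>n\<ge>1. \<exists>!t. is_tilt p (a n) t"
    and tilt_m: "\<forall>n\<ge>1. \<forall>i\<in>{1..<k n}. \<forall>y. (\<forall>j\<in>{1..i}. p (y j) > 0) \<longrightarrow>
                   (\<exists>!t. is_tilt p (m_val n (a n) y i) t)"
    and eps_pos: "\<forall>n\<ge>1. \<epsilon> n > 0"
    and eps_gap: "filterlim (\<lambda>n. (\<epsilon> n)\<^sup>2 * real (n - k n)) at_top sequentially"
    and eps_log: "(\<lambda>n. \<epsilon> n * (ln (real n))\<^sup>2) \<longlonglongrightarrow> 0"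
  shows
    "(\<exists>R. small_o_prob (\<lambda>n. path_law (k n) (cond_pdf p n (k n) (a n)))
            (\<lambda>n. \<epsilon> n * (ln (real n))\<^sup>2) R \<and>
          (\<forall>\<^sub>F n in sequentially. AE y in path_law (k n) (cond_pdf p n (k n) (a n)).
             cond_pdf p n (k n) (a n) y = g_pdf p n (k n) (a n) y * (1 + R n y))) \<and>
     (\<exists>R. small_o_prob (\<lambda>n. path_law (k n) (g_pdf p n (k n) (a n)))
            (\<lambda>n. \<epsilon> n * (ln (real n))\<^sup>2) R \<and>
          (\<forall>\<^sub>F n in sequentially. AE y in path_law (k n) (g_pdf p n (k n) (a n)).
             cond_pdf p n (k n) (a n) y = g_pdf p n (k n) (a n) y * (1 + R n y)))"
proof -
 have d1: "distributed M lborel (X 1) (%x. ennreal (p x))" using density by simp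
 interpret pdf p by (rule pdf_of_distributed[OF prob d1 p_nonneg])
 obtain N0 where inv: "integrable lborel (%s. ft p s ^ Suc N0)" using integrable_ft_power_of_Lr[OF r_ge cf_Lr] by blast
 obtain astar where a: "a \<longlonglongrightarrow> astar" using a_conv by (auto simp: convergent_def)
 have am: "a n \<in> mrange" if "n \<ge> 1" for n using tilt_a that is_tilt_mrange by blast
 have mm: "m_val n (a n) y i \<in> mrange" if "n \<ge> 1" "i \<in> {1..<k n}" "\<forall>j\<in>{1..i}. p (y j) > 0" for n i y
  using tilt_m that is_tilt_mrange by blast
 have astar: "astar \<in> mrange"
  by (rule limit_in_mrange[OF inv a _ k_ratio am mm]) (use k_less in auto)
 obtain A where A: "!!n. norm (a n) \<le> A" using convergent_imp_Bseq[OF a_conv] by (auto simp: Bseq_def)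
 obtain \<delta> C M' N1 where np: "near_point p astar \<delta> C A M' N1" using near_point_exists[OF inv astar] by blast
 interpret near_point p astar \<delta> C A M' N1 by (rule np)
 define \<rho> where "\<rho> = (%n. \<epsilon> n * (ln (real n))\<^sup>2)"
 define g where "g = (%n. real (n - k n))"
 define R where "R = (%n y. cond_pdf p n (k n) (a n) y / g_pdf p n (k n) (a n) y - 1)"
 define \<beta> where "\<beta> = (%n. (norm (a n - astar))\<^sup>2 / \<delta>\<^sup>2)"
 have g: "filterlim g at_top sequentially"
  unfolding g_def by (rule filterlim_compose[OF filterlim_real_sequentially k_gap])
 have \<beta>: "\<beta> \<longlonglongrightarrow> 0"
 proof -
  have "\<beta> \<longlonglongrightarrow> (norm (astar - astar))\<^sup>2 / \<delta>\<^sup>2" unfolding \<beta>_def using delta by (intro tendsto_intros a) simp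
  then show ?thesis by simp
 qed
 have rpos: "\<forall>\<^sub>F n in sequentially. 0 < \<rho> n"
  using eventually_ge_at_top[of 2] by eventually_elim (use eps_pos in \<open>simp add: \<rho>_def\<close>)
 have rg: "filterlim (%n. (\<rho> n)\<^sup>2 * g n) at_top sequentially"
 proof (rule filterlim_at_top_mono[OF eps_gap])
  show "\<forall>\<^sub>F n in sequentially. (\<epsilon> n)\<^sup>2 * real (n - k n) \<le> (\<rho> n)\<^sup>2 * g n"
   using eventually_ge_at_top[of 3]
  proof eventually_elim
   case (elim n)
   have "exp 1 \<le> real n" using exp_le elim by linarith
   then have "1 \<le> ln (real n)" using elim by (simp add: ln_ge_iff)
   then have "1 \<le> ((ln (real n))\<^sup>2)\<^sup>2" by (simp add: one_le_power)
   then have "((\<epsilon> n)\<^sup>2 * g n) * 1 \<le> ((\<epsilon> n)\<^sup>2 * g n) * ((ln (real n))\<^sup>2)\<^sup>2"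
    by (rule mult_left_mono) (simp add: g_def)
   then show ?case by (simp add: \<rho>_def g_def power_mult_distrib mult_ac)
  qed
 qed
 have good: "\<forall>\<^sub>F n in sequentially. 1 \<le> k n \<and> k n < n \<and> N1 \<le> n - k n \<and> 2 * C \<le> real (n - k n) \<and>
   2 * (M' / \<delta>\<^sup>2) \<le> real (n - k n) \<and> a n \<in> cball astar \<delta> \<and> n \<ge> 1"
 proof -
  have e1: "\<forall>\<^sub>F n in sequentially. 1/2 < real (k n) / real n" by (rule order_tendstoD(1)[OF k_ratio]) simp
  have e2: "\<forall>\<^sub>F n in sequentially. N1 \<le> n - k n" using k_gap by (simp add: filterlim_at_top)
  have e3: "\<forall>\<^sub>F n in sequentially. 2 * C \<le> g n" "\<forall>\<^sub>F n in sequentially. 2 * (M' / \<delta>\<^sup>2) \<le> g n"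
   using g by (simp_all only: filterlim_at_top)
  have e4: "\<forall>\<^sub>F n in sequentially. dist (a n) astar < \<delta>" by (rule tendstoD[OF a delta])
  show ?thesis using e1 e2 e3 e4 eventually_ge_at_top[of 1]
  proof eventually_elim
   case (elim n)
   have "k n \<noteq> 0"
   proof
    assume "k n = 0"
    then show False using elim(1) by simp
   qed
   then show ?case using elim k_less by (simp add: g_def dist_commute)
  qed
 qed
 have main: "small_o_prob (%n. path_law (k n) (f n)) \<rho> R \<and>
   (\<forall>\<^sub>F n in sequentially. AE y in path_law (k n) (f n). cond_pdf p n (k n) (a n) y = g_pdf p n (k n) (a n) y * (1 + R n y))"
  if f: "!!n. f n \<in> {cond_pdf p n (k n) (a n), g_pdf p n (k n) (a n)}" for f
 proof (intro conjI)
  have D: "prob_space (path_law (k n) (f n)) \<and> R n \<in> borel_measurable (path_law (k n) (f n)) \<and>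
    (\<forall>y. cond_pdf p n (k n) (a n) y = g_pdf p n (k n) (a n) y * (1 + R n y)) \<and>
    (\<forall>h \<rho>'. 0 < h \<longrightarrow> h \<le> 1/2 \<longrightarrow> 4 * h \<le> \<rho>' \<longrightarrow>
     measure (path_law (k n) (f n)) {y \<in> space (path_law (k n) (f n)). \<rho>' < \<bar>R n y\<bar>}
      \<le> 2 * ((1 + 4 * (M' / \<delta>\<^sup>2) / g n) * (1 + \<beta> n) - 1) + 2 * (4 * C / g n / h\<^sup>2) + h + 4 * C / g n / h)"
   if n: "1 \<le> k n \<and> k n < n \<and> N1 \<le> n - k n \<and> 2 * C \<le> real (n - k n) \<and>
    2 * (M' / \<delta>\<^sup>2) \<le> real (n - k n) \<and> a n \<in> cball astar \<delta> \<and> n \<ge> 1" for n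
  proof -
   have n': "1 \<le> k n" "k n < n" "N1 \<le> n - k n" "2 * C \<le> real (n - k n)" "2 * (M' / \<delta>\<^sup>2) \<le> real (n - k n)"
    "a n \<in> cball astar \<delta>" "n \<ge> 1" using n by blast+
   note pd = path_law_deviation[OF n'(1-6) A mm[OF n'(7)] f, folded R_def]
   show ?thesis
    unfolding g_def \<beta>_def R_def
    by (intro conjI allI impI pd(1) pd(2)[unfolded R_def] pd(3)[unfolded R_def] pd(4)[unfolded R_def])
  qed
  show "\<forall>\<^sub>F n in sequentially. AE y in path_law (k n) (f n). cond_pdf p n (k n) (a n) y = g_pdf p n (k n) (a n) y * (1 + R n y)"
   using good by eventually_elim (use D in blast)
  show "small_o_prob (%n. path_law (k n) (f n)) \<rho> R"
   unfolding small_o_prob_def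
  proof (intro conjI allI impI)
   show "\<forall>\<^sub>F n in sequentially. prob_space (path_law (k n) (f n)) \<and> R n \<in> borel_measurable (path_law (k n) (f n))"
    using good by eventually_elim (use D in blast)
   fix d :: real assume d: "0 < d"
   show "(%n. measure (path_law (k n) (f n)) {y \<in> space (path_law (k n) (f n)). d * \<rho> n < \<bar>R n y\<bar>}) \<longlonglongrightarrow> 0"
   proof (rule tendsto_sandwich[OF _ _ tendsto_const deviation_bound_tendsto[OF g rg _ rpos \<beta> d csts(1), of "M' / \<delta>\<^sup>2"]])
    show "\<forall>\<^sub>F n in sequentially. 0 \<le> measure (path_law (k n) (f n)) {y \<in> space (path_law (k n) (f n)). d * \<rho> n < \<bar>R n y\<bar>}"
     by simp
    show "\<rho> \<longlonglongrightarrow> 0" using eps_log unfolding \<rho>_def .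
    show "\<forall>\<^sub>F n in sequentially. measure (path_law (k n) (f n)) {y \<in> space (path_law (k n) (f n)). d * \<rho> n < \<bar>R n y\<bar>}
     \<le> 2 * ((1 + 4 * (M' / \<delta>\<^sup>2) / g n) * (1 + \<beta> n) - 1) + 2 * (4 * C / g n / (min (d * \<rho> n / 4) (1/2))\<^sup>2)
      + min (d * \<rho> n / 4) (1/2) + 4 * C / g n / min (d * \<rho> n / 4) (1/2)"
     using good rpos
    proof eventually_elim
     case (elim n)
     let ?h = "min (d * \<rho> n / 4) (1/2)"
     have "0 < ?h" "?h \<le> 1/2" "4 * ?h \<le> d * \<rho> n" using elim(2) d by simp_all
     then show ?case using D[OF elim(1)] by blast
    qed
   qed
  qed
 qed
 show ?thesis
  using main[of "%n. cond_pdf p n (k n) (a n)"] main[of "%n. g_pdf p n (k n) (a n)"]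
  unfolding \<rho>_def by blast
qed

end
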